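(* Let $\mathbb{G}=(\mathscr{M},\Delta,\phi,\psi)$ be a locally compact quantum group and let $\Gamma$ be a regular family of normal states on $\mathscr{M}$. Suppose that $\mathbb{G}$ is left-covariant (resp. right-covariant) over $\Gamma$. (i) If the Banach algebra $(\mathscr{M}_*,\star)$ is pseudo-amenable, then $\mathscr{M}$ has a right invariant mean (resp. a left invariant mean). (ii) If the Banach algebra $(\mathscr{M}_*,\star)$ is approximately amenable and has a bounded approximate identity, then $\mathscr{M}$ has a right invariant mean (resp. a left invariant mean).
   Context: Locally compact quantum group. A Hopf-von Neumann algebra $(\mathscr{M},\Delta)$ is a von Neumann algebra $\mathscr{M}$ with a normal, unital, injective $*$-homomorphism $\Delta:\mathscr{M}\to\mathscr{M}\overline{\otimes}\mathscr{M}$ (von Neumann tensor product) satisfying $(\Delta\otimes\mathrm{id})\Delta=(\mathrm{id}\otimes\Delta)\Delta$. A locally compact quantum group is a quadruple $\mathbb{G}=(\mathscr{M},\Delta,\phi,\psi)$, where $(\mathscr{M},\Delta)$ is a Hopf-von Neumann algebra and $\phi,\psi$ are normal faithful semifinite weights on $\mathscr{M}^+$ such that $\phi[(\omega\otimes\mathrm{id})\Delta(x)]=\omega(1)\phi(x)$ and $\psi[(\mathrm{id}\otimes\omega)\Delta(x)]=\omega(1)\psi(x)$ for all $\omega\in\mathscr{M}_*^+$, $x\in\mathscr{M}^+$. Product and module actions. The predual $\mathscr{M}_*$ is a Banach algebra with product $\langle f\star g,m\rangle=\langle f\otimes g,\Delta(m)\rangle$ ($f,g\in\mathscr{M}_*$,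 $m\in\mathscr{M}$). For a Banach algebra $A$ and a Banach $A$-bimodule $X$, the dual $X^*$ is a Banach $A$-bimodule via $\langle f\cdot a,x\rangle=\langle f,a\cdot x\rangle$, $\langle a\cdot f,x\rangle=\langle f,x\cdot a\rangle$. Thus $\mathscr{M}=(\mathscr{M}_* )^*$ is an $\mathscr{M}_*$-bimodule, with $F\cdot\omega=(\omega\otimes\mathrm{id})\Delta(F)$ and $\omega\cdot F=(\mathrm{id}\otimes\omega)\Delta(F)$ for $F\in\mathscr{M}$, $\omega\in\mathscr{M}_*$. Left regular representation. Let $\mathfrak{n}_\phi=\{x\in\mathscr{M}:\phi(x^*x)<\infty\}$, let $\mathscr{H}_\phi$ be the Hilbert space completion of $\mathfrak{n}_\phi$ for the inner product $\langle x|y\rangle=\phi(y^*x)$, write $\Lambda_\phi(x)$ for $x\in\mathfrak{n}_\phi$ viewed in $\mathscr{H}_\phi$, and let $\pi_\phi:\mathscr{M}\to\mathscr{B}(\mathscr{H}_\phi)$ be the (faithful, normal) GNS representation $\pi_\phi(a)\Lambda_\phi(b)=\Lambda_\phi(ab)$; $\mathscr{M}$ is identified with $\pi_\phi(\mathscr{M})$. The multiplicative unitary of $\mathbb{G}$ is the unitary $W\in\mathscr{M}\overline{\otimes}\mathscr{B}(\mathscr{H}_\phi)$ on $\mathscr{H}_\phi\otimes_2\mathscr{H}_\phi$ determined by $W^*[\Lambda_\phi(x)\otimes\Lambda_\phi(y)]=(\Lambda_\phi\otimes\Lambda_\phi)[\Delta(y)(x\otimes1)]$ for $x,y\in\mathfrak{n}_\phi$.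 The left regular representation is the injective algebra homomorphism $\lambda:\mathscr{M}_*\to\mathscr{B}(\mathscr{H}_\phi)$, $\lambda(\omega)=(\omega\otimes\mathrm{id})(W)$. $C_r^*(\mathbb{G})$ denotes the C*-algebra generated by $\lambda(\mathscr{M}_* )$. Regular family. A family $\Gamma\subset\mathscr{M}_*$ of normal states on $\mathscr{M}$ is regular if $\operatorname{span}(\Gamma)$ is norm dense in $\mathscr{M}_*$ and $\lambda(\Gamma)$ contains only unitary elements of $C_r^*(\mathbb{G})$. Covariance. For $\Gamma$ regular, $\mathbb{G}$ is left-covariant over $\Gamma$ if for each $\omega\in\Gamma$ the map $L_\omega(F)=\omega\cdot F$ is a normal $*$-automorphism of $\mathscr{M}$ and $\pi_\phi(\omega\cdot F)=\lambda(\omega)\pi_\phi(F)\lambda(\omega)^*$ for all $F\in\mathscr{M}$. $\mathbb{G}$ is right-covariant over $\Gamma$ if for each $\omega\in\Gamma$ the map $R_\omega(F)=F\cdot\omega$ is a normal $*$-automorphism of $\mathscr{M}$ and $\pi_\phi(F\cdot\omega)=\lambda(\omega)^*\pi_\phi(F)\lambda(\omega)$ for all $F\in\mathscr{M}$. Invariant means. A state $\mu\in\mathscr{M}^*$ is a left invariant mean (LIM) if $\mu((\omega\otimes\mathrm{id})\Delta(F))=\omega(1)\mu(F)$ for all $F\in\mathscr{M}$, $\omega\in\mathscr{M}_*$, and a right invariant mean (RIM) if $\mu((\mathrm{id}\otimes\omega)\Delta(F))=\omega(1)\mu(F)$ for all $F\in\mathscr{M}$, $\omega\in\mathscr{M}_*$.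 Generalized amenability. A Banach algebra $A$ is approximately amenable if for each Banach $A$-bimodule $X$ and each continuous derivation $D:A\to X$ (a linear map with $D(ab)=D(a)\cdot b+a\cdot D(b)$) there is a net $(x_i)\subset X$, possibly unbounded, with $D(a)=\lim_i(a\cdot x_i-x_i\cdot a)$ in norm for every $a\in A$. Let $A\otimes_\gamma A$ be the projective tensor product, a Banach $A$-bimodule via $a\cdot(b\otimes c)=ab\otimes c$, $(b\otimes c)\cdot a=b\otimes ca$, and let $\pi:A\otimes_\gamma A\to A$ be the bounded linear map with $\pi(a\otimes b)=ab$. $A$ is pseudo-amenable if there is a net $(u_i)\subset A\otimes_\gamma A$, possibly unbounded, with $\lim_i(a\cdot u_i-u_i\cdot a)=0$ and $\lim_i\pi(u_i)a=a$ in norm for every $a\in A$. *)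

theory Defs
  imports "HOL-Analysis.Analysis"
begin

section \<open>Complex Hilbert spaces and bounded operators\<close>

text \<open>Inner products are linear in the first argument. Positivity, definiteness and
  completeness come from the norm.\<close>

class chilbert_space = banach +
  fixes scaleC :: "complex \<Rightarrow> 'a \<Rightarrow> 'a" (infixr "*\<^sub>C" 75)
    and cinner :: "'a \<Rightarrow> 'a \<Rightarrow> complex"
  assumes scaleC_add_right: "c *\<^sub>C (x + y) = c *\<^sub>C x + c *\<^sub>C y"
    and scaleC_add_left: "(c + d) *\<^sub>C x = c *\<^sub>C x + d *\<^sub>C x"
    and scaleC_scaleC: "c *\<^sub>C (d *\<^sub>C x) = (c * d) *\<^sub>C x"
    and scaleC_of_real: "complex_of_real r *\<^sub>C x = r *\<^sub>R x"
    and cinner_commute: "cinner x y = cnj (cinner y x)"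
    and cinner_add_left: "cinner (x + y) z = cinner x z + cinner y z"
    and cinner_scaleC_left: "cinner (c *\<^sub>C x) y = c * cinner x y"
    and cinner_self: "cinner x x = complex_of_real ((norm x)\<^sup>2)"

instantiation complex :: chilbert_space
begin

definition scaleC_complex :: "complex \<Rightarrow> complex \<Rightarrow> complex"
  where "scaleC_complex c x = c * x"

definition cinner_complex :: "complex \<Rightarrow> complex \<Rightarrow> complex"
  where "cinner_complex x y = x * cnj y"

instance
proof (standard, goal_cases)
  case (4 r x) then show ?case by (simp add: scaleC_complex_def scaleR_conv_of_real)
next
  case (8 x) then show ?case
    by (simp add: cinner_complex_def complex_norm_square del: of_real_power)
qed (simp_all add: scaleC_complex_def cinner_complex_def algebra_simps)

end

text \<open>The type \<^typ>\<open>'a \<Rightarrow>\<^sub>L 'b\<close> consists of the real-linear bounded operators; the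
  complex-linear ones form a set.\<close>

definition bop :: "('a::chilbert_space \<Rightarrow>\<^sub>L 'b::chilbert_space) set"
  where "bop = {T. \<forall>c x. blinfun_apply T (c *\<^sub>C x) = c *\<^sub>C blinfun_apply T x}"

definition op_scale ::
    "complex \<Rightarrow> ('a::chilbert_space \<Rightarrow>\<^sub>L 'b::chilbert_space) \<Rightarrow> ('a \<Rightarrow>\<^sub>L 'b)"
  where "op_scale c T = Blinfun (\<lambda>x. c *\<^sub>C blinfun_apply T x)"

lemma norm_scaleC: "norm (c *\<^sub>C (x::'a::chilbert_space)) = cmod c * norm x"
proof -
  have "complex_of_real ((norm (c *\<^sub>C x))\<^sup>2) = cinner (c *\<^sub>C x) (c *\<^sub>C x)"
    by (simp only: cinner_self)
  also have "\<dots> = c * cnj (c * cinner x x)"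
    by (metis cinner_commute cinner_scaleC_left)
  also have "\<dots> = (c * cnj c) * complex_of_real ((norm x)\<^sup>2)"
    by (simp add: cinner_self)
  also have "\<dots> = complex_of_real ((cmod c)\<^sup>2) * complex_of_real ((norm x)\<^sup>2)"
    by (simp only: complex_norm_square)
  also have "\<dots> = complex_of_real ((cmod c * norm x)\<^sup>2)"
    by (simp add: power_mult_distrib)
  finally have "(norm (c *\<^sub>C x))\<^sup>2 = (cmod c * norm x)\<^sup>2"
    by (simp only: of_real_eq_iff)
  then show ?thesis by (simp add: power2_eq_iff_nonneg)
qed

lemma bounded_linear_scaleC: "bounded_linear (\<lambda>x::'a::chilbert_space. c *\<^sub>C x)"
proof (rule bounded_linear_intro[where K = "cmod c"])
  show "c *\<^sub>C (r *\<^sub>R x) = r *\<^sub>R (c *\<^sub>C x)" for r and x :: 'a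
    by (simp only: scaleC_of_real[symmetric] scaleC_scaleC mult.commute)
qed (simp_all add: scaleC_add_right norm_scaleC mult.commute)

lemma blinfun_apply_op_scale: "blinfun_apply (op_scale c T) x = c *\<^sub>C blinfun_apply T x"
proof -
  have "bounded_linear (\<lambda>x. c *\<^sub>C blinfun_apply T x)"
    by (rule bounded_linear_compose[OF bounded_linear_scaleC blinfun.bounded_linear_right])
  then show ?thesis by (simp add: op_scale_def bounded_linear_Blinfun_apply)
qed

definition adj :: "('a::chilbert_space \<Rightarrow>\<^sub>L 'b::chilbert_space) \<Rightarrow> ('b \<Rightarrow>\<^sub>L 'a)"
  where "adj T = (THE S. \<forall>x y. cinner (blinfun_apply S x) y = cinner x (blinfun_apply T y))"

definition unitary_op :: "('a::chilbert_space \<Rightarrow>\<^sub>L 'a) \<Rightarrow> bool"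
  where "unitary_op U \<longleftrightarrow>
    U \<in> bop \<and> adj U o\<^sub>L U = id_blinfun \<and> U o\<^sub>L adj U = id_blinfun"

definition op_pos :: "('a::chilbert_space \<Rightarrow>\<^sub>L 'a) \<Rightarrow> bool"
  where "op_pos T \<longleftrightarrow> T \<in> bop \<and>
    (\<forall>x. Im (cinner (blinfun_apply T x) x) = 0 \<and> 0 \<le> Re (cinner (blinfun_apply T x) x))"

text \<open>Closed \<open>*\<close>-subalgebras, not necessarily unital, of the bounded operators.\<close>

definition cstar_subalgebra :: "('a::chilbert_space \<Rightarrow>\<^sub>L 'a) set \<Rightarrow> bool"
  where "cstar_subalgebra B \<longleftrightarrow> B \<subseteq> bop \<and> closed B \<and> 0 \<in> B \<and>
    (\<forall>S\<in>B. \<forall>T\<in>B. S + T \<in> B \<and> S o\<^sub>L T \<in> B) \<and>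
    (\<forall>T\<in>B. adj T \<in> B \<and> (\<forall>c. op_scale c T \<in> B))"


section \<open>Von Neumann algebras\<close>

definition commutant :: "('a::chilbert_space \<Rightarrow>\<^sub>L 'a) set \<Rightarrow> ('a \<Rightarrow>\<^sub>L 'a) set"
  where "commutant S = {T \<in> bop. \<forall>A\<in>S. T o\<^sub>L A = A o\<^sub>L T}"

text \<open>The zero algebra is excluded: it has no states.\<close>

definition von_neumann_algebra :: "('a::chilbert_space \<Rightarrow>\<^sub>L 'a) set \<Rightarrow> bool"
  where "von_neumann_algebra M \<longleftrightarrow> M \<subseteq> bop \<and> (\<forall>T\<in>M. adj T \<in> M) \<and>
    commutant (commutant M) = M \<and> M \<noteq> {0}"

definition pos_part :: "('a::chilbert_space \<Rightarrow>\<^sub>L 'a) set \<Rightarrow> ('a \<Rightarrow>\<^sub>L 'a) set"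
  where "pos_part M = {x \<in> M. op_pos x}"

definition functional_on ::
    "('a::chilbert_space \<Rightarrow>\<^sub>L 'a) set \<Rightarrow> (('a \<Rightarrow>\<^sub>L 'a) \<Rightarrow> complex) \<Rightarrow> bool"
  where "functional_on M f \<longleftrightarrow>
    (\<forall>x\<in>M. \<forall>y\<in>M. f (x + y) = f x + f y) \<and> (\<forall>x\<in>M. \<forall>c. f (op_scale c x) = c * f x)"

definition pos_functional ::
    "('a::chilbert_space \<Rightarrow>\<^sub>L 'a) set \<Rightarrow> (('a \<Rightarrow>\<^sub>L 'a) \<Rightarrow> complex) \<Rightarrow> bool"
  where "pos_functional M f \<longleftrightarrow>
    functional_on M f \<and> (\<forall>x \<in> pos_part M. Im (f x) = 0 \<and> 0 \<le> Re (f x))"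

text \<open>States on \<open>M\<close>, not necessarily normal.\<close>

definition state_on ::
    "('a::chilbert_space \<Rightarrow>\<^sub>L 'a) set \<Rightarrow> (('a \<Rightarrow>\<^sub>L 'a) \<Rightarrow> complex) \<Rightarrow> bool"
  where "state_on M f \<longleftrightarrow> pos_functional M f \<and>
    (\<exists>K. \<forall>x\<in>M. cmod (f x) \<le> K * norm x) \<and> f id_blinfun = 1"

text \<open>The predual: the \<open>\<sigma>\<close>-weakly continuous functionals on \<open>M\<close>, which are the maps
  \<open>x \<mapsto> \<Sum>n. \<langle>x (\<xi> n), \<eta> n\<rangle>\<close> with square-summable \<open>\<xi>\<close> and \<open>\<eta>\<close>. Functionals are set to 0
  outside \<open>M\<close>, so that they are equal as soon as they agree on \<open>M\<close>.\<close>

definition predual :: "('a::chilbert_space \<Rightarrow>\<^sub>L 'a) set \<Rightarrow> (('a \<Rightarrow>\<^sub>L 'a) \<Rightarrow> complex) set"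
  where "predual M = {f. (\<exists>\<xi> \<eta>. summable (\<lambda>n. (norm (\<xi> n))\<^sup>2) \<and> summable (\<lambda>n. (norm (\<eta> n))\<^sup>2) \<and>
      (\<forall>x\<in>M. f x = (\<Sum>n. cinner (blinfun_apply x (\<xi> n)) (\<eta> n)))) \<and> (\<forall>x. x \<notin> M \<longrightarrow> f x = 0)}"

definition functional_norm ::
    "('a::chilbert_space \<Rightarrow>\<^sub>L 'a) set \<Rightarrow> (('a \<Rightarrow>\<^sub>L 'a) \<Rightarrow> complex) \<Rightarrow> real"
  where "functional_norm M f = Sup {cmod (f x) | x. x \<in> M \<and> norm x \<le> 1}"

definition sigma_weak_topology :: "('a::chilbert_space \<Rightarrow>\<^sub>L 'a) set \<Rightarrow> ('a \<Rightarrow>\<^sub>L 'a) topology"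
  where "sigma_weak_topology M =
    topology_generated_by {{x \<in> M. f x \<in> U} | f U. f \<in> predual M \<and> open U}"

definition normal_linear_map ::
    "('a::chilbert_space \<Rightarrow>\<^sub>L 'a) set \<Rightarrow> ('b::chilbert_space \<Rightarrow>\<^sub>L 'b) set \<Rightarrow>
      (('a \<Rightarrow>\<^sub>L 'a) \<Rightarrow> ('b \<Rightarrow>\<^sub>L 'b)) \<Rightarrow> bool"
  where "normal_linear_map M N \<Phi> \<longleftrightarrow> \<Phi> ` M \<subseteq> N \<and>
    (\<forall>x\<in>M. \<forall>y\<in>M. \<Phi> (x + y) = \<Phi> x + \<Phi> y) \<and>
    (\<forall>x\<in>M. \<forall>c. \<Phi> (op_scale c x) = op_scale c (\<Phi> x)) \<and>
    (\<forall>f \<in> predual N. (\<lambda>x. if x \<in> M then f (\<Phi> x) else 0) \<in> predual M)"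

definition normal_star_hom ::
    "('a::chilbert_space \<Rightarrow>\<^sub>L 'a) set \<Rightarrow> ('b::chilbert_space \<Rightarrow>\<^sub>L 'b) set \<Rightarrow>
      (('a \<Rightarrow>\<^sub>L 'a) \<Rightarrow> ('b \<Rightarrow>\<^sub>L 'b)) \<Rightarrow> bool"
  where "normal_star_hom M N \<Phi> \<longleftrightarrow> normal_linear_map M N \<Phi> \<and>
    (\<forall>x\<in>M. \<forall>y\<in>M. \<Phi> (x o\<^sub>L y) = \<Phi> x o\<^sub>L \<Phi> y) \<and> (\<forall>x\<in>M. \<Phi> (adj x) = adj (\<Phi> x))"

definition normal_star_automorphism ::
    "('a::chilbert_space \<Rightarrow>\<^sub>L 'a) set \<Rightarrow> (('a \<Rightarrow>\<^sub>L 'a) \<Rightarrow> ('a \<Rightarrow>\<^sub>L 'a)) \<Rightarrow> bool"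
  where "normal_star_automorphism M \<Phi> \<longleftrightarrow> normal_star_hom M M \<Phi> \<and> bij_betw \<Phi> M M"


section \<open>Tensor products of Hilbert spaces and von Neumann algebras\<close>

text \<open>\<open>t\<close> exhibits \<^typ>\<open>'c\<close> as the Hilbert space tensor product of \<^typ>\<open>'a\<close> and \<^typ>\<open>'b\<close>;
  this determines \<^typ>\<open>'c\<close> up to a unique unitary. Since \<open>t (c *\<^sub>C a) b = c *\<^sub>C t a b\<close>, the
  real span of the elementary tensors is their complex span.\<close>

definition hilbert_tensor ::
    "('a::chilbert_space \<Rightarrow> 'b::chilbert_space \<Rightarrow> 'c::chilbert_space) \<Rightarrow> bool"
  where "hilbert_tensor t \<longleftrightarrow>
    (\<forall>a a' b. t (a + a') b = t a b + t a' b) \<and> (\<forall>a b b'. t a (b + b') = t a b + t a b') \<and>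
    (\<forall>c a b. t (c *\<^sub>C a) b = c *\<^sub>C t a b \<and> t a (c *\<^sub>C b) = c *\<^sub>C t a b) \<and>
    (\<forall>a b a' b'. cinner (t a b) (t a' b') = cinner a a' * cinner b b') \<and>
    closure (span {t a b | a b. True}) = UNIV"

definition op_tensor ::
    "('a::chilbert_space \<Rightarrow> 'b::chilbert_space \<Rightarrow> 'c::chilbert_space) \<Rightarrow>
      ('a \<Rightarrow>\<^sub>L 'a) \<Rightarrow> ('b \<Rightarrow>\<^sub>L 'b) \<Rightarrow> ('c \<Rightarrow>\<^sub>L 'c)"
  where "op_tensor t x y = (THE T. T \<in> bop \<and>
    (\<forall>a b. blinfun_apply T (t a b) = t (blinfun_apply x a) (blinfun_apply y b)))"

definition vn_tensor ::
    "('a::chilbert_space \<Rightarrow> 'b::chilbert_space \<Rightarrow> 'c::chilbert_space) \<Rightarrow>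
      ('a \<Rightarrow>\<^sub>L 'a) set \<Rightarrow> ('b \<Rightarrow>\<^sub>L 'b) set \<Rightarrow> ('c \<Rightarrow>\<^sub>L 'c) set"
  where "vn_tensor t M N = commutant (commutant {op_tensor t x y | x y. x \<in> M \<and> y \<in> N})"

definition functional_tensor ::
    "('a::chilbert_space \<Rightarrow> 'b::chilbert_space \<Rightarrow> 'c::chilbert_space) \<Rightarrow>
      ('a \<Rightarrow>\<^sub>L 'a) set \<Rightarrow> ('b \<Rightarrow>\<^sub>L 'b) set \<Rightarrow>
      (('a \<Rightarrow>\<^sub>L 'a) \<Rightarrow> complex) \<Rightarrow> (('b \<Rightarrow>\<^sub>L 'b) \<Rightarrow> complex) \<Rightarrow> (('c \<Rightarrow>\<^sub>L 'c) \<Rightarrow> complex)"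
  where "functional_tensor t M N f g = (THE F. F \<in> predual (vn_tensor t M N) \<and>
    (\<forall>x\<in>M. \<forall>y\<in>N. F (op_tensor t x y) = f x * g y))"

text \<open>\<open>(f \<otimes> id)(X)\<close> and \<open>(id \<otimes> g)(X)\<close>, defined by duality.\<close>

definition slice_left ::
    "('a::chilbert_space \<Rightarrow> 'b::chilbert_space \<Rightarrow> 'c::chilbert_space) \<Rightarrow>
      ('a \<Rightarrow>\<^sub>L 'a) set \<Rightarrow> ('b \<Rightarrow>\<^sub>L 'b) set \<Rightarrow>
      (('a \<Rightarrow>\<^sub>L 'a) \<Rightarrow> complex) \<Rightarrow> ('c \<Rightarrow>\<^sub>L 'c) \<Rightarrow> ('b \<Rightarrow>\<^sub>L 'b)"
  where "slice_left t M N f X =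
    (THE y. y \<in> N \<and> (\<forall>g \<in> predual N. g y = functional_tensor t M N f g X))"

definition slice_right ::
    "('a::chilbert_space \<Rightarrow> 'b::chilbert_space \<Rightarrow> 'c::chilbert_space) \<Rightarrow>
      ('a \<Rightarrow>\<^sub>L 'a) set \<Rightarrow> ('b \<Rightarrow>\<^sub>L 'b) set \<Rightarrow>
      (('b \<Rightarrow>\<^sub>L 'b) \<Rightarrow> complex) \<Rightarrow> ('c \<Rightarrow>\<^sub>L 'c) \<Rightarrow> ('a \<Rightarrow>\<^sub>L 'a)"
  where "slice_right t M N g X =
    (THE x. x \<in> M \<and> (\<forall>f \<in> predual M. f x = functional_tensor t M N f g X))"

text \<open>The normal map \<open>\<Phi> \<otimes> \<Psi>\<close> from the tensor product of \<open>M\<close> and \<open>N\<close> (along \<open>s\<close>) to that of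
  \<open>P\<close> and \<open>Q\<close> (along \<open>r\<close>).\<close>

definition hom_tensor ::
    "('a::chilbert_space \<Rightarrow> 'b::chilbert_space \<Rightarrow> 'c::chilbert_space) \<Rightarrow>
      ('a \<Rightarrow>\<^sub>L 'a) set \<Rightarrow> ('b \<Rightarrow>\<^sub>L 'b) set \<Rightarrow>
      ('d::chilbert_space \<Rightarrow> 'e::chilbert_space \<Rightarrow> 'f::chilbert_space) \<Rightarrow>
      ('d \<Rightarrow>\<^sub>L 'd) set \<Rightarrow> ('e \<Rightarrow>\<^sub>L 'e) set \<Rightarrow>
      (('a \<Rightarrow>\<^sub>L 'a) \<Rightarrow> ('d \<Rightarrow>\<^sub>L 'd)) \<Rightarrow> (('b \<Rightarrow>\<^sub>L 'b) \<Rightarrow> ('e \<Rightarrow>\<^sub>L 'e)) \<Rightarrow>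
      (('c \<Rightarrow>\<^sub>L 'c) \<Rightarrow> ('f \<Rightarrow>\<^sub>L 'f))"
  where "hom_tensor s M N r P Q \<Phi> \<Psi> = (THE \<Theta>.
    normal_linear_map (vn_tensor s M N) (vn_tensor r P Q) \<Theta> \<and>
    (\<forall>X. X \<notin> vn_tensor s M N \<longrightarrow> \<Theta> X = 0) \<and>
    (\<forall>x\<in>M. \<forall>y\<in>N. \<Theta> (op_tensor s x y) = op_tensor r (\<Phi> x) (\<Psi> y)))"


section \<open>Weights\<close>

text \<open>A weight is given by its values on \<^term>\<open>pos_part M\<close>; other values are irrelevant.\<close>

definition weight :: "('a::chilbert_space \<Rightarrow>\<^sub>L 'a) set \<Rightarrow> (('a \<Rightarrow>\<^sub>L 'a) \<Rightarrow> ennreal) \<Rightarrow> bool"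
  where "weight M \<phi> \<longleftrightarrow>
    (\<forall>x \<in> pos_part M. \<forall>y \<in> pos_part M. \<phi> (x + y) = \<phi> x + \<phi> y) \<and>
    (\<forall>x \<in> pos_part M. \<forall>r\<ge>0. \<phi> (r *\<^sub>R x) = ennreal r * \<phi> x)"

definition weight_nfin ::
    "('a::chilbert_space \<Rightarrow>\<^sub>L 'a) set \<Rightarrow> (('a \<Rightarrow>\<^sub>L 'a) \<Rightarrow> ennreal) \<Rightarrow> ('a \<Rightarrow>\<^sub>L 'a) set"
  where "weight_nfin M \<phi> = {x \<in> M. \<phi> (adj x o\<^sub>L x) < \<infinity>}"

text \<open>The least upper bound \<open>x\<close> of \<open>D\<close> for the operator order.\<close>

definition pos_lub :: "('a::chilbert_space \<Rightarrow>\<^sub>L 'a) set \<Rightarrow> ('a \<Rightarrow>\<^sub>L 'a) set \<Rightarrow> ('a \<Rightarrow>\<^sub>L 'a) \<Rightarrow> bool"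
  where "pos_lub M D x \<longleftrightarrow> x \<in> pos_part M \<and> (\<forall>y\<in>D. op_pos (x - y)) \<and>
    (\<forall>z \<in> pos_part M. (\<forall>y\<in>D. op_pos (z - y)) \<longrightarrow> op_pos (z - x))"

definition weight_normal ::
    "('a::chilbert_space \<Rightarrow>\<^sub>L 'a) set \<Rightarrow> (('a \<Rightarrow>\<^sub>L 'a) \<Rightarrow> ennreal) \<Rightarrow> bool"
  where "weight_normal M \<phi> \<longleftrightarrow>
    (\<forall>D x. D \<noteq> {} \<and> D \<subseteq> pos_part M \<and>
      (\<forall>y\<in>D. \<forall>y'\<in>D. \<exists>z\<in>D. op_pos (z - y) \<and> op_pos (z - y')) \<and> pos_lub M D x \<longrightarrow>
      \<phi> x = (SUP y\<in>D. \<phi> y))"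

definition weight_faithful ::
    "('a::chilbert_space \<Rightarrow>\<^sub>L 'a) set \<Rightarrow> (('a \<Rightarrow>\<^sub>L 'a) \<Rightarrow> ennreal) \<Rightarrow> bool"
  where "weight_faithful M \<phi> \<longleftrightarrow> (\<forall>x \<in> pos_part M. \<phi> x = 0 \<longrightarrow> x = 0)"

definition weight_semifinite ::
    "('a::chilbert_space \<Rightarrow>\<^sub>L 'a) set \<Rightarrow> (('a \<Rightarrow>\<^sub>L 'a) \<Rightarrow> ennreal) \<Rightarrow> bool"
  where "weight_semifinite M \<phi> \<longleftrightarrow> sigma_weak_topology M closure_of weight_nfin M \<phi> = M"

definition nsf_weight ::
    "('a::chilbert_space \<Rightarrow>\<^sub>L 'a) set \<Rightarrow> (('a \<Rightarrow>\<^sub>L 'a) \<Rightarrow> ennreal) \<Rightarrow> bool"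
  where "nsf_weight M \<phi> \<longleftrightarrow>
    weight M \<phi> \<and> weight_normal M \<phi> \<and> weight_faithful M \<phi> \<and> weight_semifinite M \<phi>"

text \<open>The linear extension of \<open>\<phi>\<close> to the span of the positive elements of finite weight;
  it makes sense of \<open>\<phi> (y\<^sup>* x)\<close> for \<open>x\<close>, \<open>y\<close> in \<^term>\<open>weight_nfin M \<phi>\<close>.\<close>

definition weight_ext ::
    "('a::chilbert_space \<Rightarrow>\<^sub>L 'a) set \<Rightarrow> (('a \<Rightarrow>\<^sub>L 'a) \<Rightarrow> ennreal) \<Rightarrow> ('a \<Rightarrow>\<^sub>L 'a) \<Rightarrow> complex"
  where "weight_ext M \<phi> z = (THE w. \<exists>a b c d.
    {a, b, c, d} \<subseteq> {x \<in> pos_part M. \<phi> x < \<infinity>} \<and>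
    z = (a - b) + op_scale \<i> (c - d) \<and>
    w = Complex (enn2real (\<phi> a) - enn2real (\<phi> b)) (enn2real (\<phi> c) - enn2real (\<phi> d)))"

text \<open>\<open>\<Lambda>\<close> exhibits \<^typ>\<open>'g\<close> as the Hilbert space completion of \<^term>\<open>weight_nfin M \<phi>\<close> for the
  inner product \<open>\<langle>x, y\<rangle> = \<phi> (y\<^sup>* x)\<close>.\<close>

definition gns_map ::
    "('a::chilbert_space \<Rightarrow>\<^sub>L 'a) set \<Rightarrow> (('a \<Rightarrow>\<^sub>L 'a) \<Rightarrow> ennreal) \<Rightarrow>
      (('a \<Rightarrow>\<^sub>L 'a) \<Rightarrow> 'g::chilbert_space) \<Rightarrow> bool"
  where "gns_map M \<phi> \<Lambda> \<longleftrightarrow>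
    (\<forall>x \<in> weight_nfin M \<phi>. \<forall>y \<in> weight_nfin M \<phi>. \<Lambda> (x + y) = \<Lambda> x + \<Lambda> y) \<and>
    (\<forall>x \<in> weight_nfin M \<phi>. \<forall>c. \<Lambda> (op_scale c x) = c *\<^sub>C \<Lambda> x) \<and>
    (\<forall>x \<in> weight_nfin M \<phi>. \<forall>y \<in> weight_nfin M \<phi>.
      cinner (\<Lambda> x) (\<Lambda> y) = weight_ext M \<phi> (adj y o\<^sub>L x)) \<and>
    closure (\<Lambda> ` weight_nfin M \<phi>) = UNIV"

definition gns_rep ::
    "('a::chilbert_space \<Rightarrow>\<^sub>L 'a) set \<Rightarrow> (('a \<Rightarrow>\<^sub>L 'a) \<Rightarrow> ennreal) \<Rightarrow>
      (('a \<Rightarrow>\<^sub>L 'a) \<Rightarrow> 'g::chilbert_space) \<Rightarrow> ('a \<Rightarrow>\<^sub>L 'a) \<Rightarrow> ('g \<Rightarrow>\<^sub>L 'g)"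
  where "gns_rep M \<phi> \<Lambda> a = (THE T. T \<in> bop \<and>
    (\<forall>b \<in> weight_nfin M \<phi>. blinfun_apply T (\<Lambda> b) = \<Lambda> (a o\<^sub>L b)))"

text \<open>The weight \<open>\<phi> \<otimes> \<phi>\<close>, as the supremum of \<open>f \<otimes> g\<close> over the normal positive functionals
  \<open>f, g\<close> majorised by \<open>\<phi>\<close>. As a normal semifinite weight is a sum of normal positive
  functionals, this is the usual tensor product weight.\<close>

definition majorised ::
    "('a::chilbert_space \<Rightarrow>\<^sub>L 'a) set \<Rightarrow> (('a \<Rightarrow>\<^sub>L 'a) \<Rightarrow> ennreal) \<Rightarrow> (('a \<Rightarrow>\<^sub>L 'a) \<Rightarrow> complex) set"
  where "majorised M \<phi> = {f \<in> predual M. pos_functional M f \<and>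
    (\<forall>x \<in> pos_part M. ennreal (Re (f x)) \<le> \<phi> x)}"

definition weight_square ::
    "('a::chilbert_space \<Rightarrow> 'a \<Rightarrow> 'c::chilbert_space) \<Rightarrow> ('a \<Rightarrow>\<^sub>L 'a) set \<Rightarrow>
      (('a \<Rightarrow>\<^sub>L 'a) \<Rightarrow> ennreal) \<Rightarrow> (('c \<Rightarrow>\<^sub>L 'c) \<Rightarrow> ennreal)"
  where "weight_square t M \<phi> = (\<lambda>X. SUP (f, g) \<in> majorised M \<phi> \<times> majorised M \<phi>.
    ennreal (Re (functional_tensor t M M f g X)))"

text \<open>\<open>\<Lambda>2\<close> is the map \<open>\<Lambda> \<otimes> \<Lambda>\<close>: the GNS map of \<open>\<phi> \<otimes> \<phi>\<close> that takes the values
  \<open>\<Lambda> x \<otimes> \<Lambda> y\<close> on elementary tensors.\<close>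

definition gns_map_square ::
    "('a::chilbert_space \<Rightarrow> 'a \<Rightarrow> 'c::chilbert_space) \<Rightarrow>
      ('g::chilbert_space \<Rightarrow> 'g \<Rightarrow> 'k::chilbert_space) \<Rightarrow> ('a \<Rightarrow>\<^sub>L 'a) set \<Rightarrow>
      (('a \<Rightarrow>\<^sub>L 'a) \<Rightarrow> ennreal) \<Rightarrow> (('a \<Rightarrow>\<^sub>L 'a) \<Rightarrow> 'g) \<Rightarrow> (('c \<Rightarrow>\<^sub>L 'c) \<Rightarrow> 'k) \<Rightarrow> bool"
  where "gns_map_square t tg M \<phi> \<Lambda> \<Lambda>2 \<longleftrightarrow>
    gns_map (vn_tensor t M M) (weight_square t M \<phi>) \<Lambda>2 \<and>
    (\<forall>x \<in> weight_nfin M \<phi>. \<forall>y \<in> weight_nfin M \<phi>. \<Lambda>2 (op_tensor t x y) = tg (\<Lambda> x) (\<Lambda> y))"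


section \<open>Locally compact quantum groups\<close>

text \<open>\<open>t\<close> is a tensor product \<open>H \<otimes> H\<close>, while \<open>tL\<close> and \<open>tR\<close> present the same space as
  \<open>(H \<otimes> H) \<otimes> H\<close> and as \<open>H \<otimes> (H \<otimes> H)\<close>.\<close>

definition triple_tensor ::
    "('a::chilbert_space \<Rightarrow> 'a \<Rightarrow> 'c::chilbert_space) \<Rightarrow> ('c \<Rightarrow> 'a \<Rightarrow> 'd::chilbert_space) \<Rightarrow>
      ('a \<Rightarrow> 'c \<Rightarrow> 'd) \<Rightarrow> bool"
  where "triple_tensor t tL tR \<longleftrightarrow> hilbert_tensor t \<and> hilbert_tensor tL \<and> hilbert_tensor tR \<and>
    (\<forall>a b c. tL (t a b) c = tR a (t b c))"

definition hopf_von_neumann_algebra ::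
    "('a::chilbert_space \<Rightarrow> 'a \<Rightarrow> 'c::chilbert_space) \<Rightarrow> ('c \<Rightarrow> 'a \<Rightarrow> 'd::chilbert_space) \<Rightarrow>
      ('a \<Rightarrow> 'c \<Rightarrow> 'd) \<Rightarrow> ('a \<Rightarrow>\<^sub>L 'a) set \<Rightarrow> (('a \<Rightarrow>\<^sub>L 'a) \<Rightarrow> ('c \<Rightarrow>\<^sub>L 'c)) \<Rightarrow> bool"
  where "hopf_von_neumann_algebra t tL tR M \<Delta> \<longleftrightarrow>
    triple_tensor t tL tR \<and> von_neumann_algebra M \<and>
    normal_star_hom M (vn_tensor t M M) \<Delta> \<and> inj_on \<Delta> M \<and> \<Delta> id_blinfun = id_blinfun \<and>
    (\<forall>x\<in>M. hom_tensor t M M tL (vn_tensor t M M) M \<Delta> (\<lambda>y. y) (\<Delta> x) =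
           hom_tensor t M M tR M (vn_tensor t M M) (\<lambda>y. y) \<Delta> (\<Delta> x))"

text \<open>The two module actions of the predual: \<open>F \<cdot> f = (f \<otimes> id)(\<Delta> F)\<close> and
  \<open>f \<cdot> F = (id \<otimes> f)(\<Delta> F)\<close>.\<close>

definition act_right ::
    "('a::chilbert_space \<Rightarrow> 'a \<Rightarrow> 'c::chilbert_space) \<Rightarrow> ('a \<Rightarrow>\<^sub>L 'a) set \<Rightarrow>
      (('a \<Rightarrow>\<^sub>L 'a) \<Rightarrow> ('c \<Rightarrow>\<^sub>L 'c)) \<Rightarrow> ('a \<Rightarrow>\<^sub>L 'a) \<Rightarrow> (('a \<Rightarrow>\<^sub>L 'a) \<Rightarrow> complex) \<Rightarrow> ('a \<Rightarrow>\<^sub>L 'a)"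
  where "act_right t M \<Delta> F f = slice_left t M M f (\<Delta> F)"

definition act_left ::
    "('a::chilbert_space \<Rightarrow> 'a \<Rightarrow> 'c::chilbert_space) \<Rightarrow> ('a \<Rightarrow>\<^sub>L 'a) set \<Rightarrow>
      (('a \<Rightarrow>\<^sub>L 'a) \<Rightarrow> ('c \<Rightarrow>\<^sub>L 'c)) \<Rightarrow> (('a \<Rightarrow>\<^sub>L 'a) \<Rightarrow> complex) \<Rightarrow> ('a \<Rightarrow>\<^sub>L 'a) \<Rightarrow> ('a \<Rightarrow>\<^sub>L 'a)"
  where "act_left t M \<Delta> f F = slice_right t M M f (\<Delta> F)"

definition locally_compact_quantum_group ::
    "('a::chilbert_space \<Rightarrow> 'a \<Rightarrow> 'c::chilbert_space) \<Rightarrow> ('c \<Rightarrow> 'a \<Rightarrow> 'd::chilbert_space) \<Rightarrow>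
      ('a \<Rightarrow> 'c \<Rightarrow> 'd) \<Rightarrow> ('a \<Rightarrow>\<^sub>L 'a) set \<Rightarrow> (('a \<Rightarrow>\<^sub>L 'a) \<Rightarrow> ('c \<Rightarrow>\<^sub>L 'c)) \<Rightarrow>
      (('a \<Rightarrow>\<^sub>L 'a) \<Rightarrow> ennreal) \<Rightarrow> (('a \<Rightarrow>\<^sub>L 'a) \<Rightarrow> ennreal) \<Rightarrow> bool"
  where "locally_compact_quantum_group t tL tR M \<Delta> \<phi> \<psi> \<longleftrightarrow>
    hopf_von_neumann_algebra t tL tR M \<Delta> \<and> nsf_weight M \<phi> \<and> nsf_weight M \<psi> \<and>
    (\<forall>f \<in> predual M. pos_functional M f \<longrightarrow> (\<forall>x \<in> pos_part M.
      \<phi> (slice_left t M M f (\<Delta> x)) = ennreal (Re (f id_blinfun)) * \<phi> x \<and>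
      \<psi> (slice_right t M M f (\<Delta> x)) = ennreal (Re (f id_blinfun)) * \<psi> x))"

text \<open>\<open>W\<close> is the multiplicative unitary, on \<open>H\<^sub>\<phi> \<otimes> H\<^sub>\<phi>\<close>, with \<open>M\<close> identified with its image under
  the GNS representation.\<close>

definition multiplicative_unitary ::
    "('a::chilbert_space \<Rightarrow> 'a \<Rightarrow> 'c::chilbert_space) \<Rightarrow>
      ('g::chilbert_space \<Rightarrow> 'g \<Rightarrow> 'k::chilbert_space) \<Rightarrow> ('a \<Rightarrow>\<^sub>L 'a) set \<Rightarrow>
      (('a \<Rightarrow>\<^sub>L 'a) \<Rightarrow> ('c \<Rightarrow>\<^sub>L 'c)) \<Rightarrow> (('a \<Rightarrow>\<^sub>L 'a) \<Rightarrow> ennreal) \<Rightarrow> (('a \<Rightarrow>\<^sub>L 'a) \<Rightarrow> 'g) \<Rightarrow>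
      (('c \<Rightarrow>\<^sub>L 'c) \<Rightarrow> 'k) \<Rightarrow> ('k \<Rightarrow>\<^sub>L 'k) \<Rightarrow> bool"
  where "multiplicative_unitary t tg M \<Delta> \<phi> \<Lambda> \<Lambda>2 W \<longleftrightarrow>
    unitary_op W \<and> W \<in> vn_tensor tg (gns_rep M \<phi> \<Lambda> ` M) bop \<and>
    (\<forall>x \<in> weight_nfin M \<phi>. \<forall>y \<in> weight_nfin M \<phi>.
      blinfun_apply (adj W) (tg (\<Lambda> x) (\<Lambda> y)) = \<Lambda>2 (\<Delta> y o\<^sub>L op_tensor t x id_blinfun))"

text \<open>The left regular representation \<open>f \<mapsto> (f \<otimes> id)(W)\<close>; \<open>f\<close> is first transported to the
  image of the GNS representation.\<close>

definition left_regular ::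
    "('g::chilbert_space \<Rightarrow> 'g \<Rightarrow> 'k::chilbert_space) \<Rightarrow> ('a::chilbert_space \<Rightarrow>\<^sub>L 'a) set \<Rightarrow>
      (('a \<Rightarrow>\<^sub>L 'a) \<Rightarrow> ennreal) \<Rightarrow> (('a \<Rightarrow>\<^sub>L 'a) \<Rightarrow> 'g) \<Rightarrow> ('k \<Rightarrow>\<^sub>L 'k) \<Rightarrow>
      (('a \<Rightarrow>\<^sub>L 'a) \<Rightarrow> complex) \<Rightarrow> ('g \<Rightarrow>\<^sub>L 'g)"
  where "left_regular tg M \<phi> \<Lambda> W f = slice_left tg (gns_rep M \<phi> \<Lambda> ` M) bop
    (\<lambda>T. if T \<in> gns_rep M \<phi> \<Lambda> ` M then f (the_inv_into M (gns_rep M \<phi> \<Lambda>) T) else 0) W"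

definition reduced_cstar ::
    "('g::chilbert_space \<Rightarrow> 'g \<Rightarrow> 'k::chilbert_space) \<Rightarrow> ('a::chilbert_space \<Rightarrow>\<^sub>L 'a) set \<Rightarrow>
      (('a \<Rightarrow>\<^sub>L 'a) \<Rightarrow> ennreal) \<Rightarrow> (('a \<Rightarrow>\<^sub>L 'a) \<Rightarrow> 'g) \<Rightarrow> ('k \<Rightarrow>\<^sub>L 'k) \<Rightarrow> ('g \<Rightarrow>\<^sub>L 'g) set"
  where "reduced_cstar tg M \<phi> \<Lambda> W = cstar_subalgebra hull (left_regular tg M \<phi> \<Lambda> W ` predual M)"

definition regular_family ::
    "('g::chilbert_space \<Rightarrow> 'g \<Rightarrow> 'k::chilbert_space) \<Rightarrow> ('a::chilbert_space \<Rightarrow>\<^sub>L 'a) set \<Rightarrow>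
      (('a \<Rightarrow>\<^sub>L 'a) \<Rightarrow> ennreal) \<Rightarrow> (('a \<Rightarrow>\<^sub>L 'a) \<Rightarrow> 'g) \<Rightarrow> ('k \<Rightarrow>\<^sub>L 'k) \<Rightarrow>
      (('a \<Rightarrow>\<^sub>L 'a) \<Rightarrow> complex) set \<Rightarrow> bool"
  where "regular_family tg M \<phi> \<Lambda> W \<Gamma> \<longleftrightarrow>
    (\<forall>\<omega>\<in>\<Gamma>. \<omega> \<in> predual M \<and> state_on M \<omega>) \<and>
    (\<forall>f \<in> predual M. \<forall>e>0. \<exists>(n::nat) c w. (\<forall>i<n. w i \<in> \<Gamma>) \<and>
      functional_norm M (\<lambda>x. f x - (\<Sum>i<n. c i * w i x)) < e) \<and>
    (\<forall>\<omega>\<in>\<Gamma>. left_regular tg M \<phi> \<Lambda> W \<omega> \<in> reduced_cstar tg M \<phi> \<Lambda> W \<and>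
      unitary_op (left_regular tg M \<phi> \<Lambda> W \<omega>))"

definition left_covariant ::
    "('a::chilbert_space \<Rightarrow> 'a \<Rightarrow> 'c::chilbert_space) \<Rightarrow>
      ('g::chilbert_space \<Rightarrow> 'g \<Rightarrow> 'k::chilbert_space) \<Rightarrow> ('a \<Rightarrow>\<^sub>L 'a) set \<Rightarrow>
      (('a \<Rightarrow>\<^sub>L 'a) \<Rightarrow> ('c \<Rightarrow>\<^sub>L 'c)) \<Rightarrow> (('a \<Rightarrow>\<^sub>L 'a) \<Rightarrow> ennreal) \<Rightarrow> (('a \<Rightarrow>\<^sub>L 'a) \<Rightarrow> 'g) \<Rightarrow>
      ('k \<Rightarrow>\<^sub>L 'k) \<Rightarrow> (('a \<Rightarrow>\<^sub>L 'a) \<Rightarrow> complex) set \<Rightarrow> bool"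
  where "left_covariant t tg M \<Delta> \<phi> \<Lambda> W \<Gamma> \<longleftrightarrow> (\<forall>\<omega>\<in>\<Gamma>.
    normal_star_automorphism M (act_left t M \<Delta> \<omega>) \<and>
    (\<forall>F\<in>M. gns_rep M \<phi> \<Lambda> (act_left t M \<Delta> \<omega> F) =
      left_regular tg M \<phi> \<Lambda> W \<omega> o\<^sub>L gns_rep M \<phi> \<Lambda> F o\<^sub>L adj (left_regular tg M \<phi> \<Lambda> W \<omega>)))"

definition right_covariant ::
    "('a::chilbert_space \<Rightarrow> 'a \<Rightarrow> 'c::chilbert_space) \<Rightarrow>
      ('g::chilbert_space \<Rightarrow> 'g \<Rightarrow> 'k::chilbert_space) \<Rightarrow> ('a \<Rightarrow>\<^sub>L 'a) set \<Rightarrow>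
      (('a \<Rightarrow>\<^sub>L 'a) \<Rightarrow> ('c \<Rightarrow>\<^sub>L 'c)) \<Rightarrow> (('a \<Rightarrow>\<^sub>L 'a) \<Rightarrow> ennreal) \<Rightarrow> (('a \<Rightarrow>\<^sub>L 'a) \<Rightarrow> 'g) \<Rightarrow>
      ('k \<Rightarrow>\<^sub>L 'k) \<Rightarrow> (('a \<Rightarrow>\<^sub>L 'a) \<Rightarrow> complex) set \<Rightarrow> bool"
  where "right_covariant t tg M \<Delta> \<phi> \<Lambda> W \<Gamma> \<longleftrightarrow> (\<forall>\<omega>\<in>\<Gamma>.
    normal_star_automorphism M (\<lambda>F. act_right t M \<Delta> F \<omega>) \<and>
    (\<forall>F\<in>M. gns_rep M \<phi> \<Lambda> (act_right t M \<Delta> F \<omega>) =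
      adj (left_regular tg M \<phi> \<Lambda> W \<omega>) o\<^sub>L gns_rep M \<phi> \<Lambda> F o\<^sub>L left_regular tg M \<phi> \<Lambda> W \<omega>))"

definition left_invariant_mean ::
    "('a::chilbert_space \<Rightarrow> 'a \<Rightarrow> 'c::chilbert_space) \<Rightarrow> ('a \<Rightarrow>\<^sub>L 'a) set \<Rightarrow>
      (('a \<Rightarrow>\<^sub>L 'a) \<Rightarrow> ('c \<Rightarrow>\<^sub>L 'c)) \<Rightarrow> (('a \<Rightarrow>\<^sub>L 'a) \<Rightarrow> complex) \<Rightarrow> bool"
  where "left_invariant_mean t M \<Delta> \<mu> \<longleftrightarrow> state_on M \<mu> \<and>
    (\<forall>F\<in>M. \<forall>\<omega> \<in> predual M. \<mu> (slice_left t M M \<omega> (\<Delta> F)) = \<omega> id_blinfun * \<mu> F)"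

definition right_invariant_mean ::
    "('a::chilbert_space \<Rightarrow> 'a \<Rightarrow> 'c::chilbert_space) \<Rightarrow> ('a \<Rightarrow>\<^sub>L 'a) set \<Rightarrow>
      (('a \<Rightarrow>\<^sub>L 'a) \<Rightarrow> ('c \<Rightarrow>\<^sub>L 'c)) \<Rightarrow> (('a \<Rightarrow>\<^sub>L 'a) \<Rightarrow> complex) \<Rightarrow> bool"
  where "right_invariant_mean t M \<Delta> \<mu> \<longleftrightarrow> state_on M \<mu> \<and>
    (\<forall>F\<in>M. \<forall>\<omega> \<in> predual M. \<mu> (slice_right t M M \<omega> (\<Delta> F)) = \<omega> id_blinfun * \<mu> F)"


section \<open>Banach algebras and bimodules\<close>

text \<open>The predual is a set depending on \<open>M\<close>, so Banach spaces, algebras and bimodules are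
  given by explicit carriers here.\<close>

record 'x cnspace =
  Elem :: "'x set"
  Zero :: 'x
  Add :: "'x \<Rightarrow> 'x \<Rightarrow> 'x"
  Scale :: "complex \<Rightarrow> 'x \<Rightarrow> 'x"
  Norm :: "'x \<Rightarrow> real"

record 'x cnalgebra = "'x cnspace" +
  Mult :: "'x \<Rightarrow> 'x \<Rightarrow> 'x"

record ('a, 'x) cnbimodule = "'x cnspace" +
  LAct :: "'a \<Rightarrow> 'x \<Rightarrow> 'x"
  RAct :: "'x \<Rightarrow> 'a \<Rightarrow> 'x"

definition Sub :: "('x, 'm) cnspace_scheme \<Rightarrow> 'x \<Rightarrow> 'x \<Rightarrow> 'x"
  where "Sub X x y = Add X x (Scale X (-1) y)"

definition complex_normed_space :: "('x, 'm) cnspace_scheme \<Rightarrow> bool"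
  where "complex_normed_space X \<longleftrightarrow>
    Zero X \<in> Elem X \<and>
    (\<forall>x\<in>Elem X. \<forall>y\<in>Elem X. Add X x y \<in> Elem X \<and> Add X x y = Add X y x) \<and>
    (\<forall>x\<in>Elem X. \<forall>y\<in>Elem X. \<forall>z\<in>Elem X. Add X (Add X x y) z = Add X x (Add X y z)) \<and>
    (\<forall>x\<in>Elem X. Add X x (Zero X) = x \<and> Sub X x x = Zero X \<and> Scale X 1 x = x) \<and>
    (\<forall>x\<in>Elem X. \<forall>c. Scale X c x \<in> Elem X) \<and>
    (\<forall>x\<in>Elem X. \<forall>y\<in>Elem X. \<forall>c. Scale X c (Add X x y) = Add X (Scale X c x) (Scale X c y)) \<and>
    (\<forall>x\<in>Elem X. \<forall>c d. Scale X (c + d) x = Add X (Scale X c x) (Scale X d x) \<and>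
      Scale X c (Scale X d x) = Scale X (c * d) x) \<and>
    (\<forall>x\<in>Elem X. 0 \<le> Norm X x \<and> (Norm X x = 0 \<longleftrightarrow> x = Zero X) \<and>
      (\<forall>c. Norm X (Scale X c x) = cmod c * Norm X x)) \<and>
    (\<forall>x\<in>Elem X. \<forall>y\<in>Elem X. Norm X (Add X x y) \<le> Norm X x + Norm X y)"

definition banach_space :: "('x, 'm) cnspace_scheme \<Rightarrow> bool"
  where "banach_space X \<longleftrightarrow> complex_normed_space X \<and>
    (\<forall>s. (\<forall>n. s n \<in> Elem X) \<and>
      (\<forall>e>0. \<exists>N. \<forall>m\<ge>N. \<forall>n\<ge>N. Norm X (Sub X (s m) (s n)) < e) \<longrightarrow>
      (\<exists>l\<in>Elem X. (\<lambda>n. Norm X (Sub X (s n) l)) \<longlonglongrightarrow> 0))"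

definition complex_linear_on ::
    "('x, 'm) cnspace_scheme \<Rightarrow> ('y, 'n) cnspace_scheme \<Rightarrow> ('x \<Rightarrow> 'y) \<Rightarrow> bool"
  where "complex_linear_on X Y T \<longleftrightarrow> T ` Elem X \<subseteq> Elem Y \<and>
    (\<forall>x\<in>Elem X. \<forall>y\<in>Elem X. T (Add X x y) = Add Y (T x) (T y)) \<and>
    (\<forall>x\<in>Elem X. \<forall>c. T (Scale X c x) = Scale Y c (T x))"

definition banach_bimodule ::
    "('a, 'm) cnalgebra_scheme \<Rightarrow> ('a, 'x, 'n) cnbimodule_scheme \<Rightarrow> bool"
  where "banach_bimodule A X \<longleftrightarrow> banach_space X \<and>
    (\<forall>a\<in>Elem A. complex_linear_on X X (LAct X a) \<and> complex_linear_on X X (\<lambda>x. RAct X x a)) \<and>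
    (\<forall>x\<in>Elem X. complex_linear_on A X (\<lambda>a. LAct X a x) \<and> complex_linear_on A X (RAct X x)) \<and>
    (\<forall>a\<in>Elem A. \<forall>b\<in>Elem A. \<forall>x\<in>Elem X.
      LAct X (Mult A a b) x = LAct X a (LAct X b x) \<and>
      RAct X x (Mult A a b) = RAct X (RAct X x a) b \<and>
      RAct X (LAct X a x) b = LAct X a (RAct X x b)) \<and>
    (\<exists>K. \<forall>a\<in>Elem A. \<forall>x\<in>Elem X.
      Norm X (LAct X a x) \<le> K * Norm A a * Norm X x \<and>
      Norm X (RAct X x a) \<le> K * Norm A a * Norm X x)"

definition continuous_derivation ::
    "('a, 'm) cnalgebra_scheme \<Rightarrow> ('a, 'x, 'n) cnbimodule_scheme \<Rightarrow> ('a \<Rightarrow> 'x) \<Rightarrow> bool"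
  where "continuous_derivation A X D \<longleftrightarrow> complex_linear_on A X D \<and>
    (\<exists>K. \<forall>a\<in>Elem A. Norm X (D a) \<le> K * Norm A a) \<and>
    (\<forall>a\<in>Elem A. \<forall>b\<in>Elem A. D (Mult A a b) = Add X (RAct X (D a) b) (LAct X a (D b)))"

text \<open>Nets are rendered as proper filters: a net and its filter of tails have the same limits,
  and every proper filter arises in this way.\<close>

text \<open>A definition cannot quantify over types, so the bimodules range over those carried by a
  subset of \<^typ>\<open>('a \<Rightarrow> 'a \<Rightarrow> complex) \<Rightarrow> complex\<close>, with arbitrary operations. This
  loses nothing. Let \<open>A'\<close> be the unitization of \<open>A\<close>, and \<open>K\<close> the kernel of the product map
  from the projective tensor product of \<open>A'\<close> with itself to \<open>A'\<close>. For a
  derivation \<open>D\<close> into any \<open>X\<close> (made unital over \<open>A'\<close>, with \<open>D 1 = 0\<close>), the bimodule map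
  \<open>K \<rightarrow> X\<close>, \<open>a \<otimes> b \<mapsto> D a \<cdot> b\<close> takes the derivation \<open>a \<mapsto> a \<otimes> 1 - 1 \<otimes> a\<close> to \<open>D\<close>; so
  nets for this single derivation are mapped to nets for \<open>D\<close>. As the elements of \<open>K\<close> are sums of
  sequences of elementary tensors, \<open>K\<close> has a copy inside the type used here.\<close>

definition approximately_amenable :: "('a, 'm) cnalgebra_scheme \<Rightarrow> bool"
  where "approximately_amenable A \<longleftrightarrow>
    (\<forall>(X :: ('a, ('a \<Rightarrow> 'a \<Rightarrow> complex) \<Rightarrow> complex) cnbimodule) D.
      banach_bimodule A X \<and> continuous_derivation A X D \<longrightarrow>
      (\<exists>\<F>. \<F> \<noteq> bot \<and> eventually (\<lambda>x. x \<in> Elem X) \<F> \<and>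
        (\<forall>a\<in>Elem A.
          ((\<lambda>x. Norm X (Sub X (Sub X (LAct X a x) (RAct X x a)) (D a))) \<longlongrightarrow> 0) \<F>)))"

definition has_bounded_approximate_identity :: "('a, 'm) cnalgebra_scheme \<Rightarrow> bool"
  where "has_bounded_approximate_identity A \<longleftrightarrow>
    (\<exists>\<F> K. \<F> \<noteq> bot \<and> eventually (\<lambda>e. e \<in> Elem A \<and> Norm A e \<le> K) \<F> \<and>
      (\<forall>a\<in>Elem A. ((\<lambda>e. Norm A (Sub A (Mult A e a) a)) \<longlongrightarrow> 0) \<F> \<and>
                   ((\<lambda>e. Norm A (Sub A (Mult A a e) a)) \<longlongrightarrow> 0) \<F>))"

primrec psum :: "('x, 'm) cnspace_scheme \<Rightarrow> (nat \<Rightarrow> 'x) \<Rightarrow> nat \<Rightarrow> 'x"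
  where
    "psum X f 0 = Zero X"
  | "psum X f (Suc n) = Add X (psum X f n) (f n)"

definition series_sums :: "('x, 'm) cnspace_scheme \<Rightarrow> (nat \<Rightarrow> 'x) \<Rightarrow> 'x \<Rightarrow> bool"
  where "series_sums X f s \<longleftrightarrow> s \<in> Elem X \<and> (\<lambda>n. Norm X (Sub X (psum X f n) s)) \<longlonglongrightarrow> 0"

text \<open>The projective tensor product of \<open>A\<close> with itself consists of the absolutely convergent
  series of elementary tensors, with norm the infimum of \<open>\<Sum>n. \<parallel>p n\<parallel> \<parallel>q n\<parallel>\<close> over all series
  \<open>\<Sum>n. p n \<otimes> q n\<close> representing the element. Its dual space is the space of bounded bilinear
  forms on \<open>A\<close>, so two series are equal iff these forms agree on them; an element is represented
  by the corresponding evaluation functional.\<close>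

definition bounded_bilinear_forms :: "('a, 'm) cnalgebra_scheme \<Rightarrow> ('a \<Rightarrow> 'a \<Rightarrow> complex) set"
  where "bounded_bilinear_forms A = {\<beta>.
    (\<forall>a\<in>Elem A. \<forall>b\<in>Elem A. \<forall>c\<in>Elem A.
      \<beta> (Add A a b) c = \<beta> a c + \<beta> b c \<and> \<beta> c (Add A a b) = \<beta> c a + \<beta> c b) \<and>
    (\<forall>a\<in>Elem A. \<forall>b\<in>Elem A. \<forall>z.
      \<beta> (Scale A z a) b = z * \<beta> a b \<and> \<beta> a (Scale A z b) = z * \<beta> a b) \<and>
    (\<exists>K. \<forall>a\<in>Elem A. \<forall>b\<in>Elem A. cmod (\<beta> a b) \<le> K * Norm A a * Norm A b)}"

definition represents ::
    "('a, 'm) cnalgebra_scheme \<Rightarrow> (nat \<Rightarrow> 'a) \<Rightarrow> (nat \<Rightarrow> 'a) \<Rightarrow>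
      (('a \<Rightarrow> 'a \<Rightarrow> complex) \<Rightarrow> complex) \<Rightarrow> bool"
  where "represents A p q u \<longleftrightarrow> (\<forall>n. p n \<in> Elem A \<and> q n \<in> Elem A) \<and>
    summable (\<lambda>n. Norm A (p n) * Norm A (q n)) \<and>
    u = (\<lambda>\<beta>. if \<beta> \<in> bounded_bilinear_forms A then \<Sum>n. \<beta> (p n) (q n) else 0)"

definition projective_tensor ::
    "('a, 'm) cnalgebra_scheme \<Rightarrow> ('a, ('a \<Rightarrow> 'a \<Rightarrow> complex) \<Rightarrow> complex) cnbimodule"
  where "projective_tensor A = \<lparr>
    Elem = {u. \<exists>p q. represents A p q u},
    Zero = (\<lambda>\<beta>. 0),
    Add = (\<lambda>u v \<beta>. u \<beta> + v \<beta>),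
    Scale = (\<lambda>c u \<beta>. c * u \<beta>),
    Norm = (\<lambda>u. Inf {\<Sum>n. Norm A (p n) * Norm A (q n) | p q. represents A p q u}),
    LAct = (\<lambda>a u. THE v. \<exists>p q. represents A p q u \<and> represents A (\<lambda>n. Mult A a (p n)) q v),
    RAct = (\<lambda>u a. THE v. \<exists>p q. represents A p q u \<and> represents A p (\<lambda>n. Mult A (q n) a) v)\<rparr>"

definition product_map ::
    "('a, 'm) cnalgebra_scheme \<Rightarrow> (('a \<Rightarrow> 'a \<Rightarrow> complex) \<Rightarrow> complex) \<Rightarrow> 'a"
  where "product_map A u = (THE c. \<exists>p q. represents A p q u \<and>
    series_sums A (\<lambda>n. Mult A (p n) (q n)) c)"

definition pseudo_amenable :: "('a, 'm) cnalgebra_scheme \<Rightarrow> bool"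
  where "pseudo_amenable A \<longleftrightarrow> (let P = projective_tensor A in
    \<exists>\<F>. \<F> \<noteq> bot \<and> eventually (\<lambda>u. u \<in> Elem P) \<F> \<and>
      (\<forall>a\<in>Elem A. ((\<lambda>u. Norm P (Sub P (LAct P a u) (RAct P u a))) \<longlongrightarrow> 0) \<F> \<and>
                   ((\<lambda>u. Norm A (Sub A (Mult A (product_map A u) a) a)) \<longlongrightarrow> 0) \<F>))"

definition predual_algebra ::
    "('a::chilbert_space \<Rightarrow> 'a \<Rightarrow> 'c::chilbert_space) \<Rightarrow> ('a \<Rightarrow>\<^sub>L 'a) set \<Rightarrow>
      (('a \<Rightarrow>\<^sub>L 'a) \<Rightarrow> ('c \<Rightarrow>\<^sub>L 'c)) \<Rightarrow> (('a \<Rightarrow>\<^sub>L 'a) \<Rightarrow> complex) cnalgebra"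
  where "predual_algebra t M \<Delta> = \<lparr>
    Elem = predual M,
    Zero = (\<lambda>x. 0),
    Add = (\<lambda>f g x. f x + g x),
    Scale = (\<lambda>c f x. c * f x),
    Norm = functional_norm M,
    Mult = (\<lambda>f g x. if x \<in> M then functional_tensor t M M f g (\<Delta> x) else 0)\<rparr>"

end

theory Submission
  imports Defs
begin

text \<open>Both amenability hypotheses yield a net of bounded functionals \<open>n\<close> on \<open>M\<close> with \<open>n 1 \<rightarrow> 1\<close>
  and \<open>\<parallel>n (a \<cdot> F) - a 1 * n F\<parallel> \<rightarrow> 0\<close> (as functionals of \<open>F\<close>) for each \<open>a\<close> in the predual: for
  pseudo-amenability by applying the character \<open>f \<mapsto> f 1\<close> to one leg of the approximate diagonal,
  for approximate amenability from a derivation into the functionals that vanish at \<open>1\<close>. The \<open>n\<close>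
  need not be normal or positive. Choose a contraction \<open>x\<close> at which \<open>n / \<parallel>n\<parallel>\<close> almost attains its norm.
  Then \<open>F \<mapsto> n (F x) / \<parallel>n\<parallel>\<close> is nearly a state; it is nearly invariant under \<open>\<omega> \<in> \<Gamma>\<close>, because \<open>\<omega>\<close> acts
  by an automorphism, so that \<open>n / \<parallel>n\<parallel>\<close> almost attains its norm also at the preimage of \<open>x\<close>, and two
  such contractions give almost the same functional. A cluster point is a state that is invariant
  under \<open>\<Gamma>\<close>, hence an invariant mean, as the span of \<open>\<Gamma>\<close> is dense.\<close>

section \<open>Hilbert spaces\<close>

text \<open>The hypotheses speak of slices, tensor functionals, \<open>hom_tensor\<close> and
  projective tensors through definite descriptions, so these objects must first be shown to exist
  and to be unique. Uniqueness comes from the density theorem: a normal functional on a tensor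
  product is determined by its values on elementary tensors. Operators are obtained from bounded
  forms, and the sharp bounds come from Cauchy--Schwarz iterated on self-adjoint powers rather than
  from spectral theory. Normality of a limit requires a norm-closed predual; this rests on a
  duality: the norm of a normal functional on \<open>M\<close> is an infimum over its representing
  pairs of vectors. Coassociativity enters as associativity of the convolution, which makes a space
  of functionals on \<open>M\<close> a bimodule. For the mean itself, invariance must be uniform on
  the unit ball, because the test contraction depends on the functional; and the index is a pair of
  a functional and an accuracy, since a functional need not attain its norm.\<close>

lemma cinner_scaleC_right: "cinner x (c *\<^sub>C y) = cnj c * cinner (x::'a::chilbert_space) y"
  by (metis cinner_commute cinner_scaleC_left complex_cnj_mult)

lemma cinner_add_right: "cinner (x::'a::chilbert_space) (y + z) = cinner x y + cinner x z"
  by (metis cinner_commute cinner_add_left complex_cnj_add)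

lemma cinner_scaleR_left: "cinner (r *\<^sub>R (x::'a::chilbert_space)) y = of_real r * cinner x y"
  by (metis cinner_scaleC_left scaleC_of_real)

lemma cinner_scaleR_right: "cinner x (r *\<^sub>R (y::'a::chilbert_space)) = of_real r * cinner x y"
  by (metis cinner_scaleC_right scaleC_of_real complex_cnj_complex_of_real)

lemma cinner_minus_left: "cinner (- (x::'a::chilbert_space)) y = - cinner x y"
  using cinner_scaleR_left[of "-1" x y] by simp

lemma cinner_minus_right: "cinner x (- (y::'a::chilbert_space)) = - cinner x y"
  using cinner_scaleR_right[of x "-1" y] by simp

lemma cinner_diff_left: "cinner ((x::'a::chilbert_space) - y) z = cinner x z - cinner y z"
  by (metis cinner_add_left cinner_minus_left diff_conv_add_uminus)

lemma cinner_diff_right: "cinner (x::'a::chilbert_space) (y - z) = cinner x y - cinner x z"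
  by (metis cinner_add_right cinner_minus_right diff_conv_add_uminus)

lemma cinner_0_left [simp]: "cinner 0 (y::'a::chilbert_space) = 0"
  using cinner_scaleR_left[of 0 y y] by simp

lemma cinner_0_right [simp]: "cinner (y::'a::chilbert_space) 0 = 0"
  using cinner_scaleR_right[of y 0 y] by simp

lemma scaleC_0_right [simp]: "c *\<^sub>C (0::'a::chilbert_space) = 0"
  using norm_scaleC[of c "0::'a"] by simp

lemma scaleC_one [simp]: "1 *\<^sub>C (x::'a::chilbert_space) = x"
  by (metis of_real_1 scaleC_of_real scaleR_one)

lemma scaleC_0_left [simp]: "0 *\<^sub>C (x::'a::chilbert_space) = 0"
  by (metis of_real_0 scaleC_of_real scaleR_zero_left)

lemma scaleC_minus_one [simp]: "(- 1) *\<^sub>C (x::'a::chilbert_space) = - x"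
  using scaleC_of_real[of "-1" x] by simp

lemma scaleC_minus_right: "c *\<^sub>C (- x) = - (c *\<^sub>C (x::'a::chilbert_space))"
  by (metis mult.commute scaleC_minus_one scaleC_scaleC)

lemma scaleC_diff_right: "c *\<^sub>C (x - y) = c *\<^sub>C (x::'a::chilbert_space) - c *\<^sub>C y"
  by (metis diff_conv_add_uminus scaleC_add_right scaleC_minus_right)

lemma scaleC_scaleR: "c *\<^sub>C (r *\<^sub>R x) = r *\<^sub>R (c *\<^sub>C (x::'a::chilbert_space))"
  by (simp only: scaleC_of_real[symmetric] scaleC_scaleC mult.commute)

lemma norm_sq_cinner: "(norm (x::'a::chilbert_space))\<^sup>2 = Re (cinner x x)"
  by (simp add: cinner_self)

lemma norm_add_sq: "(norm ((x::'a::chilbert_space) + y))\<^sup>2 = (norm x)\<^sup>2 + (norm y)\<^sup>2 + 2 * Re (cinner x y)"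
proof -
  have "Re (cinner y x) = Re (cinner x y)" by (subst cinner_commute) simp
  then show ?thesis
    by (simp add: norm_sq_cinner cinner_add_left cinner_add_right del: cinner_self)
qed

lemma norm_diff_sq: "(norm ((x::'a::chilbert_space) - y))\<^sup>2 = (norm x)\<^sup>2 + (norm y)\<^sup>2 - 2 * Re (cinner x y)"
  using norm_add_sq[of x "- y"] by (simp add: cinner_minus_right)

lemma parallelogram:
  "(norm ((x::'a::chilbert_space) + y))\<^sup>2 + (norm (x - y))\<^sup>2 = 2 * (norm x)\<^sup>2 + 2 * (norm y)\<^sup>2"
  by (simp add: norm_add_sq norm_diff_sq)

lemma unimodular_factor: "\<exists>c. cmod c = 1 \<and> c * z = complex_of_real (cmod z)"
proof (cases "z = 0")
  case False
  show ?thesis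
  proof (intro exI conjI)
    show "cmod (cnj z / cmod z) = 1" using False by (simp add: norm_divide)
    show "cnj z / cmod z * z = complex_of_real (cmod z)"
      using False complex_norm_square[of z]
      by (simp add: field_simps power2_eq_square)
  qed
qed (auto intro: exI[of _ 1])

lemma Re_cinner_le: "Re (cinner (x::'a::chilbert_space) y) \<le> norm x * norm y"
proof (cases "x = 0 \<or> y = 0")
  case False
  then have p: "norm x > 0" "norm y > 0" by auto
  \<comment> \<open>In this difference both vectors have length norm x * norm y, so expanding the
    square yields Cauchy--Schwarz with a common positive factor.\<close>
  have "0 \<le> (norm (norm y *\<^sub>R x - norm x *\<^sub>R y))\<^sup>2" by simp
  also have "\<dots> = 2 * (norm x * norm y) * (norm x * norm y - Re (cinner x y))"
    unfolding norm_diff_sq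
    by (simp add: cinner_scaleR_left cinner_scaleR_right power2_eq_square algebra_simps)
  finally have "0 \<le> (norm x * norm y) * (norm x * norm y - Re (cinner x y))" by simp
  then show ?thesis
    using mult_pos_pos[OF p] by (simp only: zero_le_mult_iff) linarith
qed auto

lemma cauchy_schwarz: "cmod (cinner (x::'a::chilbert_space) y) \<le> norm x * norm y"
proof -
  obtain c where c: "cmod c = 1" "c * cinner x y = complex_of_real (cmod (cinner x y))"
    using unimodular_factor by blast
  have "cmod (cinner x y) = Re (cinner (c *\<^sub>C x) y)"
    by (simp add: cinner_scaleC_left c)
  also have "\<dots> \<le> norm (c *\<^sub>C x) * norm y" by (rule Re_cinner_le)
  finally show ?thesis by (simp add: norm_scaleC c)
qed

lemma bounded_bilinear_cinner: "bounded_bilinear (cinner :: 'a::chilbert_space \<Rightarrow> 'a \<Rightarrow> complex)"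
proof
  show "\<exists>K. \<forall>a b. norm (cinner (a::'a) b) \<le> norm a * norm b * K"
    using cauchy_schwarz by (intro exI[of _ 1]) auto
qed (simp_all add: cinner_add_left cinner_add_right cinner_scaleR_left cinner_scaleR_right
    scaleR_conv_of_real)

interpretation cinner: bounded_bilinear "cinner :: 'a::chilbert_space \<Rightarrow> 'a \<Rightarrow> complex"
  by (rule bounded_bilinear_cinner)

lemma cinner_ext: "(\<And>z. cinner x z = cinner y z) \<Longrightarrow> x = (y::'a::chilbert_space)"
proof -
  assume a: "\<And>z. cinner x z = cinner y z"
  have "cinner (x - y) (x - y) = 0" using a by (simp add: cinner_diff_left)
  then show ?thesis by (simp add: cinner_self)
qed

lemma norm_le_cinnerI:
  assumes "0 \<le> C" "\<And>y. cmod (cinner x y) \<le> C * norm y"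
  shows "norm (x::'a::chilbert_space) \<le> C"
proof -
  have "norm x * norm x \<le> C * norm x"
    using assms(2)[of x] by (simp add: cinner_self norm_power power2_eq_square norm_mult)
  then show ?thesis using assms(1) by (cases "norm x = 0") auto
qed

section \<open>Orthogonal projection, Riesz representation and adjoints\<close>

lemma bop_scaleC: "T \<in> bop \<Longrightarrow> blinfun_apply T (c *\<^sub>C x) = c *\<^sub>C blinfun_apply T x"
  by (simp add: bop_def)

text \<open>A minimising sequence is Cauchy by the parallelogram law.\<close>

lemma projection_exists:
  fixes S :: "'a::chilbert_space set"
  assumes cl: "closed S" and sub: "subspace S" and sc: "\<And>c x. x \<in> S \<Longrightarrow> c *\<^sub>C x \<in> S"
  shows "\<exists>p\<in>S. \<forall>s\<in>S. cinner (x - p) s = 0"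
proof -
  define d where "d = infdist x S"
  have ne: "S \<noteq> {}" using sub subspace_0 by blast
  have dle: "d \<le> norm (x - s)" if "s \<in> S" for s
    unfolding d_def using infdist_le[OF that, of x] by (simp add: dist_norm)
  have d0: "0 \<le> d" unfolding d_def by (rule infdist_nonneg)
  have "\<exists>s\<in>S. norm (x - s) < d + 1 / real (Suc n)" for n
  proof (rule ccontr)
    assume "\<not> ?thesis"
    then have "d + 1 / real (Suc n) \<le> infdist x S"
      unfolding infdist_notempty[OF ne] using ne
      by (intro cINF_greatest) (auto simp: dist_norm not_less)
    then show False unfolding d_def by simp
  qed
  then obtain s where s: "\<And>n. s n \<in> S" "\<And>n. norm (x - s n) < d + 1 / real (Suc n)"
    by metis
  \<comment> \<open>The midpoint of u and v lies in S, so (x - u) + (x - v) has norm at least 2d;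
    the parallelogram law then leaves little room for the difference u - v.\<close>
  have near: "(norm (u - v))\<^sup>2 \<le> 4 * ((d + e)\<^sup>2 - d\<^sup>2)"
    if "u \<in> S" "v \<in> S" "norm (x - u) \<le> d + e" "norm (x - v) \<le> d + e" "0 \<le> e" for u v e
  proof -
    have mid: "(1/2) *\<^sub>R (u + v) \<in> S"
      using that sub by (simp add: subspace_add subspace_scale)
    have "(x - u) + (x - v) = 2 *\<^sub>R (x - (1/2) *\<^sub>R (u + v))"
      by (simp add: algebra_simps scaleR_2)
    then have "norm ((x - u) + (x - v)) \<ge> 2 * d"
      using dle[OF mid] by simp
    then have "(norm ((x - u) + (x - v)))\<^sup>2 \<ge> (2 * d)\<^sup>2"
      using d0 by (intro power_mono) auto
    moreover have "(norm (x - u))\<^sup>2 \<le> (d + e)\<^sup>2" "(norm (x - v))\<^sup>2 \<le> (d + e)\<^sup>2"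
      using that by (auto intro!: power_mono)
    moreover have "norm ((x - u) - (x - v)) = norm (u - v)"
      by (simp add: norm_minus_commute)
    ultimately show ?thesis
      using parallelogram[of "x - u" "x - v"] by (simp add: power_mult_distrib)
  qed
  have "Cauchy s"
  proof (rule metric_CauchyI)
    fix e :: real assume e: "0 < e"
    have "(\<lambda>n. 4 * ((d + 1 / real (Suc n))\<^sup>2 - d\<^sup>2)) \<longlonglongrightarrow> 4 * ((d + 0)\<^sup>2 - d\<^sup>2)"
      by (intro tendsto_intros LIMSEQ_Suc[OF lim_1_over_n])
    then have "eventually (\<lambda>n. 4 * ((d + 1 / real (Suc n))\<^sup>2 - d\<^sup>2) < e\<^sup>2) sequentially"
      using e by (auto elim!: order_tendstoD)
    then obtain N where N: "4 * ((d + 1 / real (Suc N))\<^sup>2 - d\<^sup>2) < e\<^sup>2"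
      by (auto simp: eventually_sequentially)
    show "\<exists>M. \<forall>m\<ge>M. \<forall>n\<ge>M. dist (s m) (s n) < e"
    proof (intro exI allI impI)
      fix m n assume mn: "N \<le> m" "N \<le> n"
      have le: "norm (x - s k) \<le> d + 1 / real (Suc N)" if "N \<le> k" for k
      proof -
        have "1 / real (Suc k) \<le> 1 / real (Suc N)" using that by (simp add: frac_le)
        then show ?thesis using s(2)[of k] by linarith
      qed
      have "(norm (s m - s n))\<^sup>2 \<le> 4 * ((d + 1 / real (Suc N))\<^sup>2 - d\<^sup>2)"
        using near[OF s(1) s(1) le[OF mn(1)] le[OF mn(2)]] by simp
      then have "(norm (s m - s n))\<^sup>2 < e\<^sup>2" using N by linarith
      then show "dist (s m) (s n) < e"
        using e by (simp add: dist_norm power_less_imp_less_base)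
    qed
  qed
  then obtain p where p: "s \<longlonglongrightarrow> p" using Cauchy_convergent_iff convergent_def by blast
  have pS: "p \<in> S" using cl p s(1) closed_sequentially by blast
  have "norm (x - p) \<le> d"
  proof (rule LIMSEQ_le)
    show "(\<lambda>n. norm (x - s n)) \<longlonglongrightarrow> norm (x - p)" by (intro tendsto_intros p)
    show "(\<lambda>n. d + 1 / real (Suc n)) \<longlonglongrightarrow> d"
      using tendsto_add[OF tendsto_const[of d] LIMSEQ_Suc[OF lim_1_over_n]] by simp
  qed (use s(2) in \<open>auto intro: less_imp_le\<close>)
  then have nd: "norm (x - p) = d" using dle[OF pS] by simp
  have orth: "Re (cinner (x - p) v) = 0" if v: "v \<in> S" for v
  proof -
    have q: "2 * r * Re (cinner (x - p) v) \<le> r\<^sup>2 * (norm v)\<^sup>2" for r :: real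
    proof -
      have "p + r *\<^sub>R v \<in> S" using pS v sub by (simp add: subspace_add subspace_scale)
      from dle[OF this] have "d\<^sup>2 \<le> (norm ((x - p) - r *\<^sub>R v))\<^sup>2"
        using d0 by (intro power_mono) (auto simp: diff_diff_eq)
      then show ?thesis
        unfolding norm_diff_sq[of "x - p"]
        by (simp add: nd cinner_scaleR_right power_mult_distrib mult.assoc)
    qed
    \<comment> \<open>The inequality \<open>q\<close> holds for every real r. The value r = a / b
      nearly optimises it; the summand 1 in b allows v = 0.\<close>
    define a where "a = Re (cinner (x - p) v)"
    define b where "b = (norm v)\<^sup>2 + 1"
    have b: "b > 0" "(norm v)\<^sup>2 \<le> b" unfolding b_def by (simp_all add: add_nonneg_pos)
    have "2 * (a / b) * a \<le> (a / b)\<^sup>2 * (norm v)\<^sup>2" unfolding a_def by (rule q)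
    also have "\<dots> \<le> (a / b)\<^sup>2 * b" using b by (intro mult_left_mono) auto
    finally have "2 * a\<^sup>2 / b \<le> a\<^sup>2 / b" using b by (simp add: power2_eq_square)
    then have "a\<^sup>2 \<le> 0" using b by (simp add: divide_le_cancel)
    then show ?thesis by (simp add: a_def)
  qed
  \<comment> \<open>S is closed under complex scalars, so testing with \<i> v turns the vanishing
    real part into a vanishing imaginary part.\<close>
  have "cinner (x - p) v = 0" if v: "v \<in> S" for v
  proof -
    have "Re (cinner (x - p) (\<i> *\<^sub>C v)) = 0" using orth[OF sc[OF v]] .
    then have "Im (cinner (x - p) v) = 0" by (simp add: cinner_scaleC_right)
    with orth[OF v] show ?thesis by (simp add: complex_eq_iff)
  qed
  then show ?thesis using pS by blast
qed

text \<open>Take v orthogonal to the kernel of f with f v not 0. The vector x - (f x / f v) v lies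
  in the kernel, and its orthogonality to v reads off f x.\<close>

lemma riesz:
  fixes f :: "'a::chilbert_space \<Rightarrow> complex"
  assumes bl: "bounded_linear f" and sc: "\<And>c x. f (c *\<^sub>C x) = c * f x"
  shows "\<exists>y. \<forall>x. f x = cinner x y"
proof (cases "\<forall>x. f x = 0")
  case True then show ?thesis by (intro exI[of _ 0]) auto
next
  case False
  interpret f: bounded_linear f by (rule bl)
  obtain w where w: "f w \<noteq> 0" using False by blast
  let ?S = "{x. f x = 0}"
  have "closed ?S"
    by (intro closed_Collect_eq linear_continuous_on bl continuous_on_const)
  moreover have "subspace ?S"
    by (auto simp: subspace_def f.add f.scaleR f.zero)
  ultimately obtain p where p: "f p = 0" "\<And>s. f s = 0 \<Longrightarrow> cinner (w - p) s = 0"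
    using projection_exists[of ?S w] by (auto simp: sc)
  define v where "v = w - p"
  have fv: "f v \<noteq> 0" using p w by (simp add: v_def f.diff)
  then have vv: "cinner v v \<noteq> 0" using f.zero by (auto simp: cinner_self)
  have "f x = cinner x (cnj (f v / cinner v v) *\<^sub>C v)" for x
  proof -
    have "f (x - (f x / f v) *\<^sub>C v) = 0" using fv by (simp add: f.diff sc)
    then have "cinner (x - (f x / f v) *\<^sub>C v) v = 0"
      using p(2) by (subst cinner_commute) (simp add: v_def)
    then have "cinner x v = f x / f v * cinner v v"
      by (simp add: cinner_diff_left cinner_scaleC_left)
    then show ?thesis using fv vv by (simp add: cinner_scaleC_right field_simps)
  qed
  then show ?thesis by blast
qed

text \<open>Riesz is applied for each fixed x to the conjugate of B x, because B is conjugate linear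
  in its second argument. Adjoints, slice maps and the operator in the duality argument for the
  predual are built this way.\<close>

lemma form_operator:
  fixes B :: "'a::chilbert_space \<Rightarrow> 'b::chilbert_space \<Rightarrow> complex"
  assumes addl: "\<And>x x' y. B (x + x') y = B x y + B x' y"
    and addr: "\<And>x y y'. B x (y + y') = B x y + B x y'"
    and scl: "\<And>c x y. B (c *\<^sub>C x) y = c * B x y"
    and scr: "\<And>c x y. B x (c *\<^sub>C y) = cnj c * B x y"
    and C: "0 \<le> C" and bd: "\<And>x y. cmod (B x y) \<le> C * norm x * norm y"
  shows "\<exists>T\<in>bop. norm T \<le> C \<and> (\<forall>x y. cinner (blinfun_apply T x) y = B x y)"
proof -
  have "\<exists>v. \<forall>y. cnj (B x y) = cinner y v" for x
  proof (rule riesz)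
    show "bounded_linear (\<lambda>y. cnj (B x y))"
    proof (rule bounded_linear_intro[where K = "C * norm x"])
      show "cnj (B x (r *\<^sub>R y)) = r *\<^sub>R cnj (B x y)" for r y
        using scr[of x "of_real r" y] by (simp add: scaleC_of_real scaleR_conv_of_real)
    qed (use bd in \<open>simp_all add: addr mult.commute mult.left_commute\<close>)
  qed (simp add: scr)
  then obtain g where "\<And>x y. cnj (B x y) = cinner y (g x)" by metis
  then have g: "cinner (g x) y = B x y" for x y
    by (metis cinner_commute complex_cnj_cnj)
  have bl: "bounded_linear g"
  proof (rule bounded_linear_intro[where K = C])
    show "g (x + y) = g x + g y" for x y
      by (rule cinner_ext) (simp add: g cinner_add_left addl)
    show "g (r *\<^sub>R x) = r *\<^sub>R g x" for r x
      using scl[of "of_real r"] by - (rule cinner_ext, simp add: g cinner_scaleR_left scaleC_of_real)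
    show "norm (g x) \<le> norm x * C" for x
      by (rule norm_le_cinnerI) (use bd C in \<open>auto simp: g mult.commute\<close>)
  qed
  have ap: "blinfun_apply (Blinfun g) = g" using bl by (rule bounded_linear_Blinfun_apply)
  show ?thesis
  proof (intro bexI conjI allI)
    show "Blinfun g \<in> bop"
      unfolding bop_def ap mem_Collect_eq
      by (intro allI, rule cinner_ext) (simp add: g cinner_scaleC_left scl)
    show "norm (Blinfun g) \<le> C"
      by (rule norm_blinfun_bound[OF C], rule norm_le_cinnerI) (use bd C in \<open>auto simp: ap g\<close>)
  qed (simp_all add: ap g)
qed

lemma adj_exists:
  fixes T :: "'a::chilbert_space \<Rightarrow>\<^sub>L 'b::chilbert_space"
  assumes "T \<in> bop"
  shows "\<exists>S\<in>bop. norm S \<le> norm T \<and>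
    (\<forall>x y. cinner (blinfun_apply S x) y = cinner x (blinfun_apply T y))"
proof (rule form_operator[where B = "\<lambda>x y. cinner x (blinfun_apply T y)" and C = "norm T"])
  show "cmod (cinner x (blinfun_apply T y)) \<le> norm T * norm x * norm y" for x y
  proof -
    have "cmod (cinner x (blinfun_apply T y)) \<le> norm x * (norm T * norm y)"
      by (rule order_trans[OF cauchy_schwarz]) (intro mult_left_mono norm_blinfun norm_ge_zero)
    then show ?thesis by (simp add: mult_ac)
  qed
qed (simp_all add: cinner_add_left cinner_add_right cinner_scaleC_left cinner_scaleC_right
    bop_scaleC[OF assms] blinfun.add_right)

text \<open>As \<open>adj\<close> is a definite description, nothing about it is available before
  existence is known; uniqueness holds because inner products separate vectors.\<close>

lemma adj_spec:
  assumes "T \<in> bop"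
  shows cinner_adj_left: "cinner (blinfun_apply (adj T) x) y = cinner x (blinfun_apply T y)"
    and adj_bop: "adj T \<in> bop" and norm_adj_le: "norm (adj T) \<le> norm T"
proof -
  obtain S where S: "S \<in> bop" "norm S \<le> norm T"
    "\<And>x y. cinner (blinfun_apply S x) y = cinner x (blinfun_apply T y)"
    using adj_exists[OF assms] by blast
  have eq: "adj T = S" unfolding adj_def
  proof (rule the_equality)
    fix S' assume "\<forall>x y. cinner (blinfun_apply S' x) y = cinner x (blinfun_apply T y)"
    then show "S' = S" by - (rule blinfun_eqI, rule cinner_ext, simp add: S)
  qed (simp add: S)
  show "cinner (blinfun_apply (adj T) x) y = cinner x (blinfun_apply T y)" "adj T \<in> bop" "norm (adj T) \<le> norm T"
    by (simp_all add: eq S)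
qed

lemma cinner_adj_right: "T \<in> bop \<Longrightarrow> cinner x (blinfun_apply (adj T) y) = cinner (blinfun_apply T x) y"
  by (metis cinner_adj_left cinner_commute)

lemma adj_unique:
  assumes "T \<in> bop" "\<And>x y. cinner (blinfun_apply S x) y = cinner x (blinfun_apply T y)"
  shows "adj T = S"
  by (rule blinfun_eqI, rule cinner_ext) (simp add: assms cinner_adj_left)

lemma adj_adj [simp]: "T \<in> bop \<Longrightarrow> adj (adj T) = T"
  by (rule adj_unique) (simp_all add: adj_bop cinner_adj_right)

section \<open>Algebra of bounded operators and adjoints\<close>

lemma bop_id [simp]: "id_blinfun \<in> bop" by (simp add: bop_def)
lemma bop_0 [simp]: "0 \<in> bop" by (simp add: bop_def)
lemma bop_add: "S \<in> bop \<Longrightarrow> T \<in> bop \<Longrightarrow> S + T \<in> bop"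
  by (simp add: bop_def blinfun.add_left scaleC_add_right)
lemma bop_diff: "S \<in> bop \<Longrightarrow> T \<in> bop \<Longrightarrow> S - T \<in> bop"
  by (simp add: bop_def blinfun.diff_left scaleC_diff_right)
lemma bop_compose: "S \<in> bop \<Longrightarrow> T \<in> bop \<Longrightarrow> S o\<^sub>L T \<in> bop"
  by (simp add: bop_def)
lemma bop_op_scale: "T \<in> bop \<Longrightarrow> op_scale c T \<in> bop"
  by (simp add: bop_def blinfun_apply_op_scale scaleC_scaleC mult.commute)
lemma bop_scaleR: "T \<in> bop \<Longrightarrow> r *\<^sub>R T \<in> bop"
  by (simp add: bop_def blinfun.scaleR_left scaleC_scaleR)

lemma op_scale_of_real: "op_scale (of_real r) T = r *\<^sub>R T"
  by (intro blinfun_eqI) (simp add: blinfun_apply_op_scale scaleC_of_real blinfun.scaleR_left)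

lemma op_scale_simps [simp]: "op_scale 1 T = T" "op_scale 0 T = 0" "op_scale c 0 = 0"
  by (intro blinfun_eqI; simp add: blinfun_apply_op_scale)+

lemma op_scale_minus_one: "op_scale (-1) T = - T"
  by (intro blinfun_eqI) (simp add: blinfun_apply_op_scale blinfun.minus_left)

lemma op_scale_op_scale [simp]: "op_scale c (op_scale d T) = op_scale (c * d) T"
  by (intro blinfun_eqI) (simp add: blinfun_apply_op_scale scaleC_scaleC)

lemma op_scale_add: "op_scale c (S + T) = op_scale c S + op_scale c T"
  by (intro blinfun_eqI) (simp add: blinfun_apply_op_scale scaleC_add_right blinfun.add_left)

lemma norm_op_scale_le: "norm (op_scale c T) \<le> cmod c * norm T"
proof (rule norm_blinfun_bound)
  show "norm (blinfun_apply (op_scale c T) x) \<le> cmod c * norm T * norm x" for x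
    using mult_left_mono[OF norm_blinfun[of T x], of "cmod c"]
    by (simp add: blinfun_apply_op_scale norm_scaleC mult.assoc)
qed simp

lemma op_scale_compose_left: "op_scale c S o\<^sub>L T = op_scale c (S o\<^sub>L T)"
  by (intro blinfun_eqI) (simp add: blinfun_apply_op_scale)

lemma blinfun_compose_id [simp]: "id_blinfun o\<^sub>L T = T" "T o\<^sub>L id_blinfun = T"
  by (intro blinfun_eqI; simp)+

lemma adj_id [simp]: "adj id_blinfun = id_blinfun"
  by (rule adj_unique) auto
lemma adj_add: "S \<in> bop \<Longrightarrow> T \<in> bop \<Longrightarrow> adj (S + T) = adj S + adj T"
  by (rule adj_unique)
    (simp_all add: bop_add blinfun.add_left cinner_add_left cinner_add_right cinner_adj_left)
lemma adj_compose: "S \<in> bop \<Longrightarrow> T \<in> bop \<Longrightarrow> adj (S o\<^sub>L T) = adj T o\<^sub>L adj S"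
  by (rule adj_unique) (simp_all add: bop_compose cinner_adj_left)
lemma adj_op_scale: "T \<in> bop \<Longrightarrow> adj (op_scale c T) = op_scale (cnj c) (adj T)"
  by (rule adj_unique)
    (simp_all add: bop_op_scale blinfun_apply_op_scale cinner_scaleC_left cinner_scaleC_right cinner_adj_left)
lemma adj_scaleR: "T \<in> bop \<Longrightarrow> adj (r *\<^sub>R T) = r *\<^sub>R adj T"
  using adj_op_scale[of T "of_real r"] by (simp add: op_scale_of_real)
lemma adj_0 [simp]: "adj 0 = 0"
  by (rule adj_unique) auto

lemma norm_adj: "T \<in> bop \<Longrightarrow> norm (adj T) = norm T"
  using norm_adj_le[of T] norm_adj_le[of "adj T"] by (simp add: adj_bop antisym)

text \<open>The last clause, uniqueness of the nearest point, gives linearity here and later the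
  commutation of the projection with operators that respect S and its orthogonal complement.\<close>

lemma projection_operator:
  fixes S :: "'a::chilbert_space set"
  assumes cl: "closed S" and sub: "subspace S" and sc: "\<And>c x. x \<in> S \<Longrightarrow> c *\<^sub>C x \<in> S"
  obtains P where "P \<in> bop" "\<And>x. blinfun_apply P x \<in> S"
    "\<And>x s. s \<in> S \<Longrightarrow> cinner (x - blinfun_apply P x) s = 0"
    "\<And>x p. p \<in> S \<Longrightarrow> (\<And>s. s \<in> S \<Longrightarrow> cinner (x - p) s = 0) \<Longrightarrow> blinfun_apply P x = p"
proof -
  obtain p where p: "\<And>x. p x \<in> S" "\<And>x s. s \<in> S \<Longrightarrow> cinner (x - p x) s = 0"
    using projection_exists[OF assms] by metis
  have uniq: "p x = q" if q: "q \<in> S" "\<And>s. s \<in> S \<Longrightarrow> cinner (x - q) s = 0" for x q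
  proof -
    have "p x - q \<in> S" using p(1) q(1) sub by (simp add: subspace_diff)
    then have "cinner (x - q) (p x - q) - cinner (x - p x) (p x - q) = 0"
      using p(2) q(2) by simp
    then have "cinner (p x - q) (p x - q) = 0" by (simp add: cinner_diff_left[symmetric])
    then show ?thesis by (simp add: cinner_self)
  qed
  have bl: "bounded_linear p"
  proof (rule bounded_linear_intro[where K = 1])
    show "p (x + y) = p x + p y" for x y
    proof (rule uniq)
      show "p x + p y \<in> S" using p(1) sub by (simp add: subspace_add)
      show "cinner (x + y - (p x + p y)) s = 0" if "s \<in> S" for s
        using p(2)[OF that, of x] p(2)[OF that, of y]
        by (simp add: cinner_diff_left cinner_add_left)
    qed
    show "p (r *\<^sub>R x) = r *\<^sub>R p x" for r x
    proof (rule uniq)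
      show "r *\<^sub>R p x \<in> S" using p(1) sub by (simp add: subspace_scale)
      show "cinner (r *\<^sub>R x - r *\<^sub>R p x) s = 0" if "s \<in> S" for s
        using p(2)[OF that, of x] by (simp add: scaleR_diff_right[symmetric] cinner_scaleR_left)
    qed
    show "norm (p x) \<le> norm x * 1" for x
    proof -
      have "cinner (x - p x) (p x) = 0" by (intro p)
      then have "(norm ((x - p x) + p x))\<^sup>2 = (norm (x - p x))\<^sup>2 + (norm (p x))\<^sup>2"
        unfolding norm_add_sq by simp
      then have "(norm (p x))\<^sup>2 \<le> (norm x)\<^sup>2" by simp
      then show ?thesis by simp
    qed
  qed
  have ap: "blinfun_apply (Blinfun p) = p" using bl by (rule bounded_linear_Blinfun_apply)
  show ?thesis
  proof (rule that[of "Blinfun p"])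
    have "p (c *\<^sub>C x) = c *\<^sub>C p x" for c x
      by (rule uniq) (simp_all add: p sc scaleC_diff_right[symmetric] cinner_scaleC_left)
    then show "Blinfun p \<in> bop" by (simp add: bop_def ap)
  qed (simp_all add: ap p uniq)
qed

text \<open>A bounded linear map on a subspace is Lipschitz, so it extends uniformly continuously to
  the closure; linearity and the bound pass to limits of sequences.\<close>

lemma extend_dense:
  fixes f :: "'a::real_normed_vector \<Rightarrow> 'b::banach"
  assumes sub: "subspace D" and dense: "closure D = UNIV"
    and add: "\<And>x y. x \<in> D \<Longrightarrow> y \<in> D \<Longrightarrow> f (x + y) = f x + f y"
    and sc: "\<And>r x. x \<in> D \<Longrightarrow> f (r *\<^sub>R x) = r *\<^sub>R f x"
    and bd: "\<And>x. x \<in> D \<Longrightarrow> norm (f x) \<le> C * norm x" and C: "0 \<le> C"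
  obtains g where "bounded_linear g" "\<And>x. x \<in> D \<Longrightarrow> g x = f x" "\<And>x. norm (g x) \<le> C * norm x"
proof -
  have diff: "f (x - y) = f x - f y" if "x \<in> D" "y \<in> D" for x y
    using add[of "x" "(-1) *\<^sub>R y"] sc[of y "-1"] that sub by (simp add: subspace_neg)
  have "C-lipschitz_on D f"
  proof (rule lipschitz_onI)
    show "dist (f x) (f y) \<le> C * dist x y" if "x \<in> D" "y \<in> D" for x y
      using bd[of "x - y"] that sub by (simp add: dist_norm diff subspace_diff)
  qed (rule C)
  then have "uniformly_continuous_on D f" by (rule lipschitz_on_uniformly_continuous)
  then obtain g where g: "uniformly_continuous_on (closure D) g" "\<And>x. x \<in> D \<Longrightarrow> f x = g x"
    using uniformly_continuous_on_extension_on_closure by metis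
  have cont: "continuous_on UNIV g"
    using uniformly_continuous_imp_continuous[OF g(1)] by (simp add: dense)
  have lim: "(\<lambda>n. g (u n)) \<longlonglongrightarrow> g x" if "u \<longlonglongrightarrow> x" for u x
    using cont that by (simp add: continuous_on_eq_continuous_at isCont_tendsto_compose)
  have seq: "\<exists>u. (\<forall>n::nat. u n \<in> D) \<and> u \<longlonglongrightarrow> x" for x
    using dense closure_sequential[of x D] by auto
  have gadd: "g (x + y) = g x + g y" for x y
  proof -
    obtain u v where u: "\<And>n::nat. u n \<in> D" "u \<longlonglongrightarrow> x" and v: "\<And>n::nat. v n \<in> D" "v \<longlonglongrightarrow> y"
      using seq by metis
    have "(\<lambda>n. g (u n + v n)) \<longlonglongrightarrow> g (x + y)" by (intro lim tendsto_add u v)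
    moreover have "g (u n + v n) = g (u n) + g (v n)" for n
      using u v sub by (metis add g(2) subspace_add)
    ultimately have "(\<lambda>n. g (u n) + g (v n)) \<longlonglongrightarrow> g (x + y)" by simp
    then show ?thesis using tendsto_add[OF lim[OF u(2)] lim[OF v(2)]] LIMSEQ_unique by blast
  qed
  have gsc: "g (r *\<^sub>R x) = r *\<^sub>R g x" for r x
  proof -
    obtain u where u: "\<And>n::nat. u n \<in> D" "u \<longlonglongrightarrow> x" using seq by metis
    have "(\<lambda>n. g (r *\<^sub>R u n)) \<longlonglongrightarrow> g (r *\<^sub>R x)" by (intro lim tendsto_intros u)
    moreover have "g (r *\<^sub>R u n) = r *\<^sub>R g (u n)" for n
      using u sub by (metis sc g(2) subspace_scale)
    ultimately have "(\<lambda>n. r *\<^sub>R g (u n)) \<longlonglongrightarrow> g (r *\<^sub>R x)" by simp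
    then show ?thesis using tendsto_scaleR[OF tendsto_const lim[OF u(2)]] LIMSEQ_unique by blast
  qed
  have gbd: "norm (g x) \<le> C * norm x" for x
  proof -
    obtain u where u: "\<And>n::nat. u n \<in> D" "u \<longlonglongrightarrow> x" using seq by metis
    show ?thesis
    proof (rule LIMSEQ_le)
      show "(\<lambda>n. norm (g (u n))) \<longlonglongrightarrow> norm (g x)" by (intro tendsto_norm lim u)
      show "(\<lambda>n. C * norm (u n)) \<longlonglongrightarrow> C * norm x" by (intro tendsto_intros u)
    qed (use bd u g(2) in auto)
  qed
  have "bounded_linear g"
    using gadd gsc gbd by (intro bounded_linear_intro[where K = C]) (auto simp: mult.commute)
  then show ?thesis using that g(2) gbd by metis
qed

text \<open>Powers of a self-adjoint element double in the exponent under the Cauchy--Schwarz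
  inequality, which turns a crude bound into the sharp one.\<close>

lemma power_trick:
  fixes b :: "nat \<Rightarrow> real"
  assumes "\<And>k. 0 \<le> b k" and step: "\<And>k. (b k)\<^sup>2 \<le> b (Suc k) * c"
    and bd: "\<And>k. b k \<le> K * r ^ (2 ^ k)" and c: "0 \<le> c" and r: "0 \<le> r"
  shows "b 0 \<le> r * c"
proof (cases "c = 0")
  case True
  then show ?thesis using step[of 0] by simp
next
  case False
  then have c: "c > 0" using c by simp
  show ?thesis
  proof (rule ccontr)
    assume "\<not> ?thesis"
    then have gt: "r < b 0 / c" using c by (simp add: field_simps)
    \<comment> \<open>Iterating \<open>step\<close> forces growth of b k / c at least like the
      powers of b 0 / c. Against the bound K * r ^ (2 ^ k) this is impossible if b 0 / c exceeds
      r.\<close>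
    have p: "(b 0 / c) ^ (2 ^ k) \<le> b k / c" for k
    proof (induction k)
      case (Suc k)
      have "(b 0 / c) ^ (2 ^ Suc k) = ((b 0 / c) ^ (2 ^ k))\<^sup>2"
        by (simp add: power_mult[symmetric] mult.commute)
      also have "\<dots> \<le> (b k / c)\<^sup>2" using Suc assms(1) c by (intro power_mono) auto
      also have "\<dots> \<le> b (Suc k) / c"
        using step[of k] c by (simp add: power_divide power2_eq_square field_simps)
      finally show ?case .
    qed simp
    define q where "q = b 0 / c"
    have q: "r < q" "0 < q" using gt r by (auto simp: q_def)
    have le: "q ^ (2 ^ k) \<le> (K / c) * r ^ (2 ^ k)" for k
      using order_trans[OF p[of k] divide_right_mono[OF bd[of k]]] c by (simp add: q_def)
    have "0 \<le> r / q" "r / q < 1" using q r by (simp_all add: divide_less_eq)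
    then have "(\<lambda>n. (r / q) ^ n) \<longlonglongrightarrow> 0" by (rule LIMSEQ_realpow_zero)
    then have "(\<lambda>n. (K / c) * (r / q) ^ n) \<longlonglongrightarrow> (K / c) * 0" by (rule tendsto_mult_left)
    then have "eventually (\<lambda>n. (K / c) * (r / q) ^ n < 1) sequentially"
      by (intro order_tendstoD) auto
    then obtain N where N: "\<And>n. n \<ge> N \<Longrightarrow> (K / c) * (r / q) ^ n < 1"
      by (auto simp: eventually_sequentially)
    \<comment> \<open>Only exponents that are powers of two are available; 2 ^ N is one beyond the
      threshold N.\<close>
    have "N \<le> 2 ^ N" by (simp add: less_imp_le)
    from N[OF this] have "(K / c) * r ^ (2 ^ N) < q ^ (2 ^ N)"
      using q c by (simp add: power_divide field_simps)
    then show False using le[of N] by simp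
  qed
qed

section \<open>Commutants and von Neumann algebras\<close>

text \<open>This is \<open>von_neumann_algebra\<close> without the clause on the zero algebra, so
  that bicommutants and tensor products have it at once.\<close>

definition vna :: "('a::chilbert_space \<Rightarrow>\<^sub>L 'a) set \<Rightarrow> bool"
  where "vna M \<longleftrightarrow> M \<subseteq> bop \<and> (\<forall>T\<in>M. adj T \<in> M) \<and> commutant (commutant M) = M"

lemma commutant_sub_bop: "commutant S \<subseteq> bop"
  by (auto simp: commutant_def)

lemma commutant_antimono: "S \<subseteq> T \<Longrightarrow> commutant T \<subseteq> commutant S"
  by (auto simp: commutant_def)

lemma commutant_commutant_sup: "S \<subseteq> bop \<Longrightarrow> S \<subseteq> commutant (commutant S)"
  by (auto simp: commutant_def)

lemma commutant3: "S \<subseteq> bop \<Longrightarrow> commutant (commutant (commutant S)) = commutant S"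
  by (rule antisym)
    (simp_all add: commutant_antimono commutant_commutant_sup commutant_sub_bop)

lemma commutantD: "T \<in> commutant S \<Longrightarrow> A \<in> S \<Longrightarrow> T o\<^sub>L A = A o\<^sub>L T"
  by (simp add: commutant_def)

lemma commutantD_apply:
  "T \<in> commutant S \<Longrightarrow> A \<in> S \<Longrightarrow> blinfun_apply T (blinfun_apply A x) = blinfun_apply A (blinfun_apply T x)"
  using commutantD[of T S A] by (metis blinfun_apply_blinfun_compose)

lemma commutantI:
  "T \<in> bop \<Longrightarrow> (\<And>A x. A \<in> S \<Longrightarrow> blinfun_apply T (blinfun_apply A x) = blinfun_apply A (blinfun_apply T x))
    \<Longrightarrow> T \<in> commutant S"
  by (auto simp: commutant_def intro!: blinfun_eqI)

lemma commutant_id: "id_blinfun \<in> commutant S"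
  by (rule commutantI) auto
lemma commutant_0: "0 \<in> commutant S"
  by (rule commutantI) auto
lemma commutant_add: "A \<in> commutant S \<Longrightarrow> B \<in> commutant S \<Longrightarrow> A + B \<in> commutant S"
  by (auto intro!: commutantI bop_add dest: subsetD[OF commutant_sub_bop]
      simp: blinfun.add_left blinfun.add_right commutantD_apply)
lemma commutant_compose: "A \<in> commutant S \<Longrightarrow> B \<in> commutant S \<Longrightarrow> A o\<^sub>L B \<in> commutant S"
  by (auto intro!: commutantI bop_compose dest: subsetD[OF commutant_sub_bop]
      simp: commutantD_apply)
lemma commutant_op_scale:
  "S \<subseteq> bop \<Longrightarrow> A \<in> commutant S \<Longrightarrow> op_scale c A \<in> commutant S"
  by (auto intro!: commutantI bop_op_scale dest: subsetD[OF commutant_sub_bop]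
      simp: blinfun_apply_op_scale commutantD_apply bop_scaleC subset_iff)

lemma commutant_adj:
  assumes "S \<subseteq> bop" "\<And>A. A \<in> S \<Longrightarrow> adj A \<in> S" "T \<in> commutant S"
  shows "adj T \<in> commutant S"
proof (rule commutantI)
  have T: "T \<in> bop" using assms(3) commutant_sub_bop by blast
  then show "adj T \<in> bop" by (rule adj_bop)
  fix A x assume A: "A \<in> S"
  have "adj T o\<^sub>L A = adj (adj A o\<^sub>L T)"
    using A T assms(1) by (subst adj_compose) (auto simp: adj_bop)
  also have "adj A o\<^sub>L T = T o\<^sub>L adj A"
    using commutantD[OF assms(3) assms(2)[OF A]] by simp
  also have "adj (T o\<^sub>L adj A) = A o\<^sub>L adj T"
    using A T assms(1) by (subst adj_compose) (auto simp: adj_bop)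
  finally show "blinfun_apply (adj T) (blinfun_apply A x) = blinfun_apply A (blinfun_apply (adj T) x)"
    by (metis blinfun_apply_blinfun_compose)
qed

lemma vna_bicommutant:
  assumes "S \<subseteq> bop" "\<And>A. A \<in> S \<Longrightarrow> adj A \<in> S"
  shows "vna (commutant (commutant S))"
  unfolding vna_def
proof (intro conjI ballI)
  show "adj T \<in> commutant (commutant S)" if "T \<in> commutant (commutant S)" for T
    by (rule commutant_adj[OF commutant_sub_bop commutant_adj[OF assms]]) (use that in auto)
qed (simp_all add: commutant_sub_bop commutant3)

lemma vna_bop: "vna M \<Longrightarrow> x \<in> M \<Longrightarrow> x \<in> bop" by (auto simp: vna_def)
lemma vna_adj: "vna M \<Longrightarrow> x \<in> M \<Longrightarrow> adj x \<in> M" by (auto simp: vna_def)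
lemma vna_id: "vna M \<Longrightarrow> id_blinfun \<in> M" by (metis vna_def commutant_id)
lemma vna_0: "vna M \<Longrightarrow> 0 \<in> M" by (metis vna_def commutant_0)
lemma vna_add: "vna M \<Longrightarrow> x \<in> M \<Longrightarrow> y \<in> M \<Longrightarrow> x + y \<in> M" by (metis vna_def commutant_add)
lemma vna_compose: "vna M \<Longrightarrow> x \<in> M \<Longrightarrow> y \<in> M \<Longrightarrow> x o\<^sub>L y \<in> M"
  by (metis vna_def commutant_compose)
lemma vna_op_scale: "vna M \<Longrightarrow> x \<in> M \<Longrightarrow> op_scale c x \<in> M"
  by (metis vna_def commutant_op_scale commutant_sub_bop)
lemma vna_scaleR: "vna M \<Longrightarrow> x \<in> M \<Longrightarrow> r *\<^sub>R x \<in> M"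
  using vna_op_scale[of M x "of_real r"] by (simp add: op_scale_of_real)
lemma vna_diff: "vna M \<Longrightarrow> x \<in> M \<Longrightarrow> y \<in> M \<Longrightarrow> x - y \<in> M"
  using vna_add[of M x "op_scale (-1) y"] vna_op_scale[of M y "-1"] by (simp add: op_scale_minus_one)
text \<open>By the bicommutant property, membership is tested against the commutant. This locates in
  the algebra the operators that come from existence arguments: inverses, corners, slices and
  ampliations.\<close>

lemma vnaI_commutant:
  "vna M \<Longrightarrow> T \<in> bop \<Longrightarrow>
    (\<And>A x. A \<in> commutant M \<Longrightarrow> blinfun_apply T (blinfun_apply A x) = blinfun_apply A (blinfun_apply T x))
    \<Longrightarrow> T \<in> M"
  by (metis vna_def commutantI)

lemma vna_von_neumann_algebra: "von_neumann_algebra M \<Longrightarrow> vna M"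
  by (simp add: von_neumann_algebra_def vna_def)

section \<open>Inverses, and contractivity of homomorphisms\<close>

lemma blinfun_compose_assoc: "(A o\<^sub>L B) o\<^sub>L C = A o\<^sub>L (B o\<^sub>L C)"
  by (rule blinfun_eqI) simp

text \<open>B is the geometric series of the powers P n of K; multiplying it by K on either side
  only removes its first term.\<close>

lemma neumann_inverse:
  fixes K :: "'a::banach \<Rightarrow>\<^sub>L 'a"
  assumes "norm K < 1"
  obtains B where "B o\<^sub>L (id_blinfun - K) = id_blinfun" "(id_blinfun - K) o\<^sub>L B = id_blinfun"
proof -
  define P where "P n = ((\<lambda>A. K o\<^sub>L A) ^^ n) id_blinfun" for n
  have P0: "P 0 = id_blinfun" and PS: "P (Suc n) = K o\<^sub>L P n" for n by (simp_all add: P_def)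
  have PK: "P n o\<^sub>L K = P (Suc n)" for n
    by (induction n) (simp_all add: P0 PS blinfun_compose_assoc)
  have nP: "norm (P n) \<le> norm K ^ n" for n
  proof (induction n)
    case 0 show ?case by (simp add: P0 norm_blinfun_id_le)
  next
    case (Suc n)
    have "norm (P (Suc n)) \<le> norm K * norm (P n)" unfolding PS by (rule norm_blinfun_compose)
    also have "\<dots> \<le> norm K * norm K ^ n" by (intro mult_left_mono Suc) simp
    finally show ?case by simp
  qed
  have sP: "summable P"
    using assms by (intro summable_comparison_test'[OF summable_geometric[of "norm K"] nP]) auto
  define B where "B = suminf P"
  have split: "(\<Sum>n. P (Suc n)) = B - id_blinfun"
    unfolding B_def using suminf_split_head[OF sP] by (simp add: P0)
  have "K o\<^sub>L B = (\<Sum>n. K o\<^sub>L P n)" unfolding B_def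
    by (rule bounded_linear.suminf[OF bounded_bilinear.bounded_linear_right[OF bounded_bilinear_blinfun_compose] sP])
  then have KB: "K o\<^sub>L B = B - id_blinfun" using split by (simp add: PS)
  have "B o\<^sub>L K = (\<Sum>n. P n o\<^sub>L K)" unfolding B_def
    by (rule bounded_linear.suminf[OF bounded_bilinear.bounded_linear_left[OF bounded_bilinear_blinfun_compose] sP])
  then have BK: "B o\<^sub>L K = B - id_blinfun" using split by (simp add: PK)
  show ?thesis
    by (rule that[of B])
      (simp_all add: KB BK bounded_bilinear.diff_left[OF bounded_bilinear_blinfun_compose]
        bounded_bilinear.diff_right[OF bounded_bilinear_blinfun_compose])
qed

text \<open>The inverse is determined by K, so whatever commutes with K commutes with B. The same
  computation gives complex linearity, because the Neumann series is summed among real-linear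
  operators.\<close>

lemma vna_inverse:
  assumes M: "vna M" and K: "K \<in> M" "norm K < 1"
  shows "\<exists>B\<in>M. B o\<^sub>L (id_blinfun - K) = id_blinfun"
proof -
  obtain B where B: "B o\<^sub>L (id_blinfun - K) = id_blinfun" "(id_blinfun - K) o\<^sub>L B = id_blinfun"
    using neumann_inverse[OF K(2)] by blast
  have B1: "blinfun_apply B (x - blinfun_apply K x) = x" for x
    using arg_cong[OF B(1), of "\<lambda>T. blinfun_apply T x"] by (simp add: blinfun.diff_left)
  have B2: "blinfun_apply B x - blinfun_apply K (blinfun_apply B x) = x" for x
    using arg_cong[OF B(2), of "\<lambda>T. blinfun_apply T x"] by (simp add: blinfun.diff_left)
  have Kb: "K \<in> bop" using M K by (simp add: vna_bop)
  have "B \<in> M"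
  proof (rule vnaI_commutant[OF M])
    show "B \<in> bop"
      unfolding bop_def
    proof (intro CollectI allI)
      fix c x
      have "blinfun_apply B (c *\<^sub>C x) = blinfun_apply B (c *\<^sub>C (blinfun_apply B x - blinfun_apply K (blinfun_apply B x)))"
        by (simp add: B2)
      also have "\<dots> = c *\<^sub>C blinfun_apply B x"
        using B1[of "c *\<^sub>C blinfun_apply B x"] Kb by (simp add: scaleC_diff_right bop_scaleC)
      finally show "blinfun_apply B (c *\<^sub>C x) = c *\<^sub>C blinfun_apply B x" .
    qed
    fix A x assume A: "A \<in> commutant M"
    have "blinfun_apply B (blinfun_apply A x)
        = blinfun_apply B (blinfun_apply A (blinfun_apply B x - blinfun_apply K (blinfun_apply B x)))"
      by (simp add: B2)
    also have "\<dots> = blinfun_apply A (blinfun_apply B x)"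
      using B1[of "blinfun_apply A (blinfun_apply B x)"] commutantD_apply[OF A K(1)]
      by (simp add: blinfun.diff_right)
    finally show "blinfun_apply B (blinfun_apply A x) = blinfun_apply A (blinfun_apply B x)" .
  qed
  then show ?thesis using B by blast
qed

text \<open>If \<open>\<parallel>x\<parallel> < s = \<parallel>\<sigma> x\<parallel>\<close>, then \<open>1 - x\<^sup>* x / s\<^sup>2\<close> is invertible, although \<open>s\<^sup>2\<close> is an approximate
  eigenvalue of \<open>\<sigma> (x\<^sup>* x)\<close>.\<close>

lemma star_hom_contractive:
  fixes M :: "('a::chilbert_space \<Rightarrow>\<^sub>L 'a) set" and \<sigma> :: "('a \<Rightarrow>\<^sub>L 'a) \<Rightarrow> ('b::chilbert_space \<Rightarrow>\<^sub>L 'b)"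
  assumes M: "vna M" and bop: "\<And>x. x \<in> M \<Longrightarrow> \<sigma> x \<in> bop"
    and add: "\<And>x y. x \<in> M \<Longrightarrow> y \<in> M \<Longrightarrow> \<sigma> (x + y) = \<sigma> x + \<sigma> y"
    and sc: "\<And>c x. x \<in> M \<Longrightarrow> \<sigma> (op_scale c x) = op_scale c (\<sigma> x)"
    and mult: "\<And>x y. x \<in> M \<Longrightarrow> y \<in> M \<Longrightarrow> \<sigma> (x o\<^sub>L y) = \<sigma> x o\<^sub>L \<sigma> y"
    and ad: "\<And>x. x \<in> M \<Longrightarrow> \<sigma> (adj x) = adj (\<sigma> x)"
    and one: "\<sigma> id_blinfun = id_blinfun" and x: "x \<in> M"
  shows "norm (\<sigma> x) \<le> norm x"
proof (rule ccontr)
  define S where "S = \<sigma> x"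
  define s where "s = norm S"
  assume "\<not> ?thesis"
  then have lt: "norm x < s" by (simp add: s_def S_def)
  then have s: "0 < s" using norm_ge_zero[of x] by linarith
  have Sb: "S \<in> bop" using bop x by (simp add: S_def)
  \<comment> \<open>Scaling by s, the supposedly larger norm of \<open>\<sigma> x\<close>, is what
    pushes the norm of K below 1.\<close>
  define K where "K = (1 / s\<^sup>2) *\<^sub>R (adj x o\<^sub>L x)"
  have KM: "K \<in> M" unfolding K_def using M x by (simp add: vna_scaleR vna_compose vna_adj)
  have "norm (adj x o\<^sub>L x) \<le> norm (adj x) * norm x" by (rule norm_blinfun_compose)
  also have "\<dots> = (norm x)\<^sup>2" using vna_bop[OF M x] by (simp add: norm_adj power2_eq_square)
  also have "\<dots> < s\<^sup>2" using lt by (intro power_strict_mono) auto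
  finally have "norm K < 1" using s by (simp add: K_def field_simps)
  then obtain B where B: "B \<in> M" "B o\<^sub>L (id_blinfun - K) = id_blinfun"
    using vna_inverse[OF M KM] by blast
  define T where "T = adj S o\<^sub>L S"
  have sR: "\<sigma> (r *\<^sub>R y) = r *\<^sub>R \<sigma> y" if "y \<in> M" for r y
    using sc[OF that, of "of_real r"] by (simp add: op_scale_of_real)
  have sK: "\<sigma> K = (1 / s\<^sup>2) *\<^sub>R T"
    unfolding K_def T_def S_def using M x by (simp add: sR mult ad vna_compose vna_adj)
  have "\<sigma> (id_blinfun - K) = id_blinfun - \<sigma> K"
    using add[OF vna_id[OF M] vna_op_scale[OF M KM, of "-1"]] sc[OF KM, of "-1"] one
    by (simp add: op_scale_minus_one)
  then have inv: "\<sigma> B o\<^sub>L (id_blinfun - (1 / s\<^sup>2) *\<^sub>R T) = id_blinfun"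
    using mult[OF B(1), of "id_blinfun - K"] B(2) M KM one sK by (simp add: vna_diff vna_id)
  \<comment> \<open>The summand 1 keeps \<beta> positive, so that division by its square is
    harmless.\<close>
  define \<beta> where "\<beta> = norm (\<sigma> B) + 1"
  have \<beta>: "1 \<le> \<beta>" by (simp add: \<beta>_def)
  \<comment> \<open>Since \<open>\<sigma> B\<close> inverts 1 - T / s^2, the norm of \<xi> is at
    most \<beta> times that of ?v. Expanding the square of ?v and using that T / s^2 is a
    contraction bounds S \<xi> strictly below s times the norm of \<xi>, uniformly in \<xi>.\<close>
  have est: "(norm (blinfun_apply S \<xi>))\<^sup>2 \<le> (s\<^sup>2 * (1 - 1 / (2 * \<beta>\<^sup>2))) * (norm \<xi>)\<^sup>2" for \<xi>
  proof -
    let ?v = "\<xi> - (1 / s\<^sup>2) *\<^sub>R blinfun_apply T \<xi>"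
    have "\<xi> = blinfun_apply (\<sigma> B) ?v"
      using arg_cong[OF inv, of "\<lambda>T. blinfun_apply T \<xi>"]
      by (simp add: blinfun.diff_left blinfun.scaleR_left)
    then have "norm \<xi> \<le> norm (\<sigma> B) * norm ?v" by (metis norm_blinfun)
    also have "\<dots> \<le> \<beta> * norm ?v" by (intro mult_right_mono) (auto simp: \<beta>_def)
    finally have 1: "(norm \<xi>)\<^sup>2 \<le> \<beta>\<^sup>2 * (norm ?v)\<^sup>2"
      unfolding power_mult_distrib[symmetric] by (intro power_mono) auto
    have nS: "norm (blinfun_apply S \<xi>) \<le> s * norm \<xi>" unfolding s_def by (rule norm_blinfun)
    have "norm (blinfun_apply T \<xi>) \<le> norm (adj S) * norm (blinfun_apply S \<xi>)"
      unfolding T_def by (simp add: norm_blinfun)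
    also have "\<dots> \<le> s * (s * norm \<xi>)"
      using nS Sb s by (simp add: norm_adj s_def[symmetric] mult_left_mono)
    finally have "(norm (blinfun_apply T \<xi>))\<^sup>2 \<le> (s * (s * norm \<xi>))\<^sup>2" by (intro power_mono) auto
    then have 2: "(norm ((1 / s\<^sup>2) *\<^sub>R blinfun_apply T \<xi>))\<^sup>2 \<le> (norm \<xi>)\<^sup>2"
      using s by (simp add: power_mult_distrib power_divide field_simps power2_eq_square)
    have "Re (cinner \<xi> (blinfun_apply T \<xi>)) = (norm (blinfun_apply S \<xi>))\<^sup>2"
      unfolding T_def using Sb by (simp add: cinner_adj_right norm_sq_cinner)
    then have "(norm ?v)\<^sup>2 \<le> 2 * (norm \<xi>)\<^sup>2 - 2 * (norm (blinfun_apply S \<xi>))\<^sup>2 / s\<^sup>2"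
      unfolding norm_diff_sq using 2 by (simp add: cinner_scaleR_right)
    then have "\<beta>\<^sup>2 * (norm ?v)\<^sup>2 \<le> \<beta>\<^sup>2 * (2 * (norm \<xi>)\<^sup>2 - 2 * (norm (blinfun_apply S \<xi>))\<^sup>2 / s\<^sup>2)"
      by (intro mult_left_mono) auto
    with 1 have "(norm \<xi>)\<^sup>2 \<le> \<beta>\<^sup>2 * (2 * (norm \<xi>)\<^sup>2 - 2 * (norm (blinfun_apply S \<xi>))\<^sup>2 / s\<^sup>2)" by linarith
    then show ?thesis using s \<beta> by (simp add: field_simps)
  qed
  have "1 \<le> 2 * \<beta>\<^sup>2" using one_le_power[OF \<beta>, of 2] by linarith
  then have le1: "1 / (2 * \<beta>\<^sup>2) \<le> 1" unfolding divide_le_eq_1 by linarith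
  define \<gamma> where "\<gamma> = sqrt (s\<^sup>2 * (1 - 1 / (2 * \<beta>\<^sup>2)))"
  have \<gamma>2: "\<gamma>\<^sup>2 = s\<^sup>2 * (1 - 1 / (2 * \<beta>\<^sup>2))" "0 \<le> \<gamma>" using le1 by (auto simp: \<gamma>_def)
  have "norm S \<le> \<gamma>"
  proof (rule norm_blinfun_bound[OF \<gamma>2(2)])
    fix \<xi>
    have "(norm (blinfun_apply S \<xi>))\<^sup>2 \<le> (\<gamma> * norm \<xi>)\<^sup>2"
      using est[of \<xi>] by (simp add: power_mult_distrib \<gamma>2)
    then show "norm (blinfun_apply S \<xi>) \<le> \<gamma> * norm \<xi>"
      by (rule power2_le_imp_le) (simp add: \<gamma>2(2))
  qed
  then have "s\<^sup>2 \<le> s\<^sup>2 * (1 - 1 / (2 * \<beta>\<^sup>2))"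
    using s power_mono[of s \<gamma> 2] by (simp add: s_def[symmetric] \<gamma>2)
  moreover have "s\<^sup>2 * (1 - 1 / (2 * \<beta>\<^sup>2)) < s\<^sup>2 * 1"
    using s \<beta> by (intro mult_strict_left_mono) auto
  ultimately show False by simp
qed

section \<open>Square-summable sequences and the density theorem\<close>

text \<open>The infinite direct sum of copies of the Hilbert space: a normal functional, given by
  two square-summable sequences of vectors, becomes a functional given by a single pair of vectors
  of this space.\<close>

typedef (overloaded) 'a ell2 = "{f::nat \<Rightarrow> 'a::chilbert_space. summable (\<lambda>n. (norm (f n))\<^sup>2)}"
  morphisms ell2_nth Abs_ell2
  by (rule exI[of _ "\<lambda>_. 0"]) simp

lemma ell2_summable: "summable (\<lambda>n. (norm (ell2_nth x n))\<^sup>2)"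
  using ell2_nth[of x] by simp

lemma Abs_ell2_nth: "summable (\<lambda>n. (norm (f n))\<^sup>2) \<Longrightarrow> ell2_nth (Abs_ell2 f) = f"
  by (rule Abs_ell2_inverse) simp

lemma ell2_eqI: "(\<And>n. ell2_nth x n = ell2_nth y n) \<Longrightarrow> x = y"
  by (metis ell2_nth_inject ext)

lemma norm_add_sq_le: "(norm ((a::'a::real_normed_vector) + b))\<^sup>2 \<le> 2 * (norm a)\<^sup>2 + 2 * (norm b)\<^sup>2"
proof -
  have "(norm (a + b))\<^sup>2 \<le> (norm a + norm b)\<^sup>2" by (intro power_mono norm_triangle_ineq) auto
  also have "\<dots> \<le> 2 * (norm a)\<^sup>2 + 2 * (norm b)\<^sup>2"
    using sum_squares_bound[of "norm a" "norm b"] by (simp add: power2_eq_square algebra_simps)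
  finally show ?thesis .
qed

lemma summable_add_sq:
  assumes "summable (\<lambda>n. (norm (f n))\<^sup>2)" "summable (\<lambda>n. (norm (g n))\<^sup>2)"
  shows "summable (\<lambda>n. (norm ((f n :: 'a::real_normed_vector) + g n))\<^sup>2)"
  by (rule summable_comparison_test'[where N = 0 and g = "\<lambda>n. 2 * (norm (f n))\<^sup>2 + 2 * (norm (g n))\<^sup>2"])
    (auto intro!: summable_add summable_mult assms norm_add_sq_le)

lemma summable_bounded_sq:
  assumes "summable (\<lambda>n. (norm (f n))\<^sup>2)" "\<And>n. norm (g n) \<le> C * norm (f n)"
  shows "summable (\<lambda>n. (norm (g n))\<^sup>2)"
proof (rule summable_comparison_test'[where N = 0 and g = "\<lambda>n. C\<^sup>2 * (norm (f n))\<^sup>2"])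
  show "norm ((norm (g n))\<^sup>2) \<le> C\<^sup>2 * (norm (f n))\<^sup>2" for n
    using power_mono[OF assms(2)[of n], of 2] by (simp add: power_mult_distrib)
qed (intro summable_mult assms)

instantiation ell2 :: (chilbert_space) real_normed_vector
begin

definition "0 = Abs_ell2 (\<lambda>_. 0)"
definition "x + y = Abs_ell2 (\<lambda>n. ell2_nth x n + ell2_nth y n)"
definition "- x = Abs_ell2 (\<lambda>n. - ell2_nth x n)"
definition "(x::'a ell2) - y = x + - y"
definition "r *\<^sub>R x = Abs_ell2 (\<lambda>n. r *\<^sub>R ell2_nth x n)"
definition "norm (x::'a ell2) = sqrt (\<Sum>n. (norm (ell2_nth x n))\<^sup>2)"
definition "sgn (x::'a ell2) = inverse (norm x) *\<^sub>R x"
definition "dist (x::'a ell2) y = norm (x - y)"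
definition [code del]: "(uniformity :: ('a ell2 \<times> 'a ell2) filter) = (INF e\<in>{0<..}. principal {(x, y). dist x y < e})"
definition [code del]: "open (U :: 'a ell2 set) \<longleftrightarrow> (\<forall>x\<in>U. eventually (\<lambda>(x', y). x' = x \<longrightarrow> y \<in> U) uniformity)"

lemma ell2_nth_simps [simp]:
  "ell2_nth 0 n = 0" "ell2_nth (x + y) n = ell2_nth x n + ell2_nth y n"
  "ell2_nth (- x) n = - ell2_nth x n" "ell2_nth (x - y) n = ell2_nth x n - ell2_nth y n"
  "ell2_nth (r *\<^sub>R x) n = r *\<^sub>R ell2_nth x n"
proof -
  show add: "ell2_nth (x + y) n = ell2_nth x n + ell2_nth y n" for x y :: "'a ell2"
    unfolding plus_ell2_def by (subst Abs_ell2_nth) (auto intro!: summable_add_sq ell2_summable)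
  show um: "ell2_nth (- x) n = - ell2_nth x n" for x :: "'a ell2"
    unfolding uminus_ell2_def by (subst Abs_ell2_nth) (auto intro!: ell2_summable)
  show "ell2_nth (x - y) n = ell2_nth x n - ell2_nth y n"
    unfolding minus_ell2_def by (simp add: add um)
  show "ell2_nth 0 n = (0::'a)" unfolding zero_ell2_def by (subst Abs_ell2_nth) auto
  show "ell2_nth (r *\<^sub>R x) n = r *\<^sub>R ell2_nth x n"
    unfolding scaleR_ell2_def
    by (subst Abs_ell2_nth) (auto intro!: summable_mult ell2_summable simp: power_mult_distrib)
qed

lemma norm_ell2_sq: "(norm (x::'a ell2))\<^sup>2 = (\<Sum>n. (norm (ell2_nth x n))\<^sup>2)"
  unfolding norm_ell2_def by (simp add: suminf_nonneg ell2_summable)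

lemma norm_ell2_partial: "(\<Sum>n<k. (norm (ell2_nth (x::'a ell2) n))\<^sup>2) \<le> (norm x)\<^sup>2"
  unfolding norm_ell2_sq by (rule sum_le_suminf) (auto simp: ell2_summable)

lemma norm_ell2_leI:
  assumes "0 \<le> C" "\<And>k. (\<Sum>n<k. (norm (ell2_nth (x::'a ell2) n))\<^sup>2) \<le> C\<^sup>2"
  shows "norm x \<le> C"
proof -
  have "(norm x)\<^sup>2 \<le> C\<^sup>2" unfolding norm_ell2_sq by (intro suminf_le_const ell2_summable assms)
  then show ?thesis using assms(1) by (rule power2_le_imp_le)
qed

lemma norm_ell2_nth_le: "norm (ell2_nth (x::'a ell2) n) \<le> norm x"
proof -
  have "(norm (ell2_nth x n))\<^sup>2 \<le> (\<Sum>k<Suc n. (norm (ell2_nth x k))\<^sup>2)"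
    by (rule member_le_sum) auto
  also have "\<dots> \<le> (norm x)\<^sup>2" by (rule norm_ell2_partial)
  finally show ?thesis by (rule power2_le_imp_le) (simp add: norm_ell2_def suminf_nonneg ell2_summable)
qed

instance
proof
  fix x y z :: "'a ell2" and r s :: real
  show "dist x y = norm (x - y)" "sgn x = inverse (norm x) *\<^sub>R x"
    "uniformity = (INF e\<in>{0<..}. principal {(x, y). dist (x::'a ell2) y < e})"
    by (rule dist_ell2_def sgn_ell2_def uniformity_ell2_def)+
  show "open U \<longleftrightarrow> (\<forall>x\<in>U. eventually (\<lambda>(x', y). x' = x \<longrightarrow> y \<in> U) uniformity)" for U :: "'a ell2 set"
    by (rule open_ell2_def)
  show "x + y + z = x + (y + z)" "x + y = y + x" "0 + x = x" "- x + x = 0" "x - y = x + - y"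
    "r *\<^sub>R (x + y) = r *\<^sub>R x + r *\<^sub>R y" "(r + s) *\<^sub>R x = r *\<^sub>R x + s *\<^sub>R x"
    "r *\<^sub>R s *\<^sub>R x = (r * s) *\<^sub>R x" "1 *\<^sub>R x = x"
    by (auto intro!: ell2_eqI simp: algebra_simps)
  have n0: "0 \<le> norm x" for x :: "'a ell2" by (simp add: norm_ell2_def suminf_nonneg ell2_summable)
  show "norm x = 0 \<longleftrightarrow> x = 0"
  proof
    assume "norm x = 0"
    then have "norm (ell2_nth x n) \<le> 0" for n using norm_ell2_nth_le[of x n] by simp
    then show "x = 0" by (auto intro!: ell2_eqI)
  qed (simp add: norm_ell2_def)
  show "norm (r *\<^sub>R x) = \<bar>r\<bar> * norm x"
    by (simp add: norm_ell2_def power_mult_distrib suminf_mult ell2_summable real_sqrt_mult)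
  show "norm (x + y) \<le> norm x + norm y"
  proof (rule norm_ell2_leI)
    fix k
    have L: "L2_set (\<lambda>n. norm (ell2_nth x n)) {..<k} \<le> norm x" for x :: "'a ell2"
      unfolding L2_set_def using norm_ell2_partial[of x k] n0[of x] real_le_lsqrt by blast
    have "L2_set (\<lambda>n. norm (ell2_nth (x + y) n)) {..<k}
        \<le> L2_set (\<lambda>n. norm (ell2_nth x n) + norm (ell2_nth y n)) {..<k}"
      by (rule L2_set_mono) (auto intro: norm_triangle_ineq)
    also have "\<dots> \<le> L2_set (\<lambda>n. norm (ell2_nth x n)) {..<k} + L2_set (\<lambda>n. norm (ell2_nth y n)) {..<k}"
      by (rule L2_set_triangle_ineq)
    also have "\<dots> \<le> norm x + norm y" by (intro add_mono L)
    finally show "(\<Sum>n<k. (norm (ell2_nth (x + y) n))\<^sup>2) \<le> (norm x + norm y)\<^sup>2"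
      unfolding L2_set_def using sqrt_le_D by blast
  qed (simp add: n0)
qed

end

instance ell2 :: (chilbert_space) banach
proof
  fix X :: "nat \<Rightarrow> 'a ell2" assume C: "Cauchy X"
  have "Cauchy (\<lambda>k. ell2_nth (X k) n)" for n
  proof (rule metric_CauchyI)
    fix e :: real assume "0 < e"
    then obtain N where N: "\<And>m k. m \<ge> N \<Longrightarrow> k \<ge> N \<Longrightarrow> dist (X m) (X k) < e"
      using metric_CauchyD[OF C] by blast
    have "dist (ell2_nth (X m) n) (ell2_nth (X k) n) \<le> dist (X m) (X k)" for m k
      using norm_ell2_nth_le[of "X m - X k" n] by (simp add: dist_norm)
    then show "\<exists>M. \<forall>m\<ge>M. \<forall>k\<ge>M. dist (ell2_nth (X m) n) (ell2_nth (X k) n) < e"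
      using N by (meson le_less_trans)
  qed
  then have "\<exists>l. (\<lambda>k. ell2_nth (X k) n) \<longlonglongrightarrow> l" for n
    using Cauchy_convergent convergent_def by blast
  then obtain L where L: "\<And>n. (\<lambda>k. ell2_nth (X k) n) \<longlonglongrightarrow> L n" by metis
  \<comment> \<open>Only finite partial sums are estimated; they pass to the coordinatewise limit L
    before L is known to be square summable.\<close>
  have partial: "\<exists>N. \<forall>m\<ge>N. \<forall>k. (\<Sum>n<k. (norm (ell2_nth (X m) n - L n))\<^sup>2) \<le> e\<^sup>2" if e: "0 < e" for e
  proof -
    obtain N where N: "\<And>m j. m \<ge> N \<Longrightarrow> j \<ge> N \<Longrightarrow> norm (X m - X j) < e"
      using metric_CauchyD[OF C e] by (auto simp: dist_norm)
    show ?thesis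
    proof (intro exI allI impI)
      fix m k assume m: "N \<le> m"
      show "(\<Sum>n<k. (norm (ell2_nth (X m) n - L n))\<^sup>2) \<le> e\<^sup>2"
      proof (rule LIMSEQ_le_const2)
        show "(\<lambda>j. \<Sum>n<k. (norm (ell2_nth (X m) n - ell2_nth (X j) n))\<^sup>2)
            \<longlonglongrightarrow> (\<Sum>n<k. (norm (ell2_nth (X m) n - L n))\<^sup>2)"
          by (intro tendsto_intros L)
        show "\<exists>N. \<forall>j\<ge>N. (\<Sum>n<k. (norm (ell2_nth (X m) n - ell2_nth (X j) n))\<^sup>2) \<le> e\<^sup>2"
        proof (intro exI allI impI)
          fix j assume "N \<le> j"
          then have "(norm (X m - X j))\<^sup>2 \<le> e\<^sup>2" using N[OF m] by (intro power_mono) (auto intro: less_imp_le)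
          then show "(\<Sum>n<k. (norm (ell2_nth (X m) n - ell2_nth (X j) n))\<^sup>2) \<le> e\<^sup>2"
            using norm_ell2_partial[of "X m - X j" k] by simp
        qed
      qed
    qed
  qed
  have sD: "\<exists>N. \<forall>m\<ge>N. summable (\<lambda>n. (norm (ell2_nth (X m) n - L n))\<^sup>2)"
  proof -
    obtain N where N: "\<forall>m\<ge>N. \<forall>k. (\<Sum>n<k. (norm (ell2_nth (X m) n - L n))\<^sup>2) \<le> 1\<^sup>2"
      using partial[of 1] by auto
    have "summable (\<lambda>n. (norm (ell2_nth (X m) n - L n))\<^sup>2)" if "m \<ge> N" for m
      using N that by (intro summableI_nonneg_bounded[where x = "1\<^sup>2"]) auto
    then show ?thesis by blast
  qed
  then obtain N0 where N0: "\<And>m. m \<ge> N0 \<Longrightarrow> summable (\<lambda>n. (norm (ell2_nth (X m) n - L n))\<^sup>2)" by blast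
  \<comment> \<open>L is the difference of the square-summable sequences X N0 and X N0 - L.\<close>
  have "summable (\<lambda>n. (norm (ell2_nth (X N0) n + - (ell2_nth (X N0) n - L n)))\<^sup>2)"
    using N0[of N0] by (intro summable_add_sq ell2_summable) (simp add: norm_minus_commute)
  then have nL: "ell2_nth (Abs_ell2 L) = L" by (intro Abs_ell2_nth) simp
  have "X \<longlonglongrightarrow> Abs_ell2 L"
  proof (rule metric_LIMSEQ_I)
    fix e :: real assume e: "0 < e"
    then obtain N where N: "\<forall>m\<ge>N. \<forall>k. (\<Sum>n<k. (norm (ell2_nth (X m) n - L n))\<^sup>2) \<le> (e/2)\<^sup>2"
      using partial[of "e/2"] by auto
    have "norm (X m - Abs_ell2 L) \<le> e / 2" if "m \<ge> N" for m
      using N that e by (intro norm_ell2_leI) (auto simp: nL)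
    then show "\<exists>N. \<forall>m\<ge>N. dist (X m) (Abs_ell2 L) < e"
      using e by (intro exI[of _ N]) (force simp: dist_norm)
  qed
  then show "convergent X" by (auto simp: convergent_def)
qed

lemma mult_le_add_sq: "a * b \<le> a\<^sup>2 + b\<^sup>2" if "0 \<le> a" "0 \<le> b" for a b :: real
proof -
  have "0 \<le> (a - b)\<^sup>2 + a * b" using that by simp
  then show ?thesis by (simp add: power2_eq_square algebra_simps)
qed

lemma ell2_cinner_abs_summable:
  "summable (\<lambda>n. cmod (cinner (ell2_nth x n) (ell2_nth y n)))"
proof (rule summable_comparison_test'[where N = 0 and
      g = "\<lambda>n. (norm (ell2_nth x n))\<^sup>2 + (norm (ell2_nth y n))\<^sup>2"])
  show "norm (cmod (cinner (ell2_nth x n) (ell2_nth y n)))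
      \<le> (norm (ell2_nth x n))\<^sup>2 + (norm (ell2_nth y n))\<^sup>2" for n
    using order_trans[OF cauchy_schwarz mult_le_add_sq[OF norm_ge_zero norm_ge_zero],
        of "ell2_nth x n" "ell2_nth y n"] by simp
qed (rule summable_add[OF ell2_summable ell2_summable])

lemma ell2_cinner_summable: "summable (\<lambda>n. cinner (ell2_nth x n) (ell2_nth y n))"
  by (rule summable_norm_cancel[OF ell2_cinner_abs_summable])

instantiation ell2 :: (chilbert_space) chilbert_space
begin

definition "c *\<^sub>C x = Abs_ell2 (\<lambda>n. c *\<^sub>C ell2_nth x n)"
definition "cinner x y = (\<Sum>n. cinner (ell2_nth x n) (ell2_nth y n))"

lemma ell2_nth_scaleC [simp]: "ell2_nth (c *\<^sub>C x) n = c *\<^sub>C ell2_nth x n"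
  unfolding scaleC_ell2_def
  by (subst Abs_ell2_nth)
    (auto intro!: summable_mult ell2_summable simp: norm_scaleC power_mult_distrib)

instance
proof
  fix x y z :: "'a ell2" and c d :: complex and r :: real
  show "c *\<^sub>C (x + y) = c *\<^sub>C x + c *\<^sub>C y" "(c + d) *\<^sub>C x = c *\<^sub>C x + d *\<^sub>C x"
    "c *\<^sub>C d *\<^sub>C x = (c * d) *\<^sub>C x" "complex_of_real r *\<^sub>C x = r *\<^sub>R x"
    by (auto intro!: ell2_eqI simp: scaleC_add_right scaleC_add_left scaleC_scaleC scaleC_of_real)
  show "cinner x y = cnj (cinner y x)"
    unfolding cinner_ell2_def
    using bounded_linear.suminf[OF bounded_linear_cnj ell2_cinner_summable[of y x]]
    by (simp add: cinner_commute[symmetric])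
  show "cinner (x + y) z = cinner x z + cinner y z"
    unfolding cinner_ell2_def by (simp add: cinner_add_left suminf_add ell2_cinner_summable)
  show "cinner (c *\<^sub>C x) y = c * cinner x y"
    unfolding cinner_ell2_def by (simp add: cinner_scaleC_left suminf_mult ell2_cinner_summable)
  show "cinner x x = complex_of_real ((norm x)\<^sup>2)"
    unfolding cinner_ell2_def norm_ell2_sq by (simp only: cinner_self suminf_of_real[OF ell2_summable])
qed

end

section \<open>Amplified operators and reindexing of sequences\<close>

lemma cinner_ell2_nth: "cinner x y = (\<Sum>n. cinner (ell2_nth x n) (ell2_nth y n))"
  by (rule cinner_ell2_def)

lemma bounded_linear_ell2_nth: "bounded_linear (\<lambda>x. ell2_nth x n)"
  by (rule bounded_linear_intro[where K = 1]) (simp_all add: norm_ell2_nth_le)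

text \<open>The diagonal operator with all entries T, that is, T tensored with the identity of the
  sequence space. The functionals x \<mapsto>
  \<open>cinner (blinfun_apply (amp x) \<xi>) \<eta>\<close> are the \<sigma>-weakly continuous
  ones.\<close>

definition amp :: "('a::chilbert_space \<Rightarrow>\<^sub>L 'b::chilbert_space) \<Rightarrow> ('a ell2 \<Rightarrow>\<^sub>L 'b ell2)"
  where "amp T = Blinfun (\<lambda>x. Abs_ell2 (\<lambda>n. blinfun_apply T (ell2_nth x n)))"

lemma bounded_linear_amp:
  "bounded_linear (\<lambda>x. Abs_ell2 (\<lambda>n. blinfun_apply T (ell2_nth x n)))" (is "bounded_linear ?f")
  and ell2_nth_amp_raw: "ell2_nth (Abs_ell2 (\<lambda>n. blinfun_apply T (ell2_nth x n))) n = blinfun_apply T (ell2_nth x n)"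
proof -
  have nth: "ell2_nth (?f x) n = blinfun_apply T (ell2_nth x n)" for x n
    by (subst Abs_ell2_nth) (rule summable_bounded_sq[OF ell2_summable norm_blinfun], rule refl)
  then show "ell2_nth (?f x) n = blinfun_apply T (ell2_nth x n)" .
  show "bounded_linear ?f"
  proof (rule bounded_linear_intro[where K = "norm T"])
    show "?f (x + y) = ?f x + ?f y" for x y
      by (rule ell2_eqI, simp only: nth) (simp add: nth blinfun.add_right)
    show "?f (r *\<^sub>R x) = r *\<^sub>R ?f x" for r x
      by (rule ell2_eqI, simp only: nth) (simp add: nth blinfun.scaleR_right)
    show "norm (?f x) \<le> norm x * norm T" for x
    proof (rule norm_ell2_leI)
      fix k
      have "(\<Sum>n<k. (norm (ell2_nth (?f x) n))\<^sup>2) \<le> (\<Sum>n<k. (norm T)\<^sup>2 * (norm (ell2_nth x n))\<^sup>2)"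
        unfolding nth power_mult_distrib[symmetric]
        by (intro sum_mono power_mono norm_blinfun norm_ge_zero)
      also have "\<dots> \<le> (norm T)\<^sup>2 * (norm x)\<^sup>2"
        unfolding sum_distrib_left[symmetric] by (intro mult_left_mono norm_ell2_partial) simp
      finally show "(\<Sum>n<k. (norm (ell2_nth (?f x) n))\<^sup>2) \<le> (norm x * norm T)\<^sup>2"
        by (simp add: power_mult_distrib mult.commute)
    qed simp
  qed
qed

lemma ell2_nth_amp [simp]: "ell2_nth (blinfun_apply (amp T) x) n = blinfun_apply T (ell2_nth x n)"
  unfolding amp_def bounded_linear_Blinfun_apply[OF bounded_linear_amp] by (rule ell2_nth_amp_raw)

lemma amp_bop: "T \<in> bop \<Longrightarrow> amp T \<in> bop"
  unfolding bop_def[of] by (auto intro!: ell2_eqI)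

lemma amp_simps:
  "amp (S + T) = amp S + amp T" "amp (S - T) = amp S - amp T" "amp (r *\<^sub>R T) = r *\<^sub>R amp T"
  "amp (S' o\<^sub>L T) = amp S' o\<^sub>L amp T" "amp (op_scale c T) = op_scale c (amp T)"
  "amp id_blinfun = id_blinfun" "amp 0 = 0"
  by (rule blinfun_eqI, rule ell2_eqI, simp add: blinfun.add_left blinfun.diff_left
      blinfun.scaleR_left blinfun_apply_op_scale)+

lemma cinner_amp_adj:
  "T \<in> bop \<Longrightarrow> cinner (blinfun_apply (amp T) x) y = cinner x (blinfun_apply (amp (adj T)) y)"
  by (simp add: cinner_ell2_nth cinner_adj_right)

lemma norm_amp_le: "norm (blinfun_apply (amp T) x) \<le> norm T * norm x"
proof (rule norm_ell2_leI)
  fix k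
  have "(\<Sum>n<k. (norm (ell2_nth (blinfun_apply (amp T) x) n))\<^sup>2) \<le> (\<Sum>n<k. (norm T)\<^sup>2 * (norm (ell2_nth x n))\<^sup>2)"
    unfolding ell2_nth_amp power_mult_distrib[symmetric]
    by (intro sum_mono power_mono norm_blinfun norm_ge_zero)
  also have "\<dots> \<le> (norm T)\<^sup>2 * (norm x)\<^sup>2"
    unfolding sum_distrib_left[symmetric] by (intro mult_left_mono norm_ell2_partial) simp
  finally show "(\<Sum>n<k. (norm (ell2_nth (blinfun_apply (amp T) x) n))\<^sup>2) \<le> (norm T * norm x)\<^sup>2"
    by (simp add: power_mult_distrib)
qed simp

text \<open>For a strictly increasing \<open>\<phi>\<close> this isometry moves slot m to slot
  \<open>\<phi> m\<close> and fills the other slots with 0; it commutes with every amplified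
  operator.\<close>

definition emb :: "(nat \<Rightarrow> nat) \<Rightarrow> 'a::chilbert_space ell2 \<Rightarrow> 'a ell2"
  where "emb \<phi> x = Abs_ell2 (\<lambda>n. if n \<in> range \<phi> then ell2_nth x (inv \<phi> n) else 0)"

lemma ell2_nth_emb:
  assumes "strict_mono \<phi>"
  shows "ell2_nth (emb \<phi> x) n = (if n \<in> range \<phi> then ell2_nth x (inv \<phi> n) else 0)"
proof -
  have "inj \<phi>" using assms by (rule strict_mono_imp_inj_on)
  then have "summable ((\<lambda>n. (norm (if n \<in> range \<phi> then ell2_nth x (inv \<phi> n) else 0))\<^sup>2) \<circ> \<phi>)"
    by (simp add: o_def ell2_summable)
  then have "summable (\<lambda>n. (norm (if n \<in> range \<phi> then ell2_nth x (inv \<phi> n) else 0))\<^sup>2)"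
    by (subst summable_mono_reindex[OF assms, symmetric]) (auto simp: o_def)
  then show ?thesis unfolding emb_def by (subst Abs_ell2_nth) auto
qed

lemma ell2_nth_emb_image [simp]: "strict_mono \<phi> \<Longrightarrow> ell2_nth (emb \<phi> x) (\<phi> m) = ell2_nth x m"
  by (simp add: ell2_nth_emb strict_mono_imp_inj_on)

lemma cinner_emb:
  assumes "strict_mono \<phi>"
  shows "cinner (emb \<phi> x) (emb \<phi> y) = cinner x y"
  unfolding cinner_ell2_nth
  by (subst suminf_mono_reindex[OF assms, symmetric]) (auto simp: ell2_nth_emb assms strict_mono_imp_inj_on)

lemma cinner_emb_disjoint:
  "strict_mono \<phi> \<Longrightarrow> strict_mono \<psi> \<Longrightarrow> range \<phi> \<inter> range \<psi> = {} \<Longrightarrow> cinner (emb \<phi> x) (emb \<psi> y) = 0"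
  unfolding cinner_ell2_nth by (subst suminf_cong[where g = "\<lambda>_. 0"]) (auto simp: ell2_nth_emb)

lemma amp_emb: "strict_mono \<phi> \<Longrightarrow> blinfun_apply (amp T) (emb \<phi> x) = emb \<phi> (blinfun_apply (amp T) x)"
  by (rule ell2_eqI) (simp add: ell2_nth_emb)

text \<open>Two vectors are stored in the even and in the odd slots of one. Sums of two normal
  functionals thus stay vector functionals, and several vectors can be approximated at once.\<close>

definition ilv :: "'a::chilbert_space ell2 \<Rightarrow> 'a ell2 \<Rightarrow> 'a ell2"
  where "ilv x y = emb (\<lambda>n. 2 * n) x + emb (\<lambda>n. Suc (2 * n)) y"

lemma cinner_ilv: "cinner (ilv x y) (ilv x' y') = cinner x x' + cinner y y'"
proof -
  have s: "strict_mono (\<lambda>n::nat. 2 * n)" "strict_mono (\<lambda>n. Suc (2 * n))"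
    by (auto simp: strict_mono_def)
  have "range (\<lambda>n::nat. 2 * n) \<inter> range (\<lambda>n. Suc (2 * n)) = {}" 
    by auto presburger
  then show ?thesis
    unfolding ilv_def using s
    by (simp add: cinner_add_left cinner_add_right cinner_emb cinner_emb_disjoint Int_commute)
qed

lemma amp_ilv: "blinfun_apply (amp T) (ilv x y) = ilv (blinfun_apply (amp T) x) (blinfun_apply (amp T) y)"
  unfolding ilv_def by (subst blinfun.add_right, subst amp_emb amp_emb, simp add: strict_mono_def)
    (subst amp_emb, auto simp: strict_mono_def)

lemma norm_ilv: "(norm (ilv x y))\<^sup>2 = (norm x)\<^sup>2 + (norm y)\<^sup>2"
  by (simp add: norm_sq_cinner cinner_ilv)

definition incl :: "nat \<Rightarrow> 'a::chilbert_space \<Rightarrow> 'a ell2"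
  where "incl j h = Abs_ell2 (\<lambda>n. if n = j then h else 0)"

lemma ell2_nth_incl [simp]: "ell2_nth (incl j h) n = (if n = j then h else 0)"
proof -
  have "summable (\<lambda>n. (norm (if n = j then h else 0))\<^sup>2)"
    by (rule summable_finite[of "{j}"]) auto
  then show ?thesis unfolding incl_def by (subst Abs_ell2_nth) auto
qed

lemma incl_add: "incl j (x + y) = incl j x + incl j y"
  and incl_scaleR: "incl j (r *\<^sub>R x) = r *\<^sub>R incl j x"
  and incl_scaleC: "incl j (c *\<^sub>C x) = c *\<^sub>C incl j x"
  and amp_incl: "blinfun_apply (amp T) (incl j x) = incl j (blinfun_apply T x)"
  by (rule ell2_eqI, simp)+

lemma cinner_incl_left: "cinner (incl j h) x = cinner h (ell2_nth x j)"
  unfolding cinner_ell2_nth by (subst suminf_finite[of "{j}"]) auto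

lemma norm_incl: "norm (incl j h) = norm h"
proof -
  have "(norm (incl j h))\<^sup>2 = (norm h)\<^sup>2" by (simp add: norm_sq_cinner cinner_incl_left)
  then show ?thesis by (simp add: power2_eq_iff_nonneg)
qed

lemma bounded_linear_incl: "bounded_linear (incl j)"
  by (rule bounded_linear_intro[where K = 1]) (simp_all add: incl_add incl_scaleR norm_incl)

text \<open>The argument goes through the adjoint: by pairing with \<open>incl j h\<close>, each
  coordinate of its values is seen to be 0.\<close>

lemma ell2_op_eq_0:
  fixes D :: "'a::chilbert_space ell2 \<Rightarrow>\<^sub>L 'b::chilbert_space"
  assumes D: "D \<in> bop" and 0: "\<And>j h. blinfun_apply D (incl j h) = 0"
  shows "blinfun_apply D y = 0"
proof -
  have "blinfun_apply (adj D) z = 0" for z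
  proof (rule ell2_eqI)
    fix j
    have "cinner h (ell2_nth (blinfun_apply (adj D) z) j) = 0" for h
      unfolding cinner_incl_left[symmetric] by (simp add: cinner_adj_right D 0)
    then have "ell2_nth (blinfun_apply (adj D) z) j = 0"
      by (metis cinner_self norm_eq_zero of_real_eq_0_iff power_eq_0_iff)
    then show "ell2_nth (blinfun_apply (adj D) z) j = ell2_nth 0 j" by simp
  qed
  then have "cinner (blinfun_apply D y) z = cinner 0 z" for z
    using cinner_adj_right[OF D, of y z] by simp
  then show ?thesis by (rule cinner_ext)
qed

section \<open>The density theorem\<close>

definition star_algebra :: "('a::chilbert_space \<Rightarrow>\<^sub>L 'a) set \<Rightarrow> bool"
  where "star_algebra A \<longleftrightarrow> A \<subseteq> bop \<and> id_blinfun \<in> A \<and> subspace A \<and>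
    (\<forall>a\<in>A. adj a \<in> A \<and> (\<forall>c. op_scale c a \<in> A) \<and> (\<forall>b\<in>A. a o\<^sub>L b \<in> A))"

lemma subspace_closure:
  fixes S :: "'a::real_normed_vector set"
  assumes "subspace S"
  shows "subspace (closure S)"
proof (rule subspaceI)
  show "0 \<in> closure S" using assms subspace_0 closure_subset by blast
  fix x y assume "x \<in> closure S" "y \<in> closure S"
  then obtain u v where u: "\<And>n. u n \<in> S" "u \<longlonglongrightarrow> x" and v: "\<And>n. v n \<in> S" "v \<longlonglongrightarrow> y"
    unfolding closure_sequential by blast
  have "(\<lambda>n. u n + v n) \<longlonglongrightarrow> x + y" by (intro tendsto_add u v)
  moreover have "u n + v n \<in> S" for n using u v assms by (simp add: subspace_add)
  ultimately show "x + y \<in> closure S"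
    unfolding closure_sequential by (intro exI[of _ "\<lambda>n. u n + v n"]) simp
next
  fix c x assume "x \<in> closure S"
  moreover have "(\<lambda>x. c *\<^sub>R x) ` closure S \<subseteq> closure ((\<lambda>x. c *\<^sub>R x) ` S)"
    by (rule closure_bounded_linear_image_subset[OF bounded_linear_scaleR_right])
  moreover have "closure ((\<lambda>x. c *\<^sub>R x) ` S) \<subseteq> closure S"
    using assms by (intro closure_mono) (auto simp: subspace_scale)
  ultimately show "c *\<^sub>R x \<in> closure S" by blast
qed

text \<open>The density theorem: the projection onto the closure of \<open>A\<^sup>\<infinity> \<xi>\<close> has all its matrix
  entries in the commutant of \<open>A\<close>.\<close>

theorem density_ell2:
  assumes A: "star_algebra A" and X: "X \<in> commutant (commutant A)"
  shows "blinfun_apply (amp X) \<xi> \<in> closure ((\<lambda>a. blinfun_apply (amp a) \<xi>) ` A)"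
proof -
  define E0 where "E0 = (\<lambda>a. blinfun_apply (amp a) \<xi>) ` A"
  have Ab: "a \<in> bop" if "a \<in> A" for a using A that by (auto simp: star_algebra_def)
  have Xb: "X \<in> bop" using X commutant_sub_bop by blast
  have sub0: "subspace E0"
  proof -
    have "linear (\<lambda>a. blinfun_apply (amp a) \<xi>)"
      by (rule linearI) (simp_all add: amp_simps blinfun.add_left blinfun.scaleR_left)
    then show ?thesis unfolding E0_def using A
      by (intro linear_subspace_image) (auto simp: star_algebra_def)
  qed
  have stable: "f ` closure E0 \<subseteq> closure E0" if f: "bounded_linear f" "f ` E0 \<subseteq> E0" for f
    using closure_bounded_linear_image_subset[OF f(1), of E0] closure_mono[OF f(2)] by blast
  have scE: "c *\<^sub>C x \<in> closure E0" if "x \<in> closure E0" for c x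
  proof -
    have "(\<lambda>x. c *\<^sub>C x) ` E0 \<subseteq> E0"
    proof clarify
      fix x assume "x \<in> E0"
      then obtain a where a: "a \<in> A" "x = blinfun_apply (amp a) \<xi>" by (auto simp: E0_def)
      then have "c *\<^sub>C x = blinfun_apply (amp (op_scale c a)) \<xi>"
        by (simp add: amp_simps blinfun_apply_op_scale)
      then show "c *\<^sub>C x \<in> E0" using A a by (auto simp: E0_def star_algebra_def)
    qed
    from stable[OF bounded_linear_scaleC this] that show ?thesis by blast
  qed
  have ampE: "blinfun_apply (amp a) x \<in> closure E0" if "a \<in> A" "x \<in> closure E0" for a x
  proof -
    have "blinfun_apply (amp a) ` E0 \<subseteq> E0"
    proof clarify
      fix x assume "x \<in> E0"
      then obtain b where b: "b \<in> A" "x = blinfun_apply (amp b) \<xi>" by (auto simp: E0_def)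
      then have "blinfun_apply (amp a) x = blinfun_apply (amp (a o\<^sub>L b)) \<xi>"
        by (simp add: amp_simps)
      then show "blinfun_apply (amp a) x \<in> E0" using A b \<open>a \<in> A\<close> by (auto simp: E0_def star_algebra_def)
    qed
    from stable[OF blinfun.bounded_linear_right this] that show ?thesis by blast
  qed
  obtain P where P: "P \<in> bop" "\<And>x. blinfun_apply P x \<in> closure E0"
    "\<And>x s. s \<in> closure E0 \<Longrightarrow> cinner (x - blinfun_apply P x) s = 0"
    "\<And>x p. p \<in> closure E0 \<Longrightarrow> (\<And>s. s \<in> closure E0 \<Longrightarrow> cinner (x - p) s = 0) \<Longrightarrow> blinfun_apply P x = p"
    using projection_operator[OF closed_closure subspace_closure[OF sub0] scE] by blast
  \<comment> \<open>The closure of E0 is invariant under A, and A contains adjoints, so the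
    orthogonal complement is invariant too; hence the projection commutes with A.\<close>
  have comm: "blinfun_apply P (blinfun_apply (amp a) x) = blinfun_apply (amp a) (blinfun_apply P x)"
    if a: "a \<in> A" for a x
  proof (rule P(4))
    show "blinfun_apply (amp a) (blinfun_apply P x) \<in> closure E0" by (intro ampE a P)
    fix s assume s: "s \<in> closure E0"
    have "adj a \<in> A" using A a by (auto simp: star_algebra_def)
    then have "cinner (x - blinfun_apply P x) (blinfun_apply (amp (adj a)) s) = 0"
      by (intro P(3) ampE s)
    then show "cinner (blinfun_apply (amp a) x - blinfun_apply (amp a) (blinfun_apply P x)) s = 0"
      by (simp add: blinfun.diff_right[symmetric] cinner_amp_adj[OF Ab[OF a]])
  qed
  \<comment> \<open>The entries of P as an infinite operator matrix. As P commutes with all diagonal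
    operators \<open>amp a\<close>, each entry commutes with a.\<close>
  define T where "T i j = Blinfun (\<lambda>h. ell2_nth (blinfun_apply P (incl j h)) i)" for i j
  have T: "blinfun_apply (T i j) h = ell2_nth (blinfun_apply P (incl j h)) i" for i j h
  proof -
    have "bounded_linear (\<lambda>h. ell2_nth (blinfun_apply P (incl j h)) i)"
      by (rule bounded_linear_compose[OF bounded_linear_ell2_nth
            bounded_linear_compose[OF blinfun.bounded_linear_right bounded_linear_incl]])
    then show ?thesis unfolding T_def by (simp add: bounded_linear_Blinfun_apply)
  qed
  have Tc: "T i j \<in> commutant A" for i j
  proof (rule commutantI)
    show "T i j \<in> bop" unfolding bop_def by (simp add: T incl_scaleC bop_scaleC[OF P(1)])
    show "blinfun_apply (T i j) (blinfun_apply a h) = blinfun_apply a (blinfun_apply (T i j) h)"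
      if "a \<in> A" for a h
      using comm[OF that] by (simp add: T amp_incl[symmetric])
  qed
  \<comment> \<open>X commutes with every entry of P because it lies in the bicommutant. So the
    commutator of \<open>amp X\<close> and P vanishes on each coordinate subspace, hence
    everywhere.\<close>
  define D where "D = (P o\<^sub>L amp X) - (amp X o\<^sub>L P)"
  have "blinfun_apply D y = 0" for y
  proof (rule ell2_op_eq_0)
    show "D \<in> bop" unfolding D_def using P(1) Xb by (intro bop_diff bop_compose amp_bop)
    show "blinfun_apply D (incl j h) = 0" for j h
    proof (rule ell2_eqI)
      fix i
      show "ell2_nth (blinfun_apply D (incl j h)) i = ell2_nth 0 i"
        using commutantD_apply[OF X Tc, of i j h] by (simp add: D_def blinfun.diff_left amp_incl T)
    qed
  qed
  from this[of \<xi>] have "blinfun_apply P (blinfun_apply (amp X) \<xi>) = blinfun_apply (amp X) (blinfun_apply P \<xi>)"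
    by (simp add: D_def blinfun.diff_left)
  \<comment> \<open>The unit of A is what puts \<xi> itself into the subspace.\<close>
  moreover have "\<xi> \<in> closure E0"
  proof -
    have "\<xi> = blinfun_apply (amp id_blinfun) \<xi>" by (simp add: amp_simps)
    then have "\<xi> \<in> E0" using A unfolding E0_def star_algebra_def by blast
    then show ?thesis using closure_subset by blast
  qed
  then have "blinfun_apply P \<xi> = \<xi>" by (intro P(4)) simp_all
  ultimately show ?thesis using P(2)[of "blinfun_apply (amp X) \<xi>"] by (simp add: E0_def)
qed

text \<open>Interleaving packs the finitely many vectors into one vector \<zeta> on which every
  amplified operator is at least as large as on each of them; one application of the density theorem
  to \<zeta> serves all. Sequences suffice, as only finitely many vectors are involved.\<close>

lemma density_seq:
  assumes A: "star_algebra A" and X: "X \<in> commutant (commutant A)"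
  obtains a :: "nat \<Rightarrow> 'a::chilbert_space \<Rightarrow>\<^sub>L 'a" where "\<And>k. a k \<in> A"
    "\<And>\<xi>. \<xi> \<in> set \<xi>s \<Longrightarrow> (\<lambda>k. blinfun_apply (amp (a k)) \<xi>) \<longlonglongrightarrow> blinfun_apply (amp X) \<xi>"
proof -
  have "\<exists>\<zeta>. \<forall>\<xi>\<in>set \<xi>s. \<forall>T::'a \<Rightarrow>\<^sub>L 'a. norm (blinfun_apply (amp T) \<xi>) \<le> norm (blinfun_apply (amp T) \<zeta>)" for \<xi>s
  proof (induction \<xi>s)
    case (Cons \<eta> \<xi>s)
    then obtain \<zeta> where \<zeta>: "\<And>\<xi> T. \<xi> \<in> set \<xi>s \<Longrightarrow> norm (blinfun_apply (amp T) \<xi>) \<le> norm (blinfun_apply (amp (T::'a \<Rightarrow>\<^sub>L 'a)) \<zeta>)"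
      by blast
    have "norm (blinfun_apply (amp T) \<eta>) \<le> norm (blinfun_apply (amp T) (ilv \<eta> \<zeta>))"
      "norm (blinfun_apply (amp T) \<zeta>) \<le> norm (blinfun_apply (amp T) (ilv \<eta> \<zeta>))" for T :: "'a \<Rightarrow>\<^sub>L 'a"
      by (rule power2_le_imp_le; simp add: amp_ilv norm_ilv)+
    then show ?case by (intro exI[of _ "ilv \<eta> \<zeta>"]) (auto intro: order_trans[OF \<zeta>])
  qed simp
  then obtain \<zeta> where \<zeta>: "\<And>\<xi> T. \<xi> \<in> set \<xi>s \<Longrightarrow> norm (blinfun_apply (amp T) \<xi>) \<le> norm (blinfun_apply (amp (T::'a \<Rightarrow>\<^sub>L 'a)) \<zeta>)"
    by blast
  obtain u where u: "\<And>n. u n \<in> (\<lambda>a. blinfun_apply (amp a) \<zeta>) ` A" "u \<longlonglongrightarrow> blinfun_apply (amp X) \<zeta>"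
    using density_ell2[OF A X, of \<zeta>] unfolding closure_sequential by blast
  then have "\<forall>n. \<exists>a\<in>A. u n = blinfun_apply (amp a) \<zeta>" by blast
  then obtain a where a: "\<And>n. a n \<in> A" "\<And>n. u n = blinfun_apply (amp (a n)) \<zeta>" by metis
  show ?thesis
  proof (rule that[of a])
    fix \<xi> assume \<xi>: "\<xi> \<in> set \<xi>s"
    have "(\<lambda>k. norm (blinfun_apply (amp (a k)) \<zeta> - blinfun_apply (amp X) \<zeta>)) \<longlonglongrightarrow> 0"
      using u(2) unfolding a(2) by (intro tendsto_norm_zero LIM_zero)
    then have "(\<lambda>k. norm (blinfun_apply (amp (a k)) \<xi> - blinfun_apply (amp X) \<xi>)) \<longlonglongrightarrow> 0"
    proof (rule tendsto_sandwich[OF _ _ tendsto_const, rotated 2])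
      show "\<forall>\<^sub>F k in sequentially. norm (blinfun_apply (amp (a k)) \<xi> - blinfun_apply (amp X) \<xi>)
          \<le> norm (blinfun_apply (amp (a k)) \<zeta> - blinfun_apply (amp X) \<zeta>)"
        using \<zeta>[OF \<xi>, of "a _ - X"] by (simp add: amp_simps blinfun.diff_left)
    qed simp
    then show "(\<lambda>k. blinfun_apply (amp (a k)) \<xi>) \<longlonglongrightarrow> blinfun_apply (amp X) \<xi>"
      by (rule LIM_zero_cancel[OF tendsto_norm_zero_cancel])
  qed (rule a)
qed

section \<open>The predual\<close>

text \<open>The two sequences in the definition of \<open>predual\<close> are read as two vectors of
  the sequence space.\<close>

lemma predual_ell2:
  "f \<in> predual M \<longleftrightarrow> (\<exists>\<xi> \<eta>. (\<forall>x\<in>M. f x = cinner (blinfun_apply (amp x) \<xi>) \<eta>) \<and> (\<forall>x. x \<notin> M \<longrightarrow> f x = 0))"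
proof
  assume "f \<in> predual M"
  then obtain \<xi> \<eta> where *: "summable (\<lambda>n. (norm (\<xi> n))\<^sup>2)" "summable (\<lambda>n. (norm (\<eta> n))\<^sup>2)"
      "\<And>x. x \<in> M \<Longrightarrow> f x = (\<Sum>n. cinner (blinfun_apply x (\<xi> n)) (\<eta> n))" "\<And>x. x \<notin> M \<Longrightarrow> f x = 0"
    unfolding predual_def by auto
  show "\<exists>\<xi> \<eta>. (\<forall>x\<in>M. f x = cinner (blinfun_apply (amp x) \<xi>) \<eta>) \<and> (\<forall>x. x \<notin> M \<longrightarrow> f x = 0)"
    by (rule exI[of _ "Abs_ell2 \<xi>"], rule exI[of _ "Abs_ell2 \<eta>"])
      (simp add: * cinner_ell2_nth Abs_ell2_nth)
next
  assume "\<exists>\<xi> \<eta>. (\<forall>x\<in>M. f x = cinner (blinfun_apply (amp x) \<xi>) \<eta>) \<and> (\<forall>x. x \<notin> M \<longrightarrow> f x = 0)"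
  then obtain \<xi> \<eta> where *: "\<And>x. x \<in> M \<Longrightarrow> f x = cinner (blinfun_apply (amp x) \<xi>) \<eta>" "\<And>x. x \<notin> M \<Longrightarrow> f x = 0"
    by blast
  show "f \<in> predual M" unfolding predual_def
    by (rule CollectI, rule conjI, rule exI[of _ "ell2_nth \<xi>"], rule exI[of _ "ell2_nth \<eta>"])
      (simp_all add: * cinner_ell2_nth ell2_summable)
qed

lemma predualE:
  assumes "f \<in> predual M"
  obtains \<xi> \<eta> where "\<And>x. x \<in> M \<Longrightarrow> f x = cinner (blinfun_apply (amp x) \<xi>) \<eta>"
  using assms unfolding predual_ell2 by blast

lemma predualI:
  assumes "\<And>x. x \<in> M \<Longrightarrow> f x = cinner (blinfun_apply (amp x) \<xi>) \<eta>" "\<And>x. x \<notin> M \<Longrightarrow> f x = 0"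
  shows "f \<in> predual M"
  using assms unfolding predual_ell2 by blast

lemma predual_outside: "f \<in> predual M \<Longrightarrow> x \<notin> M \<Longrightarrow> f x = 0"
  unfolding predual_ell2 by blast

lemma predual_add:
  assumes "f \<in> predual M" "g \<in> predual M"
  shows "(\<lambda>x. f x + g x) \<in> predual M"
proof -
  obtain \<xi> \<eta> where f: "\<And>x. x \<in> M \<Longrightarrow> f x = cinner (blinfun_apply (amp x) \<xi>) \<eta>" using assms(1) by (rule predualE) auto
  obtain \<xi>' \<eta>' where g: "\<And>x. x \<in> M \<Longrightarrow> g x = cinner (blinfun_apply (amp x) \<xi>') \<eta>'" using assms(2) by (rule predualE) auto
  show ?thesis
    by (rule predualI[where \<xi> = "ilv \<xi> \<xi>'" and \<eta> = "ilv \<eta> \<eta>'"])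
      (simp_all add: f g amp_ilv cinner_ilv predual_outside[OF assms(1)] predual_outside[OF assms(2)])
qed

lemma predual_scale:
  assumes "f \<in> predual M"
  shows "(\<lambda>x. c * f x) \<in> predual M"
proof -
  obtain \<xi> \<eta> where f: "\<And>x. x \<in> M \<Longrightarrow> f x = cinner (blinfun_apply (amp x) \<xi>) \<eta>" using assms(1) by (rule predualE) auto
  show ?thesis
    by (rule predualI[where \<xi> = \<xi> and \<eta> = "cnj c *\<^sub>C \<eta>"])
      (simp_all add: f cinner_scaleC_right predual_outside[OF assms(1)])
qed

lemma predual_0: "(\<lambda>x. 0) \<in> predual M"
  by (rule predualI[where \<xi> = 0 and \<eta> = 0]) auto

lemma predual_diff:
  "f \<in> predual M \<Longrightarrow> g \<in> predual M \<Longrightarrow> (\<lambda>x. f x - g x) \<in> predual M"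
  using predual_add[of f M "\<lambda>x. -1 * g x"] predual_scale[of g M "-1"] by simp

lemma predual_sum: "(\<And>i. i \<in> I \<Longrightarrow> f i \<in> predual M) \<Longrightarrow> (\<lambda>x. \<Sum>i\<in>I. f i x) \<in> predual M"
  by (induction I rule: infinite_finite_induct) (simp_all add: predual_0 predual_add)

lemma predual_sum_list: "(\<And>i. i \<in> set l \<Longrightarrow> f i \<in> predual M) \<Longrightarrow> (\<lambda>x. \<Sum>i\<leftarrow>l. f i x) \<in> predual M"
  by (induction l) (simp_all add: predual_0 predual_add)

definition vec_fun :: "('a::chilbert_space \<Rightarrow>\<^sub>L 'a) set \<Rightarrow> 'a \<Rightarrow> 'a \<Rightarrow> ('a \<Rightarrow>\<^sub>L 'a) \<Rightarrow> complex"
  where "vec_fun M u v x = (if x \<in> M then cinner (blinfun_apply x u) v else 0)"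

lemma vec_fun_predual: "vec_fun M u v \<in> predual M"
  by (rule predualI[where \<xi> = "incl 0 u" and \<eta> = "incl 0 v"])
    (simp_all add: vec_fun_def amp_incl cinner_incl_left)

text \<open>Looser than the definition of \<open>predual\<close>: any index type is allowed and only
  the products of norms must be summable. Families indexed by pairs, as tensor products produce
  them, fit directly, and unordered sums give Fubini.\<close>

definition normal_rep where
  "normal_rep M f \<xi> \<eta> \<longleftrightarrow> (\<lambda>i. norm (\<xi> i) * norm (\<eta> i)) summable_on UNIV \<and>
    (\<forall>x\<in>M. f x = (\<Sum>\<^sub>\<infinity>i. cinner (blinfun_apply x (\<xi> i)) (\<eta> i))) \<and> (\<forall>x. x \<notin> M \<longrightarrow> f x = 0)"

lemma rep_abs_summable:
  assumes "(\<lambda>i. norm (\<xi> i) * norm (\<eta> i)) summable_on UNIV"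
  shows "(\<lambda>i. norm (cinner (blinfun_apply x (\<xi> i)) (\<eta> i))) summable_on UNIV"
proof (rule summable_on_comparison_test)
  show "(\<lambda>i. norm x * (norm (\<xi> i) * norm (\<eta> i))) summable_on UNIV"
    using assms by (rule summable_on_cmult_right)
  show "norm (cinner (blinfun_apply x (\<xi> i)) (\<eta> i)) \<le> norm x * (norm (\<xi> i) * norm (\<eta> i))" for i
    using order_trans[OF cauchy_schwarz mult_right_mono[OF norm_blinfun norm_ge_zero]]
    by (simp add: mult.assoc)
qed simp

lemma predual_normal_rep:
  assumes "f \<in> predual M"
  obtains \<xi> \<eta> :: "nat \<Rightarrow> 'a::chilbert_space" where "normal_rep M f \<xi> \<eta>"
proof -
  obtain \<xi> \<eta> where f: "\<And>x. x \<in> M \<Longrightarrow> f x = cinner (blinfun_apply (amp x) \<xi>) \<eta>" using assms(1) by (rule predualE) auto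
  have s: "(\<lambda>n. norm (ell2_nth \<xi> n) * norm (ell2_nth \<eta> n)) summable_on UNIV"
  proof (rule summable_on_comparison_test)
    show "(\<lambda>n. (norm (ell2_nth \<xi> n))\<^sup>2 + (norm (ell2_nth \<eta> n))\<^sup>2) summable_on UNIV"
      by (intro summable_nonneg_imp_summable_on summable_add ell2_summable) simp
  qed (simp_all add: mult_le_add_sq)
  show ?thesis
  proof (rule that[of "ell2_nth \<xi>" "ell2_nth \<eta>"])
    have "(\<Sum>n. cinner (blinfun_apply x (ell2_nth \<xi> n)) (ell2_nth \<eta> n)) =
        (\<Sum>\<^sub>\<infinity>n. cinner (blinfun_apply x (ell2_nth \<xi> n)) (ell2_nth \<eta> n))" for x :: "'a \<Rightarrow>\<^sub>L 'a"
    proof -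
      have "(\<lambda>n. cinner (blinfun_apply x (ell2_nth \<xi> n)) (ell2_nth \<eta> n)) summable_on UNIV"
        by (rule abs_summable_summable[OF rep_abs_summable[OF s]])
      then have "(\<lambda>n. cinner (blinfun_apply x (ell2_nth \<xi> n)) (ell2_nth \<eta> n)) sums
          (\<Sum>\<^sub>\<infinity>n. cinner (blinfun_apply x (ell2_nth \<xi> n)) (ell2_nth \<eta> n))"
        by (intro has_sum_imp_sums has_sum_infsum)
      then show ?thesis by (rule sums_unique[symmetric])
    qed
    then show "normal_rep M f (ell2_nth \<xi>) (ell2_nth \<eta>)"
      unfolding normal_rep_def using s f predual_outside[OF assms] by (simp add: cinner_ell2_nth)
  qed
qed

text \<open>Rescaling each pair to equal norms leaves its contribution unchanged and makes both
  families square summable; a countable index type is then enumerated.\<close>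

lemma normal_rep_predual:
  fixes \<xi> \<eta> :: "'i::countable \<Rightarrow> 'a::chilbert_space"
  assumes "normal_rep M f \<xi> \<eta>"
  shows "f \<in> predual M"
proof -
  define m where "m i = norm (\<xi> i) * norm (\<eta> i)" for i
  \<comment> \<open>If the product of norms is 0, one vector vanishes but the other may be large;
    both are replaced by 0.\<close>
  define \<alpha> where "\<alpha> i = (if m i = 0 then 0 else sqrt (norm (\<eta> i) / norm (\<xi> i)) *\<^sub>R \<xi> i)" for i
  define \<beta> where "\<beta> i = (if m i = 0 then 0 else sqrt (norm (\<xi> i) / norm (\<eta> i)) *\<^sub>R \<eta> i)" for i
  have n: "(norm (\<alpha> i))\<^sup>2 = m i" "(norm (\<beta> i))\<^sup>2 = m i" for i
    by (auto simp: \<alpha>_def \<beta>_def m_def power_mult_distrib) (simp_all add: power2_eq_square)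
  have sc: "cinner (blinfun_apply x (\<alpha> i)) (\<beta> i) = cinner (blinfun_apply x (\<xi> i)) (\<eta> i)" for x :: "'a \<Rightarrow>\<^sub>L 'a" and i
  proof (cases "m i = 0")
    case True
    then have "\<xi> i = 0 \<or> \<eta> i = 0" by (simp add: m_def)
    then show ?thesis using True by (auto simp: \<alpha>_def \<beta>_def)
  next
    case False
    then have "sqrt (norm (\<xi> i) / norm (\<eta> i)) * sqrt (norm (\<eta> i) / norm (\<xi> i)) = 1"
      unfolding real_sqrt_mult[symmetric] by (simp add: m_def)
    then show ?thesis using False
      by (simp add: \<alpha>_def \<beta>_def blinfun.scaleR_right cinner_scaleR_left cinner_scaleR_right
          mult.assoc[symmetric] of_real_mult[symmetric] del: of_real_mult)
  qed
  \<comment> \<open>Numbers that encode no index get the vector 0 and so do not contribute.\<close>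
  define ex :: "('i \<Rightarrow> 'a) \<Rightarrow> nat \<Rightarrow> 'a" where "ex \<gamma> k = (if k \<in> range (to_nat :: 'i \<Rightarrow> nat) then \<gamma> (from_nat k) else 0)" for \<gamma> k
  have ms: "m summable_on UNIV" using assms by (simp add: normal_rep_def m_def[abs_def])
  have sq: "summable (\<lambda>k. (norm (ex \<gamma> k))\<^sup>2)" if "\<And>i. (norm (\<gamma> i))\<^sup>2 = m i" for \<gamma>
  proof -
    have "((\<lambda>k. (norm (ex \<gamma> k))\<^sup>2) \<circ> to_nat) summable_on (UNIV :: 'i set)"
      using ms by (simp add: o_def ex_def that)
    then have "(\<lambda>k. (norm (ex \<gamma> k))\<^sup>2) summable_on range (to_nat :: 'i \<Rightarrow> nat)"
      by (simp add: summable_on_reindex)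
    then have "(\<lambda>k. (norm (ex \<gamma> k))\<^sup>2) summable_on UNIV"
      by (subst summable_on_cong_neutral[where T = "range to_nat"]) (auto simp: ex_def)
    then show ?thesis by (rule summable_on_imp_summable)
  qed
  show ?thesis
  proof (rule predualI[where \<xi> = "Abs_ell2 (ex \<alpha>)" and \<eta> = "Abs_ell2 (ex \<beta>)"])
    fix x assume x: "x \<in> M"
    let ?g = "\<lambda>k. cinner (blinfun_apply x (ex \<alpha> k)) (ex \<beta> k)"
    have "f x = (\<Sum>\<^sub>\<infinity>i. cinner (blinfun_apply x (\<xi> i)) (\<eta> i))"
      using assms x by (simp add: normal_rep_def)
    also have "\<dots> = infsum (?g \<circ> to_nat) (UNIV :: 'i set)"
      by (rule infsum_cong) (simp add: ex_def sc)
    also have "\<dots> = infsum ?g (range (to_nat :: 'i \<Rightarrow> nat))"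
      by (rule infsum_reindex[symmetric]) simp
    also have "\<dots> = infsum ?g UNIV" by (rule infsum_cong_neutral) (auto simp: ex_def)
    also have "\<dots> = (\<Sum>k. ?g k)"
    proof -
      have "summable (\<lambda>k. cmod (?g k))"
        using ell2_cinner_abs_summable[of "blinfun_apply (amp x) (Abs_ell2 (ex \<alpha>))" "Abs_ell2 (ex \<beta>)"]
        by (simp add: Abs_ell2_nth sq n)
      then have "?g summable_on UNIV" by (rule norm_summable_imp_summable_on)
      then show ?thesis by (intro sums_unique has_sum_imp_sums has_sum_infsum)
    qed
    finally show "f x = cinner (blinfun_apply (amp x) (Abs_ell2 (ex \<alpha>))) (Abs_ell2 (ex \<beta>))"
      by (simp add: cinner_ell2_nth Abs_ell2_nth sq n)
  qed (use assms in \<open>simp add: normal_rep_def\<close>)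
qed

text \<open>The difference f - g is represented by one pair of vectors, and the density theorem
  approximates x by elements of A on the first of them.\<close>

lemma predual_eq_bicommutant:
  assumes A: "star_algebra A" and N: "N = commutant (commutant A)"
    and f: "f \<in> predual N" and g: "g \<in> predual N" and eq: "\<And>a. a \<in> A \<Longrightarrow> f a = g a"
  shows "f = g"
proof
  fix x
  show "f x = g x"
  proof (cases "x \<in> N")
    case True
    have AN: "A \<subseteq> N" unfolding N using A by (intro commutant_commutant_sup) (simp add: star_algebra_def)
    obtain \<xi> \<eta> where h: "\<And>x. x \<in> N \<Longrightarrow> f x - g x = cinner (blinfun_apply (amp x) \<xi>) \<eta>"
      using predual_diff[OF f g] by (rule predualE) auto
    obtain a where a: "\<And>k. a k \<in> A" "(\<lambda>k. blinfun_apply (amp (a k)) \<xi>) \<longlonglongrightarrow> blinfun_apply (amp x) \<xi>"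
      using density_seq[OF A, of x "[\<xi>]"] True N by auto
    have "(\<lambda>k. cinner (blinfun_apply (amp (a k)) \<xi>) \<eta>) \<longlonglongrightarrow> cinner (blinfun_apply (amp x) \<xi>) \<eta>"
      by (intro cinner.tendsto a tendsto_const)
    moreover have "cinner (blinfun_apply (amp (a k)) \<xi>) \<eta> = 0" for k
      using h[of "a k"] AN a(1)[of k] eq by auto
    ultimately have "cinner (blinfun_apply (amp x) \<xi>) \<eta> = 0"
      by (simp add: LIMSEQ_const_iff)
    then show ?thesis using h[OF True] by simp
  qed (simp add: predual_outside[OF f] predual_outside[OF g])
qed

section \<open>Bounded functionals and their norms\<close>

definition bounded_functional :: "('a::chilbert_space \<Rightarrow>\<^sub>L 'a) set \<Rightarrow> (('a \<Rightarrow>\<^sub>L 'a) \<Rightarrow> complex) \<Rightarrow> bool"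
  where "bounded_functional M f \<longleftrightarrow> functional_on M f \<and> (\<exists>K. \<forall>x\<in>M. cmod (f x) \<le> K * norm x)"

lemma functional_on_add: "functional_on M f \<Longrightarrow> x \<in> M \<Longrightarrow> y \<in> M \<Longrightarrow> f (x + y) = f x + f y"
  by (simp add: functional_on_def)
lemma functional_on_op_scale: "functional_on M f \<Longrightarrow> x \<in> M \<Longrightarrow> f (op_scale c x) = c * f x"
  by (simp add: functional_on_def)
lemma functional_on_scaleR: "functional_on M f \<Longrightarrow> x \<in> M \<Longrightarrow> f (r *\<^sub>R x) = of_real r * f x"
  using functional_on_op_scale[of M f x "of_real r"] by (simp add: op_scale_of_real)
lemma functional_on_0: "functional_on M f \<Longrightarrow> 0 \<in> M \<Longrightarrow> f 0 = 0"
  using functional_on_op_scale[of M f 0 0] by simp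
lemma functional_on_diff:
  "functional_on M f \<Longrightarrow> vna M \<Longrightarrow> x \<in> M \<Longrightarrow> y \<in> M \<Longrightarrow> f (x - y) = f x - f y"
  using functional_on_add[of M f x "op_scale (-1) y"] functional_on_op_scale[of M f y "-1"]
    vna_op_scale[of M y "-1"] by (simp add: op_scale_minus_one)

lemma functional_norm_upper:
  assumes "bounded_functional M f" "x \<in> M" "norm x \<le> 1"
  shows "cmod (f x) \<le> functional_norm M f"
proof -
  obtain K where K: "\<And>x. x \<in> M \<Longrightarrow> cmod (f x) \<le> K * norm x"
    using assms(1) by (auto simp: bounded_functional_def)
  have "cmod (f y) \<le> \<bar>K\<bar>" if "y \<in> M" "norm y \<le> 1" for y
  proof -
    have "cmod (f y) \<le> \<bar>K\<bar> * norm y"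
      by (rule order_trans[OF K[OF that(1)] mult_right_mono]) auto
    also have "\<dots> \<le> \<bar>K\<bar> * 1" using that by (intro mult_left_mono) auto
    finally show ?thesis by simp
  qed
  then show ?thesis unfolding functional_norm_def
    by (intro cSup_upper bdd_aboveI[where M = "\<bar>K\<bar>"]) (use assms in auto)
qed

lemma functional_norm_bound:
  assumes M: "vna M" and f: "bounded_functional M f" and x: "x \<in> M"
  shows "cmod (f x) \<le> functional_norm M f * norm x"
proof (cases "x = 0")
  case True
  then show ?thesis using f functional_on_0[of M f] vna_0[OF M] by (simp add: bounded_functional_def)
next
  case False
  have "cmod (f ((1 / norm x) *\<^sub>R x)) \<le> functional_norm M f"
    using False by (intro functional_norm_upper f vna_scaleR M x) simp
  moreover have "f ((1 / norm x) *\<^sub>R x) = of_real (1 / norm x) * f x"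
    using f x by (intro functional_on_scaleR) (auto simp: bounded_functional_def)
  ultimately have "cmod (f x) / norm x \<le> functional_norm M f"
    by (simp add: norm_mult norm_divide)
  then show ?thesis using False by (simp add: divide_le_eq)
qed

lemma functional_norm_leI:
  assumes "vna M" "\<And>x. x \<in> M \<Longrightarrow> norm x \<le> 1 \<Longrightarrow> cmod (f x) \<le> C"
  shows "functional_norm M f \<le> C"
  unfolding functional_norm_def
proof (rule cSup_least)
  have "cmod (f 0) \<in> {cmod (f x) | x. x \<in> M \<and> norm x \<le> 1}"
    using vna_0[OF assms(1)] by force
  then show "{cmod (f x) | x. x \<in> M \<and> norm x \<le> 1} \<noteq> {}" by blast
qed (use assms in auto)

lemma functional_norm_leI':
  assumes "vna M" "0 \<le> C" "\<And>x. x \<in> M \<Longrightarrow> cmod (f x) \<le> C * norm x"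
  shows "functional_norm M f \<le> C"
proof (rule functional_norm_leI[OF assms(1)])
  show "cmod (f x) \<le> C" if "x \<in> M" "norm x \<le> 1" for x
    using assms(3)[OF that(1)] mult_left_mono[OF that(2) assms(2)] by simp
qed

lemma functional_norm_nonneg:
  assumes "vna M" "bounded_functional M f"
  shows "0 \<le> functional_norm M f"
  by (rule order_trans[OF norm_ge_zero functional_norm_upper[OF assms(2) vna_0[OF assms(1)]]]) simp

lemma predual_bounded_functional:
  assumes M: "vna M" and f: "f \<in> predual M"
  shows "bounded_functional M f"
proof -
  obtain \<xi> \<eta> where h: "\<And>x. x \<in> M \<Longrightarrow> f x = cinner (blinfun_apply (amp x) \<xi>) \<eta>"
    using f by (rule predualE) auto
  have "cmod (f x) \<le> (norm \<xi> * norm \<eta>) * norm x" if "x \<in> M" for x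
  proof -
    have "cmod (f x) \<le> norm (blinfun_apply (amp x) \<xi>) * norm \<eta>" unfolding h[OF that] by (rule cauchy_schwarz)
    also have "\<dots> \<le> norm x * norm \<xi> * norm \<eta>" by (intro mult_right_mono norm_amp_le) simp
    finally show ?thesis by (simp add: mult_ac)
  qed
  then show ?thesis unfolding bounded_functional_def functional_on_def
    by (auto simp: h vna_add[OF M] vna_op_scale[OF M] amp_simps blinfun.add_left cinner_add_left
        blinfun_apply_op_scale cinner_scaleC_left)
qed

lemma predual_functional_on: "vna M \<Longrightarrow> f \<in> predual M \<Longrightarrow> functional_on M f"
  using predual_bounded_functional by (auto simp: bounded_functional_def)

lemma predual_bound: "vna M \<Longrightarrow> f \<in> predual M \<Longrightarrow> x \<in> M \<Longrightarrow> cmod (f x) \<le> functional_norm M f * norm x"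
  by (intro functional_norm_bound predual_bounded_functional)

lemma op_eqI:
  assumes "\<And>u v. cinner (blinfun_apply x u) v = cinner (blinfun_apply y u) v"
  shows "x = y"
  by (rule blinfun_eqI, rule cinner_ext) (rule assms)

lemma predual_separates:
  assumes "x \<in> M" "y \<in> M" "\<And>f. f \<in> predual M \<Longrightarrow> f x = f y"
  shows "x = y"
  by (rule op_eqI) (use assms(3)[OF vec_fun_predual] assms in \<open>simp add: vec_fun_def\<close>)

section \<open>The Hahn--Banach theorem via minimal sublinear functionals\<close>

text \<open>The value 0 off S makes a comparison on S decide the comparison of the total functions,
  which is the order used with Zorn's lemma.\<close>

definition sublinear_on :: "'v::real_vector set \<Rightarrow> ('v \<Rightarrow> real) \<Rightarrow> bool"
  where "sublinear_on S p \<longleftrightarrow> (\<forall>x\<in>S. \<forall>y\<in>S. p (x + y) \<le> p x + p y) \<and>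
    (\<forall>x\<in>S. \<forall>r>0. p (r *\<^sub>R x) \<le> r * p x) \<and> p 0 \<le> 0 \<and> (\<forall>x. x \<notin> S \<longrightarrow> p x = 0)"

context
  fixes S :: "'v::real_vector set"
  assumes S: "subspace S"
begin

lemma sublinear_lower:
  assumes "sublinear_on S p" "x \<in> S"
  shows "- p (- x) \<le> p x"
proof -
  have "p (0 + 0) \<le> p 0 + p 0" using assms S unfolding sublinear_on_def by (meson subspace_0)
  moreover have "p (x + - x) \<le> p x + p (- x)"
    using assms S unfolding sublinear_on_def by (meson subspace_neg)
  ultimately show ?thesis by simp
qed

lemma sublinear_scale:
  assumes "sublinear_on S p" "x \<in> S" "0 < r"
  shows "p (r *\<^sub>R x) = r * p x"
proof (rule antisym)
  show "p (r *\<^sub>R x) \<le> r * p x" using assms unfolding sublinear_on_def by blast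
  have "p (inverse r *\<^sub>R (r *\<^sub>R x)) \<le> inverse r * p (r *\<^sub>R x)"
    using assms S unfolding sublinear_on_def by (meson positive_imp_inverse_positive subspace_scale)
  then show "r * p x \<le> p (r *\<^sub>R x)" using assms(3) by (simp add: field_simps)
qed

text \<open>The infimum of p (x + t y) - t * p y over nonnegative t stays sublinear; t = 0 gives q
  \<le> p and t = 1 gives the value at - y. For a minimal p it follows that q = p, so p is
  odd.\<close>

lemma sublinear_shift:
  assumes p: "sublinear_on S p" and y: "y \<in> S"
  obtains q where "sublinear_on S q" "\<And>x. x \<in> S \<Longrightarrow> q x \<le> p x" "q (- y) \<le> - p y"
proof -
  define q where "q x = (if x \<in> S then (INF t\<in>{0..}. p (x + t *\<^sub>R y) - t * p y) else 0)" for x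
  have inS: "x + t *\<^sub>R y \<in> S" if "x \<in> S" for x t
    using that y S by (simp add: subspace_add subspace_scale)
  have p0: "p 0 \<le> 0" using p by (simp add: sublinear_on_def)
  have padd: "p (a + b) \<le> p a + p b" if "a \<in> S" "b \<in> S" for a b
    using p that by (simp add: sublinear_on_def)
  have ty: "t * p y \<le> p (t *\<^sub>R y)" if "0 \<le> t" for t
  proof (cases "t = 0")
    case True
    have "0 \<le> p 0" using padd[of 0 0] S by (simp add: subspace_0)
    then show ?thesis using True by simp
  qed (use sublinear_scale[OF p y] that in simp)
  have low: "- p (- x) \<le> p (x + t *\<^sub>R y) - t * p y" if "x \<in> S" "0 \<le> t" for x t
    using padd[of "x + t *\<^sub>R y" "- x"] ty[OF that(2)] inS[OF that(1)] that S by (simp add: subspace_neg)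
  have bdd: "bdd_below ((\<lambda>t. p (x + t *\<^sub>R y) - t * p y) ` {0..})" if "x \<in> S" for x
    using low[OF that] by (intro bdd_belowI[where m = "- p (- x)"]) auto
  have le: "q x \<le> p (x + t *\<^sub>R y) - t * p y" if "x \<in> S" "0 \<le> t" for x t
    unfolding q_def using that by (auto intro!: cINF_lower bdd)
  have ge: "c \<le> q x" if "x \<in> S" "\<And>t. 0 \<le> t \<Longrightarrow> c \<le> p (x + t *\<^sub>R y) - t * p y" for c x
    unfolding q_def using that by (auto intro!: cINF_greatest)
  show ?thesis
  proof (rule that[of q])
    show qp: "q x \<le> p x" if "x \<in> S" for x using le[OF that, of 0] by simp
    show "q (- y) \<le> - p y" using le[of "- y" 1] y S p0 by (simp add: subspace_neg)
    show "sublinear_on S q" unfolding sublinear_on_def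
    proof (intro conjI ballI allI impI)
      fix x x' assume x: "x \<in> S" "x' \<in> S"
      have "q (x + x') - (p (x' + t' *\<^sub>R y) - t' * p y) \<le> q x" if t': "0 \<le> t'" for t'
      proof (rule ge[OF x(1)])
        fix t :: real assume t: "0 \<le> t"
        have "q (x + x') \<le> p ((x + x') + (t + t') *\<^sub>R y) - (t + t') * p y"
          using x t t' S by (intro le) (auto simp: subspace_add)
        also have "(x + x') + (t + t') *\<^sub>R y = (x + t *\<^sub>R y) + (x' + t' *\<^sub>R y)"
          by (simp add: scaleR_add_left)
        also have "p \<dots> \<le> p (x + t *\<^sub>R y) + p (x' + t' *\<^sub>R y)" by (intro padd inS x)
        finally show "q (x + x') - (p (x' + t' *\<^sub>R y) - t' * p y) \<le> p (x + t *\<^sub>R y) - t * p y"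
          by (simp add: algebra_simps)
      qed
      then have "q (x + x') - q x \<le> q x'" by (intro ge x) (simp add: algebra_simps)
      then show "q (x + x') \<le> q x + q x'" by simp
    next
      fix x and r :: real assume x: "x \<in> S" and r: "0 < r"
      have "q (r *\<^sub>R x) / r \<le> q x"
      proof (rule ge[OF x])
        fix t :: real assume t: "0 \<le> t"
        have "q (r *\<^sub>R x) \<le> p (r *\<^sub>R x + (r * t) *\<^sub>R y) - (r * t) * p y"
          using x t r S by (intro le) (auto simp: subspace_scale)
        also have "r *\<^sub>R x + (r * t) *\<^sub>R y = r *\<^sub>R (x + t *\<^sub>R y)" by (simp add: scaleR_add_right)
        also have "p \<dots> = r * p (x + t *\<^sub>R y)" by (intro sublinear_scale[OF p] inS x r)
        finally show "q (r *\<^sub>R x) / r \<le> p (x + t *\<^sub>R y) - t * p y"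
          using r by (simp add: field_simps)
      qed
      then show "q (r *\<^sub>R x) \<le> r * q x" using r by (simp add: field_simps)
    next
      show "q 0 \<le> 0" using qp[of 0] p0 S by (simp add: subspace_0)
    qed (simp add: q_def)
  qed
qed

text \<open>A chain has its pointwise infimum as a lower bound: members below p satisfy q x \<ge> -
  p (- x), so the infimum is finite.\<close>

lemma sublinear_minimal:
  assumes p: "sublinear_on S p"
  obtains m where "sublinear_on S m" "\<And>x. x \<in> S \<Longrightarrow> m x \<le> p x"
    "\<And>q. sublinear_on S q \<Longrightarrow> (\<And>x. x \<in> S \<Longrightarrow> q x \<le> m x) \<Longrightarrow> q = m"
proof -
  define Q where "Q = {q. sublinear_on S q \<and> (\<forall>x. q x \<le> p x)}"
  \<comment> \<open>The order is reversed, so that the maximal elements supplied by Zorn's lemma are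
    the minimal functionals.\<close>
  define P where "P = (\<lambda>q q' :: 'v \<Rightarrow> real. \<forall>x. q' x \<le> q x)"
  have pQ: "p \<in> Q" using p by (simp add: Q_def)
  have "partial_order_on Q (relation_of P Q)"
    by (rule partial_order_on_relation_ofI) (auto simp: P_def fun_eq_iff intro: order_trans antisym)
  moreover have "\<exists>u\<in>Q. \<forall>a\<in>C. P a u" if C: "C \<in> Chains (relation_of P Q)" for C
  proof (cases "C = {}")
    case True then show ?thesis using pQ by blast
  next
    case False
    have CQ: "q \<in> Q" if "q \<in> C" for q using C that by (auto simp: Chains_def relation_of_def)
    have tot: "P q q' \<or> P q' q" if "q \<in> C" "q' \<in> C" for q q'
      using C that by (auto simp: Chains_def relation_of_def)
    define u where "u x = (INF q\<in>C. q x)" for x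
    have out: "q x = 0" if "q \<in> C" "x \<notin> S" for q x using CQ[OF that(1)] that(2) by (simp add: Q_def sublinear_on_def)
    have bdd: "bdd_below ((\<lambda>q. q x) ` C)" for x
    proof (cases "x \<in> S")
      case True
      have "- p (- x) \<le> q x" if "q \<in> C" for q
      proof -
        have "- q (- x) \<le> q x" using CQ[OF that] True by (intro sublinear_lower) (auto simp: Q_def)
        moreover have "q (- x) \<le> p (- x)" using CQ[OF that] by (simp add: Q_def)
        ultimately show ?thesis by linarith
      qed
      then show ?thesis by (intro bdd_belowI[where m = "- p (- x)"]) auto
    next
      case False
      then show ?thesis by (intro bdd_belowI[where m = 0]) (auto simp: out)
    qed
    have le: "u x \<le> q x" if "q \<in> C" for q x
      unfolding u_def using that by (intro cINF_lower bdd)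
    have ge: "c \<le> u x" if "\<And>q. q \<in> C \<Longrightarrow> c \<le> q x" for c x
      unfolding u_def using that False by (intro cINF_greatest)
    have "sublinear_on S u" unfolding sublinear_on_def
    proof (intro conjI ballI allI impI)
      fix x y assume xy: "x \<in> S" "y \<in> S"
      have "u (x + y) - q' y \<le> u x" if q': "q' \<in> C" for q'
      proof (rule ge)
        fix q assume q: "q \<in> C"
        \<comment> \<open>In a chain one of q and q' lies below both; its subadditivity passes to
          the infimum.\<close>
        obtain r where r: "r \<in> C" "\<And>x. r x \<le> q x" "\<And>x. r x \<le> q' x"
          using tot[OF q q'] q q' by (auto simp: P_def)
        have "u (x + y) \<le> r (x + y)" by (rule le[OF r(1)])
        also have "\<dots> \<le> r x + r y" using CQ[OF r(1)] xy by (simp add: Q_def sublinear_on_def)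
        finally show "u (x + y) - q' y \<le> q x" using r(2)[of x] r(3)[of y] by linarith
      qed
      then have "u (x + y) - u x \<le> u y" by (intro ge) (simp add: algebra_simps)
      then show "u (x + y) \<le> u x + u y" by simp
    next
      fix x and r :: real assume x: "x \<in> S" and r: "0 < r"
      have "u (r *\<^sub>R x) / r \<le> u x"
      proof (rule ge)
        fix q assume q: "q \<in> C"
        have "u (r *\<^sub>R x) \<le> q (r *\<^sub>R x)" by (rule le[OF q])
        also have "\<dots> = r * q x" using CQ[OF q] x r by (intro sublinear_scale) (auto simp: Q_def)
        finally show "u (r *\<^sub>R x) / r \<le> q x" using r by (simp add: field_simps)
      qed
      then show "u (r *\<^sub>R x) \<le> r * u x" using r by (simp add: field_simps)
    next
      obtain q where "q \<in> C" using False by blast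
      then show "u 0 \<le> 0" using le[of q 0] CQ[of q] by (auto simp: Q_def sublinear_on_def)
    next
      show "u x = 0" if "x \<notin> S" for x
      proof -
        obtain q where q: "q \<in> C" using False by blast
        have "u x \<le> 0" using le[OF q, of x] out[OF q that] by simp
        moreover have "0 \<le> u x" by (rule ge) (simp add: out that)
        ultimately show ?thesis by simp
      qed
    qed
    moreover have "u x \<le> p x" for x
    proof -
      obtain q where "q \<in> C" using False by blast
      then show ?thesis using le[of q x] CQ[of q] by (auto simp: Q_def intro: order_trans)
    qed
    ultimately have "u \<in> Q" by (simp add: Q_def)
    then show ?thesis using le by (auto simp: P_def)
  qed
  ultimately obtain m where m: "m \<in> Q" "\<And>a. a \<in> Q \<Longrightarrow> P m a \<Longrightarrow> a = m"
    using predicate_Zorn[of Q P] by blast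
  show ?thesis
  proof (rule that[of m])
    show "sublinear_on S m" "m x \<le> p x" for x using m(1) by (auto simp: Q_def)
    fix q assume q: "sublinear_on S q" "\<And>x. x \<in> S \<Longrightarrow> q x \<le> m x"
    have qm: "q x \<le> m x" for x
      using q m(1) by (cases "x \<in> S") (auto simp: Q_def sublinear_on_def)
    then have "q \<in> Q" using q m(1) by (auto simp: Q_def intro: order_trans)
    then show "q = m" using qm by (intro m(2)) (auto simp: P_def)
  qed
qed

text \<open>A minimal sublinear functional is odd, because shifting it in any direction gives
  nothing new, and an odd sublinear functional is linear. Shifting p along v beforehand fixes the
  value at v.\<close>

theorem hahn_banach_sublinear:
  assumes p: "sublinear_on S p" and v: "v \<in> S"
  obtains F where "\<And>x y. x \<in> S \<Longrightarrow> y \<in> S \<Longrightarrow> F (x + y) = F x + F y"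
    "\<And>x r. x \<in> S \<Longrightarrow> F (r *\<^sub>R x) = r * F x" "\<And>x. x \<in> S \<Longrightarrow> F x \<le> p x" "p v \<le> F v"
proof -
  obtain q where q: "sublinear_on S q" "\<And>x. x \<in> S \<Longrightarrow> q x \<le> p x" "q (- v) \<le> - p v"
    using sublinear_shift[OF p v] by blast
  obtain m where m: "sublinear_on S m" "\<And>x. x \<in> S \<Longrightarrow> m x \<le> q x"
    "\<And>q. sublinear_on S q \<Longrightarrow> (\<And>x. x \<in> S \<Longrightarrow> q x \<le> m x) \<Longrightarrow> q = m"
    using sublinear_minimal[OF q(1)] by blast
  have odd: "m (- y) = - m y" if y: "y \<in> S" for y
  proof -
    obtain q' where q': "sublinear_on S q'" "\<And>x. x \<in> S \<Longrightarrow> q' x \<le> m x" "q' (- y) \<le> - m y"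
      using sublinear_shift[OF m(1) y] by blast
    have "q' = m" by (rule m(3)[OF q'(1,2)])
    then have "m (- y) \<le> - m y" using q'(3) by simp
    moreover have "- m y \<le> m (- y)" using sublinear_lower[OF m(1), of "- y"] y S by (simp add: subspace_neg)
    ultimately show ?thesis by simp
  qed
  have add: "m (x + y) = m x + m y" if "x \<in> S" "y \<in> S" for x y
  proof (rule antisym)
    show "m (x + y) \<le> m x + m y" using m(1) that by (simp add: sublinear_on_def)
    have "m ((x + y) + - y) \<le> m (x + y) + m (- y)"
      using m(1) that S unfolding sublinear_on_def by (meson subspace_add subspace_neg)
    then show "m x + m y \<le> m (x + y)" using odd[OF that(2)] by simp
  qed
  have m0: "m 0 = 0" using add[of 0 0] S by (simp add: subspace_0)
  have sc: "m (r *\<^sub>R x) = r * m x" if x: "x \<in> S" for r x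
  proof -
    consider "r = 0" | "0 < r" | "r < 0" by linarith
    then show ?thesis
    proof cases
      case 3
      have "m (- ((- r) *\<^sub>R x)) = - m ((- r) *\<^sub>R x)" by (intro odd subspace_scale S x)
      moreover have "m ((- r) *\<^sub>R x) = (- r) * m x" using 3 by (intro sublinear_scale[OF m(1) x]) simp
      ultimately show ?thesis by simp
    qed (simp_all add: m0 sublinear_scale[OF m(1) x])
  qed
  show ?thesis
  proof (rule that[of m])
    show "m x \<le> p x" if "x \<in> S" for x using m(2)[OF that] q(2)[OF that] by linarith
    have "m (- v) \<le> - p v" using m(2)[of "- v"] q(3) v S by (simp add: subspace_neg)
    then show "p v \<le> m v" using odd[OF v] by simp
  qed (use add sc in auto)
qed

end

section \<open>The norm of a normal functional as an infimum over its representations\<close>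

text \<open>These functionals live on all operators, not only on \<open>M\<close>. They form a real
  vector space to which Hahn--Banach applies; agreement on \<open>M\<close> is accounted for by
  \<open>mass\<close>.\<close>

definition tf :: "'a::chilbert_space ell2 \<Rightarrow> 'a ell2 \<Rightarrow> ('a \<Rightarrow>\<^sub>L 'a) \<Rightarrow>\<^sub>L complex"
  where "tf \<xi> \<eta> = Blinfun (\<lambda>x. cinner (blinfun_apply (amp x) \<xi>) \<eta>)"

lemma tf_apply [simp]: "blinfun_apply (tf \<xi> \<eta>) x = cinner (blinfun_apply (amp x) \<xi>) \<eta>"
proof -
  have "bounded_linear (\<lambda>x. cinner (blinfun_apply (amp x) \<xi>) \<eta>)"
  proof (rule bounded_linear_intro[where K = "norm \<xi> * norm \<eta>"])
    show "norm (cinner (blinfun_apply (amp x) \<xi>) \<eta>) \<le> norm x * (norm \<xi> * norm \<eta>)" for x :: "'a \<Rightarrow>\<^sub>L 'a"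
    proof -
      have "norm (cinner (blinfun_apply (amp x) \<xi>) \<eta>) \<le> norm (blinfun_apply (amp x) \<xi>) * norm \<eta>" by (rule cauchy_schwarz)
      also have "\<dots> \<le> norm x * norm \<xi> * norm \<eta>" by (intro mult_right_mono norm_amp_le) simp
      finally show ?thesis by (simp add: mult_ac)
    qed
  qed (simp_all add: amp_simps blinfun.add_left blinfun.scaleR_left cinner_add_left cinner_scaleR_left scaleR_conv_of_real)
  then show ?thesis by (simp add: tf_def bounded_linear_Blinfun_apply)
qed

text \<open>With equal norms the squared norms add under interleaving, and so do the products of
  norms; this yields subadditivity of \<open>mass\<close>.\<close>

lemma balanced_rep:
  obtains \<xi>' \<eta>' :: "'a::chilbert_space ell2" where "tf \<xi>' \<eta>' = tf \<xi> \<eta>"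
    "(norm \<xi>')\<^sup>2 = norm \<xi> * norm \<eta>" "(norm \<eta>')\<^sup>2 = norm \<xi> * norm \<eta>"
proof (cases "\<xi> = 0 \<or> \<eta> = 0")
  case True
  then have "tf 0 0 = tf \<xi> \<eta>" by (intro blinfun_eqI) auto
  then show ?thesis using True by (intro that[of 0 0]) auto
next
  case False
  define a b where "a = sqrt (norm \<eta> / norm \<xi>)" and "b = sqrt (norm \<xi> / norm \<eta>)"
  have ab: "a * b = 1" unfolding a_def b_def real_sqrt_mult[symmetric] using False by simp
  show ?thesis
  proof (rule that[of "a *\<^sub>R \<xi>" "b *\<^sub>R \<eta>"])
    show "tf (a *\<^sub>R \<xi>) (b *\<^sub>R \<eta>) = tf \<xi> \<eta>"
      using ab by (intro blinfun_eqI) (simp add: blinfun.scaleR_right cinner_scaleR_left cinner_scaleR_right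
          mult.assoc[symmetric] of_real_mult[symmetric] mult.commute[of b] del: of_real_mult)
    show "(norm (a *\<^sub>R \<xi>))\<^sup>2 = norm \<xi> * norm \<eta>" "(norm (b *\<^sub>R \<eta>))\<^sup>2 = norm \<xi> * norm \<eta>"
      using False by (simp_all add: power_mult_distrib a_def b_def) (simp_all add: power2_eq_square)
  qed
qed

text \<open>The tail of \<xi> from index n on.\<close>

definition trunc :: "nat \<Rightarrow> 'a::chilbert_space ell2 \<Rightarrow> 'a ell2"
  where "trunc n \<xi> = \<xi> - (\<Sum>j<n. incl j (ell2_nth \<xi> j))"

lemma ell2_nth_sum: "ell2_nth (\<Sum>j\<in>J. f j) n = (\<Sum>j\<in>J. ell2_nth (f j) n)"
  by (induction J rule: infinite_finite_induct) simp_all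

lemma ell2_nth_trunc: "ell2_nth (trunc n \<xi>) i = (if i < n then 0 else ell2_nth \<xi> i)"
  by (simp add: trunc_def ell2_nth_sum)

lemma norm_trunc: "(\<lambda>n. norm (trunc n \<xi>)) \<longlonglongrightarrow> 0"
proof -
  have eq: "(norm (trunc n \<xi>))\<^sup>2 = (norm \<xi>)\<^sup>2 - (\<Sum>i<n. (norm (ell2_nth \<xi> i))\<^sup>2)" for n
  proof -
    have "(\<lambda>i. if i < n then (norm (ell2_nth \<xi> i))\<^sup>2 else 0) sums (\<Sum>i<n. (norm (ell2_nth \<xi> i))\<^sup>2)"
      using sums_If_finite[of "\<lambda>i. i < n" "\<lambda>i. (norm (ell2_nth \<xi> i))\<^sup>2"] by (simp add: lessThan_def)
    then have "(\<lambda>i. (norm (ell2_nth \<xi> i))\<^sup>2 - (if i < n then (norm (ell2_nth \<xi> i))\<^sup>2 else 0)) sums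
        ((norm \<xi>)\<^sup>2 - (\<Sum>i<n. (norm (ell2_nth \<xi> i))\<^sup>2))"
      unfolding norm_ell2_sq by (intro sums_diff summable_sums ell2_summable)
    moreover have "(norm (ell2_nth \<xi> i))\<^sup>2 - (if i < n then (norm (ell2_nth \<xi> i))\<^sup>2 else 0)
        = (norm (ell2_nth (trunc n \<xi>) i))\<^sup>2" for i
      by (simp add: ell2_nth_trunc)
    ultimately show ?thesis unfolding norm_ell2_sq[of "trunc n \<xi>"] by (simp add: sums_iff)
  qed
  have "(\<lambda>n. (norm \<xi>)\<^sup>2 - (\<Sum>i<n. (norm (ell2_nth \<xi> i))\<^sup>2)) \<longlonglongrightarrow> (norm \<xi>)\<^sup>2 - (norm \<xi>)\<^sup>2"
    unfolding norm_ell2_sq by (intro tendsto_diff tendsto_const summable_LIMSEQ ell2_summable)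
  then have "(\<lambda>n. sqrt ((norm (trunc n \<xi>))\<^sup>2)) \<longlonglongrightarrow> sqrt 0"
    unfolding eq by (intro tendsto_real_sqrt) simp
  then show ?thesis by simp
qed

lemma tf_trunc: "tf \<xi> \<eta> = (\<Sum>j<n. tf (incl 0 (ell2_nth \<xi> j)) (incl 0 (ell2_nth \<eta> j))) + tf (trunc n \<xi>) (trunc n \<eta>)"
proof (rule blinfun_eqI)
  fix x :: "'a \<Rightarrow>\<^sub>L 'a"
  let ?g = "\<lambda>j. cinner (blinfun_apply x (ell2_nth \<xi> j)) (ell2_nth \<eta> j)"
  have s: "summable ?g" using ell2_cinner_summable[of "blinfun_apply (amp x) \<xi>" \<eta>] by simp
  have "(\<lambda>j. if j < n then ?g j else 0) sums (\<Sum>j<n. ?g j)"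
    using sums_If_finite[of "\<lambda>i. i < n" ?g] by (simp add: lessThan_def)
  then have "(\<lambda>j. ?g j - (if j < n then ?g j else 0)) sums ((\<Sum>j. ?g j) - (\<Sum>j<n. ?g j))"
    using s by (intro sums_diff summable_sums)
  moreover have "?g j - (if j < n then ?g j else 0) =
      cinner (ell2_nth (blinfun_apply (amp x) (trunc n \<xi>)) j) (ell2_nth (trunc n \<eta>) j)" for j
    by (simp add: ell2_nth_trunc)
  ultimately have "cinner (blinfun_apply (amp x) (trunc n \<xi>)) (trunc n \<eta>) = (\<Sum>j. ?g j) - (\<Sum>j<n. ?g j)"
    unfolding cinner_ell2_nth by (simp add: sums_iff)
  then show "blinfun_apply (tf \<xi> \<eta>) x =
      blinfun_apply ((\<Sum>j<n. tf (incl 0 (ell2_nth \<xi> j)) (incl 0 (ell2_nth \<eta> j))) + tf (trunc n \<xi>) (trunc n \<eta>)) x"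
    by (simp add: blinfun.add_left blinfun.sum_left amp_incl cinner_incl_left cinner_ell2_nth[of "blinfun_apply (amp x) \<xi>"])
qed

lemma tf_ilv: "tf (ilv \<xi> \<xi>') (ilv \<eta> \<eta>') = tf \<xi> \<eta> + tf \<xi>' \<eta>'"
  by (rule blinfun_eqI) (simp add: amp_ilv cinner_ilv blinfun.add_left)

lemma tf_scaleR: "tf \<xi> (r *\<^sub>R \<eta>) = r *\<^sub>R tf \<xi> \<eta>"
  by (rule blinfun_eqI) (simp add: cinner_scaleR_right blinfun.scaleR_left scaleR_conv_of_real)

definition TF :: "(('a::chilbert_space \<Rightarrow>\<^sub>L 'a) \<Rightarrow>\<^sub>L complex) set"
  where "TF = {tf \<xi> \<eta> | \<xi> \<eta>. True}"

lemma tf_TF [simp]: "tf \<xi> \<eta> \<in> TF" by (auto simp: TF_def)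

lemma subspace_TF: "subspace TF"
proof (rule subspaceI)
  have "0 = tf 0 0" by (rule blinfun_eqI) simp
  then show "0 \<in> TF" by (metis tf_TF)
  show "F + G \<in> TF" if "F \<in> TF" "G \<in> TF" for F G
  proof -
    from that obtain \<xi> \<eta> \<xi>' \<eta>' where "F = tf \<xi> \<eta>" "G = tf \<xi>' \<eta>'" by (auto simp: TF_def)
    then show ?thesis by (simp add: tf_ilv[symmetric])
  qed
  show "c *\<^sub>R F \<in> TF" if "F \<in> TF" for c F
  proof -
    from that obtain \<xi> \<eta> where "F = tf \<xi> \<eta>" by (auto simp: TF_def)
    then show ?thesis by (simp add: tf_scaleR[symmetric])
  qed
qed

text \<open>A quotient norm: the functionals \<open>tf \<xi> \<eta>\<close> are taken modulo those
  vanishing on \<open>M\<close>, and the size of a class is that of its cheapest pair of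
  vectors.\<close>

definition mass :: "('a::chilbert_space \<Rightarrow>\<^sub>L 'a) set \<Rightarrow> (('a \<Rightarrow>\<^sub>L 'a) \<Rightarrow>\<^sub>L complex) \<Rightarrow> real"
  where "mass M F = (if F \<in> TF then
    Inf {norm \<xi> * norm \<eta> | \<xi> \<eta>. \<forall>x\<in>M. blinfun_apply F x = blinfun_apply (tf \<xi> \<eta>) x} else 0)"

lemma mass_le:
  assumes "F \<in> TF" "\<And>x. x \<in> M \<Longrightarrow> blinfun_apply F x = blinfun_apply (tf \<xi> \<eta>) x"
  shows "mass M F \<le> norm \<xi> * norm \<eta>"
  unfolding mass_def using assms by (auto intro!: cInf_lower bdd_belowI[where m = 0])

lemma mass_less:
  assumes "F \<in> TF" "mass M F < c"
  obtains \<xi> \<eta> where "\<And>x. x \<in> M \<Longrightarrow> blinfun_apply F x = blinfun_apply (tf \<xi> \<eta>) x" "norm \<xi> * norm \<eta> < c"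
proof -
  let ?A = "{norm \<xi> * norm \<eta> | \<xi> \<eta>. \<forall>x\<in>M. blinfun_apply F x = blinfun_apply (tf \<xi> \<eta>) x}"
  obtain \<xi> \<eta> where "F = tf \<xi> \<eta>" using assms(1) by (auto simp: TF_def)
  then have "?A \<noteq> {}" by blast
  then obtain a where "a \<in> ?A" "a < c"
    using cInf_lessD[of ?A c] assms by (auto simp: mass_def)
  then show ?thesis using that by blast
qed

lemma mass_sublinear: "sublinear_on TF (mass M)"
  unfolding sublinear_on_def
proof (intro conjI ballI allI impI)
  fix F G :: "('a \<Rightarrow>\<^sub>L 'a) \<Rightarrow>\<^sub>L complex" assume FG: "F \<in> TF" "G \<in> TF"
  show "mass M (F + G) \<le> mass M F + mass M G"
  proof (rule field_le_epsilon)
    fix e :: real assume e: "0 < e"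
    obtain \<xi> \<eta> where F: "\<And>x. x \<in> M \<Longrightarrow> blinfun_apply F x = blinfun_apply (tf \<xi> \<eta>) x" "norm \<xi> * norm \<eta> < mass M F + e / 2"
      using mass_less[OF FG(1), of M "mass M F + e / 2"] e by auto
    obtain \<xi>' \<eta>' where G: "\<And>x. x \<in> M \<Longrightarrow> blinfun_apply G x = blinfun_apply (tf \<xi>' \<eta>') x" "norm \<xi>' * norm \<eta>' < mass M G + e / 2"
      using mass_less[OF FG(2), of M "mass M G + e / 2"] e by auto
    obtain a b where ab: "tf a b = tf \<xi> \<eta>" "(norm a)\<^sup>2 = norm \<xi> * norm \<eta>" "(norm b)\<^sup>2 = norm \<xi> * norm \<eta>"
      using balanced_rep by blast
    obtain a' b' where ab': "tf a' b' = tf \<xi>' \<eta>'" "(norm a')\<^sup>2 = norm \<xi>' * norm \<eta>'" "(norm b')\<^sup>2 = norm \<xi>' * norm \<eta>'"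
      using balanced_rep by blast
    \<comment> \<open>The two interleaved vectors again have equal norms, so the product of their
      norms is the sum of the two given products.\<close>
    have "norm (ilv a a') = norm (ilv b b')"
      by (rule power2_eq_imp_eq) (simp_all add: norm_ilv ab ab')
    then have n: "norm (ilv a a') * norm (ilv b b') = norm \<xi> * norm \<eta> + norm \<xi>' * norm \<eta>'"
      using norm_ilv[of b b'] by (simp add: power2_eq_square[symmetric] ab ab')
    have "mass M (F + G) \<le> norm (ilv a a') * norm (ilv b b')"
      by (rule mass_le) (use subspace_add[OF subspace_TF FG] F G in \<open>simp_all add: tf_ilv ab ab' blinfun.add_left\<close>)
    then show "mass M (F + G) \<le> mass M F + mass M G + e" using F(2) G(2) n by linarith
  qed
next
  fix F :: "('a \<Rightarrow>\<^sub>L 'a) \<Rightarrow>\<^sub>L complex" and r :: real assume F: "F \<in> TF" and r: "0 < r"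
  have "mass M (r *\<^sub>R F) / r \<le> mass M F"
  proof (rule field_le_epsilon)
    fix e :: real assume e: "0 < e"
    obtain \<xi> \<eta> where *: "\<And>x. x \<in> M \<Longrightarrow> blinfun_apply F x = blinfun_apply (tf \<xi> \<eta>) x" "norm \<xi> * norm \<eta> < mass M F + e"
      using mass_less[OF F, of M "mass M F + e"] e by auto
    have "mass M (r *\<^sub>R F) \<le> norm \<xi> * norm (r *\<^sub>R \<eta>)"
      by (rule mass_le) (use subspace_scale[OF subspace_TF F] * in \<open>simp_all add: tf_scaleR blinfun.scaleR_left del: tf_apply\<close>)
    then have "mass M (r *\<^sub>R F) / r \<le> norm \<xi> * norm \<eta>" using r by (simp add: field_simps)
    then show "mass M (r *\<^sub>R F) / r \<le> mass M F + e" using *(2) by linarith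
  qed
  then show "mass M (r *\<^sub>R F) \<le> r * mass M F" using r by (simp add: field_simps)
next
  show "mass M 0 \<le> 0"
    using mass_le[of 0 M 0 0] subspace_0[OF subspace_TF] by simp
qed (simp add: mass_def)

text \<open>Duality: Hahn--Banach gives a real-linear R below \<open>mass M\<close> that attains the
  mass of f. On vector functionals R is the real part of a form, hence of a contraction X. As R sees
  only values on \<open>M\<close>, X commutes with the commutant and so lies in \<open>M\<close>.
  Thus the mass of f is at most Re (f X), hence at most the norm of f.\<close>

theorem predual_mass_rep:
  assumes M: "vna M" and f: "f \<in> predual M" and e: "0 < e"
  obtains \<xi> \<eta> where "\<And>x. x \<in> M \<Longrightarrow> f x = blinfun_apply (tf \<xi> \<eta>) x"
    "norm \<xi> * norm \<eta> < functional_norm M f + e"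
proof -
  obtain \<xi>\<^sub>0 \<eta>\<^sub>0 where f0: "\<And>x. x \<in> M \<Longrightarrow> f x = blinfun_apply (tf \<xi>\<^sub>0 \<eta>\<^sub>0) x"
    using f by (rule predualE) auto
  obtain R where Radd: "\<And>F G. F \<in> TF \<Longrightarrow> G \<in> TF \<Longrightarrow> R (F + G) = R F + R G"
    and Rsc: "\<And>F r. F \<in> TF \<Longrightarrow> R (r *\<^sub>R F) = r * R F"
    and Rle: "\<And>F. F \<in> TF \<Longrightarrow> R F \<le> mass M F" and R0: "mass M (tf \<xi>\<^sub>0 \<eta>\<^sub>0) \<le> R (tf \<xi>\<^sub>0 \<eta>\<^sub>0)"
    using hahn_banach_sublinear[OF subspace_TF mass_sublinear tf_TF] by metis
  have Rabs: "\<bar>R (tf \<xi> \<eta>)\<bar> \<le> norm \<xi> * norm \<eta>" for \<xi> \<eta>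
  proof -
    have "R (tf \<xi> \<eta>) \<le> norm \<xi> * norm \<eta>"
      by (rule order_trans[OF Rle[OF tf_TF] mass_le[OF tf_TF refl]])
    moreover have "R (tf \<xi> ((-1) *\<^sub>R \<eta>)) \<le> norm \<xi> * norm ((-1) *\<^sub>R \<eta>)"
      by (rule order_trans[OF Rle[OF tf_TF] mass_le[OF tf_TF refl]])
    ultimately show ?thesis using Rsc[OF tf_TF, of "-1" \<xi> \<eta>] by (simp only: tf_scaleR) simp
  qed
  \<comment> \<open>The difference of two functionals that agree on \<open>M\<close> is represented
    there by zero vectors, so its mass is at most 0.\<close>
  have Req: "R (tf \<xi> \<eta>) = R (tf \<xi>' \<eta>')"
    if "\<And>x. x \<in> M \<Longrightarrow> blinfun_apply (tf \<xi> \<eta>) x = blinfun_apply (tf \<xi>' \<eta>') x" for \<xi> \<eta> \<xi>' \<eta>'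
  proof -
    have *: "R (tf \<xi> \<eta>) \<le> R (tf \<xi>' \<eta>')"
      if "\<And>x. x \<in> M \<Longrightarrow> blinfun_apply (tf \<xi> \<eta>) x = blinfun_apply (tf \<xi>' \<eta>') x" for \<xi> \<eta> \<xi>' \<eta>'
    proof -
      let ?G = "tf \<xi> \<eta> + (-1) *\<^sub>R tf \<xi>' \<eta>'"
      have G: "?G \<in> TF" by (intro subspace_add subspace_scale subspace_TF tf_TF)
      have "R ?G \<le> mass M ?G" by (rule Rle[OF G])
      also have "\<dots> \<le> norm (0::'a ell2) * norm (0::'a ell2)"
        by (rule mass_le[OF G]) (use that in \<open>simp add: blinfun.diff_left\<close>)
      finally have "R ?G \<le> 0" by simp
      then show ?thesis
        unfolding Radd[OF tf_TF subspace_scale[OF subspace_TF tf_TF]] Rsc[OF tf_TF] by simp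
    qed
    show ?thesis using *[OF that] *[OF that[symmetric]] by (simp add: antisym)
  qed
  define v where "v h k = tf (incl 0 h) (incl 0 k)" for h k :: 'a
  have v_apply: "blinfun_apply (v h k) x = cinner (blinfun_apply x h) k" for h k x
    by (simp add: v_def amp_incl cinner_incl_left)
  have vTF: "v h k \<in> TF" for h k by (simp add: v_def)
  have vR: "R (v h k) = R (v h' k')"
    if "\<And>x. x \<in> M \<Longrightarrow> cinner (blinfun_apply x h) k = cinner (blinfun_apply x h') k'" for h k h' k'
    unfolding v_def by (rule Req) (use that in \<open>simp add: amp_incl cinner_incl_left\<close>)
  have vaddl: "v (h + h') k = v h k + v h' k" and vaddr: "v h (k + k') = v h k + v h k'"
    and vsc: "v h (r *\<^sub>R k) = r *\<^sub>R v h k" for h h' k k' r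
    by (rule blinfun_eqI, simp add: v_apply blinfun.add_left blinfun.add_right blinfun.scaleR_left
        cinner_add_left cinner_add_right cinner_scaleR_right scaleR_conv_of_real)+
  \<comment> \<open>R recovers the real part of the form; conjugate linearity in k makes the value
    at \<i> k the imaginary part.\<close>
  define B where "B h k = Complex (R (v h k)) (R (v h (\<i> *\<^sub>C k)))" for h k
  have Bradd: "B h (k + k') = B h k + B h k'" for h k k'
    by (simp add: B_def scaleC_add_right vaddr Radd vTF complex_eq_iff)
  have Bladd: "B (h + h') k = B h k + B h' k" for h h' k
    by (simp add: B_def vaddl Radd vTF complex_eq_iff)
  have Brsc: "B h (c *\<^sub>C k) = cnj c * B h k" for c h k
  proof -
    have c: "c *\<^sub>C w = Re c *\<^sub>R w + Im c *\<^sub>R (\<i> *\<^sub>C w)" for w :: 'a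
    proof -
      have "c *\<^sub>C w = (of_real (Re c) + of_real (Im c) * \<i>) *\<^sub>C w"
        by (metis complex_eq mult.commute)
      then show ?thesis by (simp add: scaleC_add_left scaleC_of_real scaleC_scaleC[symmetric])
    qed
    have Rv: "R (v h (a *\<^sub>R k + b *\<^sub>R k')) = a * R (v h k) + b * R (v h k')" for a b k k'
      by (simp add: vaddr vsc Radd Rsc vTF subspace_scale[OF subspace_TF])
    have i: "\<i> *\<^sub>C (c *\<^sub>C k) = Re c *\<^sub>R (\<i> *\<^sub>C k) + (- Im c) *\<^sub>R k"
    proof -
      have "\<i> *\<^sub>C (c *\<^sub>C k) = c *\<^sub>C (\<i> *\<^sub>C k)" by (simp add: scaleC_scaleC mult.commute)
      also have "\<dots> = Re c *\<^sub>R (\<i> *\<^sub>C k) + Im c *\<^sub>R (\<i> *\<^sub>C \<i> *\<^sub>C k)" by (rule c)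
      also have "\<i> *\<^sub>C \<i> *\<^sub>C k = - k" by (simp add: scaleC_scaleC)
      finally show ?thesis by simp
    qed
    have "R (v h (c *\<^sub>C k)) = Re c * R (v h k) + Im c * R (v h (\<i> *\<^sub>C k))"
      by (simp only: c[of k] Rv)
    moreover have "R (v h (\<i> *\<^sub>C (c *\<^sub>C k))) = Re c * R (v h (\<i> *\<^sub>C k)) + (- Im c) * R (v h k)"
      by (simp only: i Rv)
    ultimately show ?thesis by (simp add: B_def complex_eq_iff algebra_simps)
  qed
  have Blsc: "B (c *\<^sub>C h) k = c * B h k" for c h k
  proof -
    \<comment> \<open>Both vector functionals agree on the complex-linear operators of
      \<open>M\<close>, so R does not distinguish them.\<close>
    have "B (c *\<^sub>C h) k = B h (cnj c *\<^sub>C k)"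
      unfolding B_def
      by (intro arg_cong2[where f = Complex] vR)
        (simp_all add: bop_scaleC[OF vna_bop[OF M]] cinner_scaleC_left cinner_scaleC_right)
    then show ?thesis by (simp add: Brsc)
  qed
  have Bbd: "cmod (B h k) \<le> 1 * norm h * norm k" for h k
  proof -
    obtain c where c: "cmod c = 1" "c * B h k = complex_of_real (cmod (B h k))"
      using unimodular_factor by blast
    have "cmod (B h k) = Re (B h (cnj c *\<^sub>C k))" by (simp add: Brsc c)
    also have "\<dots> \<le> norm (incl 0 h) * norm (incl 0 (cnj c *\<^sub>C k))"
      using Rabs[of "incl 0 h" "incl 0 (cnj c *\<^sub>C k)"] by (simp add: B_def v_def)
    finally show ?thesis by (simp add: norm_incl norm_scaleC c)
  qed
  obtain X where X: "X \<in> bop" "norm X \<le> 1" "\<And>h k. cinner (blinfun_apply X h) k = B h k"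
    using form_operator[of B 1, OF Bladd Bradd Blsc Brsc _ Bbd] by auto
  have XM: "X \<in> M"
  proof (rule vnaI_commutant[OF M X(1)])
    fix A h assume A: "A \<in> commutant M"
    have Ab: "A \<in> bop" using A commutant_sub_bop by blast
    show "blinfun_apply X (blinfun_apply A h) = blinfun_apply A (blinfun_apply X h)"
    proof (rule cinner_ext)
      fix k
      \<comment> \<open>A commutes with \<open>M\<close>, so on \<open>M\<close> the pairs (A h, k)
        and (h, \<open>adj A\<close> k) define the same functional.\<close>
      have "B (blinfun_apply A h) k = B h (blinfun_apply (adj A) k)"
        unfolding B_def bop_scaleC[OF adj_bop[OF Ab], symmetric]
        by (intro arg_cong2[where f = Complex] vR)
          (simp_all add: cinner_adj_right[OF Ab] commutantD_apply[OF A])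
      then show "cinner (blinfun_apply X (blinfun_apply A h)) k = cinner (blinfun_apply A (blinfun_apply X h)) k"
        by (simp add: X(3) cinner_adj_right[OF Ab, symmetric])
    qed
  qed
  have RX: "R (tf \<xi> \<eta>) = Re (cinner (blinfun_apply (amp X) \<xi>) \<eta>)" for \<xi> \<eta>
  proof -
    have Rsum: "R (\<Sum>j\<in>J. v (h j) (k j)) = (\<Sum>j\<in>J. R (v (h j) (k j)))" if "finite J" for J :: "nat set" and h k
      using that
    proof (induction J rule: finite_induct)
      case empty
      have "R (0 *\<^sub>R tf 0 0) = 0" by (subst Rsc) auto
      then show ?case by simp
    next
      case (insert j J)
      have "(\<Sum>j\<in>J. v (h j) (k j)) \<in> TF" by (intro subspace_sum subspace_TF vTF)
      then show ?case using insert by (simp add: Radd vTF)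
    qed
    \<comment> \<open>X is known on vector functionals only; a general functional is a finite sum of
      those plus a tail, and R of the tail is bounded by the norms of the truncated vectors.\<close>
    have eq: "R (tf \<xi> \<eta>) = (\<Sum>j<n. R (v (ell2_nth \<xi> j) (ell2_nth \<eta> j))) + R (tf (trunc n \<xi>) (trunc n \<eta>))" for n
    proof -
      have "R (tf \<xi> \<eta>) = R ((\<Sum>j<n. v (ell2_nth \<xi> j) (ell2_nth \<eta> j)) + tf (trunc n \<xi>) (trunc n \<eta>))"
        unfolding v_def by (subst tf_trunc[of \<xi> \<eta> n]) simp
      also have "\<dots> = R (\<Sum>j<n. v (ell2_nth \<xi> j) (ell2_nth \<eta> j)) + R (tf (trunc n \<xi>) (trunc n \<eta>))"
        by (intro Radd subspace_sum subspace_TF vTF tf_TF)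
      finally show ?thesis by (simp add: Rsum)
    qed
    have Bv: "R (v h k) = Re (cinner (blinfun_apply X h) k)" for h k by (simp add: X(3) B_def)
    have "(\<lambda>n. norm (trunc n \<xi>) * norm (trunc n \<eta>)) \<longlonglongrightarrow> 0 * 0" by (intro tendsto_mult norm_trunc)
    then have "(\<lambda>n. norm (trunc n \<xi>) * norm (trunc n \<eta>)) \<longlonglongrightarrow> 0" by simp
    then have "(\<lambda>n. R (tf (trunc n \<xi>) (trunc n \<eta>))) \<longlonglongrightarrow> 0"
      by (rule Lim_null_comparison[rotated]) (simp add: Rabs)
    then have "(\<lambda>n. R (tf \<xi> \<eta>) - R (tf (trunc n \<xi>) (trunc n \<eta>))) \<longlonglongrightarrow> R (tf \<xi> \<eta>) - 0"
      by (intro tendsto_diff tendsto_const)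
    also have "(\<lambda>n. R (tf \<xi> \<eta>) - R (tf (trunc n \<xi>) (trunc n \<eta>)))
        = (\<lambda>n. Re (\<Sum>j<n. cinner (ell2_nth (blinfun_apply (amp X) \<xi>) j) (ell2_nth \<eta> j)))"
    proof
      show "R (tf \<xi> \<eta>) - R (tf (trunc n \<xi>) (trunc n \<eta>))
          = Re (\<Sum>j<n. cinner (ell2_nth (blinfun_apply (amp X) \<xi>) j) (ell2_nth \<eta> j))" for n
        using eq[of n] by (simp add: Bv)
    qed
    finally have L1: "(\<lambda>n. Re (\<Sum>j<n. cinner (ell2_nth (blinfun_apply (amp X) \<xi>) j) (ell2_nth \<eta> j)))
        \<longlonglongrightarrow> R (tf \<xi> \<eta>)" by simp
    have L2: "(\<lambda>n. Re (\<Sum>j<n. cinner (ell2_nth (blinfun_apply (amp X) \<xi>) j) (ell2_nth \<eta> j)))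
        \<longlonglongrightarrow> Re (cinner (blinfun_apply (amp X) \<xi>) \<eta>)"
      unfolding cinner_ell2_nth[of "blinfun_apply (amp X) \<xi>"]
      by (intro tendsto_Re summable_LIMSEQ ell2_cinner_summable)
    show ?thesis by (rule LIMSEQ_unique[OF L1 L2])
  qed
  have "mass M (tf \<xi>\<^sub>0 \<eta>\<^sub>0) \<le> Re (f X)" using R0 f0[OF XM] by (simp add: RX)
  also have "\<dots> \<le> cmod (f X)" by (rule complex_Re_le_cmod)
  also have "\<dots> \<le> functional_norm M f"
    by (rule functional_norm_upper[OF predual_bounded_functional[OF M f] XM X(2)])
  finally have "mass M (tf \<xi>\<^sub>0 \<eta>\<^sub>0) < functional_norm M f + e" using e by linarith
  then obtain \<xi> \<eta> where "\<And>x. x \<in> M \<Longrightarrow> blinfun_apply (tf \<xi>\<^sub>0 \<eta>\<^sub>0) x = blinfun_apply (tf \<xi> \<eta>) x"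
    "norm \<xi> * norm \<eta> < functional_norm M f + e"
    by (rule mass_less[OF tf_TF]) auto
  then show ?thesis using f0 by (intro that) auto
qed

text \<open>f is a telescoping series of normal functionals with geometrically decreasing norms. By
  \<open>predual_mass_rep\<close> their vectors can be chosen almost as small as these norms, so
  that all of them together form one summable family indexed by pairs.\<close>

theorem predual_closed:
  assumes M: "vna M" and out: "\<And>x. x \<notin> M \<Longrightarrow> f x = 0"
    and ap: "\<And>e. 0 < e \<Longrightarrow> \<exists>g\<in>predual M. \<forall>x\<in>M. cmod (f x - g x) \<le> e * norm x"
  shows "f \<in> predual M"
proof -
  have "\<exists>g\<in>predual M. \<forall>x\<in>M. cmod (f x - g x) \<le> (1/2) ^ k * norm x" for k :: nat
    by (rule ap) simp
  then obtain g where g: "\<And>k. g k \<in> predual M" "\<And>k x. x \<in> M \<Longrightarrow> cmod (f x - g k x) \<le> (1/2) ^ k * norm x"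
    by metis
  \<comment> \<open>The successive differences, started with g 0 itself, so that the first n + 1
    terms add up to g n.\<close>
  define h where "h k = (case k of 0 \<Rightarrow> g 0 | Suc j \<Rightarrow> (\<lambda>x. g (Suc j) x - g j x))" for k
  have hP: "h k \<in> predual M" for k by (cases k) (simp_all add: h_def g predual_diff)
  have hsum: "(\<Sum>k<Suc n. h k x) = g n x" for n x
    by (induction n) (simp_all add: h_def)
  have hn: "functional_norm M (h (Suc j)) \<le> 2 * (1/2) ^ j" for j
  proof (rule functional_norm_leI'[OF M])
    fix x assume x: "x \<in> M"
    have "cmod (h (Suc j) x) = cmod ((f x - g j x) - (f x - g (Suc j) x))" by (simp add: h_def)
    also have "\<dots> \<le> (1/2) ^ j * norm x + (1/2) ^ Suc j * norm x"
      by (rule order_trans[OF norm_triangle_ineq4 add_mono]) (intro g x)+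
    also have "\<dots> \<le> 2 * (1/2) ^ j * norm x" by simp
    finally show "cmod (h (Suc j) x) \<le> 2 * (1/2) ^ j * norm x" .
  qed simp
  have "\<exists>\<xi> \<eta>. (\<forall>x\<in>M. h k x = blinfun_apply (tf \<xi> \<eta>) x) \<and>
      (norm \<xi>)\<^sup>2 \<le> functional_norm M (h k) + (1/2) ^ k \<and> (norm \<eta>)\<^sup>2 \<le> functional_norm M (h k) + (1/2) ^ k" for k
  proof -
    obtain \<xi> \<eta> where 1: "\<And>x. x \<in> M \<Longrightarrow> h k x = blinfun_apply (tf \<xi> \<eta>) x"
        "norm \<xi> * norm \<eta> < functional_norm M (h k) + (1/2) ^ k"
      using predual_mass_rep[OF M hP[of k], of "(1/2) ^ k"] by auto
    obtain \<xi>' \<eta>' where 2: "tf \<xi>' \<eta>' = tf \<xi> \<eta>" "(norm \<xi>')\<^sup>2 = norm \<xi> * norm \<eta>" "(norm \<eta>')\<^sup>2 = norm \<xi> * norm \<eta>"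
      using balanced_rep by blast
    show ?thesis by (rule exI[of _ \<xi>'], rule exI[of _ \<eta>']) (use 1 2 in simp)
  qed
  then obtain \<xi> \<eta> where rep: "\<And>k x. x \<in> M \<Longrightarrow> h k x = blinfun_apply (tf (\<xi> k) (\<eta> k)) x"
      and n\<xi>: "\<And>k. (norm (\<xi> k))\<^sup>2 \<le> functional_norm M (h k) + (1/2) ^ k"
      and n\<eta>: "\<And>k. (norm (\<eta> k))\<^sup>2 \<le> functional_norm M (h k) + (1/2) ^ k" by metis
  \<comment> \<open>The slack (1/2) ^ k allowed to the k-th representation is itself
    summable.\<close>
  define c where "c k = functional_norm M (h k) + (1/2) ^ k" for k :: nat
  have sc: "summable c"
  proof -
    have "c (Suc j) \<le> 3 * (1/2) ^ j" for j
    proof -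
      have "0 \<le> (1/2::real) ^ j" by simp
      then show ?thesis unfolding c_def power_Suc using hn[of j] by linarith
    qed
    moreover have "0 \<le> c k" for k
      using functional_norm_nonneg[OF M predual_bounded_functional[OF M hP]] by (simp add: c_def)
    ultimately have "summable (\<lambda>j. c (Suc j))"
      by (intro summable_comparison_test'[OF summable_mult[OF summable_geometric[of "1/2::real"]], where N = 0]) auto
    then show ?thesis by (simp add: summable_Suc_iff)
  qed
  have s: "summable (\<lambda>n. norm (ell2_nth (\<xi> k) n) * norm (ell2_nth (\<eta> k) n))"
    "(\<Sum>n. norm (ell2_nth (\<xi> k) n) * norm (ell2_nth (\<eta> k) n)) \<le> 2 * c k" for k
  proof -
    have le: "norm (ell2_nth (\<xi> k) n) * norm (ell2_nth (\<eta> k) n) \<le> (norm (ell2_nth (\<xi> k) n))\<^sup>2 + (norm (ell2_nth (\<eta> k) n))\<^sup>2" for n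
      by (rule mult_le_add_sq) auto
    have S: "summable (\<lambda>n. (norm (ell2_nth (\<xi> k) n))\<^sup>2 + (norm (ell2_nth (\<eta> k) n))\<^sup>2)"
      by (intro summable_add ell2_summable)
    show *: "summable (\<lambda>n. norm (ell2_nth (\<xi> k) n) * norm (ell2_nth (\<eta> k) n))"
      by (rule summable_comparison_test'[OF S, where N = 0]) (use le in auto)
    have "(\<Sum>n. norm (ell2_nth (\<xi> k) n) * norm (ell2_nth (\<eta> k) n)) \<le>
        (\<Sum>n. (norm (ell2_nth (\<xi> k) n))\<^sup>2 + (norm (ell2_nth (\<eta> k) n))\<^sup>2)"
      by (rule suminf_le[OF le * S])
    also have "\<dots> = (norm (\<xi> k))\<^sup>2 + (norm (\<eta> k))\<^sup>2"
      unfolding norm_ell2_sq by (intro suminf_add[symmetric] ell2_summable)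
    also have "\<dots> \<le> 2 * c k" using n\<xi>[of k] n\<eta>[of k] by (simp add: c_def)
    finally show "(\<Sum>n. norm (ell2_nth (\<xi> k) n) * norm (ell2_nth (\<eta> k) n)) \<le> 2 * c k" .
  qed
  \<comment> \<open>The index k selects the telescoping term and n the coordinate of its
    representing vector.\<close>
  define a where "a = (\<lambda>(k, n). ell2_nth (\<xi> k) n)"
  define b where "b = (\<lambda>(k, n). ell2_nth (\<eta> k) n)"
  have ab: "(\<lambda>i. norm (a i) * norm (b i)) summable_on UNIV"
    unfolding UNIV_Times_UNIV[symmetric]
  proof (rule summable_on_SigmaI)
    show "((\<lambda>n. norm (a (k, n)) * norm (b (k, n))) has_sum (\<Sum>n. norm (ell2_nth (\<xi> k) n) * norm (ell2_nth (\<eta> k) n))) UNIV" for k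
      unfolding a_def b_def using s(1) by (auto intro!: sums_nonneg_imp_has_sum summable_sums)
    have "summable (\<lambda>k. \<Sum>n. norm (ell2_nth (\<xi> k) n) * norm (ell2_nth (\<eta> k) n))"
      by (rule summable_comparison_test'[OF summable_mult[OF sc, of 2], where N = 0])
        (use s in \<open>auto simp: suminf_nonneg\<close>)
    then show "(\<lambda>k. \<Sum>n. norm (ell2_nth (\<xi> k) n) * norm (ell2_nth (\<eta> k) n)) summable_on UNIV"
      by (rule summable_nonneg_imp_summable_on) (use s in \<open>auto simp: suminf_nonneg\<close>)
  qed simp
  have "normal_rep M f a b"
    unfolding normal_rep_def
  proof (intro conjI ballI allI impI ab)
    fix x assume x: "x \<in> M"
    let ?G = "\<lambda>i. cinner (blinfun_apply x (a i)) (b i)"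
    have G: "?G summable_on UNIV" by (rule abs_summable_summable[OF rep_abs_summable[OF ab]])
    have inner: "((\<lambda>n. ?G (k, n)) has_sum h k x) UNIV" for k
    proof (rule norm_summable_imp_has_sum)
      show "summable (\<lambda>n. norm (?G (k, n)))" "(\<lambda>n. ?G (k, n)) sums h k x"
        using ell2_cinner_abs_summable[of "blinfun_apply (amp x) (\<xi> k)" "\<eta> k"]
          summable_sums[OF ell2_cinner_summable[of "blinfun_apply (amp x) (\<xi> k)" "\<eta> k"]]
        by (simp_all add: a_def b_def rep[OF x] cinner_ell2_nth[of "blinfun_apply (amp x) (\<xi> k)"])
    qed
    have "((\<lambda>k. h k x) has_sum infsum ?G UNIV) UNIV"
      by (rule has_sum_SigmaD[where f = ?G and A = UNIV and B = "\<lambda>_. UNIV"])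
        (use G inner in \<open>simp_all add: has_sum_infsum\<close>)
    then have "(\<lambda>k. h k x) sums infsum ?G UNIV" by (rule has_sum_imp_sums)
    then have "(\<lambda>n. g n x) \<longlonglongrightarrow> infsum ?G UNIV"
      unfolding sums_def using LIMSEQ_Suc[of "\<lambda>n. \<Sum>k<n. h k x"] by (simp only: hsum)
    moreover have "(\<lambda>n. g n x) \<longlonglongrightarrow> f x"
    proof (rule LIM_zero_cancel, rule Lim_null_comparison)
      show "\<forall>\<^sub>F n in sequentially. norm (g n x - f x) \<le> (1/2) ^ n * norm x"
        using g(2)[OF x] by (simp add: norm_minus_commute)
      have "(\<lambda>n. (1/2) ^ n * norm x) \<longlonglongrightarrow> 0 * norm x"
        by (intro tendsto_mult_right LIMSEQ_realpow_zero) auto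
      then show "(\<lambda>n. (1/2) ^ n * norm x) \<longlonglongrightarrow> 0" by simp
    qed
    ultimately show "f x = infsum ?G UNIV" by (rule LIMSEQ_unique[rotated])
  qed (rule out)
  then show ?thesis by (rule normal_rep_predual)
qed

section \<open>Tensor products of operators\<close>

text \<open>Lists stand for formal sums of elementary tensors. Any g may take the place of t, so a
  candidate for an image can be evaluated before it is known to be well defined.\<close>

definition tvec :: "('a \<Rightarrow> 'b \<Rightarrow> 'c::chilbert_space) \<Rightarrow> ('a \<times> 'b) list \<Rightarrow> 'c"
  where "tvec t l = (\<Sum>(a, b)\<leftarrow>l. t a b)"

lemma tvec_simps [simp]: "tvec t [] = 0" "tvec t (p # l) = t (fst p) (snd p) + tvec t l"
  "tvec t (l @ l') = tvec t l + tvec t l'"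
  by (simp_all add: tvec_def case_prod_beta)

locale hilbert_tensor_product =
  fixes t :: "'a::chilbert_space \<Rightarrow> 'b::chilbert_space \<Rightarrow> 'c::chilbert_space"
  assumes tensor: "hilbert_tensor t"
begin

lemma t_add_left: "t (a + a') b = t a b + t a' b"
  and t_add_right: "t a (b + b') = t a b + t a b'"
  and t_scaleC_left: "t (c *\<^sub>C a) b = c *\<^sub>C t a b"
  and t_scaleC_right: "t a (c *\<^sub>C b) = c *\<^sub>C t a b"
  and cinner_t: "cinner (t a b) (t a' b') = cinner a a' * cinner b b'"
  and t_dense: "closure (span {t a b | a b. True}) = UNIV"
  using tensor unfolding hilbert_tensor_def by blast+

lemma t_scaleR_left: "t (r *\<^sub>R a) b = r *\<^sub>R t a b"
  and t_scaleR_right: "t a (r *\<^sub>R b) = r *\<^sub>R t a b"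
  by (simp_all only: scaleC_of_real[symmetric] t_scaleC_left t_scaleC_right)

lemma norm_t: "norm (t a b) = norm a * norm b"
proof -
  have "complex_of_real ((norm (t a b))\<^sup>2) = complex_of_real ((norm a * norm b)\<^sup>2)"
    by (simp add: cinner_self[symmetric] cinner_t power_mult_distrib del: of_real_power)
  then have "(norm (t a b))\<^sup>2 = (norm a * norm b)\<^sup>2" by (simp only: of_real_eq_iff)
  then show ?thesis by (simp add: power2_eq_iff_nonneg)
qed

lemma tvec_scaleC: "tvec t (map (\<lambda>(a, b). (c *\<^sub>C a, b)) l) = c *\<^sub>C tvec t l"
  by (induction l) (auto simp: t_scaleC_left scaleC_add_right)

lemma tvec_scaleR: "tvec t (map (\<lambda>(a, b). (r *\<^sub>R a, b)) l) = r *\<^sub>R tvec t l"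
  by (induction l) (auto simp: t_scaleR_left scaleR_add_right)

lemma subspace_tvec: "subspace (range (tvec t))"
proof (rule subspaceI)
  show "0 \<in> range (tvec t)" by (rule range_eqI[of _ _ "[]"]) simp
  show "x + y \<in> range (tvec t)" if "x \<in> range (tvec t)" "y \<in> range (tvec t)" for x y
    using that by (auto simp: tvec_simps(3)[symmetric] simp del: tvec_simps)
  show "c *\<^sub>R x \<in> range (tvec t)" if "x \<in> range (tvec t)" for c x
    using that by (auto simp: tvec_scaleR[symmetric])
qed

lemma tvec_dense: "closure (range (tvec t)) = UNIV"
proof -
  have "t a b \<in> range (tvec t)" for a b by (rule range_eqI[of _ _ "[(a, b)]"]) simp
  then have "span {t a b | a b. True} \<subseteq> range (tvec t)"
    by (intro span_minimal subspace_tvec) auto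
  then show ?thesis using closure_mono t_dense by blast
qed

lemma tensor_op_eqI:
  fixes S T :: "'c \<Rightarrow>\<^sub>L 'd::real_normed_vector"
  assumes "\<And>a b. blinfun_apply S (t a b) = blinfun_apply T (t a b)"
  shows "S = T"
proof (rule blinfun_eqI)
  fix x
  have cl: "closed {x. blinfun_apply S x = blinfun_apply T x}"
    by (intro closed_Collect_eq linear_continuous_on blinfun.bounded_linear_right)
  have "blinfun_apply S (tvec t l) = blinfun_apply T (tvec t l)" for l
    by (induction l) (simp_all add: blinfun.add_right assms)
  then have "range (tvec t) \<subseteq> {x. blinfun_apply S x = blinfun_apply T x}" by auto
  then have "closure (range (tvec t)) \<subseteq> {x. blinfun_apply S x = blinfun_apply T x}"
    by (rule closure_minimal[OF _ cl])
  then show "blinfun_apply S x = blinfun_apply T x" by (auto simp: tvec_dense)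
qed

lemma tensor_vec_eqI:
  assumes "\<And>a b. cinner x (t a b) = cinner y (t a b)"
  shows "x = y"
proof (rule cinner_ext)
  have bl: "bounded_linear (\<lambda>z. cinner w z)" for w :: 'c by (rule cinner.bounded_linear_right)
  have "Blinfun (cinner x) = Blinfun (cinner y)"
    by (rule tensor_op_eqI) (simp add: bounded_linear_Blinfun_apply[OF bl] assms)
  then have "blinfun_apply (Blinfun (cinner x)) z = blinfun_apply (Blinfun (cinner y)) z" for z by simp
  then show "cinner x z = cinner y z" for z by (simp add: bounded_linear_Blinfun_apply[OF bl])
qed

lemma tensor_bop_eqI:
  assumes "\<And>a b a' b'. cinner (blinfun_apply S (t a b)) (t a' b') = cinner (blinfun_apply T (t a b)) (t a' b')"
  shows "S = T"
  by (rule tensor_op_eqI, rule tensor_vec_eqI) (rule assms)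

text \<open>The bound on lists contains well-definedness: if two lists give the same tensor, their
  formal difference gives 0, and the bound forces its image to be 0.\<close>

lemma tensor_extend:
  fixes g :: "'a \<Rightarrow> 'b \<Rightarrow> 'd::chilbert_space"
  assumes bd: "\<And>l. norm (tvec g l) \<le> C * norm (tvec t l)" and C: "0 \<le> C"
    and sc: "\<And>c a b. g (c *\<^sub>C a) b = c *\<^sub>C g a b"
  obtains T where "T \<in> bop" "norm T \<le> C" "\<And>a b. blinfun_apply T (t a b) = g a b"
proof -
  have gsc: "tvec g (map (\<lambda>(a, b). (c *\<^sub>C a, b)) l) = c *\<^sub>C tvec g l" for c l
    by (induction l) (auto simp: sc scaleC_add_right)
  have wd: "tvec g l = tvec g l'" if "tvec t l = tvec t l'" for l l'
  proof -
    have "tvec t (l @ map (\<lambda>(a, b). ((-1) *\<^sub>C a, b)) l') = 0"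
      using that by (simp only: tvec_simps tvec_scaleC) simp
    then have "tvec g (l @ map (\<lambda>(a, b). ((-1) *\<^sub>C a, b)) l') = 0"
      using bd[of "l @ map (\<lambda>(a, b). ((-1) *\<^sub>C a, b)) l'"] by simp
    then show ?thesis by (simp only: tvec_simps gsc) simp
  qed
  \<comment> \<open>Any list representing v will do, by \<open>wd\<close>.\<close>
  define f where "f v = tvec g (SOME l. tvec t l = v)" for v
  have f: "f (tvec t l) = tvec g l" for l
    unfolding f_def by (rule wd) (rule someI[of "\<lambda>l'. tvec t l' = tvec t l"], rule refl)
  have fadd: "f (x + y) = f x + f y" if x: "x \<in> range (tvec t)" and y: "y \<in> range (tvec t)" for x y
  proof -
    obtain l l' where "x = tvec t l" "y = tvec t l'" using x y by blast
    then show ?thesis using f[of "l @ l'"] by (simp add: f)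
  qed
  have fsc: "f (r *\<^sub>R x) = r *\<^sub>R f x" if x: "x \<in> range (tvec t)" for r x
  proof -
    obtain l where "x = tvec t l" using x by blast
    then show ?thesis
      using f[of "map (\<lambda>(a, b). (of_real r *\<^sub>C a, b)) l"]
      by (simp add: tvec_scaleC gsc scaleC_of_real[of r "tvec t l"] scaleC_of_real[of r "tvec g l"] f)
  qed
  have fbd: "norm (f x) \<le> C * norm x" if "x \<in> range (tvec t)" for x
    using that bd by (auto simp: f)
  have "\<exists>F. bounded_linear F \<and> (\<forall>x\<in>range (tvec t). F x = f x) \<and> (\<forall>x. norm (F x) \<le> C * norm x)"
  proof (rule extend_dense[OF subspace_tvec tvec_dense fadd fsc fbd C])
    fix g assume "bounded_linear g" "\<And>x. x \<in> range (tvec t) \<Longrightarrow> g x = f x" "\<And>x. norm (g x) \<le> C * norm x"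
    then show ?thesis by (intro exI[of _ g]) simp
  qed
  then obtain F where F: "bounded_linear F" "\<And>x. x \<in> range (tvec t) \<Longrightarrow> F x = f x"
    "\<And>x. norm (F x) \<le> C * norm x" by auto
  have ap: "blinfun_apply (Blinfun F) = F" using F(1) by (rule bounded_linear_Blinfun_apply)
  have Ft: "F (tvec t l) = tvec g l" for l using F(2) f by auto
  have "F (c *\<^sub>C x) = c *\<^sub>C F x" for c x
  proof -
    \<comment> \<open>The continuous extension is only real linear by construction; complex
      homogeneity is compared on elementary tensors.\<close>
    have "Blinfun (\<lambda>x. F (c *\<^sub>C x)) = Blinfun (\<lambda>x. c *\<^sub>C F x)"
    proof (rule tensor_op_eqI)
      fix a b
      have "F (c *\<^sub>C t a b) = c *\<^sub>C F (t a b)"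
        using Ft[of "[(a, b)]"] Ft[of "[(c *\<^sub>C a, b)]"] by (simp add: t_scaleC_left sc)
      then show "blinfun_apply (Blinfun (\<lambda>x. F (c *\<^sub>C x))) (t a b) = blinfun_apply (Blinfun (\<lambda>x. c *\<^sub>C F x)) (t a b)"
        by (simp add: bounded_linear_Blinfun_apply bounded_linear_compose[OF F(1) bounded_linear_scaleC]
            bounded_linear_compose[OF bounded_linear_scaleC F(1)])
    qed
    then have "blinfun_apply (Blinfun (\<lambda>x. F (c *\<^sub>C x))) x = blinfun_apply (Blinfun (\<lambda>x. c *\<^sub>C F x)) x" by simp
    then show ?thesis
      by (simp add: bounded_linear_Blinfun_apply bounded_linear_compose[OF F(1) bounded_linear_scaleC]
            bounded_linear_compose[OF bounded_linear_scaleC F(1)])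
  qed
  then show ?thesis
  proof (intro that[of "Blinfun F"])
    show "norm (Blinfun F) \<le> C" by (rule norm_blinfun_bound[OF C]) (simp add: ap F(3))
    show "blinfun_apply (Blinfun F) (t a b) = g a b" for a b using Ft[of "[(a, b)]"] by (simp add: ap)
  qed (simp add: bop_def ap)
qed

end

section \<open>Tensor products of bounded operators and their span\<close>

definition op_pow :: "('a::chilbert_space \<Rightarrow>\<^sub>L 'a) \<Rightarrow> nat \<Rightarrow> ('a \<Rightarrow>\<^sub>L 'a)"
  where "op_pow h n = ((\<lambda>A. h o\<^sub>L A) ^^ n) id_blinfun"

lemma op_pow_simps [simp]: "op_pow h 0 = id_blinfun" "op_pow h (Suc n) = h o\<^sub>L op_pow h n"
  by (simp_all add: op_pow_def)

lemma op_pow_add: "op_pow h (m + n) = op_pow h m o\<^sub>L op_pow h n"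
  by (induction m) (simp_all add: blinfun_compose_assoc)

lemma op_pow_bop: "h \<in> bop \<Longrightarrow> op_pow h n \<in> bop"
  by (induction n) (simp_all add: bop_compose)

lemma adj_op_pow: "h \<in> bop \<Longrightarrow> adj h = h \<Longrightarrow> adj (op_pow h n) = op_pow h n"
proof (induction n)
  case (Suc n)
  then have "adj (op_pow h (Suc n)) = op_pow h n o\<^sub>L op_pow h 1"
    by (simp add: adj_compose op_pow_bop)
  then show ?case using op_pow_add[of h n 1] by simp
qed simp

lemma norm_op_pow: "norm (op_pow h n) \<le> norm h ^ n"
proof (induction n)
  case (Suc n)
  have "norm (op_pow h (Suc n)) \<le> norm h * norm (op_pow h n)" by (simp add: norm_blinfun_compose)
  also have "\<dots> \<le> norm h * norm h ^ n" by (intro mult_left_mono Suc) simp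
  finally show ?case by simp
qed (simp add: norm_blinfun_id_le)

lemma vna_op_pow: "vna M \<Longrightarrow> h \<in> M \<Longrightarrow> op_pow h n \<in> M"
  by (induction n) (simp_all add: vna_id vna_compose)

context hilbert_tensor_product
begin

definition tmap :: "('a \<Rightarrow>\<^sub>L 'a) \<Rightarrow> ('b \<Rightarrow>\<^sub>L 'b) \<Rightarrow> 'a \<Rightarrow> 'b \<Rightarrow> 'c"
  where "tmap x y a b = t (blinfun_apply x a) (blinfun_apply y b)"

lemma cinner_tmap:
  assumes "x \<in> bop" "y \<in> bop"
  shows "cinner (tvec (tmap x y) l) (tvec (tmap p q) m) = cinner (tvec t l) (tvec (tmap (adj x o\<^sub>L p) (adj y o\<^sub>L q)) m)"
proof (induction l)
  case (Cons u l)
  have "cinner (tmap x y a b) (tvec (tmap p q) m) = cinner (t a b) (tvec (tmap (adj x o\<^sub>L p) (adj y o\<^sub>L q)) m)" for a b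
    by (induction m) (simp_all add: tmap_def cinner_add_right cinner_t cinner_adj_right assms)
  then show ?case using Cons by (simp add: cinner_add_left)
qed simp

text \<open>Boundedness of the tensor product of x and y is proved before the operator exists.
  Cauchy--Schwarz replaces (x, y) by (\<open>adj x\<close> x, \<open>adj y\<close> y) and then
  doubles the exponent; \<open>power_trick\<close> turns a bound depending on the list l into the
  sharp one.\<close>

lemma norm_tmap_le:
  assumes x: "x \<in> bop" and y: "y \<in> bop"
  shows "norm (tvec (tmap x y) l) \<le> (norm x * norm y) * norm (tvec t l)"
proof -
  define h g where "h = adj x o\<^sub>L x" and "g = adj y o\<^sub>L y"
  have hg: "h \<in> bop" "g \<in> bop" "adj h = h" "adj g = g"
    unfolding h_def g_def using x y by (simp_all add: bop_compose adj_bop adj_compose)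
  define c where "c = norm (tvec t l)"
  define b where "b k = norm (tvec (tmap (op_pow h (2 ^ k)) (op_pow g (2 ^ k))) l)" for k
  have c1: "cmod (cinner (tvec t l) v) \<le> c * norm v" for v
    unfolding c_def by (rule cauchy_schwarz)
  have sq: "(norm (tvec (tmap p q) l))\<^sup>2 \<le> norm (tvec (tmap (adj p o\<^sub>L p) (adj q o\<^sub>L q)) l) * c"
    if "p \<in> bop" "q \<in> bop" for p q
  proof -
    have "(norm (tvec (tmap p q) l))\<^sup>2 = cmod (cinner (tvec (tmap p q) l) (tvec (tmap p q) l))"
      by (simp add: cinner_self norm_power)
    also have "\<dots> \<le> c * norm (tvec (tmap (adj p o\<^sub>L p) (adj q o\<^sub>L q)) l)"
      unfolding cinner_tmap[OF that] by (rule c1)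
    finally show ?thesis by (simp add: mult.commute)
  qed
  have "b 0 \<le> (norm h * norm g) * c"
  proof (rule power_trick)
    show "0 \<le> b k" for k by (simp add: b_def)
    show "(b k)\<^sup>2 \<le> b (Suc k) * c" for k
      using sq[OF op_pow_bop[OF hg(1)] op_pow_bop[OF hg(2)], of "2 ^ k" "2 ^ k"]
      by (simp add: b_def adj_op_pow hg op_pow_add[symmetric] mult_2)
    \<comment> \<open>The triangle inequality on the given list; K depends on l but not on k, which
      is enough for \<open>power_trick\<close>.\<close>
    define K where "K = (\<Sum>(u, v)\<leftarrow>l. norm u * norm v)"
    have crude: "norm (tvec (tmap p q) l) \<le> K * (norm p * norm q)" for p q
      unfolding K_def
    proof (induction l)
      case (Cons w l)
      have "norm (tmap p q (fst w) (snd w)) \<le> (norm p * norm (fst w)) * (norm q * norm (snd w))"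
        unfolding tmap_def norm_t by (intro mult_mono norm_blinfun) auto
      then have "norm (tvec (tmap p q) (w # l)) \<le> (norm p * norm (fst w)) * (norm q * norm (snd w)) + norm (tvec (tmap p q) l)"
        using norm_triangle_ineq[of "tmap p q (fst w) (snd w)" "tvec (tmap p q) l"] by simp
      then show ?case using Cons by (simp add: algebra_simps case_prod_beta)
    qed simp
    have K0: "0 \<le> K" unfolding K_def by (induction l) auto
    show "b k \<le> K * (norm h * norm g) ^ (2 ^ k)" for k
    proof -
      have "norm (op_pow h (2 ^ k)) * norm (op_pow g (2 ^ k)) \<le> norm h ^ (2 ^ k) * norm g ^ (2 ^ k)"
        by (intro mult_mono norm_op_pow) auto
      then show ?thesis
        unfolding b_def power_mult_distrib by (intro order_trans[OF crude] mult_left_mono K0)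
    qed
  qed (auto simp: c_def)
  moreover have "b 0 = norm (tvec (tmap h g) l)" by (simp add: b_def)
  ultimately have 1: "(norm (tvec (tmap x y) l))\<^sup>2 \<le> (norm h * norm g) * c * c"
    using sq[OF x y] mult_right_mono[of "b 0" "(norm h * norm g) * c" c] by (simp add: h_def g_def c_def)
  have "norm h \<le> norm x * norm x" "norm g \<le> norm y * norm y"
    unfolding h_def g_def using norm_blinfun_compose[of "adj x" x] norm_blinfun_compose[of "adj y" y] x y
    by (simp_all add: norm_adj)
  then have "(norm h * norm g) * c * c \<le> (norm x * norm x) * (norm y * norm y) * c * c"
    by (intro mult_right_mono mult_mono) (auto simp: c_def)
  with 1 have "(norm (tvec (tmap x y) l))\<^sup>2 \<le> ((norm x * norm y) * c)\<^sup>2"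
    by (simp add: power2_eq_square mult_ac)
  then show ?thesis unfolding c_def by (rule power2_le_imp_le) simp
qed

lemma op_tensor_exists:
  assumes x: "x \<in> bop" and y: "y \<in> bop"
  shows op_tensor_bop: "op_tensor t x y \<in> bop"
    and op_tensor_apply: "blinfun_apply (op_tensor t x y) (t a b) = t (blinfun_apply x a) (blinfun_apply y b)"
proof -
  have sc: "tmap x y (c *\<^sub>C a) b = c *\<^sub>C tmap x y a b" for c a b
    by (simp add: tmap_def bop_scaleC[OF x] t_scaleC_left)
  have "\<exists>T\<in>bop. \<forall>a b. blinfun_apply T (t a b) = tmap x y a b"
  proof (rule tensor_extend[OF norm_tmap_le[OF x y] _ sc])
    fix T assume "T \<in> bop" "\<And>a b. blinfun_apply T (t a b) = tmap x y a b"
    then show ?thesis by (intro bexI[of _ T]) simp_all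
  qed simp
  then obtain T where T: "T \<in> bop" "\<And>a b. blinfun_apply T (t a b) = tmap x y a b" by auto
  have "op_tensor t x y = T"
    unfolding op_tensor_def
  proof (rule the_equality)
    fix S assume "S \<in> bop \<and> (\<forall>a b. blinfun_apply S (t a b) = t (blinfun_apply x a) (blinfun_apply y b))"
    then show "S = T" using T(2) by (intro tensor_op_eqI) (simp add: tmap_def)
  qed (use T in \<open>simp add: tmap_def\<close>)
  then show "op_tensor t x y \<in> bop"
    "blinfun_apply (op_tensor t x y) (t a b) = t (blinfun_apply x a) (blinfun_apply y b)"
    using T by (simp_all add: tmap_def)
qed

lemma op_tensor_eqI:
  assumes "x \<in> bop" "y \<in> bop" "\<And>a b. blinfun_apply T (t a b) = t (blinfun_apply x a) (blinfun_apply y b)"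
  shows "op_tensor t x y = T"
  by (rule tensor_op_eqI) (simp add: op_tensor_apply assms)

lemma op_tensor_id: "op_tensor t id_blinfun id_blinfun = id_blinfun"
  by (rule op_tensor_eqI) auto

lemma op_tensor_compose:
  "x \<in> bop \<Longrightarrow> y \<in> bop \<Longrightarrow> x' \<in> bop \<Longrightarrow> y' \<in> bop \<Longrightarrow>
    op_tensor t x y o\<^sub>L op_tensor t x' y' = op_tensor t (x o\<^sub>L x') (y o\<^sub>L y')"
  by (rule tensor_op_eqI) (simp add: op_tensor_apply bop_compose)

lemma op_tensor_scale:
  "x \<in> bop \<Longrightarrow> y \<in> bop \<Longrightarrow> op_scale c (op_tensor t x y) = op_tensor t (op_scale c x) y"
  by (rule tensor_op_eqI) (simp add: op_tensor_apply bop_op_scale blinfun_apply_op_scale t_scaleC_left)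

lemma adj_op_tensor:
  assumes "x \<in> bop" "y \<in> bop"
  shows "adj (op_tensor t x y) = op_tensor t (adj x) (adj y)"
  by (rule tensor_bop_eqI)
    (simp_all add: assms op_tensor_bop adj_bop op_tensor_apply cinner_adj_left cinner_t)

text \<open>The real span is already complex, since a scalar can be moved into the first
  factor.\<close>

definition tensor_alg :: "('a \<Rightarrow>\<^sub>L 'a) set \<Rightarrow> ('b \<Rightarrow>\<^sub>L 'b) set \<Rightarrow> ('c \<Rightarrow>\<^sub>L 'c) set"
  where "tensor_alg M N = span {op_tensor t x y | x y. x \<in> M \<and> y \<in> N}"

lemma op_tensor_in_alg: "x \<in> M \<Longrightarrow> y \<in> N \<Longrightarrow> op_tensor t x y \<in> tensor_alg M N"
  unfolding tensor_alg_def by (rule span_base) blast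

lemma tensor_alg_star:
  assumes M: "vna M" and N: "vna N"
  shows "star_algebra (tensor_alg M N)"
proof -
  let ?S = "{op_tensor t x y | x y. x \<in> M \<and> y \<in> N}"
  have Sb: "?S \<subseteq> bop" using op_tensor_bop vna_bop[OF M] vna_bop[OF N] by blast
  have "subspace (bop :: ('c \<Rightarrow>\<^sub>L 'c) set)" by (intro subspaceI) (simp_all add: bop_add bop_scaleR)
  then have Ab: "tensor_alg M N \<subseteq> bop" unfolding tensor_alg_def by (rule span_minimal[OF Sb])
  have sub: "subspace (tensor_alg M N)" unfolding tensor_alg_def by (rule subspace_span)
  have lin: "f ` tensor_alg M N \<subseteq> tensor_alg M N"
    if f: "\<And>x y. x \<in> bop \<Longrightarrow> y \<in> bop \<Longrightarrow> f (x + y) = f x + f y" "\<And>r x. x \<in> bop \<Longrightarrow> f (r *\<^sub>R x) = r *\<^sub>R f x"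
      and g: "\<And>x y. x \<in> M \<Longrightarrow> y \<in> N \<Longrightarrow> f (op_tensor t x y) \<in> tensor_alg M N" for f
  proof -
    have "x \<in> bop \<and> f x \<in> tensor_alg M N" if "x \<in> tensor_alg M N" for x
      using that unfolding tensor_alg_def
    proof (induction x rule: span_induct_alt)
      case base
      have "f (0 *\<^sub>R 0) = 0 *\<^sub>R f 0" by (rule f) simp
      then show ?case by (simp add: span_zero)
    next
      case (step r u v)
      then have "u \<in> bop" "f u \<in> span ?S" using Sb g by (auto simp: tensor_alg_def)
      then show ?case using step by (simp add: f bop_add bop_scaleR span_add span_scale)
    qed
    then show ?thesis by blast
  qed
  have "adj ` tensor_alg M N \<subseteq> tensor_alg M N"
    by (rule lin) (auto simp: adj_add adj_scaleR adj_op_tensor vna_bop[OF M] vna_bop[OF N]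
        intro!: op_tensor_in_alg vna_adj M N)
  moreover have "op_scale c ` tensor_alg M N \<subseteq> tensor_alg M N" for c
    by (rule lin) (auto simp: op_scale_add op_tensor_scale vna_bop[OF M] vna_bop[OF N]
        op_scale_of_real[symmetric] mult.commute intro!: op_tensor_in_alg vna_op_scale M N)
  moreover have "a o\<^sub>L b \<in> tensor_alg M N" if a: "a \<in> tensor_alg M N" and b: "b \<in> tensor_alg M N" for a b
  proof -
    have 1: "(\<lambda>b. op_tensor t x y o\<^sub>L b) ` tensor_alg M N \<subseteq> tensor_alg M N" if "x \<in> M" "y \<in> N" for x y
      using that by (intro lin) (auto simp: op_tensor_compose vna_bop[OF M] vna_bop[OF N]
          bounded_bilinear.add_right[OF bounded_bilinear_blinfun_compose]
          bounded_bilinear.scaleR_right[OF bounded_bilinear_blinfun_compose]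
          intro!: op_tensor_in_alg vna_compose M N)
    have "(\<lambda>a. a o\<^sub>L b) ` tensor_alg M N \<subseteq> tensor_alg M N"
      using 1 b by (intro lin) (auto simp: bounded_bilinear.add_left[OF bounded_bilinear_blinfun_compose]
          bounded_bilinear.scaleR_left[OF bounded_bilinear_blinfun_compose])
    then show ?thesis using a by blast
  qed
  moreover have "id_blinfun \<in> tensor_alg M N"
    using op_tensor_in_alg[OF vna_id[OF M] vna_id[OF N]] by (simp add: op_tensor_id)
  ultimately show ?thesis using Ab sub unfolding star_algebra_def by blast
qed

lemma commutant_span:
  fixes S :: "('x::chilbert_space \<Rightarrow>\<^sub>L 'x) set"
  shows "commutant (span S) = commutant S"
proof (rule antisym)
  show "commutant (span S) \<subseteq> commutant S" by (rule commutant_antimono) (rule span_superset)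
  show "commutant S \<subseteq> commutant (span S)"
  proof
    fix T assume T: "T \<in> commutant S"
    have "T o\<^sub>L A = A o\<^sub>L T" if "A \<in> span S" for A
      using that
    proof (induction A rule: span_induct_alt)
      case base show ?case by (rule blinfun_eqI) simp
    next
      case (step r u v)
      then show ?case using commutantD[OF T]
        by (simp add: bounded_bilinear.add_right[OF bounded_bilinear_blinfun_compose]
          bounded_bilinear.scaleR_right[OF bounded_bilinear_blinfun_compose]
          bounded_bilinear.add_left[OF bounded_bilinear_blinfun_compose]
          bounded_bilinear.scaleR_left[OF bounded_bilinear_blinfun_compose])
    qed
    then show "T \<in> commutant (span S)" using T by (simp add: commutant_def)
  qed
qed

lemma vn_tensor_alg: "vn_tensor t M N = commutant (commutant (tensor_alg M N))"
  unfolding vn_tensor_def tensor_alg_def commutant_span ..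

lemma vn_tensor_vna:
  assumes "vna M" "vna N"
  shows "vna (vn_tensor t M N)"
  unfolding vn_tensor_alg using tensor_alg_star[OF assms]
  by (intro vna_bicommutant) (auto simp: star_algebra_def)

lemma tensor_alg_sub: "vna M \<Longrightarrow> vna N \<Longrightarrow> tensor_alg M N \<subseteq> vn_tensor t M N"
  unfolding vn_tensor_alg by (intro commutant_commutant_sup) (use tensor_alg_star in \<open>auto simp: star_algebra_def\<close>)

lemma op_tensor_in: "vna M \<Longrightarrow> vna N \<Longrightarrow> x \<in> M \<Longrightarrow> y \<in> N \<Longrightarrow> op_tensor t x y \<in> vn_tensor t M N"
  using tensor_alg_sub op_tensor_in_alg by blast

text \<open>By the density theorem normal functionals are determined on the span of elementary
  tensors. This is the uniqueness half behind \<open>functional_tensor\<close> and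
  \<open>hom_tensor\<close>, and the standard way of comparing normal functionals below.\<close>

lemma predual_tensor_eqI:
  assumes M: "vna M" and N: "vna N"
    and F: "F \<in> predual (vn_tensor t M N)" and G: "G \<in> predual (vn_tensor t M N)"
    and eq: "\<And>x y. x \<in> M \<Longrightarrow> y \<in> N \<Longrightarrow> F (op_tensor t x y) = G (op_tensor t x y)"
  shows "F = G"
proof (rule predual_eq_bicommutant[OF tensor_alg_star[OF M N] vn_tensor_alg F G])
  fix a assume "a \<in> tensor_alg M N"
  then have "a \<in> vn_tensor t M N \<and> F a = G a" unfolding tensor_alg_def
  proof (induction a rule: span_induct_alt)
    case base
    note V = vn_tensor_vna[OF M N]
    show ?case
      using functional_on_0[OF predual_functional_on[OF V F] vna_0[OF V]]
        functional_on_0[OF predual_functional_on[OF V G] vna_0[OF V]] vna_0[OF V] by simp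
  next
    case (step r u v)
    then have "u \<in> vn_tensor t M N" "F u = G u" using eq op_tensor_in[OF M N] by auto
    moreover have "functional_on (vn_tensor t M N) F" "functional_on (vn_tensor t M N) G"
      using predual_functional_on[OF vn_tensor_vna[OF M N]] F G by auto
    ultimately show ?case using step
      by (simp add: functional_on_add functional_on_scaleR vna_add vna_scaleR vn_tensor_vna[OF M N])
  qed
  then show "F a = G a" by simp
qed

text \<open>The family of tensors of the representing vectors, indexed by pairs, is summable and
  represents the product functional. This settles the definite description and supplies an explicit
  double sum for it.\<close>

lemma tensor_rep:
  fixes \<xi> \<eta> :: "'i::countable \<Rightarrow> 'a" and \<xi>' \<eta>' :: "'j::countable \<Rightarrow> 'b"
  assumes M: "vna M" and N: "vna N" and f: "normal_rep M f \<xi> \<eta>" and g: "normal_rep N g \<xi>' \<eta>'"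
  shows normal_rep_tensor: "normal_rep (vn_tensor t M N) (functional_tensor t M N f g)
      (\<lambda>(i, j). t (\<xi> i) (\<xi>' j)) (\<lambda>(i, j). t (\<eta> i) (\<eta>' j))" (is "normal_rep _ _ ?a ?b")
    and functional_tensor_apply:
      "x \<in> M \<Longrightarrow> y \<in> N \<Longrightarrow> functional_tensor t M N f g (op_tensor t x y) = f x * g y"
proof -
  define F where "F X = (if X \<in> vn_tensor t M N then \<Sum>\<^sub>\<infinity>p. cinner (blinfun_apply X (?a p)) (?b p) else 0)" for X
  let ?p = "\<lambda>i. norm (\<xi> i) * norm (\<eta> i)" and ?q = "\<lambda>j. norm (\<xi>' j) * norm (\<eta>' j)"
  have pq: "?p summable_on UNIV" "?q summable_on UNIV" using f g by (simp_all add: normal_rep_def)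
  have s: "(\<lambda>p. norm (?a p) * norm (?b p)) summable_on UNIV"
    unfolding UNIV_Times_UNIV[symmetric]
  proof (rule summable_on_SigmaI)
    show "((\<lambda>j. norm (?a (i, j)) * norm (?b (i, j))) has_sum (?p i * infsum ?q UNIV)) UNIV" for i
    proof -
      have "((\<lambda>j. ?p i * ?q j) has_sum (?p i * infsum ?q UNIV)) UNIV"
        by (intro has_sum_cmult_right has_sum_infsum pq)
      then show ?thesis by (simp add: norm_t mult_ac)
    qed
    show "(\<lambda>i. ?p i * infsum ?q UNIV) summable_on UNIV" by (intro summable_on_cmult_left pq)
  qed auto
  have rep: "normal_rep (vn_tensor t M N) F ?a ?b" unfolding normal_rep_def using s by (simp add: F_def)
  have FP: "F \<in> predual (vn_tensor t M N)" by (rule normal_rep_predual[OF rep])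
  have Fop: "F (op_tensor t x y) = f x * g y" if x: "x \<in> M" and y: "y \<in> N" for x y
  proof -
    let ?A = "\<lambda>i. cinner (blinfun_apply x (\<xi> i)) (\<eta> i)" and ?B = "\<lambda>j. cinner (blinfun_apply y (\<xi>' j)) (\<eta>' j)"
    have app: "cinner (blinfun_apply (op_tensor t x y) (?a (i, j))) (?b (i, j)) = ?A i * ?B j" for i j
      by (simp add: op_tensor_apply vna_bop[OF M x] vna_bop[OF N y] cinner_t)
    have "(\<lambda>p. cinner (blinfun_apply (op_tensor t x y) (?a p)) (?b p)) summable_on UNIV"
      by (rule abs_summable_summable[OF rep_abs_summable[OF s]])
    then have "F (op_tensor t x y) = (\<Sum>\<^sub>\<infinity>i. \<Sum>\<^sub>\<infinity>j. cinner (blinfun_apply (op_tensor t x y) (?a (i, j))) (?b (i, j)))"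
      using op_tensor_in[OF M N x y] unfolding F_def UNIV_Times_UNIV[symmetric]
      by (subst infsum_Sigma_banach) auto
    also have "\<dots> = (\<Sum>\<^sub>\<infinity>i. ?A i * infsum ?B UNIV)"
      unfolding app by (simp add: infsum_cmult_right')
    also have "\<dots> = infsum ?A UNIV * infsum ?B UNIV" by (rule infsum_cmult_left')
    also have "\<dots> = f x * g y" using f g x y by (simp add: normal_rep_def)
    finally show ?thesis .
  qed
  have "functional_tensor t M N f g = F"
    unfolding functional_tensor_def
  proof (rule the_equality)
    show "G = F" if "G \<in> predual (vn_tensor t M N) \<and> (\<forall>x\<in>M. \<forall>y\<in>N. G (op_tensor t x y) = f x * g y)" for G
      using that Fop by (intro predual_tensor_eqI[OF M N _ FP]) auto
  qed (use FP Fop in simp)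
  then show "normal_rep (vn_tensor t M N) (functional_tensor t M N f g) ?a ?b"
    "x \<in> M \<Longrightarrow> y \<in> N \<Longrightarrow> functional_tensor t M N f g (op_tensor t x y) = f x * g y"
    using rep Fop by simp_all
qed

lemma functional_tensor_spec:
  assumes M: "vna M" and N: "vna N" and f: "f \<in> predual M" and g: "g \<in> predual N"
  shows functional_tensor_predual: "functional_tensor t M N f g \<in> predual (vn_tensor t M N)"
    and functional_tensor_op: "x \<in> M \<Longrightarrow> y \<in> N \<Longrightarrow> functional_tensor t M N f g (op_tensor t x y) = f x * g y"
proof -
  obtain \<xi> \<eta> :: "nat \<Rightarrow> 'a" where 1: "normal_rep M f \<xi> \<eta>" using f by (rule predual_normal_rep)
  obtain \<xi>' \<eta>' :: "nat \<Rightarrow> 'b" where 2: "normal_rep N g \<xi>' \<eta>'" using g by (rule predual_normal_rep)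
  show "functional_tensor t M N f g \<in> predual (vn_tensor t M N)"
    by (rule normal_rep_predual[OF normal_rep_tensor[OF M N 1 2]])
  show "x \<in> M \<Longrightarrow> y \<in> N \<Longrightarrow> functional_tensor t M N f g (op_tensor t x y) = f x * g y"
    by (rule functional_tensor_apply[OF M N 1 2])
qed

lemma functional_tensor_eqI:
  assumes "vna M" "vna N" "f \<in> predual M" "g \<in> predual N" "F \<in> predual (vn_tensor t M N)"
    "\<And>x y. x \<in> M \<Longrightarrow> y \<in> N \<Longrightarrow> F (op_tensor t x y) = f x * g y"
  shows "functional_tensor t M N f g = F"
  by (rule predual_tensor_eqI[OF assms(1,2)]) (simp_all add: functional_tensor_predual functional_tensor_op assms)

section \<open>Slice maps\<close>

definition leg :: "'a \<Rightarrow> ('b \<Rightarrow>\<^sub>L 'c)"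
  where "leg u = Blinfun (t u)"

lemma leg_apply: "blinfun_apply (leg u) b = t u b"
proof -
  have "bounded_linear (t u)"
    by (rule bounded_linear_intro[where K = "norm u"])
      (simp_all add: t_add_right t_scaleR_right norm_t mult.commute)
  then show ?thesis by (simp add: leg_def bounded_linear_Blinfun_apply)
qed

lemma leg_bop: "leg u \<in> bop"
  by (simp add: bop_def leg_apply t_scaleC_right)

lemma norm_leg_le: "norm (leg u) \<le> norm u"
  by (rule norm_blinfun_bound) (simp_all add: leg_apply norm_t)

text \<open>The slice of X by the vector functional of u and v on the first factor.\<close>

definition corner :: "('c \<Rightarrow>\<^sub>L 'c) \<Rightarrow> 'a \<Rightarrow> 'a \<Rightarrow> ('b \<Rightarrow>\<^sub>L 'b)"
  where "corner X u v = adj (leg v) o\<^sub>L X o\<^sub>L leg u"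

lemma cinner_corner:
  "X \<in> bop \<Longrightarrow> cinner (blinfun_apply (corner X u v) b) d = cinner (blinfun_apply X (t u b)) (t v d)"
  by (simp add: corner_def cinner_adj_left leg_bop leg_apply)

lemma corner_bop: "X \<in> bop \<Longrightarrow> corner X u v \<in> bop"
  unfolding corner_def by (intro bop_compose adj_bop leg_bop)

lemma norm_corner: "norm (corner X u v) \<le> norm X * norm u * norm v"
proof -
  have "norm (corner X u v) \<le> norm (adj (leg v) o\<^sub>L X) * norm (leg u)"
    unfolding corner_def by (rule norm_blinfun_compose)
  also have "\<dots> \<le> (norm (adj (leg v)) * norm X) * norm u"
    by (intro mult_mono norm_blinfun_compose norm_leg_le) auto
  also have "\<dots> \<le> (norm v * norm X) * norm u"
    using norm_leg_le[of v] by (intro mult_right_mono) (simp_all add: norm_adj leg_bop)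
  finally show ?thesis by (simp add: mult_ac)
qed

lemma commutant_left_leg:
  assumes "vna M" "vna N" "A \<in> commutant M"
  shows "op_tensor t A id_blinfun \<in> commutant {op_tensor t x y | x y. x \<in> M \<and> y \<in> N}"
proof -
  have A: "A \<in> bop" using assms(3) commutant_sub_bop by blast
  show ?thesis unfolding commutant_def
    using assms A by (auto simp: op_tensor_bop op_tensor_compose vna_bop commutantD)
qed

lemma commutant_right_leg:
  assumes "vna M" "vna N" "B \<in> commutant N"
  shows "op_tensor t id_blinfun B \<in> commutant {op_tensor t x y | x y. x \<in> M \<and> y \<in> N}"
proof -
  have B: "B \<in> bop" using assms(3) commutant_sub_bop by blast
  show ?thesis unfolding commutant_def
    using assms B by (auto simp: op_tensor_bop op_tensor_compose vna_bop commutantD)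
qed

text \<open>X commutes with the tensor product of 1 and B for every B in the commutant of N, and
  this B can be moved out of the corner.\<close>

lemma corner_in:
  assumes M: "vna M" and N: "vna N" and X: "X \<in> vn_tensor t M N"
  shows "corner X u v \<in> N"
proof (rule vnaI_commutant[OF N])
  have Xb: "X \<in> bop" by (rule vna_bop[OF vn_tensor_vna[OF M N] X])
  then show "corner X u v \<in> bop" by (rule corner_bop)
  fix B b assume B: "B \<in> commutant N"
  have Bb: "B \<in> bop" using B commutant_sub_bop by blast
  have comm: "blinfun_apply X (blinfun_apply (op_tensor t id_blinfun B) z) = blinfun_apply (op_tensor t id_blinfun B) (blinfun_apply X z)" for z
    using X commutant_right_leg[OF M N B] unfolding vn_tensor_def by (rule commutantD_apply)
  show "blinfun_apply (corner X u v) (blinfun_apply B b) = blinfun_apply B (blinfun_apply (corner X u v) b)"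
  proof (rule cinner_ext)
    fix d
    have "cinner (blinfun_apply (corner X u v) (blinfun_apply B b)) d
        = cinner (blinfun_apply X (blinfun_apply (op_tensor t id_blinfun B) (t u b))) (t v d)"
      by (simp add: cinner_corner[OF Xb] op_tensor_apply Bb)
    also have "\<dots> = cinner (blinfun_apply X (t u b)) (blinfun_apply (adj (op_tensor t id_blinfun B)) (t v d))"
      unfolding comm by (simp add: cinner_adj_right op_tensor_bop Bb)
    also have "\<dots> = cinner (blinfun_apply (corner X u v) b) (blinfun_apply (adj B) d)"
      by (simp add: adj_op_tensor Bb op_tensor_apply adj_bop cinner_corner[OF Xb])
    finally show "cinner (blinfun_apply (corner X u v) (blinfun_apply B b)) d
        = cinner (blinfun_apply B (blinfun_apply (corner X u v) b)) d"
      by (simp add: cinner_adj_right Bb)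
  qed
qed

text \<open>The slice by g is the operator of the form (u, v) \<mapsto> g (corner X u v). It is
  bounded because corners are, and the formula for general f in the predual of M is Fubini for the
  double sum of \<open>tensor_rep\<close>.\<close>

lemma slice_right_exists:
  assumes M: "vna M" and N: "vna N" and g: "g \<in> predual N" and X: "X \<in> vn_tensor t M N"
  shows slice_right_in: "slice_right t M N g X \<in> M"
    and norm_slice_right: "norm (slice_right t M N g X) \<le> functional_norm N g * norm X"
    and cinner_slice_right: "cinner (blinfun_apply (slice_right t M N g X) u) v = g (corner X u v)"
    and slice_right_functional: "f \<in> predual M \<Longrightarrow> f (slice_right t M N g X) = functional_tensor t M N f g X"
proof -
  have Xb: "X \<in> bop" by (rule vna_bop[OF vn_tensor_vna[OF M N] X])
  have gf: "functional_on N g" by (rule predual_functional_on[OF N g])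
  note cin = corner_in[OF M N X]
  have "\<exists>y\<in>bop. norm y \<le> functional_norm N g * norm X \<and> (\<forall>u v. cinner (blinfun_apply y u) v = g (corner X u v))"
  proof (rule form_operator)
    show "g (corner X (u + u') v) = g (corner X u v) + g (corner X u' v)" for u u' v
    proof -
      have "corner X (u + u') v = corner X u v + corner X u' v"
        by (rule op_eqI) (simp add: cinner_corner[OF Xb] t_add_left blinfun.add_right cinner_add_left blinfun.add_left)
      then show ?thesis by (simp add: functional_on_add[OF gf cin cin])
    qed
    show "g (corner X u (v + v')) = g (corner X u v) + g (corner X u v')" for u v v'
    proof -
      have "corner X u (v + v') = corner X u v + corner X u v'"
        by (rule op_eqI) (simp add: cinner_corner[OF Xb] t_add_left cinner_add_right cinner_add_left blinfun.add_left)
      then show ?thesis by (simp add: functional_on_add[OF gf cin cin])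
    qed
    show "g (corner X (c *\<^sub>C u) v) = c * g (corner X u v)" for c u v
    proof -
      have "corner X (c *\<^sub>C u) v = op_scale c (corner X u v)"
        by (rule op_eqI) (simp add: cinner_corner[OF Xb] t_scaleC_left bop_scaleC[OF Xb] cinner_scaleC_left blinfun_apply_op_scale)
      then show ?thesis by (simp add: functional_on_op_scale[OF gf cin])
    qed
    show "g (corner X u (c *\<^sub>C v)) = cnj c * g (corner X u v)" for c u v
    proof -
      have "corner X u (c *\<^sub>C v) = op_scale (cnj c) (corner X u v)"
        by (rule op_eqI) (simp add: cinner_corner[OF Xb] t_scaleC_left cinner_scaleC_right cinner_scaleC_left blinfun_apply_op_scale)
      then show ?thesis by (simp add: functional_on_op_scale[OF gf cin])
    qed
    have gn: "0 \<le> functional_norm N g" by (rule functional_norm_nonneg[OF N predual_bounded_functional[OF N g]])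
    then show "0 \<le> functional_norm N g * norm X" by simp
    show "cmod (g (corner X u v)) \<le> functional_norm N g * norm X * norm u * norm v" for u v
      using order_trans[OF predual_bound[OF N g cin] mult_left_mono[OF norm_corner gn], of u v]
      by (simp add: mult.assoc)
  qed
  then obtain y where y: "y \<in> bop" "norm y \<le> functional_norm N g * norm X"
    "\<And>u v. cinner (blinfun_apply y u) v = g (corner X u v)" by blast
  have yM: "y \<in> M"
  proof (rule vnaI_commutant[OF M y(1)])
    fix A u assume A: "A \<in> commutant M"
    have Ab: "A \<in> bop" using A commutant_sub_bop by blast
    have comm: "blinfun_apply X (blinfun_apply (op_tensor t A id_blinfun) z) = blinfun_apply (op_tensor t A id_blinfun) (blinfun_apply X z)" for z
      using X commutant_left_leg[OF M N A] unfolding vn_tensor_def by (rule commutantD_apply)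
    \<comment> \<open>The form does not distinguish moving A in the first vector from moving its
      adjoint in the second; this is commutation of y with A.\<close>
    have cc: "corner X (blinfun_apply A u) v = corner X u (blinfun_apply (adj A) v)" for v
    proof (rule op_eqI)
      fix b d
      have "cinner (blinfun_apply (corner X (blinfun_apply A u) v) b) d
          = cinner (blinfun_apply X (blinfun_apply (op_tensor t A id_blinfun) (t u b))) (t v d)"
        by (simp add: cinner_corner[OF Xb] op_tensor_apply Ab)
      also have "\<dots> = cinner (blinfun_apply X (t u b)) (blinfun_apply (adj (op_tensor t A id_blinfun)) (t v d))"
        unfolding comm by (simp add: cinner_adj_right op_tensor_bop Ab)
      also have "\<dots> = cinner (blinfun_apply (corner X u (blinfun_apply (adj A) v)) b) d"
        by (simp add: adj_op_tensor Ab op_tensor_apply adj_bop cinner_corner[OF Xb])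
      finally show "cinner (blinfun_apply (corner X (blinfun_apply A u) v) b) d
          = cinner (blinfun_apply (corner X u (blinfun_apply (adj A) v)) b) d" .
    qed
    show "blinfun_apply y (blinfun_apply A u) = blinfun_apply A (blinfun_apply y u)"
      by (rule cinner_ext) (simp add: y(3) cc cinner_adj_right[OF Ab, symmetric])
  qed
  \<comment> \<open>Summing over the second index first applies g to a corner; summing over the
    first index then applies f to y.\<close>
  have yf: "f y = functional_tensor t M N f g X" if f: "f \<in> predual M" for f
  proof -
    obtain \<xi> \<eta> :: "nat \<Rightarrow> 'a" where 1: "normal_rep M f \<xi> \<eta>" using f by (rule predual_normal_rep)
    obtain \<xi>' \<eta>' :: "nat \<Rightarrow> 'b" where 2: "normal_rep N g \<xi>' \<eta>'" using g by (rule predual_normal_rep)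
    let ?a = "\<lambda>(i, j). t (\<xi> i) (\<xi>' j)" and ?b = "\<lambda>(i, j). t (\<eta> i) (\<eta>' j)"
    note rep = normal_rep_tensor[OF M N 1 2]
    have s: "(\<lambda>p. cinner (blinfun_apply X (?a p)) (?b p)) summable_on UNIV"
      by (rule abs_summable_summable[OF rep_abs_summable]) (use rep in \<open>simp add: normal_rep_def\<close>)
    have "functional_tensor t M N f g X = (\<Sum>\<^sub>\<infinity>p. cinner (blinfun_apply X (?a p)) (?b p))"
      using rep X by (simp add: normal_rep_def)
    also have "\<dots> = (\<Sum>\<^sub>\<infinity>i. \<Sum>\<^sub>\<infinity>j. cinner (blinfun_apply X (?a (i, j))) (?b (i, j)))"
      using s unfolding UNIV_Times_UNIV[symmetric] by (subst infsum_Sigma_banach) auto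
    also have "\<dots> = (\<Sum>\<^sub>\<infinity>i. g (corner X (\<xi> i) (\<eta> i)))"
      using 2 cin by (intro infsum_cong) (simp add: normal_rep_def cinner_corner[OF Xb])
    also have "\<dots> = f y" using 1 yM by (simp add: normal_rep_def y(3))
    finally show ?thesis by simp
  qed
  have "slice_right t M N g X = y"
    unfolding slice_right_def
  proof (rule the_equality)
    show "x = y" if "x \<in> M \<and> (\<forall>f\<in>predual M. f x = functional_tensor t M N f g X)" for x
      using that yf by (intro predual_separates[of _ M]) (auto simp: yM)
  qed (use yM yf in simp)
  then show "slice_right t M N g X \<in> M" "norm (slice_right t M N g X) \<le> functional_norm N g * norm X"
    "cinner (blinfun_apply (slice_right t M N g X) u) v = g (corner X u v)"
    "f \<in> predual M \<Longrightarrow> f (slice_right t M N g X) = functional_tensor t M N f g X"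
    using y yM yf by simp_all
qed

lemma functional_tensor_bound:
  assumes M: "vna M" and N: "vna N" and f: "f \<in> predual M" and g: "g \<in> predual N" and X: "X \<in> vn_tensor t M N"
  shows "cmod (functional_tensor t M N f g X) \<le> functional_norm M f * functional_norm N g * norm X"
proof -
  have "cmod (functional_tensor t M N f g X) \<le> functional_norm M f * norm (slice_right t M N g X)"
    unfolding slice_right_functional[OF M N g X f, symmetric]
    by (rule predual_bound[OF M f slice_right_in[OF M N g X]])
  also have "\<dots> \<le> functional_norm M f * (functional_norm N g * norm X)"
    by (intro mult_left_mono norm_slice_right M N g X functional_norm_nonneg predual_bounded_functional f)
  finally show ?thesis by (simp add: mult.assoc)
qed

end

section \<open>Symmetry under exchange of the tensor factors\<close>

lemma hilbert_tensor_flip: "hilbert_tensor t \<Longrightarrow> hilbert_tensor (\<lambda>b a. t a b)"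
proof -
  have "{t a b | b a. True} = {t a b | a b. True}" by auto
  then show "hilbert_tensor t \<Longrightarrow> hilbert_tensor (\<lambda>b a. t a b)"
    unfolding hilbert_tensor_def by (simp add: mult.commute)
qed

lemma op_tensor_flip: "op_tensor (\<lambda>b a. t a b) y x = op_tensor t x y"
  unfolding op_tensor_def by (rule arg_cong[where f = The], rule ext, subst all_comm, rule refl)

lemma vn_tensor_flip: "vn_tensor (\<lambda>b a. t a b) N M = vn_tensor t M N"
proof -
  have "{op_tensor (\<lambda>b a. t a b) x y | x y. x \<in> N \<and> y \<in> M} = {op_tensor t x y | x y. x \<in> M \<and> y \<in> N}"
    by (auto simp: op_tensor_flip[of t])
  then show ?thesis unfolding vn_tensor_def by simp
qed

lemma functional_tensor_flip: "functional_tensor (\<lambda>b a. t a b) N M g f = functional_tensor t M N f g"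
proof -
  have "(\<forall>x\<in>N. \<forall>y\<in>M. F (op_tensor t y x) = g x * f y) \<longleftrightarrow> (\<forall>x\<in>M. \<forall>y\<in>N. F (op_tensor t x y) = f x * g y)" for F
  proof
    assume "\<forall>x\<in>N. \<forall>y\<in>M. F (op_tensor t y x) = g x * f y"
    then show "\<forall>x\<in>M. \<forall>y\<in>N. F (op_tensor t x y) = f x * g y" by (intro ballI) (simp add: mult.commute)
  next
    assume "\<forall>x\<in>M. \<forall>y\<in>N. F (op_tensor t x y) = f x * g y"
    then show "\<forall>x\<in>N. \<forall>y\<in>M. F (op_tensor t y x) = g x * f y" by (intro ballI) (simp add: mult.commute)
  qed
  then show ?thesis unfolding functional_tensor_def vn_tensor_flip[of t] op_tensor_flip[of t] by (simp only:)
qed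

text \<open>Left slices become right slices of the flipped tensor product, so results on slices are
  proved for one side only.\<close>

lemma slice_flip: "slice_right (\<lambda>b a. t a b) N M f X = slice_left t M N f X"
  unfolding slice_right_def slice_left_def functional_tensor_flip[of t] ..

section \<open>Ampliations of normal homomorphisms\<close>

lemma blinfun_compose_simps:
  "(A + B) o\<^sub>L C = (A o\<^sub>L C) + (B o\<^sub>L C)" "A o\<^sub>L (B + C) = (A o\<^sub>L B) + (A o\<^sub>L C)"
  "(r *\<^sub>R A) o\<^sub>L C = r *\<^sub>R (A o\<^sub>L C)" "A o\<^sub>L (r *\<^sub>R C) = r *\<^sub>R (A o\<^sub>L C)"
  "0 o\<^sub>L C = 0" "A o\<^sub>L 0 = 0"
  by (rule blinfun_eqI, simp add: blinfun.add_left blinfun.add_right blinfun.scaleR_left blinfun.scaleR_right)+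

lemma normal_linear_mapD:
  assumes "normal_linear_map M N \<Phi>"
  shows "x \<in> M \<Longrightarrow> \<Phi> x \<in> N" "x \<in> M \<Longrightarrow> y \<in> M \<Longrightarrow> \<Phi> (x + y) = \<Phi> x + \<Phi> y"
    "x \<in> M \<Longrightarrow> \<Phi> (op_scale c x) = op_scale c (\<Phi> x)"
    "f \<in> predual N \<Longrightarrow> (\<lambda>x. if x \<in> M then f (\<Phi> x) else 0) \<in> predual M"
  using assms unfolding normal_linear_map_def by auto

text \<open>The setting for extending \<Phi> by the identity of N on the second factor; the
  extension on the other side arises by flipping both tensor products.\<close>

locale ampliation = S: hilbert_tensor_product s + R: hilbert_tensor_product r
  for s :: "'a::chilbert_space \<Rightarrow> 'b::chilbert_space \<Rightarrow> 'c::chilbert_space"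
    and r :: "'d::chilbert_space \<Rightarrow> 'b \<Rightarrow> 'f::chilbert_space" +
  fixes M :: "('a \<Rightarrow>\<^sub>L 'a) set" and N :: "('b \<Rightarrow>\<^sub>L 'b) set" and P :: "('d \<Rightarrow>\<^sub>L 'd) set"
    and \<Phi> :: "('a \<Rightarrow>\<^sub>L 'a) \<Rightarrow> ('d \<Rightarrow>\<^sub>L 'd)"
  assumes M: "vna M" and N: "vna N" and P: "vna P" and hom: "normal_star_hom M P \<Phi>"
begin

abbreviation V where "V \<equiv> vn_tensor s M N"
abbreviation Q where "Q \<equiv> vn_tensor r P N"

lemma V: "vna V" by (rule S.vn_tensor_vna[OF M N])
lemma Q: "vna Q" by (rule R.vn_tensor_vna[OF P N])

lemma lin: "normal_linear_map M P \<Phi>" using hom by (simp add: normal_star_hom_def)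
lemmas Phi_in = normal_linear_mapD(1)[OF lin]
lemmas Phi_pre = normal_linear_mapD(4)[OF lin]
lemma Phi_bop: "x \<in> M \<Longrightarrow> \<Phi> x \<in> bop" by (rule vna_bop[OF P Phi_in])
lemma Phi_compose: "x \<in> M \<Longrightarrow> y \<in> M \<Longrightarrow> \<Phi> (x o\<^sub>L y) = \<Phi> x o\<^sub>L \<Phi> y"
  and Phi_adj: "x \<in> M \<Longrightarrow> \<Phi> (adj x) = adj (\<Phi> x)"
  using hom by (simp_all add: normal_star_hom_def)

definition pf where "pf u v = (\<lambda>x. if x \<in> M then vec_fun P u v (\<Phi> x) else 0)"

lemma pf_predual: "pf u v \<in> predual M"
  unfolding pf_def by (rule Phi_pre[OF vec_fun_predual])

lemma pf_apply: "x \<in> M \<Longrightarrow> pf u v x = cinner (blinfun_apply (\<Phi> x) u) v"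
  by (simp add: pf_def vec_fun_def Phi_in)

text \<open>The matrix coefficient, between the elementary tensors given by p and q, of the operator
  to be constructed. It is defined on all of \<open>V\<close> because \<Phi> pulls normal
  functionals back to normal ones.\<close>

definition G where "G p q = functional_tensor s M N (pf (fst p) (fst q)) (vec_fun N (snd p) (snd q))"

lemma G_predual: "G p q \<in> predual V"
  unfolding G_def by (rule S.functional_tensor_predual[OF M N pf_predual vec_fun_predual])

lemma G_op:
  assumes "x \<in> M" "y \<in> N"
  shows "G p q (op_tensor s x y) =
    cinner (blinfun_apply (op_tensor r (\<Phi> x) y) (r (fst p) (snd p))) (r (fst q) (snd q))"
  unfolding G_def
  by (simp add: S.functional_tensor_op[OF M N pf_predual vec_fun_predual] assms pf_apply
      vec_fun_def R.op_tensor_apply Phi_bop vna_bop[OF N] R.cinner_t)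

text \<open>The matrix coefficients of the operator \<open>(\<Phi> \<otimes> id) X\<close> that is yet to be constructed.\<close>

definition B where "B X l l' = (\<Sum>p\<leftarrow>l. \<Sum>q\<leftarrow>l'. G p q X)"

lemma B_predual: "(\<lambda>X. B X l l') \<in> predual V"
  unfolding B_def by (intro predual_sum_list G_predual)

lemma B_functional: "functional_on V (\<lambda>X. B X l l')"
  by (rule predual_functional_on[OF V B_predual])

lemma B_op:
  assumes "x \<in> M" "y \<in> N"
  shows "B (op_tensor s x y) l l' = cinner (blinfun_apply (op_tensor r (\<Phi> x) y) (tvec r l)) (tvec r l')"
proof (induction l)
  case (Cons p l)
  have "(\<Sum>q\<leftarrow>l'. G p q (op_tensor s x y)) =
      cinner (blinfun_apply (op_tensor r (\<Phi> x) y) (r (fst p) (snd p))) (tvec r l')"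
    by (induction l') (simp_all add: G_op[OF assms] cinner_add_right)
  then show ?case using Cons by (simp add: B_def blinfun.add_right cinner_add_left)
qed (simp add: B_def)

text \<open>The graph of the map on the algebraic tensor product, as a span of pairs. Working with a
  relation avoids a separate proof that the map is well defined there.\<close>

definition Rel where "Rel = span {(op_tensor s x y, op_tensor r (\<Phi> x) y) | x y. x \<in> M \<and> y \<in> N}"

lemma Rel_B:
  assumes "p \<in> Rel"
  shows "fst p \<in> V \<and> snd p \<in> bop \<and> (\<forall>l l'. B (fst p) l l' = cinner (blinfun_apply (snd p) (tvec r l)) (tvec r l'))"
  using assms unfolding Rel_def
proof (induction p rule: span_induct_alt)
  case base
  then show ?case by (simp add: vna_0[OF V] functional_on_0[OF B_functional])
next
  case (step c p q)
  then obtain x y where xy: "x \<in> M" "y \<in> N" "p = (op_tensor s x y, op_tensor r (\<Phi> x) y)" by blast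
  have "fst p \<in> V" using xy by (simp add: S.op_tensor_in[OF M N])
  moreover have "snd p \<in> bop" using xy by (simp add: R.op_tensor_bop Phi_bop vna_bop[OF N])
  ultimately show ?case using step.IH xy
    by (auto simp: vna_add[OF V] vna_scaleR[OF V] bop_add bop_scaleR functional_on_add[OF B_functional]
        functional_on_scaleR[OF B_functional] B_op blinfun.add_left blinfun.scaleR_left
        cinner_add_left cinner_scaleR_left)
qed

lemma Rel_adj_compose:
  assumes p: "p \<in> Rel" and q: "q \<in> Rel"
  shows "(adj (fst p) o\<^sub>L fst q, adj (snd p) o\<^sub>L snd q) \<in> Rel"
proof -
  have Rsub: "subspace Rel" unfolding Rel_def by (rule subspace_span)
  have gen: "(adj (op_tensor s x y) o\<^sub>L fst q, adj (op_tensor r (\<Phi> x) y) o\<^sub>L snd q) \<in> Rel"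
    if xy: "x \<in> M" "y \<in> N" for x y
    using q unfolding Rel_def
  proof (induction q rule: span_induct_alt)
    case base
    show ?case using subspace_0[OF Rsub] by (simp add: blinfun_compose_simps Rel_def zero_prod_def)
  next
    case (step c q q')
    then obtain x' y' where xy': "x' \<in> M" "y' \<in> N" "q = (op_tensor s x' y', op_tensor r (\<Phi> x') y')" by blast
    have "(op_tensor s (adj x o\<^sub>L x') (adj y o\<^sub>L y'), op_tensor r (\<Phi> (adj x o\<^sub>L x')) (adj y o\<^sub>L y')) \<in> Rel"
      unfolding Rel_def using xy xy' by (intro span_base) (auto intro!: vna_compose vna_adj M N)
    moreover have "op_tensor s (adj x o\<^sub>L x') (adj y o\<^sub>L y') = adj (op_tensor s x y) o\<^sub>L fst q"
      using xy xy' by (simp add: S.adj_op_tensor S.op_tensor_compose vna_bop[OF M] vna_bop[OF N] adj_bop)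
    moreover have "op_tensor r (\<Phi> (adj x o\<^sub>L x')) (adj y o\<^sub>L y') = adj (op_tensor r (\<Phi> x) y) o\<^sub>L snd q"
      using xy xy' by (simp add: R.adj_op_tensor R.op_tensor_compose Phi_bop vna_bop[OF N] adj_bop
          Phi_compose Phi_adj vna_adj[OF M])
    ultimately have "(adj (op_tensor s x y) o\<^sub>L fst q, adj (op_tensor r (\<Phi> x) y) o\<^sub>L snd q) \<in> Rel" by simp
    then have "c *\<^sub>R (adj (op_tensor s x y) o\<^sub>L fst q, adj (op_tensor r (\<Phi> x) y) o\<^sub>L snd q)
        + (adj (op_tensor s x y) o\<^sub>L fst q', adj (op_tensor r (\<Phi> x) y) o\<^sub>L snd q') \<in> Rel"
      using step.IH by (intro subspace_add subspace_scale Rsub) (simp_all add: Rel_def)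
    then show ?case by (simp add: blinfun_compose_simps Rel_def)
  qed
  have "fst p \<in> bop \<and> snd p \<in> bop \<and> (adj (fst p) o\<^sub>L fst q, adj (snd p) o\<^sub>L snd q) \<in> Rel"
    using p unfolding Rel_def
  proof (induction p rule: span_induct_alt)
    case base
    show ?case using subspace_0[OF Rsub] by (simp add: blinfun_compose_simps Rel_def zero_prod_def)
  next
    case (step c p p')
    then obtain x y where xy: "x \<in> M" "y \<in> N" "p = (op_tensor s x y, op_tensor r (\<Phi> x) y)" by blast
    have pb: "fst p \<in> bop" "snd p \<in> bop"
      using xy by (simp_all add: S.op_tensor_bop R.op_tensor_bop Phi_bop vna_bop[OF N] vna_bop[OF M])
    have "c *\<^sub>R (adj (fst p) o\<^sub>L fst q, adj (snd p) o\<^sub>L snd q)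
        + (adj (fst p') o\<^sub>L fst q, adj (snd p') o\<^sub>L snd q) \<in> Rel"
      using step.IH gen[OF xy(1,2)] xy(3) by (intro subspace_add subspace_scale Rsub) (simp_all add: Rel_def)
    then show ?case using pb step.IH
      by (simp add: blinfun_compose_simps Rel_def bop_add bop_scaleR adj_add adj_scaleR)
  qed
  then show ?thesis by simp
qed

lemma Rel_exists:
  assumes "a \<in> S.tensor_alg M N"
  shows "\<exists>T. (a, T) \<in> Rel"
  using assms unfolding S.tensor_alg_def
proof (induction a rule: span_induct_alt)
  case base
  have "0 \<in> Rel" unfolding Rel_def by (rule span_zero)
  then show ?case by (auto simp: zero_prod_def)
next
  case (step c u v)
  then obtain x y T where xy: "x \<in> M" "y \<in> N" "u = op_tensor s x y" and T: "(v, T) \<in> Rel" by blast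
  have "(u, op_tensor r (\<Phi> x) y) \<in> Rel" unfolding Rel_def using xy by (intro span_base) blast
  then have "c *\<^sub>R (u, op_tensor r (\<Phi> x) y) + (v, T) \<in> Rel"
    using T unfolding Rel_def by (intro span_add span_scale)
  then show ?case by auto
qed

text \<open>On the algebraic tensor product \<open>\<Phi> \<otimes> id\<close> is a \<open>*\<close>-homomorphism, and the inequality below is
  Cauchy--Schwarz there; it passes to \<open>V\<close> by strong approximation on the vectors that represent
  the two normal functionals involved.\<close>

lemma B_cauchy_schwarz:
  assumes X: "X \<in> V"
  shows "(cmod (B X l l'))\<^sup>2 \<le> cmod (B (adj X o\<^sub>L X) l l) * (norm (tvec r l'))\<^sup>2"
proof -
  obtain \<xi> \<eta> where 1: "\<And>x. x \<in> V \<Longrightarrow> B x l l' = cinner (blinfun_apply (amp x) \<xi>) \<eta>"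
    using B_predual[of l l'] by (rule predualE) auto
  obtain \<alpha> \<beta> where 2: "\<And>x. x \<in> V \<Longrightarrow> B x l l = cinner (blinfun_apply (amp x) \<alpha>) \<beta>"
    using B_predual[of l l] by (rule predualE) auto
  have "X \<in> commutant (commutant (S.tensor_alg M N))" using X by (simp add: S.vn_tensor_alg)
  then obtain a where a: "\<And>k. a k \<in> S.tensor_alg M N"
    and lim: "\<And>\<zeta>. \<zeta> \<in> set [\<xi>, \<alpha>, \<beta>] \<Longrightarrow> (\<lambda>k. blinfun_apply (amp (a k)) \<zeta>) \<longlonglongrightarrow> blinfun_apply (amp X) \<zeta>"
    using density_seq[OF S.tensor_alg_star[OF M N], of X "[\<xi>, \<alpha>, \<beta>]"] by metis
  have aV: "a k \<in> V" for k using a S.tensor_alg_sub[OF M N] by blast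
  \<comment> \<open>A quadratic expression in x becomes an inner product of x applied to two
    vectors; strong convergence on both \<alpha> and \<beta> is therefore required.\<close>
  have BB: "B (adj x o\<^sub>L x) l l = cinner (blinfun_apply (amp x) \<alpha>) (blinfun_apply (amp x) \<beta>)" if "x \<in> V" for x
    using that 2[OF vna_compose[OF V vna_adj[OF V that] that]]
    by (simp add: amp_simps cinner_amp_adj[OF adj_bop] vna_bop[OF V])
  have le: "(cmod (B (a k) l l'))\<^sup>2 \<le> cmod (B (adj (a k) o\<^sub>L a k) l l) * (norm (tvec r l'))\<^sup>2" for k
  proof -
    obtain T where T: "(a k, T) \<in> Rel" using Rel_exists[OF a] by blast
    have Tb: "T \<in> bop" and Ba: "B (a k) l l' = cinner (blinfun_apply T (tvec r l)) (tvec r l')"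
      using Rel_B[OF T] by auto
    have "B (adj (a k) o\<^sub>L a k) l l = cinner (blinfun_apply T (tvec r l)) (blinfun_apply T (tvec r l))"
      using Rel_B[OF Rel_adj_compose[OF T T]] by (simp add: cinner_adj_left[OF Tb])
    then have "cmod (B (adj (a k) o\<^sub>L a k) l l) = (norm (blinfun_apply T (tvec r l)))\<^sup>2"
      by (simp add: cinner_self norm_power)
    moreover have "(cmod (B (a k) l l'))\<^sup>2 \<le> (norm (blinfun_apply T (tvec r l)) * norm (tvec r l'))\<^sup>2"
      unfolding Ba by (intro power_mono cauchy_schwarz) simp
    ultimately show ?thesis by (simp add: power_mult_distrib)
  qed
  show ?thesis
  proof (rule LIMSEQ_le)
    show "(\<lambda>k. (cmod (B (a k) l l'))\<^sup>2) \<longlonglongrightarrow> (cmod (B X l l'))\<^sup>2"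
      unfolding 1[OF aV] 1[OF X] by (intro tendsto_intros cinner.tendsto lim) simp
    show "(\<lambda>k. cmod (B (adj (a k) o\<^sub>L a k) l l) * (norm (tvec r l'))\<^sup>2) \<longlonglongrightarrow>
        cmod (B (adj X o\<^sub>L X) l l) * (norm (tvec r l'))\<^sup>2"
      unfolding BB[OF aV] BB[OF X] by (intro tendsto_intros cinner.tendsto lim) simp_all
  qed (use le in blast)
qed

text \<open>As for \<open>norm_tmap_le\<close>: Cauchy--Schwarz is iterated on powers of
  \<open>adj X\<close> X. The crude bound is now the norm of the normal functional X \<mapsto> B X l
  l, which exists because \<open>B\<close> is normal in X.\<close>

lemma B_bound:
  assumes X: "X \<in> V"
  shows "cmod (B X l l') \<le> norm X * norm (tvec r l) * norm (tvec r l')"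
proof -
  have Xb: "X \<in> bop" by (rule vna_bop[OF V X])
  define h where "h = adj X o\<^sub>L X"
  have hV: "h \<in> V" unfolding h_def by (intro vna_compose vna_adj V X)
  have hb: "h \<in> bop" by (rule vna_bop[OF V hV])
  have hs: "adj h = h" unfolding h_def using Xb by (simp add: adj_compose adj_bop)
  define b where "b k = cmod (B (op_pow h (2 ^ k)) l l)" for k
  define c where "c = (norm (tvec r l))\<^sup>2"
  have "b 0 \<le> norm h * c"
  proof (rule power_trick)
    show "(b k)\<^sup>2 \<le> b (Suc k) * c" for k
      using B_cauchy_schwarz[OF vna_op_pow[OF V hV], of "2 ^ k" l l]
      by (simp add: b_def c_def adj_op_pow[OF hb hs] op_pow_add[symmetric] mult_2)
    show "b k \<le> functional_norm V (\<lambda>X. B X l l) * norm h ^ (2 ^ k)" for k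
    proof -
      have "b k \<le> functional_norm V (\<lambda>X. B X l l) * norm (op_pow h (2 ^ k))"
        unfolding b_def by (rule predual_bound[OF V B_predual vna_op_pow[OF V hV]])
      also have "\<dots> \<le> functional_norm V (\<lambda>X. B X l l) * norm h ^ (2 ^ k)"
        by (intro mult_left_mono norm_op_pow functional_norm_nonneg[OF V predual_bounded_functional[OF V B_predual]])
      finally show ?thesis .
    qed
  qed (simp_all add: b_def c_def)
  then have "cmod (B h l l) \<le> norm h * c" by (simp add: b_def)
  also have "norm h \<le> (norm X)\<^sup>2"
    unfolding h_def using norm_blinfun_compose[of "adj X" X] by (simp add: norm_adj[OF Xb] power2_eq_square)
  finally have "cmod (B h l l) \<le> (norm X)\<^sup>2 * c" by (simp add: c_def mult_right_mono)
  then have "(cmod (B X l l'))\<^sup>2 \<le> (norm X)\<^sup>2 * c * (norm (tvec r l'))\<^sup>2"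
    using B_cauchy_schwarz[OF X, of l l'] mult_right_mono[of "cmod (B h l l)" "(norm X)\<^sup>2 * c" "(norm (tvec r l'))\<^sup>2"]
    by (simp add: h_def)
  then have "(cmod (B X l l'))\<^sup>2 \<le> (norm X * norm (tvec r l) * norm (tvec r l'))\<^sup>2"
    by (simp add: c_def power_mult_distrib)
  then show ?thesis by (rule power2_le_imp_le) simp
qed

lemma G_scale_left: "X \<in> V \<Longrightarrow> G (c *\<^sub>C u, b) q X = c * G (u, b) q X"
proof -
  have "G (c *\<^sub>C u, b) q = (\<lambda>X. c * G (u, b) q X)"
    by (rule S.predual_tensor_eqI[OF M N G_predual predual_scale[OF G_predual]])
      (simp add: G_op R.t_scaleC_left bop_scaleC[OF R.op_tensor_bop] Phi_bop vna_bop[OF N] cinner_scaleC_left)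
  then show "G (c *\<^sub>C u, b) q X = c * G (u, b) q X" by simp
qed

lemma G_scale_right: "X \<in> V \<Longrightarrow> G p (c *\<^sub>C v, d) X = cnj c * G p (v, d) X"
proof -
  have "G p (c *\<^sub>C v, d) = (\<lambda>X. cnj c * G p (v, d) X)"
    by (rule S.predual_tensor_eqI[OF M N G_predual predual_scale[OF G_predual]])
      (simp add: G_op R.t_scaleC_left cinner_scaleC_right)
  then show "G p (c *\<^sub>C v, d) X = cnj c * G p (v, d) X" by simp
qed

text \<open>Two extensions: for fixed (u, b) the coefficients extend to a bounded functional, which
  Riesz turns into a vector y u b; then y extends linearly in (u, b). Both bounds are instances of
  \<open>B_bound\<close>.\<close>

lemma ampliate_exists:
  assumes X: "X \<in> V"
  shows "\<exists>T\<in>bop. norm T \<le> norm X \<and> (\<forall>u b v d. cinner (blinfun_apply T (r u b)) (r v d) = G (u, b) (v, d) X)"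
proof -
  have "\<exists>y. \<forall>v d. cinner y (r v d) = G (u, b) (v, d) X" for u b
  proof -
    \<comment> \<open>The conjugate makes the coefficients linear in (v, d), as the extension
      requires.\<close>
    define g where "g v d = cnj (G (u, b) (v, d) X)" for v d
    have gB: "tvec g l' = cnj (B X [(u, b)] l')" for l'
      by (induction l') (simp_all add: g_def B_def)
    have "norm (tvec g l') \<le> (norm X * norm (r u b)) * norm (tvec r l')" for l'
      using B_bound[OF X, of "[(u, b)]" l'] by (simp add: gB)
    moreover have "g (c *\<^sub>C v) d = c *\<^sub>C g v d" for c v d
      by (simp add: g_def G_scale_right[OF X] scaleC_complex_def)
    ultimately obtain T where T: "T \<in> bop" "\<And>v d. blinfun_apply T (r v d) = g v d"
      using R.tensor_extend[of g "norm X * norm (r u b)"] by (metis mult_nonneg_nonneg norm_ge_zero)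
    obtain y where y: "\<And>z. blinfun_apply T z = cinner z y"
      using riesz[of "blinfun_apply T"] bop_scaleC[OF T(1)]
      by (auto simp: scaleC_complex_def blinfun.bounded_linear_right)
    have "cinner y (r v d) = G (u, b) (v, d) X" for v d
    proof -
      have "cinner (r v d) y = cnj (G (u, b) (v, d) X)" using y[of "r v d"] T(2)[of v d] by (simp add: g_def)
      then show ?thesis by (subst cinner_commute) simp
    qed
    then show ?thesis by blast
  qed
  then obtain y where y: "\<And>u b v d. cinner (y u b) (r v d) = G (u, b) (v, d) X" by metis
  have yB: "cinner (tvec y l) (tvec r l') = B X l l'" for l l'
  proof (induction l)
    case (Cons p l)
    have "cinner (y (fst p) (snd p)) (tvec r l') = (\<Sum>q\<leftarrow>l'. G p q X)"
      by (induction l') (simp_all add: cinner_add_right y)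
    then show ?case using Cons by (simp add: B_def cinner_add_left)
  qed (simp add: B_def)
  have "norm (tvec y l) \<le> norm X * norm (tvec r l)" for l
  proof (rule norm_le_cinnerI)
    fix z
    have "closed {z. cmod (cinner (tvec y l) z) \<le> norm X * norm (tvec r l) * norm z}"
      by (intro closed_Collect_le continuous_intros linear_continuous_on cinner.bounded_linear_right)
    then have "closure (range (tvec r)) \<subseteq> {z. cmod (cinner (tvec y l) z) \<le> norm X * norm (tvec r l) * norm z}"
      using B_bound[OF X] by (intro closure_minimal) (auto simp: yB)
    then show "cmod (cinner (tvec y l) z) \<le> norm X * norm (tvec r l) * norm z" by (auto simp: R.tvec_dense)
  qed simp
  moreover have "y (c *\<^sub>C u) b = c *\<^sub>C y u b" for c u b
    by (rule R.tensor_vec_eqI) (simp add: y G_scale_left[OF X] cinner_scaleC_left)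
  ultimately obtain T where "T \<in> bop" "norm T \<le> norm X" "\<And>u b. blinfun_apply T (r u b) = y u b"
    using R.tensor_extend[of y "norm X"] by (metis norm_ge_zero)
  then show ?thesis using y by (intro bexI[of _ T]) auto
qed

text \<open>The value 0 outside \<open>V\<close> is the normalisation that \<open>hom_tensor\<close>
  demands.\<close>

definition Th where "Th X = (if X \<in> V then SOME T. T \<in> bop \<and> norm T \<le> norm X \<and>
    (\<forall>u b v d. cinner (blinfun_apply T (r u b)) (r v d) = G (u, b) (v, d) X) else 0)"

lemma Th_spec:
  assumes "X \<in> V"
  shows Th_bop: "Th X \<in> bop" and norm_Th: "norm (Th X) \<le> norm X"
    and cinner_Th: "cinner (blinfun_apply (Th X) (r u b)) (r v d) = G (u, b) (v, d) X"
proof -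
  have "\<exists>T. T \<in> bop \<and> norm T \<le> norm X \<and>
    (\<forall>u b v d. cinner (blinfun_apply T (r u b)) (r v d) = G (u, b) (v, d) X)"
    using ampliate_exists[OF assms] by blast
  from someI_ex[OF this] show "Th X \<in> bop" "norm (Th X) \<le> norm X"
    "cinner (blinfun_apply (Th X) (r u b)) (r v d) = G (u, b) (v, d) X"
    by (simp_all add: Th_def assms)
qed

lemma Th_tvec: "X \<in> V \<Longrightarrow> cinner (blinfun_apply (Th X) (tvec r l)) (tvec r l') = B X l l'"
proof (induction l)
  case (Cons p l)
  have "cinner (blinfun_apply (Th X) (r (fst p) (snd p))) (tvec r l') = (\<Sum>q\<leftarrow>l'. G p q X)"
    by (induction l') (simp_all add: cinner_add_right cinner_Th Cons)
  then show ?case using Cons by (simp add: B_def cinner_add_left blinfun.add_right)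
qed (simp add: B_def)

lemma Th_add: "X \<in> V \<Longrightarrow> Y \<in> V \<Longrightarrow> Th (X + Y) = Th X + Th Y"
  by (rule R.tensor_bop_eqI)
    (simp add: cinner_Th vna_add[OF V] blinfun.add_left cinner_add_left
      functional_on_add[OF predual_functional_on[OF V G_predual]])

lemma Th_scale: "X \<in> V \<Longrightarrow> Th (op_scale c X) = op_scale c (Th X)"
  by (rule R.tensor_bop_eqI)
    (simp add: cinner_Th vna_op_scale[OF V] blinfun_apply_op_scale cinner_scaleC_left
      functional_on_op_scale[OF predual_functional_on[OF V G_predual]])

lemma Th_op:
  assumes "x \<in> M" "y \<in> N"
  shows "Th (op_tensor s x y) = op_tensor r (\<Phi> x) y"
  by (rule R.tensor_bop_eqI) (simp add: cinner_Th S.op_tensor_in[OF M N] assms G_op)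

text \<open>For finite sums of elementary tensors the coefficient is \<open>B\<close>, hence normal.
  General vectors are norm limits of these, the coefficients converge uniformly on bounded sets, and
  \<open>predual_closed\<close> applies.\<close>

lemma Th_vec_predual: "(\<lambda>X. if X \<in> V then cinner (blinfun_apply (Th X) \<zeta>) \<theta> else 0) \<in> predual V"
proof (rule predual_closed[OF V])
  fix e :: real assume e: "0 < e"
  have "\<exists>u. (\<forall>n::nat. u n \<in> range (tvec r)) \<and> u \<longlonglongrightarrow> x" for x
    using R.tvec_dense closure_sequential[of x "range (tvec r)"] by auto
  then obtain u w where u: "\<And>n::nat. u n \<in> range (tvec r)" "u \<longlonglongrightarrow> \<zeta>" and w: "\<And>n::nat. w n \<in> range (tvec r)" "w \<longlonglongrightarrow> \<theta>"
    by metis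
  have "(\<lambda>n. norm (\<zeta> - u n) * norm \<theta> + norm (u n) * norm (\<theta> - w n)) \<longlonglongrightarrow> norm (\<zeta> - \<zeta>) * norm \<theta> + norm \<zeta> * norm (\<theta> - \<theta>)"
    by (intro tendsto_intros u w)
  then have "eventually (\<lambda>n. norm (\<zeta> - u n) * norm \<theta> + norm (u n) * norm (\<theta> - w n) < e) sequentially"
    using e by (intro order_tendstoD(2)) auto
  then obtain n where n: "norm (\<zeta> - u n) * norm \<theta> + norm (u n) * norm (\<theta> - w n) < e"
    by (auto simp: eventually_sequentially)
  obtain l l' where l: "u n = tvec r l" "w n = tvec r l'" using u(1)[of n] w(1)[of n] by blast
  show "\<exists>g\<in>predual V. \<forall>X\<in>V. cmod ((if X \<in> V then cinner (blinfun_apply (Th X) \<zeta>) \<theta> else 0) - g X) \<le> e * norm X"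
  proof (intro bexI[OF _ B_predual] ballI)
    fix X assume X: "X \<in> V"
    have eq: "cinner (blinfun_apply (Th X) \<zeta>) \<theta> - B X l l' =
        cinner (blinfun_apply (Th X) (\<zeta> - u n)) \<theta> + cinner (blinfun_apply (Th X) (u n)) (\<theta> - w n)"
      by (simp add: Th_tvec[OF X, symmetric] l cinner_diff_left cinner_diff_right blinfun.diff_right)
    have est: "cmod (cinner (blinfun_apply (Th X) a) b) \<le> norm X * (norm a * norm b)" for a b
    proof -
      have "cmod (cinner (blinfun_apply (Th X) a) b) \<le> norm (blinfun_apply (Th X) a) * norm b" by (rule cauchy_schwarz)
      also have "\<dots> \<le> (norm (Th X) * norm a) * norm b" by (intro mult_right_mono norm_blinfun) simp
      also have "\<dots> \<le> (norm X * norm a) * norm b" by (intro mult_right_mono norm_Th X) auto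
      finally show ?thesis by (simp add: mult.assoc)
    qed
    have "cmod (cinner (blinfun_apply (Th X) \<zeta>) \<theta> - B X l l') \<le>
        norm X * (norm (\<zeta> - u n) * norm \<theta>) + norm X * (norm (u n) * norm (\<theta> - w n))"
      unfolding eq by (rule order_trans[OF norm_triangle_ineq add_mono[OF est est]])
    also have "\<dots> = norm X * (norm (\<zeta> - u n) * norm \<theta> + norm (u n) * norm (\<theta> - w n))" by (simp add: distrib_left)
    also have "\<dots> \<le> norm X * e" using n by (intro mult_left_mono) auto
    finally show "cmod ((if X \<in> V then cinner (blinfun_apply (Th X) \<zeta>) \<theta> else 0) - B X l l') \<le> e * norm X"
      using X by (simp add: mult.commute)
  qed
qed simp

text \<open>Commutation with A is an equality of two normal functionals of X, so it need only be
  checked on elementary tensors, where the value of \<open>Th\<close> is known.\<close>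

lemma Th_in: 
  assumes X: "X \<in> V"
  shows "Th X \<in> Q"
proof (rule vnaI_commutant[OF Q Th_bop[OF X]])
  fix A \<zeta> assume A: "A \<in> commutant Q"
  have Ab: "A \<in> bop" using A commutant_sub_bop by blast
  show "blinfun_apply (Th X) (blinfun_apply A \<zeta>) = blinfun_apply A (blinfun_apply (Th X) \<zeta>)"
  proof (rule cinner_ext)
    fix \<theta>
    have "(\<lambda>X. if X \<in> V then cinner (blinfun_apply (Th X) (blinfun_apply A \<zeta>)) \<theta> else 0)
        = (\<lambda>X. if X \<in> V then cinner (blinfun_apply (Th X) \<zeta>) (blinfun_apply (adj A) \<theta>) else 0)"
    proof (rule S.predual_tensor_eqI[OF M N Th_vec_predual Th_vec_predual])
      fix x y assume xy: "x \<in> M" "y \<in> N"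
      have "op_tensor r (\<Phi> x) y \<in> Q" by (intro R.op_tensor_in P N Phi_in xy)
      then have "cinner (blinfun_apply (op_tensor r (\<Phi> x) y) (blinfun_apply A \<zeta>)) \<theta>
          = cinner (blinfun_apply (op_tensor r (\<Phi> x) y) \<zeta>) (blinfun_apply (adj A) \<theta>)"
        by (simp add: cinner_adj_right[OF Ab] commutantD_apply[OF A])
      then show "(if op_tensor s x y \<in> V then cinner (blinfun_apply (Th (op_tensor s x y)) (blinfun_apply A \<zeta>)) \<theta> else 0)
          = (if op_tensor s x y \<in> V then cinner (blinfun_apply (Th (op_tensor s x y)) \<zeta>) (blinfun_apply (adj A) \<theta>) else 0)"
        by (simp add: Th_op xy)
    qed
    from fun_cong[OF this, of X]
    show "cinner (blinfun_apply (Th X) (blinfun_apply A \<zeta>)) \<theta> = cinner (blinfun_apply A (blinfun_apply (Th X) \<zeta>)) \<theta>"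
      using X by (simp add: cinner_adj_right[OF Ab])
  qed
qed

text \<open>Cutting off the representing vectors of f leaves finitely many vector functionals of
  \<open>Th X\<close>, normal by \<open>Th_vec_predual\<close>, and an error controlled by the
  tails.\<close>

lemma Th_predual:
  assumes f: "f \<in> predual Q"
  shows "(\<lambda>X. if X \<in> V then f (Th X) else 0) \<in> predual V"
proof (rule predual_closed[OF V])
  obtain \<xi> \<eta> where rep: "\<And>x. x \<in> Q \<Longrightarrow> f x = cinner (blinfun_apply (amp x) \<xi>) \<eta>"
    using f by (rule predualE) auto
  fix e :: real assume e: "0 < e"
  have "(\<lambda>n. norm (trunc n \<xi>) * norm (trunc n \<eta>)) \<longlonglongrightarrow> 0 * 0" by (intro tendsto_mult norm_trunc)
  then have "eventually (\<lambda>n. norm (trunc n \<xi>) * norm (trunc n \<eta>) < e) sequentially"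
    using e by (intro order_tendstoD(2)) auto
  then obtain n where n: "norm (trunc n \<xi>) * norm (trunc n \<eta>) < e" by (auto simp: eventually_sequentially)
  let ?g = "\<lambda>X. \<Sum>j<n. (if X \<in> V then cinner (blinfun_apply (Th X) (ell2_nth \<xi> j)) (ell2_nth \<eta> j) else 0)"
  show "\<exists>g\<in>predual V. \<forall>X\<in>V. cmod ((if X \<in> V then f (Th X) else 0) - g X) \<le> e * norm X"
  proof (intro bexI[of _ ?g] ballI)
    show "?g \<in> predual V" by (rule predual_sum[OF Th_vec_predual])
    fix X assume X: "X \<in> V"
    have "f (Th X) = blinfun_apply (tf \<xi> \<eta>) (Th X)" using rep[OF Th_in[OF X]] by simp
    also have "\<dots> = ?g X + cinner (blinfun_apply (amp (Th X)) (trunc n \<xi>)) (trunc n \<eta>)"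
      using X by (subst tf_trunc[of \<xi> \<eta> n]) (simp add: blinfun.add_left blinfun.sum_left amp_incl cinner_incl_left)
    finally have "cmod (f (Th X) - ?g X) = cmod (cinner (blinfun_apply (amp (Th X)) (trunc n \<xi>)) (trunc n \<eta>))"
      by simp
    also have "\<dots> \<le> norm (blinfun_apply (amp (Th X)) (trunc n \<xi>)) * norm (trunc n \<eta>)" by (rule cauchy_schwarz)
    also have "\<dots> \<le> (norm X * norm (trunc n \<xi>)) * norm (trunc n \<eta>)"
      by (intro mult_right_mono order_trans[OF norm_amp_le] norm_Th X) auto
    also have "\<dots> \<le> norm X * e" using n by (simp add: mult.assoc mult_left_mono)
    finally show "cmod ((if X \<in> V then f (Th X) else 0) - ?g X) \<le> e * norm X"
      using X by (simp add: mult.commute)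
  qed
qed simp

lemma Th_normal: "normal_linear_map V Q Th"
  unfolding normal_linear_map_def using Th_in Th_add Th_scale Th_predual by blast

lemma hom_tensor_eq: "hom_tensor s M N r P N \<Phi> (\<lambda>y. y) = Th"
  unfolding hom_tensor_def
proof (rule the_equality)
  show "normal_linear_map V Q Th \<and> (\<forall>X. X \<notin> V \<longrightarrow> Th X = 0) \<and>
      (\<forall>x\<in>M. \<forall>y\<in>N. Th (op_tensor s x y) = op_tensor r (\<Phi> x) y)"
    using Th_normal Th_op by (simp add: Th_def)
  fix T assume T: "normal_linear_map V Q T \<and> (\<forall>X. X \<notin> V \<longrightarrow> T X = 0) \<and>
      (\<forall>x\<in>M. \<forall>y\<in>N. T (op_tensor s x y) = op_tensor r (\<Phi> x) y)"
  then have Tn: "normal_linear_map V Q T" by blast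
  show "T = Th"
  proof
    fix X
    show "T X = Th X"
    proof (cases "X \<in> V")
      case True
      show ?thesis
      proof (rule predual_separates[OF normal_linear_mapD(1)[OF Tn True] Th_in[OF True]])
        fix f assume f: "f \<in> predual Q"
        have "(\<lambda>X. if X \<in> V then f (T X) else 0) = (\<lambda>X. if X \<in> V then f (Th X) else 0)"
          by (rule S.predual_tensor_eqI[OF M N normal_linear_mapD(4)[OF Tn f] Th_predual[OF f]])
            (use T in \<open>simp add: Th_op\<close>)
        from fun_cong[OF this, of X] show "f (T X) = f (Th X)" using True by simp
      qed
    qed (use T in \<open>simp add: Th_def\<close>)
  qed
qed

end

lemma hom_tensor_flip:
  "hom_tensor (\<lambda>b a. s a b) N M (\<lambda>b a. r a b) Q P \<Psi> \<Phi> = hom_tensor s M N r P Q \<Phi> \<Psi>"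
proof -
  have "(\<forall>x\<in>N. \<forall>y\<in>M. T (op_tensor s y x) = op_tensor r (\<Phi> y) (\<Psi> x)) \<longleftrightarrow>
      (\<forall>x\<in>M. \<forall>y\<in>N. T (op_tensor s x y) = op_tensor r (\<Phi> x) (\<Psi> y))" for T
  proof
    assume "\<forall>x\<in>N. \<forall>y\<in>M. T (op_tensor s y x) = op_tensor r (\<Phi> y) (\<Psi> x)"
    then show "\<forall>x\<in>M. \<forall>y\<in>N. T (op_tensor s x y) = op_tensor r (\<Phi> x) (\<Psi> y)" by (intro ballI) simp
  next
    assume "\<forall>x\<in>M. \<forall>y\<in>N. T (op_tensor s x y) = op_tensor r (\<Phi> x) (\<Psi> y)"
    then show "\<forall>x\<in>N. \<forall>y\<in>M. T (op_tensor s y x) = op_tensor r (\<Phi> y) (\<Psi> x)" by (intro ballI) simp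
  qed
  then show ?thesis
    unfolding hom_tensor_def vn_tensor_flip[of s] vn_tensor_flip[of r] op_tensor_flip[of s] op_tensor_flip[of r]
    by (simp only:)
qed

section \<open>The convolution product of a Hopf--von Neumann algebra\<close>

locale hopf_vna =
  fixes t :: "'a::chilbert_space \<Rightarrow> 'a \<Rightarrow> 'c::chilbert_space"
    and tL :: "'c \<Rightarrow> 'a \<Rightarrow> 'd::chilbert_space" and tR :: "'a \<Rightarrow> 'c \<Rightarrow> 'd"
    and M :: "('a \<Rightarrow>\<^sub>L 'a) set" and \<Delta> :: "('a \<Rightarrow>\<^sub>L 'a) \<Rightarrow> ('c \<Rightarrow>\<^sub>L 'c)"
  assumes hopf: "hopf_von_neumann_algebra t tL tR M \<Delta>"
begin

sublocale hilbert_tensor_product t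
  using hopf by unfold_locales (simp add: hopf_von_neumann_algebra_def triple_tensor_def)
sublocale L: hilbert_tensor_product tL
  using hopf by unfold_locales (simp add: hopf_von_neumann_algebra_def triple_tensor_def)
sublocale R: hilbert_tensor_product tR
  using hopf by unfold_locales (simp add: hopf_von_neumann_algebra_def triple_tensor_def)

lemma M: "vna M" using hopf by (simp add: hopf_von_neumann_algebra_def vna_von_neumann_algebra)

abbreviation MM where "MM \<equiv> vn_tensor t M M"
lemma MM: "vna MM" by (rule vn_tensor_vna[OF M M])

lemma Delta_hom: "normal_star_hom M MM \<Delta>" and Delta_one: "\<Delta> id_blinfun = id_blinfun"
  and triple: "tL (t a b) c = tR a (t b c)"
  and coassoc: "x \<in> M \<Longrightarrow> hom_tensor t M M tL MM M \<Delta> (\<lambda>y. y) (\<Delta> x) = hom_tensor t M M tR M MM (\<lambda>y. y) \<Delta> (\<Delta> x)"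
  using hopf by (simp_all add: hopf_von_neumann_algebra_def triple_tensor_def)

lemma Delta_lin: "normal_linear_map M MM \<Delta>" using Delta_hom by (simp add: normal_star_hom_def)
lemmas Delta_in = normal_linear_mapD(1)[OF Delta_lin]

lemma norm_Delta: "x \<in> M \<Longrightarrow> norm (\<Delta> x) \<le> norm x"
  using Delta_hom
  by (intro star_hom_contractive[OF M, of \<Delta>])
    (auto simp: normal_star_hom_def Delta_one intro: vna_bop[OF MM Delta_in] normal_linear_mapD[OF Delta_lin])

abbreviation ft where "ft \<equiv> functional_tensor t M M"

definition conv where "conv f g = (\<lambda>x. if x \<in> M then ft f g (\<Delta> x) else 0)"

lemma conv_predual: "f \<in> predual M \<Longrightarrow> g \<in> predual M \<Longrightarrow> conv f g \<in> predual M"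
  unfolding conv_def by (intro normal_linear_mapD(4)[OF Delta_lin] functional_tensor_predual M)

lemma conv_apply: "x \<in> M \<Longrightarrow> conv f g x = ft f g (\<Delta> x)"
  by (simp add: conv_def)

text \<open>Both sides are the same triple sum, bracketed differently: ((i, j), k) against (i, (j,
  k)). The two threefold tensor products are not identified as sets; instead Y is taken from
  both.\<close>

lemma ft_triple:
  assumes f: "f \<in> predual M" and g: "g \<in> predual M" and h: "h \<in> predual M"
    and Y: "Y \<in> vn_tensor tL MM M" "Y \<in> vn_tensor tR M MM"
  shows "functional_tensor tL MM M (ft f g) h Y = functional_tensor tR M MM f (ft g h) Y"
proof -
  obtain \<xi> \<eta> :: "nat \<Rightarrow> 'a" where 1: "normal_rep M f \<xi> \<eta>" using f by (rule predual_normal_rep)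
  obtain \<xi>' \<eta>' :: "nat \<Rightarrow> 'a" where 2: "normal_rep M g \<xi>' \<eta>'" using g by (rule predual_normal_rep)
  obtain \<xi>'' \<eta>'' :: "nat \<Rightarrow> 'a" where 3: "normal_rep M h \<xi>'' \<eta>''" using h by (rule predual_normal_rep)
  let ?F = "\<lambda>p. cinner (blinfun_apply Y (tL (t (\<xi> (fst (fst p))) (\<xi>' (snd (fst p)))) (\<xi>'' (snd p))))
      (tL (t (\<eta> (fst (fst p))) (\<eta>' (snd (fst p)))) (\<eta>'' (snd p)))"
  have "functional_tensor tL MM M (ft f g) h Y = infsum ?F UNIV"
    using L.normal_rep_tensor[OF MM M normal_rep_tensor[OF M M 1 2] 3] Y(1)
    unfolding normal_rep_def by (simp add: case_prod_beta)
  also have "\<dots> = infsum (\<lambda>p. ?F ((fst p, fst (snd p)), snd (snd p))) UNIV"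
    by (rule infsum_reindex_bij_betw[of "\<lambda>p. ((fst p, fst (snd p)), snd (snd p))" UNIV UNIV ?F, symmetric])
      (auto simp: bij_betw_def inj_on_def image_iff)
  also have "\<dots> = functional_tensor tR M MM f (ft g h) Y"
    using R.normal_rep_tensor[OF M MM 1 normal_rep_tensor[OF M M 2 3]] Y(2)
    unfolding normal_rep_def by (simp add: case_prod_beta triple)
  finally show ?thesis .
qed

text \<open>Tensoring \<open>conv f g\<close> with h is the triple functional composed with the
  ampliation of \<Delta> in the first factor, and symmetrically on the other side; elementary
  tensors decide this. Coassociativity equates the two ampliations at \<Delta> x.\<close>

lemma conv_assoc:
  assumes f: "f \<in> predual M" and g: "g \<in> predual M" and h: "h \<in> predual M"
  shows "conv (conv f g) h = conv f (conv g h)"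
proof
  fix x
  interpret LA: ampliation t tL M M MM \<Delta>
    by unfold_locales (rule M MM Delta_hom)+
  interpret tf': hilbert_tensor_product "\<lambda>b a. t a b"
    by unfold_locales (rule hilbert_tensor_flip[OF tensor])
  interpret RA: ampliation "\<lambda>b a. t a b" "\<lambda>b a. tR a b" M M MM \<Delta>
    by unfold_locales (rule M MM Delta_hom hilbert_tensor_flip[OF tensor] hilbert_tensor_flip[OF R.tensor])+
  note flips = vn_tensor_flip[of t] vn_tensor_flip[of tR] op_tensor_flip[of t] op_tensor_flip[of tR]
  show "conv (conv f g) h x = conv f (conv g h) x"
  proof (cases "x \<in> M")
    case True
    let ?GL = "functional_tensor tL MM M (ft f g) h" and ?GR = "functional_tensor tR M MM f (ft g h)"
    have fg: "ft f g \<in> predual MM" "ft g h \<in> predual MM" by (intro functional_tensor_predual M f g h)+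
    have GL: "?GL \<in> predual (vn_tensor tL MM M)" by (intro L.functional_tensor_predual MM M fg h)
    have GR: "?GR \<in> predual (vn_tensor tR M MM)" by (intro R.functional_tensor_predual MM M fg f)
    have 1: "ft (conv f g) h = (\<lambda>X. if X \<in> MM then ?GL (LA.Th X) else 0)"
      by (rule functional_tensor_eqI[OF M M conv_predual[OF f g] h LA.Th_predual[OF GL]])
        (simp add: LA.Th_op op_tensor_in[OF M M] L.functional_tensor_op[OF MM M fg(1) h] Delta_in conv_apply)
    have 2: "ft f (conv g h) = (\<lambda>X. if X \<in> MM then ?GR (RA.Th X) else 0)"
    proof (rule functional_tensor_eqI[OF M M f conv_predual[OF g h]])
      show "(\<lambda>X. if X \<in> MM then ?GR (RA.Th X) else 0) \<in> predual MM"
        using RA.Th_predual[of ?GR] GR by (simp only: flips)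
      show "(if op_tensor t y z \<in> MM then ?GR (RA.Th (op_tensor t y z)) else 0) = f y * conv g h z"
        if "y \<in> M" "z \<in> M" for y z
        using that RA.Th_op[of z y]
        by (simp add: flips op_tensor_in[OF M M] R.functional_tensor_op[OF M MM f fg(2)] Delta_in conv_apply)
    qed
    have D: "\<Delta> x \<in> MM" by (rule Delta_in[OF True])
    have eq: "LA.Th (\<Delta> x) = RA.Th (\<Delta> x)"
      using coassoc[OF True] unfolding LA.hom_tensor_eq hom_tensor_flip[where s = t and r = tR, symmetric] RA.hom_tensor_eq .
    \<comment> \<open>Equality of the two images places this element in both threefold tensor
      products.\<close>
    have "LA.Th (\<Delta> x) \<in> vn_tensor tR M MM"
      unfolding eq using RA.Th_in[of "\<Delta> x"] D by (simp only: flips)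
    then have "?GL (LA.Th (\<Delta> x)) = ?GR (RA.Th (\<Delta> x))"
      using ft_triple[OF f g h LA.Th_in[OF D]] by (simp add: eq)
    then show ?thesis using True D by (simp add: conv_apply 1 2)
  qed (simp add: conv_def)
qed

end

section \<open>Module actions\<close>

context hopf_vna
begin

lemma flip_tensor: "hilbert_tensor_product (\<lambda>b a. t a b)"
  by unfold_locales (rule hilbert_tensor_flip[OF tensor])

text \<open>The action \<open>F \<mapsto> a \<cdot> F\<close>, or \<open>F \<mapsto> F \<cdot> a\<close> if the flag is set; the two cases of the theorem
  are mirror images of each other.\<close>

definition act :: "bool \<Rightarrow> (('a \<Rightarrow>\<^sub>L 'a) \<Rightarrow> complex) \<Rightarrow> ('a \<Rightarrow>\<^sub>L 'a) \<Rightarrow> ('a \<Rightarrow>\<^sub>L 'a)"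
  where "act sw a F = (if sw then slice_left t M M a (\<Delta> F) else slice_right t M M a (\<Delta> F))"

lemma act_flip: "act True a F = slice_right (\<lambda>b a. t a b) M M a (\<Delta> F)"
  by (simp add: act_def slice_flip[of t])

text \<open>Pairing with normal functionals turns either action into a convolution. As these
  functionals separate points, the algebraic laws of the actions follow from those of
  \<open>conv\<close>.\<close>

lemma act_spec:
  assumes a: "a \<in> predual M" and F: "F \<in> M"
  shows act_in: "act sw a F \<in> M"
    and norm_act: "norm (act sw a F) \<le> functional_norm M a * norm F"
    and act_pair: "f \<in> predual M \<Longrightarrow> f (act sw a F) = (if sw then conv a f F else conv f a F)"
proof -
  interpret flip: hilbert_tensor_product "\<lambda>b a. t a b" by (rule flip_tensor)
  have D: "\<Delta> F \<in> MM" by (rule Delta_in[OF F])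
  have D': "\<Delta> F \<in> vn_tensor (\<lambda>b a. t a b) M M" using D by (simp only: vn_tensor_flip[of t])
  have n: "functional_norm M a * norm (\<Delta> F) \<le> functional_norm M a * norm F"
    by (intro mult_left_mono norm_Delta F functional_norm_nonneg[OF M predual_bounded_functional[OF M a]])
  note r = slice_right_in[OF M M a D] norm_slice_right[OF M M a D] slice_right_functional[OF M M a D]
  note l = flip.slice_right_in[OF M M a D'] flip.norm_slice_right[OF M M a D'] flip.slice_right_functional[OF M M a D']
  show "act sw a F \<in> M"
    using r(1) l(1) by (cases sw) (simp_all only: act_flip, simp add: act_def)
  show "norm (act sw a F) \<le> functional_norm M a * norm F"
    using order_trans[OF r(2) n] order_trans[OF l(2) n]
    by (cases sw) (simp_all only: act_flip, simp add: act_def)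
  show "f \<in> predual M \<Longrightarrow> f (act sw a F) = (if sw then conv a f F else conv f a F)"
    using r(3)[of f] l(3)[of f]
    by (cases sw) (simp_all only: act_flip functional_tensor_flip[of t], simp_all add: act_def conv_apply F)
qed

lemma conv_add_left: "f \<in> predual M \<Longrightarrow> f' \<in> predual M \<Longrightarrow> g \<in> predual M \<Longrightarrow>
    conv (\<lambda>x. f x + f' x) g = (\<lambda>x. conv f g x + conv f' g x)"
  and conv_add_right: "f \<in> predual M \<Longrightarrow> g \<in> predual M \<Longrightarrow> g' \<in> predual M \<Longrightarrow>
    conv f (\<lambda>x. g x + g' x) = (\<lambda>x. conv f g x + conv f g' x)"
  and conv_scale_left: "f \<in> predual M \<Longrightarrow> g \<in> predual M \<Longrightarrow> conv (\<lambda>x. c * f x) g = (\<lambda>x. c * conv f g x)"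
  and conv_scale_right: "f \<in> predual M \<Longrightarrow> g \<in> predual M \<Longrightarrow> conv f (\<lambda>x. c * g x) = (\<lambda>x. c * conv f g x)"
proof -
  assume f: "f \<in> predual M" and f': "f' \<in> predual M" and g: "g \<in> predual M"
  have "ft (\<lambda>x. f x + f' x) g = (\<lambda>x. ft f g x + ft f' g x)"
    by (rule functional_tensor_eqI[OF M M])
      (simp_all add: predual_add functional_tensor_predual functional_tensor_op M f f' g algebra_simps)
  then show "conv (\<lambda>x. f x + f' x) g = (\<lambda>x. conv f g x + conv f' g x)" by (auto simp: conv_def)
next
  assume f: "f \<in> predual M" and g: "g \<in> predual M" and g': "g' \<in> predual M"
  have "ft f (\<lambda>x. g x + g' x) = (\<lambda>x. ft f g x + ft f g' x)"
    by (rule functional_tensor_eqI[OF M M])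
      (simp_all add: predual_add functional_tensor_predual functional_tensor_op M f g g' algebra_simps)
  then show "conv f (\<lambda>x. g x + g' x) = (\<lambda>x. conv f g x + conv f g' x)" by (auto simp: conv_def)
next
  assume f: "f \<in> predual M" and g: "g \<in> predual M"
  have "ft (\<lambda>x. c * f x) g = (\<lambda>x. c * ft f g x)" "ft f (\<lambda>x. c * g x) = (\<lambda>x. c * ft f g x)"
    by (rule functional_tensor_eqI[OF M M];
      simp add: predual_scale functional_tensor_predual functional_tensor_op M f g)+
  then show "conv (\<lambda>x. c * f x) g = (\<lambda>x. c * conv f g x)" "conv f (\<lambda>x. c * g x) = (\<lambda>x. c * conv f g x)"
    by (auto simp: conv_def)
qed

lemma conv_bound: "f \<in> predual M \<Longrightarrow> g \<in> predual M \<Longrightarrow> x \<in> M \<Longrightarrow>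
    cmod (conv f g x) \<le> functional_norm M f * functional_norm M g * norm x"
proof -
  assume f: "f \<in> predual M" and g: "g \<in> predual M" and x: "x \<in> M"
  note nn = functional_norm_nonneg[OF M predual_bounded_functional[OF M]]
  have "cmod (conv f g x) \<le> functional_norm M f * functional_norm M g * norm (\<Delta> x)"
    unfolding conv_apply[OF x] by (rule functional_tensor_bound[OF M M f g Delta_in[OF x]])
  also have "\<dots> \<le> functional_norm M f * functional_norm M g * norm x"
    by (intro mult_left_mono norm_Delta x mult_nonneg_nonneg nn f g)
  finally show "cmod (conv f g x) \<le> functional_norm M f * functional_norm M g * norm x" .
qed

lemma norm_conv: "f \<in> predual M \<Longrightarrow> g \<in> predual M \<Longrightarrow>
    functional_norm M (conv f g) \<le> functional_norm M f * functional_norm M g"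
  using conv_bound functional_norm_nonneg[OF M predual_bounded_functional[OF M]]
  by (intro functional_norm_leI'[OF M]) auto

lemma conv_one: "f \<in> predual M \<Longrightarrow> g \<in> predual M \<Longrightarrow> conv f g id_blinfun = f id_blinfun * g id_blinfun"
  using functional_tensor_op[OF M M, of f g id_blinfun id_blinfun]
  by (simp add: conv_apply vna_id[OF M] Delta_one op_tensor_id)

lemma act_add:
  assumes "a \<in> predual M" "x \<in> M" "y \<in> M"
  shows "act sw a (x + y) = act sw a x + act sw a y"
proof (rule predual_separates[OF act_in vna_add[OF M]])
  fix f assume f: "f \<in> predual M"
  note cf = predual_functional_on[OF M conv_predual] and ff = predual_functional_on[OF M f]
  show "f (act sw a (x + y)) = f (act sw a x + act sw a y)"
    using assms f
    by (simp add: act_pair vna_add[OF M] act_in functional_on_add[OF ff] functional_on_add[OF cf])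
qed (use assms in \<open>simp_all add: vna_add[OF M] act_in\<close>)

lemma act_scale:
  assumes "a \<in> predual M" "x \<in> M"
  shows "act sw a (op_scale c x) = op_scale c (act sw a x)"
proof (rule predual_separates[OF act_in vna_op_scale[OF M]])
  fix f assume f: "f \<in> predual M"
  note cf = predual_functional_on[OF M conv_predual] and ff = predual_functional_on[OF M f]
  show "f (act sw a (op_scale c x)) = f (op_scale c (act sw a x))"
    using assms f
    by (simp add: act_pair vna_op_scale[OF M] act_in functional_on_op_scale[OF ff] functional_on_op_scale[OF cf])
qed (use assms in \<open>simp_all add: vna_op_scale[OF M] act_in\<close>)

lemma act_add_left:
  assumes "a \<in> predual M" "b \<in> predual M" "x \<in> M"
  shows "act sw (\<lambda>F. a F + b F) x = act sw a x + act sw b x"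
proof (rule predual_separates[OF act_in vna_add[OF M]])
  fix f assume f: "f \<in> predual M"
  show "f (act sw (\<lambda>F. a F + b F) x) = f (act sw a x + act sw b x)"
    using assms f
    by (simp add: act_pair predual_add act_in functional_on_add[OF predual_functional_on[OF M f]]
        conv_add_left conv_add_right)
qed (use assms in \<open>simp_all add: predual_add act_in\<close>)

lemma act_scale_left:
  assumes "a \<in> predual M" "x \<in> M"
  shows "act sw (\<lambda>F. c * a F) x = op_scale c (act sw a x)"
proof (rule predual_separates[OF act_in vna_op_scale[OF M]])
  fix f assume f: "f \<in> predual M"
  show "f (act sw (\<lambda>F. c * a F) x) = f (op_scale c (act sw a x))"
    using assms f
    by (simp add: act_pair predual_scale act_in functional_on_op_scale[OF predual_functional_on[OF M f]]
        conv_scale_left conv_scale_right)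
qed (use assms in \<open>simp_all add: predual_scale act_in\<close>)

lemma act_one:
  assumes "a \<in> predual M"
  shows "act sw a id_blinfun = op_scale (a id_blinfun) id_blinfun"
proof (rule predual_separates[OF act_in vna_op_scale[OF M]])
  fix f assume f: "f \<in> predual M"
  show "f (act sw a id_blinfun) = f (op_scale (a id_blinfun) id_blinfun)"
    using assms f
    by (simp add: act_pair vna_id[OF M] functional_on_op_scale[OF predual_functional_on[OF M f]] conv_one)
qed (use assms in \<open>simp_all add: vna_id[OF M]\<close>)

lemma act_conv:
  assumes "a \<in> predual M" "b \<in> predual M" "F \<in> M"
  shows "act sw (conv a b) F = (if sw then act sw b (act sw a F) else act sw a (act sw b F))"
proof (rule predual_separates[where M = M])
  fix f assume f: "f \<in> predual M"
  show "f (act sw (conv a b) F) = f (if sw then act sw b (act sw a F) else act sw a (act sw b F))"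
    using assms f by (simp add: act_pair act_in conv_predual conv_assoc)
qed (use assms in \<open>simp_all add: conv_predual act_in\<close>)

end

section \<open>From an asymptotically invariant net of functionals to an invariant mean\<close>

text \<open>The inverse of the automorphism is again a unital *-homomorphism and therefore
  contractive, so a contraction has a contraction as preimage.\<close>

lemma normal_star_automorphismD:
  assumes M: "vna M" and \<sigma>: "normal_star_automorphism M \<sigma>" and x: "x \<in> M"
  shows "\<exists>y\<in>M. \<sigma> y = x \<and> norm y \<le> norm x"
proof -
  have bij: "bij_betw \<sigma> M M" and hom: "normal_star_hom M M \<sigma>" using \<sigma> by (auto simp: normal_star_automorphism_def)
  have lin: "normal_linear_map M M \<sigma>" using hom by (simp add: normal_star_hom_def)
  have inj: "inj_on \<sigma> M" and onto: "\<sigma> ` M = M" using bij by (auto simp: bij_betw_def)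
  define \<tau> where "\<tau> = the_inv_into M \<sigma>"
  have \<tau>: "\<tau> x \<in> M" "\<sigma> (\<tau> x) = x" if "x \<in> M" for x
    using that inj onto the_inv_into_into[OF inj, of x M] f_the_inv_into_f[OF inj, of x] by (auto simp: \<tau>_def)
  have \<tau>\<sigma>: "\<tau> (\<sigma> x) = x" if "x \<in> M" for x using the_inv_into_f_f[OF inj that] by (simp add: \<tau>_def)
  note l = normal_linear_mapD[OF lin]
  have mult: "\<sigma> (x o\<^sub>L y) = \<sigma> x o\<^sub>L \<sigma> y" and ad: "\<sigma> (adj x) = adj (\<sigma> x)" if "x \<in> M" "y \<in> M" for x y
    using hom that by (simp_all add: normal_star_hom_def)
  have "norm (\<tau> x) \<le> norm x"
  proof (rule star_hom_contractive[OF M _ _ _ _ _ _ x])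
    show "\<tau> x \<in> bop" if "x \<in> M" for x using \<tau>(1)[OF that] by (rule vna_bop[OF M])
    show "\<tau> (x + y) = \<tau> x + \<tau> y" if "x \<in> M" "y \<in> M" for x y
      using \<tau>\<sigma>[of "\<tau> x + \<tau> y"] l(2)[of "\<tau> x" "\<tau> y"] \<tau> that by (simp add: vna_add[OF M])
    show "\<tau> (op_scale c x) = op_scale c (\<tau> x)" if "x \<in> M" for c x
      using \<tau>\<sigma>[of "op_scale c (\<tau> x)"] l(3)[of "\<tau> x" c] \<tau> that by (simp add: vna_op_scale[OF M])
    show m: "\<tau> (x o\<^sub>L y) = \<tau> x o\<^sub>L \<tau> y" if "x \<in> M" "y \<in> M" for x y
      using \<tau>\<sigma>[of "\<tau> x o\<^sub>L \<tau> y"] mult[of "\<tau> x" "\<tau> y"] \<tau> that by (simp add: vna_compose[OF M])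
    show "\<tau> (adj x) = adj (\<tau> x)" if "x \<in> M" for x
      using \<tau>\<sigma>[of "adj (\<tau> x)"] ad[of "\<tau> x" "\<tau> x"] \<tau> that by (simp add: vna_adj[OF M])
    \<comment> \<open>Multiplicativity of \<tau> at the product of
      \<open>\<sigma> id_blinfun\<close> and 1 says 1 = \<tau> 1.\<close>
    have "\<tau> (\<sigma> id_blinfun o\<^sub>L id_blinfun) = \<tau> (\<sigma> id_blinfun) o\<^sub>L \<tau> id_blinfun"
      using vna_id[OF M] l(1) by (intro m) auto
    then show "\<tau> id_blinfun = id_blinfun" using \<tau>\<sigma>[OF vna_id[OF M]] by simp
  qed
  then show ?thesis using \<tau> x by blast
qed

section \<open>Positivity, and functionals that almost attain their norm\<close>

lemma norm_add_scaled_id: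
  assumes F: "op_pos F" and z: "Re z \<le> 0"
  shows "(norm (F + op_scale z id_blinfun))\<^sup>2 \<le> (norm F)\<^sup>2 + (cmod z)\<^sup>2"
proof -
  define C where "C = sqrt ((norm F)\<^sup>2 + (cmod z)\<^sup>2)"
  have C: "0 \<le> C" "C\<^sup>2 = (norm F)\<^sup>2 + (cmod z)\<^sup>2" by (simp_all add: C_def)
  have "norm (F + op_scale z id_blinfun) \<le> C"
  proof (rule norm_blinfun_bound[OF C(1)])
    fix x
    have re: "Im (cinner (blinfun_apply F x) x) = 0" "0 \<le> Re (cinner (blinfun_apply F x) x)"
      using F by (auto simp: op_pos_def)
    have "Re (cinner (blinfun_apply F x) (z *\<^sub>C x)) = Re z * Re (cinner (blinfun_apply F x) x)"
      using re by (simp add: cinner_scaleC_right)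
    then have "(norm (blinfun_apply F x + z *\<^sub>C x))\<^sup>2 \<le> (norm (blinfun_apply F x))\<^sup>2 + (norm (z *\<^sub>C x))\<^sup>2"
      unfolding norm_add_sq using z re(2) by (simp add: mult_nonpos_nonneg)
    also have "\<dots> \<le> (norm F * norm x)\<^sup>2 + (cmod z * norm x)\<^sup>2"
      unfolding norm_scaleC by (intro add_mono power_mono norm_blinfun) auto
    also have "\<dots> = (C * norm x)\<^sup>2" by (simp add: power_mult_distrib C(2) distrib_right)
    finally have "norm (blinfun_apply F x + z *\<^sub>C x) \<le> C * norm x"
      by (rule power2_le_imp_le) (use C(1) in simp)
    then show "norm (blinfun_apply (F + op_scale z id_blinfun) x) \<le> C * norm x"
      by (simp add: blinfun.add_left blinfun_apply_op_scale)
  qed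
  then have "(norm (F + op_scale z id_blinfun))\<^sup>2 \<le> C\<^sup>2" by (intro power_mono) auto
  then show ?thesis by (simp only: C(2))
qed

lemma nonpos_if_multiples_bounded:
  fixes x K :: real
  assumes K: "0 \<le> K" and bd: "\<And>s. 0 \<le> s \<Longrightarrow> 2 * s * x \<le> K"
  shows "x \<le> 0"
proof (rule ccontr)
  assume "\<not> x \<le> 0"
  then have x: "0 < x" by simp
  have "2 * ((K + 1) / x) * x \<le> K" using x K by (intro bd) simp
  then have "2 * (K + 1) \<le> K" using x by simp
  then show False using K by simp
qed

text \<open>Contractivity at F + z, for z in the closed left half-plane, bounds the square of |f F +
  z| by norm F squared plus |z| squared. The quadratic terms in z cancel, and the linear term can
  stay bounded only if f F is real and nonnegative.\<close>

lemma unital_contractive_state: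
  assumes M: "vna M" and f: "functional_on M f" and bd: "\<And>x. x \<in> M \<Longrightarrow> cmod (f x) \<le> norm x"
    and one: "f id_blinfun = 1"
  shows "state_on M f"
proof -
  have "Im (f F) = 0 \<and> 0 \<le> Re (f F)" if "F \<in> pos_part M" for F
  proof -
    have F: "F \<in> M" "op_pos F" using that by (auto simp: pos_part_def)
    have key: "(cmod (f F + z))\<^sup>2 \<le> (norm F)\<^sup>2 + (cmod z)\<^sup>2" if z: "Re z \<le> 0" for z
    proof -
      have "f (F + op_scale z id_blinfun) = f F + z"
        using f F(1) M by (simp add: functional_on_add functional_on_op_scale vna_id vna_op_scale one)
      then have "cmod (f F + z) \<le> norm (F + op_scale z id_blinfun)"
        using bd[of "F + op_scale z id_blinfun"] F(1) M by (simp add: vna_add vna_op_scale vna_id)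
      then have "(cmod (f F + z))\<^sup>2 \<le> (norm (F + op_scale z id_blinfun))\<^sup>2" by (intro power_mono) auto
      then show ?thesis using norm_add_scaled_id[OF F(2) z] by linarith
    qed
    have zero: "x \<le> 0" if "\<And>s. 0 \<le> s \<Longrightarrow> 2 * s * x \<le> (norm F)\<^sup>2" for x :: real
      by (rule nonpos_if_multiples_bounded[OF _ that]) simp
    have sq: "(cmod (f F + z))\<^sup>2 = (Re (f F))\<^sup>2 + (Im (f F))\<^sup>2 + (cmod z)\<^sup>2 + 2 * (Re (f F) * Re z + Im (f F) * Im z)" for z
      unfolding cmod_power2 by (simp add: power2_eq_square algebra_simps)
    have lower: "0 \<le> (Re (f F))\<^sup>2 + (Im (f F))\<^sup>2" by simp
    \<comment> \<open>The values \<i> s, - \<i> s and - s of z, with s arbitrarily large, yield the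
      three sign conditions.\<close>
    have key': "2 * (Re (f F) * Re z + Im (f F) * Im z) \<le> (norm F)\<^sup>2" if "Re z \<le> 0" for z
      using key[OF that] lower unfolding sq by linarith
    have "Im (f F) \<le> 0"
      by (rule zero) (use key'[of "Complex 0 s" for s] in \<open>simp add: mult_ac\<close>)
    moreover have "- Im (f F) \<le> 0"
      by (rule zero) (use key'[of "Complex 0 (- s)" for s] in \<open>simp add: mult_ac\<close>)
    moreover have "- Re (f F) \<le> 0"
      by (rule zero) (use key'[of "Complex (- s) 0" for s] in \<open>simp add: mult_ac\<close>)
    ultimately show ?thesis by simp
  qed
  then show ?thesis using f bd one unfolding state_on_def pos_functional_def by (auto intro: exI[of _ 1])
qed

text \<open>If \<open>\<parallel>f\<parallel> = 1\<close> and \<open>f\<close> almost attains its norm at \<open>x\<close> and at \<open>y\<close>, then \<open>f (F x)\<close> and \<open>f (F y)\<close> almost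
  agree: by the parallelogram law the column with entries \<open>m = (x + y) / 2\<close> and \<open>z = (x - y) / 2\<close>
  is a contraction, so that \<open>\<parallel>m + s F z\<parallel>\<^sup>2 \<le> 1 + s\<^sup>2\<close>. This replaces the polar decomposition of \<open>f\<close>.\<close>

lemma norm_attaining_close:
  assumes M: "vna M" and f: "functional_on M f" and bd: "\<And>x. x \<in> M \<Longrightarrow> cmod (f x) \<le> norm x"
    and x: "x \<in> M" "norm x \<le> 1" "1 - e \<le> Re (f x)" and y: "y \<in> M" "norm y \<le> 1" "1 - e \<le> Re (f y)"
    and F: "F \<in> M" "norm F \<le> 1"
  shows "cmod (f (F o\<^sub>L x) - f (F o\<^sub>L y)) \<le> 2 * sqrt (2 * e)"
proof -
  define m where "m = (1/2) *\<^sub>R (x + y)"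
  define z where "z = (1/2) *\<^sub>R (x - y)"
  have mz: "m \<in> M" "z \<in> M" using x y M by (simp_all add: m_def z_def vna_scaleR vna_add vna_diff)
  have fm: "1 - e \<le> Re (f m)"
    using x y f M by (simp add: m_def functional_on_scaleR functional_on_add vna_add)
  define \<alpha> where "\<alpha> = cmod (f (F o\<^sub>L z))"
  obtain c where c: "cmod c = 1" "c * f (F o\<^sub>L z) = complex_of_real \<alpha>"
    using unimodular_factor[of "f (F o\<^sub>L z)"] by (auto simp: \<alpha>_def)
  \<comment> \<open>The scale of the perturbation is \<alpha> itself, and c rotates f (F z) to a
    nonnegative real, so that f w = \<alpha>^2.\<close>
  define w where "w = op_scale (of_real \<alpha> * c) (F o\<^sub>L z)"
  have w: "w \<in> M" using F mz M by (simp add: w_def vna_op_scale vna_compose)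
  have fw: "f w = of_real (\<alpha>\<^sup>2)"
    using F mz M c f by (simp add: w_def functional_on_op_scale vna_compose mult.assoc power2_eq_square)
  have "norm (m + w) \<le> sqrt (1 + \<alpha>\<^sup>2)"
  proof (rule norm_blinfun_bound)
    fix \<xi>
    let ?a = "norm (blinfun_apply m \<xi>)" and ?b = "norm (blinfun_apply z \<xi>)"
    have "?a\<^sup>2 + ?b\<^sup>2 = ((norm (blinfun_apply x \<xi>))\<^sup>2 + (norm (blinfun_apply y \<xi>))\<^sup>2) / 2"
      using parallelogram[of "blinfun_apply x \<xi>" "blinfun_apply y \<xi>"]
      by (simp add: m_def z_def blinfun.scaleR_left blinfun.add_left blinfun.diff_left power_mult_distrib power2_eq_square)
    also have "\<dots> \<le> ((norm \<xi>)\<^sup>2 + (norm \<xi>)\<^sup>2) / 2"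
    proof -
      have "norm (blinfun_apply x \<xi>) \<le> norm \<xi>" "norm (blinfun_apply y \<xi>) \<le> norm \<xi>"
        using order_trans[OF norm_blinfun mult_right_mono[OF x(2)], of \<xi>]
          order_trans[OF norm_blinfun mult_right_mono[OF y(2)], of \<xi>] by simp_all
      then show ?thesis by (intro divide_right_mono add_mono power_mono) auto
    qed
    finally have ab: "?a\<^sup>2 + ?b\<^sup>2 \<le> (norm \<xi>)\<^sup>2" by simp
    have "norm (blinfun_apply w \<xi>) \<le> \<alpha> * ?b"
    proof -
      have "norm (blinfun_apply F (blinfun_apply z \<xi>)) \<le> ?b"
        using order_trans[OF norm_blinfun mult_right_mono[OF F(2)], of "blinfun_apply z \<xi>"] by simp
      then show ?thesis
        by (simp add: w_def blinfun_apply_op_scale norm_scaleC norm_mult c \<alpha>_def mult_left_mono)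
    qed
    then have "norm (blinfun_apply (m + w) \<xi>) \<le> ?a + \<alpha> * ?b"
      using norm_triangle_ineq[of "blinfun_apply m \<xi>" "blinfun_apply w \<xi>"] by (simp add: blinfun.add_left)
    also have "\<dots> \<le> sqrt (1 + \<alpha>\<^sup>2) * norm \<xi>"
    proof (rule power2_le_imp_le)
      \<comment> \<open>Cauchy--Schwarz for (1, \<alpha>) and (?a, ?b), with the defect written as a
        square.\<close>
      have "(?a + \<alpha> * ?b)\<^sup>2 = (1 + \<alpha>\<^sup>2) * (?a\<^sup>2 + ?b\<^sup>2) - (\<alpha> * ?a - ?b)\<^sup>2"
        by (simp add: power2_eq_square algebra_simps)
      also have "\<dots> \<le> (1 + \<alpha>\<^sup>2) * (?a\<^sup>2 + ?b\<^sup>2)" by simp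
      also have "\<dots> \<le> (1 + \<alpha>\<^sup>2) * (norm \<xi>)\<^sup>2" by (rule mult_left_mono[OF ab]) simp
      finally show "(?a + \<alpha> * ?b)\<^sup>2 \<le> (sqrt (1 + \<alpha>\<^sup>2) * norm \<xi>)\<^sup>2" by (simp add: power_mult_distrib)
    qed simp
    finally show "norm (blinfun_apply (m + w) \<xi>) \<le> sqrt (1 + \<alpha>\<^sup>2) * norm \<xi>" .
  qed simp
  moreover have "Re (f m) + \<alpha>\<^sup>2 \<le> norm (m + w)"
    using complex_Re_le_cmod[of "f (m + w)"] bd[of "m + w"] f mz w M fw
    by (simp add: functional_on_add vna_add)
  \<comment> \<open>The lower bound gains \<alpha>^2 while the norm grows by at most half of that;
    hence \<alpha>^2 is at most 2 * e.\<close>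
  moreover have "sqrt (1 + \<alpha>\<^sup>2) \<le> 1 + \<alpha>\<^sup>2 / 2"
  proof (rule real_le_lsqrt)
    have "(1 + \<alpha>\<^sup>2 / 2)\<^sup>2 = 1 + \<alpha>\<^sup>2 + (\<alpha>\<^sup>2 / 2)\<^sup>2" by (simp add: power2_eq_square algebra_simps)
    then show "1 + \<alpha>\<^sup>2 \<le> (1 + \<alpha>\<^sup>2 / 2)\<^sup>2" by simp
  qed simp
  ultimately have "\<alpha>\<^sup>2 \<le> 2 * e" using fm by linarith
  then have "\<alpha> \<le> sqrt (2 * e)" by (rule real_le_rsqrt)
  moreover have "f (F o\<^sub>L x) - f (F o\<^sub>L y) = 2 * f (F o\<^sub>L z)"
  proof -
    have "F o\<^sub>L z = (1/2) *\<^sub>R ((F o\<^sub>L x) - (F o\<^sub>L y))"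
      by (rule blinfun_eqI) (simp add: z_def blinfun.scaleR_left blinfun.diff_left blinfun.scaleR_right blinfun.diff_right)
    then show ?thesis using f x y F M by (simp add: functional_on_scaleR functional_on_diff vna_diff vna_compose)
  qed
  ultimately show ?thesis by (simp add: \<alpha>_def norm_mult)
qed

text \<open>Tychonoff for the product of the discs of radius norm x. The functions are arbitrary
  here; linearity of a cluster point is recovered from the functionals converging to it.\<close>

lemma compact_bounded_functions: "compact {g :: 'x::real_normed_vector \<Rightarrow> complex. \<forall>x. cmod (g x) \<le> norm x}"
proof -
  have "compactin (product_topology (\<lambda>_. euclidean) UNIV) (PiE UNIV (\<lambda>x::'x. cball (0::complex) (norm x)))"
    by (simp add: compactin_PiE)
  moreover have "PiE UNIV (\<lambda>x::'x. cball (0::complex) (norm x)) = {g. \<forall>x. cmod (g x) \<le> norm x}"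
    by (auto simp: PiE_def Pi_def)
  ultimately show ?thesis by (simp add: euclidean_product_topology)
qed

text \<open>Invariance is required in norm, uniformly on the unit ball: it will be evaluated at
  contractions that depend on n. Normality and positivity of n are not part of the notion.\<close>

definition asymptotically_invariant ::
    "('a::chilbert_space \<Rightarrow>\<^sub>L 'a) set \<Rightarrow> ((('a \<Rightarrow>\<^sub>L 'a) \<Rightarrow> complex) \<Rightarrow> ('a \<Rightarrow>\<^sub>L 'a) \<Rightarrow> ('a \<Rightarrow>\<^sub>L 'a)) \<Rightarrow>
      (('a \<Rightarrow>\<^sub>L 'a) \<Rightarrow> complex) filter \<Rightarrow> bool"
  where "asymptotically_invariant M R \<F> \<longleftrightarrow> \<F> \<noteq> bot \<and> eventually (bounded_functional M) \<F> \<and>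
    ((\<lambda>n. n id_blinfun) \<longlongrightarrow> 1) \<F> \<and>
    (\<forall>a\<in>predual M. ((\<lambda>n. functional_norm M (\<lambda>F. n (R a F) - a id_blinfun * n F)) \<longlongrightarrow> 0) \<F>)"

text \<open>The cut-down functionals \<nu> are indexed by pairs (n, e), where e measures how nearly
  the chosen contraction attains the norm of n. The limit is taken along both at once.\<close>

lemma invariant_state_exists:
  assumes M: "vna M" and net: "asymptotically_invariant M R \<F>"
    and \<Gamma>: "\<And>\<omega>. \<omega> \<in> \<Gamma> \<Longrightarrow> \<omega> \<in> predual M \<and> \<omega> id_blinfun = 1 \<and> normal_star_automorphism M (R \<omega>)"
  shows "\<exists>\<mu>. state_on M \<mu> \<and> (\<forall>F\<in>M. cmod (\<mu> F) \<le> norm F) \<and> (\<forall>\<omega>\<in>\<Gamma>. \<forall>F\<in>M. \<mu> (R \<omega> F) = \<mu> F)"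
proof -
  have F0: "\<F> \<noteq> bot" and Fb: "eventually (bounded_functional M) \<F>"
    and F1: "((\<lambda>n. n id_blinfun) \<longlongrightarrow> 1) \<F>"
    and Finv: "\<And>a. a \<in> predual M \<Longrightarrow> ((\<lambda>n. functional_norm M (\<lambda>F. n (R a F) - a id_blinfun * n F)) \<longlongrightarrow> 0) \<F>"
    using net by (auto simp: asymptotically_invariant_def)
  \<comment> \<open>The values at 1 tend to 1, so the norms eventually exceed 1/2; this permits
    division by them with a uniform constant.\<close>
  define good where "good n \<longleftrightarrow> bounded_functional M n \<and> 1/2 \<le> functional_norm M n" for n
  have "eventually (\<lambda>n. dist (n id_blinfun) 1 < 1/2) \<F>" using F1 by (rule tendstoD) simp
  then have Fg: "eventually good \<F>"
    using Fb
  proof eventually_elim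
    case (elim n)
    have "1/2 \<le> cmod (n id_blinfun)"
      using elim(1) norm_triangle_ineq[of "n id_blinfun" "1 - n id_blinfun"] by (simp add: dist_norm norm_minus_commute)
    also have "\<dots> \<le> functional_norm M n"
      by (rule functional_norm_upper[OF elim(2) vna_id[OF M]]) (rule norm_blinfun_id_le)
    finally show ?case using elim(2) by (simp add: good_def)
  qed
  have near: "\<exists>x\<in>M. norm x \<le> 1 \<and> n x = of_real (Re (n x)) \<and> functional_norm M n * (1 - e) \<le> Re (n x)"
    if n: "good n" and e: "0 < e" for n e
  proof -
    have nb: "bounded_functional M n" and n0: "0 < functional_norm M n" using n by (auto simp: good_def)
    have "\<exists>x\<in>M. norm x \<le> 1 \<and> functional_norm M n * (1 - e) \<le> cmod (n x)"
    proof (rule ccontr)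
      assume "\<not> ?thesis"
      then have "functional_norm M n \<le> functional_norm M n * (1 - e)"
        by (intro functional_norm_leI[OF M]) (auto simp: not_le intro: less_imp_le)
      then show False using mult_pos_pos[OF n0 e] by (simp add: algebra_simps)
    qed
    then obtain x where x: "x \<in> M" "norm x \<le> 1" "functional_norm M n * (1 - e) \<le> cmod (n x)" by blast
    obtain c where c: "cmod c = 1" "c * n x = complex_of_real (cmod (n x))" using unimodular_factor by blast
    have "n (op_scale c x) = complex_of_real (cmod (n x))"
      using functional_on_op_scale[OF _ x(1), of n c] nb c by (simp add: bounded_functional_def)
    moreover have "norm (op_scale c x) \<le> 1" using order_trans[OF norm_op_scale_le[of c x]] x c by simp
    ultimately show ?thesis using x by (intro bexI[of _ "op_scale c x"]) (simp_all add: vna_op_scale[OF M])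
  qed
  \<comment> \<open>A contraction nearly attaining the norm of n, rotated so that n takes a real
    value there.\<close>
  define pk where "pk n e = (SOME x. x \<in> M \<and> norm x \<le> 1 \<and> n x = of_real (Re (n x)) \<and> functional_norm M n * (1 - e) \<le> Re (n x))" for n e
  have pk: "pk n e \<in> M" "norm (pk n e) \<le> 1" "n (pk n e) = of_real (Re (n (pk n e)))"
    "functional_norm M n * (1 - e) \<le> Re (n (pk n e))" if "good n" "0 < e" for n e
  proof -
    have "\<exists>x. x \<in> M \<and> norm x \<le> 1 \<and> n x = of_real (Re (n x)) \<and> functional_norm M n * (1 - e) \<le> Re (n x)"
      using near[OF that] by blast
    from someI_ex[OF this] show "pk n e \<in> M" "norm (pk n e) \<le> 1" "n (pk n e) = of_real (Re (n (pk n e)))"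
      "functional_norm M n * (1 - e) \<le> Re (n (pk n e))" unfolding pk_def by blast+
  qed
  define \<nu> where "\<nu> = (\<lambda>(n, e) F. if F \<in> M \<and> good n \<and> 0 < e then n (F o\<^sub>L pk n e) / of_real (functional_norm M n) else 0)"
  \<comment> \<open>The accuracy e tends to 0 from the right independently of n.\<close>
  define \<G> where "\<G> = \<F> \<times>\<^sub>F at_right (0::real)"
  have G0: "\<G> \<noteq> bot" unfolding \<G>_def using F0 by (simp add: prod_filter_eq_bot)
  have Gg: "eventually (\<lambda>p. good (fst p) \<and> 0 < snd p) \<G>"
    unfolding \<G>_def
    by (rule eventually_conj[OF eventually_prodI[OF Fg eventually_True, simplified] eventually_prodI[OF eventually_True eventually_at_right_less, simplified]])
  have \<nu>_bound: "cmod (\<nu> p F) \<le> norm F" for p F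
  proof (cases "F \<in> M \<and> good (fst p) \<and> 0 < snd p")
    case True
    obtain n e where p: "p = (n, e)" by (cases p)
    have g: "good n" "0 < e" "F \<in> M" using True p by auto
    have nb: "bounded_functional M n" "0 < functional_norm M n" using g by (auto simp: good_def)
    have "cmod (n (F o\<^sub>L pk n e)) \<le> functional_norm M n * norm (F o\<^sub>L pk n e)"
      by (rule functional_norm_bound[OF M nb(1) vna_compose[OF M g(3) pk(1)[OF g(1,2)]]])
    also have "norm (F o\<^sub>L pk n e) \<le> norm F * 1"
      by (rule order_trans[OF norm_blinfun_compose mult_left_mono[OF pk(2)[OF g(1,2)]]]) simp
    finally have "cmod (n (F o\<^sub>L pk n e)) \<le> functional_norm M n * norm F" using nb(2) by (simp add: mult_left_mono)
    then show ?thesis using g nb(2) p by (simp add: \<nu>_def norm_divide field_simps)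
  qed (auto simp: \<nu>_def split: prod.splits)
  define \<H> where "\<H> = filtermap \<nu> \<G>"
  have H0: "\<H> \<noteq> bot" using G0 by (simp add: \<H>_def filtermap_bot_iff)
  have "eventually (\<lambda>g. g \<in> {g. \<forall>F. cmod (g F) \<le> norm F}) \<H>"
    unfolding \<H>_def eventually_filtermap using \<nu>_bound by simp
  \<comment> \<open>A cluster point for pointwise convergence; in general no limit along
    \<open>\<H>\<close> itself exists.\<close>
  then obtain \<mu> where \<mu>: "\<mu> \<in> {g. \<forall>F. cmod (g F) \<le> norm F}" "inf (nhds \<mu>) \<H> \<noteq> bot"
    using compact_bounded_functions H0 unfolding compact_filter by blast
  have lim\<mu>: "((\<lambda>g. g F) \<longlongrightarrow> \<mu> F) (inf (nhds \<mu>) \<H>)" for F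
  proof -
    have "((\<lambda>g. g F) \<longlongrightarrow> \<mu> F) (nhds \<mu>)"
    proof (rule topological_tendstoI)
      fix S :: "complex set" assume S: "open S" "\<mu> F \<in> S"
      have "open ((\<lambda>g :: ('a \<Rightarrow>\<^sub>L 'a) \<Rightarrow> complex. g F) -` S)"
        by (rule open_vimage[OF S(1) continuous_on_product_coordinates])
      then show "eventually (\<lambda>g. g F \<in> S) (nhds \<mu>)"
        unfolding eventually_nhds using S(2) by (intro exI[of _ "(\<lambda>g. g F) -` S"]) auto
    qed
    then show ?thesis by (rule tendsto_mono[OF inf_le1])
  qed
  \<comment> \<open>Every property of \<mu> below is an instance: the filter of neighbourhoods of
    \<mu> met with \<open>\<H>\<close> is proper, so a limit along \<open>\<G>\<close> and
    continuity at \<mu> must give the same value.\<close>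
  have limit: "h \<mu> = c" if ev: "((\<lambda>p. h (\<nu> p)) \<longlongrightarrow> c) \<G>" and cont: "(h \<longlongrightarrow> h \<mu>) (inf (nhds \<mu>) \<H>)"
    for h :: "(('a \<Rightarrow>\<^sub>L 'a) \<Rightarrow> complex) \<Rightarrow> complex" and c
  proof -
    have "(h \<longlongrightarrow> c) \<H>" unfolding \<H>_def using ev by (simp add: filterlim_filtermap)
    then have "(h \<longlongrightarrow> c) (inf (nhds \<mu>) \<H>)" by (rule tendsto_mono[OF inf_le2])
    then show ?thesis by (rule tendsto_unique[OF \<mu>(2) cont])
  qed
  have \<nu>_eq: "\<nu> (n, e) F = n (F o\<^sub>L pk n e) / of_real (functional_norm M n)" if "good n" "0 < e" "F \<in> M" for n e F
    using that by (simp add: \<nu>_def)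
  have \<nu>_fun: "functional_on M (\<nu> (n, e))" if g: "good n" "0 < e" for n e
    unfolding functional_on_def
  proof (intro conjI ballI allI)
    have nf: "functional_on M n" using g by (auto simp: good_def bounded_functional_def)
    fix x y c assume x: "x \<in> M"
    show "\<nu> (n, e) (op_scale c x) = c * \<nu> (n, e) x"
      using x by (simp add: \<nu>_eq g vna_op_scale[OF M] op_scale_compose_left
          functional_on_op_scale[OF nf] vna_compose[OF M] pk(1)[OF g])
    assume y: "y \<in> M"
    show "\<nu> (n, e) (x + y) = \<nu> (n, e) x + \<nu> (n, e) y"
      using x y by (simp add: \<nu>_eq g vna_add[OF M] blinfun_compose_simps
          functional_on_add[OF nf] vna_compose[OF M] pk(1)[OF g] add_divide_distrib)
  qed
  have \<mu>_fun: "functional_on M \<mu>" unfolding functional_on_def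
  proof (intro conjI ballI allI)
    fix x y c assume x: "x \<in> M"
    have "\<mu> (op_scale c x) - c * \<mu> x = 0"
    proof (rule limit[of "\<lambda>g. g (op_scale c x) - c * g x"])
      show "((\<lambda>p. \<nu> p (op_scale c x) - c * \<nu> p x) \<longlongrightarrow> 0) \<G>"
        by (rule tendsto_eventually, rule eventually_mono[OF Gg])
          (auto simp: functional_on_op_scale[OF \<nu>_fun x])
    qed (intro tendsto_intros lim\<mu>)
    then show "\<mu> (op_scale c x) = c * \<mu> x" by simp
    assume y: "y \<in> M"
    have "\<mu> (x + y) - (\<mu> x + \<mu> y) = 0"
    proof (rule limit[of "\<lambda>g. g (x + y) - (g x + g y)"])
      show "((\<lambda>p. \<nu> p (x + y) - (\<nu> p x + \<nu> p y)) \<longlongrightarrow> 0) \<G>"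
        by (rule tendsto_eventually, rule eventually_mono[OF Gg])
          (auto simp: functional_on_add[OF \<nu>_fun x y])
    qed (intro tendsto_intros lim\<mu>)
    then show "\<mu> (x + y) = \<mu> x + \<mu> y" by simp
  qed
  have limsnd: "((\<lambda>p. snd p) \<longlongrightarrow> 0) \<G>"
    unfolding \<G>_def by (rule filterlim_compose[OF tendsto_ident_at filterlim_snd])
  have \<nu>1: "1 - e \<le> Re (\<nu> (n, e) id_blinfun)" "\<nu> (n, e) id_blinfun = of_real (Re (\<nu> (n, e) id_blinfun))"
    if g: "good n" "0 < e" for n e
  proof -
    have n0: "0 < functional_norm M n" using g by (auto simp: good_def)
    have eq: "\<nu> (n, e) id_blinfun = of_real (Re (n (pk n e)) / functional_norm M n)"
      using pk(3)[OF g] by (simp add: \<nu>_eq g vna_id[OF M])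
    show "1 - e \<le> Re (\<nu> (n, e) id_blinfun)" "\<nu> (n, e) id_blinfun = of_real (Re (\<nu> (n, e) id_blinfun))"
      using pk(4)[OF g] n0 unfolding eq by (simp_all add: field_simps)
  qed
  have "\<mu> id_blinfun - 1 = 0"
  proof (rule limit[of "\<lambda>g. g id_blinfun - 1"])
    show "((\<lambda>p. \<nu> p id_blinfun - 1) \<longlongrightarrow> 0) \<G>"
    proof (rule Lim_null_comparison[OF _ limsnd], rule eventually_mono[OF Gg])
      fix p :: "(('a \<Rightarrow>\<^sub>L 'a) \<Rightarrow> complex) \<times> real" assume "good (fst p) \<and> 0 < snd p"
      then obtain n e where p: "p = (n, e)" and g: "good n" "0 < e" by (cases p) auto
      have "Re (\<nu> (n, e) id_blinfun) \<le> 1"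
        using order_trans[OF complex_Re_le_cmod order_trans[OF \<nu>_bound norm_blinfun_id_le]] by blast
      then have "\<bar>Re (\<nu> (n, e) id_blinfun) - 1\<bar> \<le> e" using \<nu>1(1)[OF g] by linarith
      moreover have "\<nu> (n, e) id_blinfun - 1 = of_real (Re (\<nu> (n, e) id_blinfun) - 1)"
        using \<nu>1(2)[OF g] by simp
      ultimately show "norm (\<nu> p id_blinfun - 1) \<le> snd p" unfolding p by (simp only: norm_of_real snd_conv)
    qed
  qed (intro tendsto_intros lim\<mu>)
  then have \<mu>1: "\<mu> id_blinfun = 1" by simp
  have \<mu>b: "cmod (\<mu> F) \<le> norm F" for F using \<mu>(1) by simp
  have inv1: "\<mu> (R \<omega> F) = \<mu> F" if \<omega>: "\<omega> \<in> \<Gamma>" and F: "F \<in> M" "norm F \<le> 1" for \<omega> F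
  proof -
    have wP: "\<omega> \<in> predual M" and w1: "\<omega> id_blinfun = 1" and aut: "normal_star_automorphism M (R \<omega>)"
      using \<Gamma>[OF \<omega>] by auto
    have hom: "normal_star_hom M M (R \<omega>)" using aut by (simp add: normal_star_automorphism_def)
    have lin: "normal_linear_map M M (R \<omega>)" using hom by (simp add: normal_star_hom_def)
    note RM = normal_linear_mapD(1)[OF lin]
    \<comment> \<open>The factor 2 absorbs the later division by the norm of n, which is at least
      1/2.\<close>
    define \<delta> where "\<delta> n = 2 * functional_norm M (\<lambda>F. n (R \<omega> F) - \<omega> id_blinfun * n F)" for n
    have lim\<delta>: "((\<lambda>p. \<delta> (fst p)) \<longlongrightarrow> 0) \<G>"
    proof -
      have "(\<delta> \<longlongrightarrow> 2 * 0) \<F>" unfolding \<delta>_def by (intro tendsto_mult tendsto_const Finv wP)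
      then show ?thesis unfolding \<G>_def using filterlim_compose[OF _ filterlim_fst] by fastforce
    qed
    have "\<mu> (R \<omega> F) - \<mu> F = 0"
    proof (rule limit[of "\<lambda>g. g (R \<omega> F) - g F"])
      have "((\<lambda>p. \<delta> (fst p) + 2 * sqrt (2 * (snd p + \<delta> (fst p)))) \<longlongrightarrow> 0 + 2 * sqrt (2 * (0 + 0))) \<G>"
        by (intro tendsto_intros lim\<delta> limsnd)
      then have L: "((\<lambda>p. \<delta> (fst p) + 2 * sqrt (2 * (snd p + \<delta> (fst p)))) \<longlongrightarrow> 0) \<G>" by simp
      show "((\<lambda>p. \<nu> p (R \<omega> F) - \<nu> p F) \<longlongrightarrow> 0) \<G>"
      proof (rule Lim_null_comparison[OF _ L], rule eventually_mono[OF Gg])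
        fix p :: "(('a \<Rightarrow>\<^sub>L 'a) \<Rightarrow> complex) \<times> real" assume "good (fst p) \<and> 0 < snd p"
        then obtain n e where p: "p = (n, e)" and g: "good n" "0 < e" by (cases p) auto
        have nb: "bounded_functional M n" and nf: "functional_on M n" and n12: "1/2 \<le> functional_norm M n"
          using g by (auto simp: good_def bounded_functional_def)
        define k where "k = functional_norm M n"
        have k: "1/2 \<le> k" "0 < k" using n12 by (auto simp: k_def)
        define f where "f F = n F / of_real k" for F
        have ff: "functional_on M f" using nf by (simp add: functional_on_def f_def add_divide_distrib)
        have fb: "cmod (f x) \<le> norm x" if "x \<in> M" for x
          using functional_norm_bound[OF M nb that] k by (simp add: f_def norm_divide k_def[symmetric] field_simps)
        \<comment> \<open>\<open>functional_norm\<close> is a supremum of reals, so boundedness must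
          be known before it bounds any single value.\<close>
        have db: "bounded_functional M (\<lambda>F. n (R \<omega> F) - \<omega> id_blinfun * n F)"
          unfolding bounded_functional_def
        proof
          show "functional_on M (\<lambda>F. n (R \<omega> F) - \<omega> id_blinfun * n F)"
            using normal_linear_mapD[OF lin] nf by (simp add: functional_on_def w1 algebra_simps)
          have "norm (R \<omega> x) \<le> norm x" if "x \<in> M" for x
          proof (rule star_hom_contractive[OF M _ _ _ _ _ _ that])
            \<comment> \<open>Surjectivity makes the automorphism unital, and hence
              contractive.\<close>
            obtain i where i: "i \<in> M" "R \<omega> i = id_blinfun"
              using normal_star_automorphismD[OF M aut vna_id[OF M]] by blast
            have "R \<omega> (i o\<^sub>L id_blinfun) = R \<omega> i o\<^sub>L R \<omega> id_blinfun"
              using hom i vna_id[OF M] by (simp add: normal_star_hom_def del: blinfun_compose_id)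
            then show "R \<omega> id_blinfun = id_blinfun" using i by simp
          qed (use hom normal_linear_mapD[OF lin] vna_bop[OF M] in \<open>auto simp: normal_star_hom_def\<close>)
          note Rn = this
          have "cmod (n (R \<omega> x) - \<omega> id_blinfun * n x) \<le> (2 * k) * norm x" if x: "x \<in> M" for x
          proof -
            have "cmod (n (R \<omega> x)) \<le> k * norm (R \<omega> x)"
              unfolding k_def by (rule functional_norm_bound[OF M nb RM[OF x]])
            also have "\<dots> \<le> k * norm x" using k by (intro mult_left_mono Rn x) auto
            finally have "cmod (n (R \<omega> x)) \<le> k * norm x" .
            moreover have "cmod (n x) \<le> k * norm x" unfolding k_def by (rule functional_norm_bound[OF M nb x])
            ultimately show ?thesis using norm_triangle_ineq4[of "n (R \<omega> x)" "n x"] by (simp add: w1)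
          qed
          then show "\<exists>K. \<forall>x\<in>M. cmod (n (R \<omega> x) - \<omega> id_blinfun * n x) \<le> K * norm x" by blast
        qed
        have d0: "0 \<le> \<delta> n" unfolding \<delta>_def using functional_norm_nonneg[OF M db] by simp
        have close: "cmod (f (R \<omega> x) - f x) \<le> \<delta> n" if x: "x \<in> M" "norm x \<le> 1" for x
        proof -
          have "cmod (n (R \<omega> x) - \<omega> id_blinfun * n x) \<le> \<delta> n / 2"
            using functional_norm_upper[OF db x] by (simp add: \<delta>_def)
          moreover have "f (R \<omega> x) - f x = (n (R \<omega> x) - \<omega> id_blinfun * n x) / of_real k"
            by (simp add: f_def w1 diff_divide_distrib)
          ultimately have "cmod (f (R \<omega> x) - f x) \<le> (\<delta> n / 2) / k"
            using k divide_right_mono[of "cmod (n (R \<omega> x) - \<omega> id_blinfun * n x)" "\<delta> n / 2" k]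
            by (simp only: norm_divide norm_of_real) simp
          also have "\<dots> \<le> (\<delta> n / 2) / (1/2)" using k d0 by (intro divide_left_mono) auto
          finally show ?thesis by simp
        qed
        define x where "x = pk n e"
        have x: "x \<in> M" "norm x \<le> 1" using pk[OF g] by (auto simp: x_def)
        have fx: "1 - e \<le> Re (f x)"
          using \<nu>1(1)[OF g] by (simp add: \<nu>_eq g vna_id[OF M] f_def k_def x_def)
        \<comment> \<open>The value of f at y is close to that at its image x, so f nearly attains
          its norm at y as well.\<close>
        obtain y where y: "y \<in> M" "R \<omega> y = x" "norm y \<le> 1"
          using normal_star_automorphismD[OF M aut x(1)] x(2) by (auto intro: order_trans)
        have fy: "1 - (e + \<delta> n) \<le> Re (f y)"
          using close[OF y(1,3)] fx abs_Re_le_cmod[of "f x - f y"] y(2) by simp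
        \<comment> \<open>Multiplicativity turns the translate of F tested at x into the translate
          of F y, to which near invariance applies.\<close>
        have "R \<omega> F o\<^sub>L x = R \<omega> (F o\<^sub>L y)"
          using hom F y by (simp add: normal_star_hom_def)
        moreover have "norm (F o\<^sub>L y) \<le> 1"
          using order_trans[OF norm_blinfun_compose mult_le_one[OF F(2) norm_ge_zero y(3)]] .
        ultimately have 1: "cmod (f (R \<omega> F o\<^sub>L x) - f (F o\<^sub>L y)) \<le> \<delta> n"
          using close[of "F o\<^sub>L y"] vna_compose[OF M F(1) y(1)] by simp
        \<comment> \<open>The accuracy at y is e + \<delta> n, so this weaker value is used for both
          contractions.\<close>
        have 2: "cmod (f (F o\<^sub>L y) - f (F o\<^sub>L x)) \<le> 2 * sqrt (2 * (e + \<delta> n))"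
          by (rule norm_attaining_close[OF M ff fb y(1,3) fy x _ F]) (use fx d0 in simp_all)
        have "\<nu> p (R \<omega> F) - \<nu> p F = (f (R \<omega> F o\<^sub>L x) - f (F o\<^sub>L y)) + (f (F o\<^sub>L y) - f (F o\<^sub>L x))"
          by (simp add: p \<nu>_eq g RM F f_def k_def x_def)
        then show "norm (\<nu> p (R \<omega> F) - \<nu> p F) \<le> \<delta> (fst p) + 2 * sqrt (2 * (snd p + \<delta> (fst p)))"
          using norm_triangle_mono[OF 1 2] by (simp add: p)
      qed
    qed (intro tendsto_intros lim\<mu>)
    then show ?thesis by simp
  qed
  have "\<mu> (R \<omega> F) = \<mu> F" if \<omega>: "\<omega> \<in> \<Gamma>" and F: "F \<in> M" for \<omega> F
  proof -
    have lin: "normal_linear_map M M (R \<omega>)"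
      using \<Gamma>[OF \<omega>] by (simp add: normal_star_automorphism_def normal_star_hom_def)
    \<comment> \<open>Scaling F into the unit ball, where \<open>inv1\<close> applies.\<close>
    define r where "r = 1 / (norm F + 1)"
    have r: "0 < r" by (simp add: r_def add_nonneg_pos)
    have "norm (op_scale (of_real r) F) = r * norm F" unfolding op_scale_of_real using r by simp
    also have "\<dots> = norm F / (norm F + 1)" by (simp add: r_def)
    also have "\<dots> \<le> 1" by (simp add: divide_le_eq not_less)
    finally have "norm (op_scale (of_real r) F) \<le> 1" .
    then have "\<mu> (R \<omega> (op_scale (of_real r) F)) = \<mu> (op_scale (of_real r) F)"
      by (intro inv1 \<omega> vna_op_scale[OF M F])
    then show ?thesis using r F normal_linear_mapD(1,3)[OF lin F]
      by (simp add: functional_on_op_scale[OF \<mu>_fun])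
  qed
  then show ?thesis using unital_contractive_state[OF M \<mu>_fun \<mu>b \<mu>1] \<mu>b by blast
qed

section \<open>Pseudo-amenability\<close>

text \<open>Merges two representing series of projective tensors into one, which then represents
  their sum.\<close>

definition interleave :: "(nat \<Rightarrow> 'x) \<Rightarrow> (nat \<Rightarrow> 'x) \<Rightarrow> nat \<Rightarrow> 'x"
  where "interleave f g n = (if even n then f (n div 2) else g (n div 2))"

lemma interleave_sums:
  fixes f g :: "nat \<Rightarrow> 'x::real_normed_vector"
  assumes "f sums x" "g sums y"
  shows "interleave f g sums (x + y)"
proof -
  have s: "strict_mono (\<lambda>n::nat. 2 * n)" "strict_mono (\<lambda>n. Suc (2 * n))" by (auto simp: strict_mono_def)
  have "(\<lambda>n. if even n then f (n div 2) else 0) sums x"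
    using assms(1) by (subst sums_mono_reindex[OF s(1), symmetric]) (auto elim!: evenE)
  moreover have "(\<lambda>n. if even n then 0 else g (n div 2)) sums y"
    using assms(2) by (subst sums_mono_reindex[OF s(2), symmetric]) (auto elim!: oddE)
  ultimately have "(\<lambda>n. (if even n then f (n div 2) else 0) + (if even n then 0 else g (n div 2))) sums (x + y)"
    by (rule sums_add)
  moreover have "(\<lambda>n. (if even n then f (n div 2) else 0) + (if even n then 0 else g (n div 2))) = interleave f g"
    by (auto simp: interleave_def)
  ultimately show ?thesis by simp
qed

lemma interleave_map2: "(\<lambda>n. h (interleave p p' n) (interleave q q' n)) = interleave (\<lambda>n. h (p n) (q n)) (\<lambda>n. h (p' n) (q' n))"
  by (auto simp: interleave_def)

context hopf_vna
begin

abbreviation A where "A \<equiv> predual_algebra t M \<Delta>"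

lemma A_simps [simp]:
  "Elem A = predual M" "Zero A = (\<lambda>x. 0)" "Add A f g = (\<lambda>x. f x + g x)" "Scale A c f = (\<lambda>x. c * f x)"
  "Norm A = functional_norm M" "Mult A f g = conv f g" "Sub A f g = (\<lambda>x. f x - g x)"
  by (simp_all add: predual_algebra_def Sub_def conv_def)

lemma fn_nonneg: "f \<in> predual M \<Longrightarrow> 0 \<le> functional_norm M f"
  by (rule functional_norm_nonneg[OF M predual_bounded_functional[OF M]])

lemma predual_one_bound: "f \<in> predual M \<Longrightarrow> cmod (f id_blinfun) \<le> functional_norm M f"
  by (rule functional_norm_upper[OF predual_bounded_functional[OF M] vna_id[OF M] norm_blinfun_id_le])

abbreviation BBF where "BBF \<equiv> bounded_bilinear_forms A"

lemma BBF_I: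
  assumes "\<And>a b c. a \<in> predual M \<Longrightarrow> b \<in> predual M \<Longrightarrow> c \<in> predual M \<Longrightarrow> \<beta> (\<lambda>x. a x + b x) c = \<beta> a c + \<beta> b c"
    "\<And>a b c. a \<in> predual M \<Longrightarrow> b \<in> predual M \<Longrightarrow> c \<in> predual M \<Longrightarrow> \<beta> c (\<lambda>x. a x + b x) = \<beta> c a + \<beta> c b"
    "\<And>a b z. a \<in> predual M \<Longrightarrow> b \<in> predual M \<Longrightarrow> \<beta> (\<lambda>x. z * a x) b = z * \<beta> a b"
    "\<And>a b z. a \<in> predual M \<Longrightarrow> b \<in> predual M \<Longrightarrow> \<beta> a (\<lambda>x. z * b x) = z * \<beta> a b"
    "\<And>a b. a \<in> predual M \<Longrightarrow> b \<in> predual M \<Longrightarrow> cmod (\<beta> a b) \<le> K * functional_norm M a * functional_norm M b"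
  shows "\<beta> \<in> BBF"
  unfolding bounded_bilinear_forms_def using assms by (auto intro!: exI[of _ K])

lemma BBF_D:
  assumes "\<beta> \<in> BBF"
  shows "a \<in> predual M \<Longrightarrow> b \<in> predual M \<Longrightarrow> c \<in> predual M \<Longrightarrow> \<beta> (\<lambda>x. a x + b x) c = \<beta> a c + \<beta> b c"
    "a \<in> predual M \<Longrightarrow> b \<in> predual M \<Longrightarrow> c \<in> predual M \<Longrightarrow> \<beta> c (\<lambda>x. a x + b x) = \<beta> c a + \<beta> c b"
    "a \<in> predual M \<Longrightarrow> b \<in> predual M \<Longrightarrow> \<beta> (\<lambda>x. z * a x) b = z * \<beta> a b"
    "a \<in> predual M \<Longrightarrow> b \<in> predual M \<Longrightarrow> \<beta> a (\<lambda>x. z * b x) = z * \<beta> a b"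
  using assms unfolding bounded_bilinear_forms_def by auto

lemma BBF_bound:
  assumes "\<beta> \<in> BBF"
  shows "\<exists>K\<ge>0. \<forall>a\<in>predual M. \<forall>b\<in>predual M. cmod (\<beta> a b) \<le> K * (functional_norm M a * functional_norm M b)"
proof -
  have "\<exists>K. \<forall>a\<in>predual M. \<forall>b\<in>predual M. cmod (\<beta> a b) \<le> K * functional_norm M a * functional_norm M b"
    using assms unfolding bounded_bilinear_forms_def by simp
  then obtain K where K: "\<forall>a\<in>predual M. \<forall>b\<in>predual M. cmod (\<beta> a b) \<le> K * functional_norm M a * functional_norm M b"
    by blast
  have "cmod (\<beta> a b) \<le> \<bar>K\<bar> * (functional_norm M a * functional_norm M b)" if "a \<in> predual M" "b \<in> predual M" for a b
    by (rule order_trans[OF K[rule_format, OF that]])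
      (simp add: mult.assoc mult_right_mono fn_nonneg that)
  then show ?thesis by (intro exI[of _ "\<bar>K\<bar>"]) auto
qed

text \<open>The module actions on projective tensors are evaluated by precomposing the form, which
  must therefore stay bounded and bilinear.\<close>

lemma BBF_conv_left:
  assumes \<beta>: "\<beta> \<in> BBF" and a: "a \<in> predual M"
  shows "(\<lambda>p q. \<beta> (conv a p) q) \<in> BBF"
proof -
  obtain K where K: "0 \<le> K" "\<And>a b. a \<in> predual M \<Longrightarrow> b \<in> predual M \<Longrightarrow> cmod (\<beta> a b) \<le> K * (functional_norm M a * functional_norm M b)"
    using BBF_bound[OF \<beta>] by blast
  show ?thesis
  proof (rule BBF_I[where K = "K * functional_norm M a"])
    fix p q assume p: "p \<in> predual M" and q: "q \<in> predual M"
    have "cmod (\<beta> (conv a p) q) \<le> K * (functional_norm M (conv a p) * functional_norm M q)"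
      by (rule K(2)[OF conv_predual[OF a p] q])
    also have "\<dots> \<le> K * ((functional_norm M a * functional_norm M p) * functional_norm M q)"
      by (intro mult_left_mono mult_right_mono norm_conv a p fn_nonneg q K(1))
    finally show "cmod (\<beta> (conv a p) q) \<le> K * functional_norm M a * functional_norm M p * functional_norm M q"
      by (simp add: mult.assoc)
  qed (simp_all add: conv_add_right conv_scale_right a conv_predual BBF_D[OF \<beta>])
qed

lemma BBF_conv_right:
  assumes \<beta>: "\<beta> \<in> BBF" and a: "a \<in> predual M"
  shows "(\<lambda>p q. \<beta> p (conv q a)) \<in> BBF"
proof -
  obtain K where K: "0 \<le> K" "\<And>a b. a \<in> predual M \<Longrightarrow> b \<in> predual M \<Longrightarrow> cmod (\<beta> a b) \<le> K * (functional_norm M a * functional_norm M b)"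
    using BBF_bound[OF \<beta>] by blast
  show ?thesis
  proof (rule BBF_I[where K = "K * functional_norm M a"])
    fix p q assume p: "p \<in> predual M" and q: "q \<in> predual M"
    have "cmod (\<beta> p (conv q a)) \<le> K * (functional_norm M p * functional_norm M (conv q a))"
      by (rule K(2)[OF p conv_predual[OF q a]])
    also have "\<dots> \<le> K * (functional_norm M p * (functional_norm M q * functional_norm M a))"
      by (intro mult_left_mono norm_conv a q fn_nonneg p K(1))
    finally show "cmod (\<beta> p (conv q a)) \<le> K * functional_norm M a * functional_norm M p * functional_norm M q"
      by (simp add: mult_ac)
  qed (simp_all add: conv_add_left conv_scale_left a conv_predual BBF_D[OF \<beta>])
qed

lemma representsD:
  assumes "represents A p q u"
  shows "p n \<in> predual M" "q n \<in> predual M" "summable (\<lambda>n. functional_norm M (p n) * functional_norm M (q n))"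
    "\<beta> \<in> BBF \<Longrightarrow> u \<beta> = (\<Sum>n. \<beta> (p n) (q n))" "\<beta> \<notin> BBF \<Longrightarrow> u \<beta> = 0"
  using assms by (auto simp: represents_def)

lemma represents_sum_bound:
  assumes r: "represents A p q u" and K: "0 \<le> K"
    and bd: "\<And>a b. a \<in> predual M \<Longrightarrow> b \<in> predual M \<Longrightarrow> norm (\<beta> a b) \<le> K * (functional_norm M a * functional_norm M b)"
  shows "summable (\<lambda>n. norm (\<beta> (p n) (q n)))"
    "(\<Sum>n. norm (\<beta> (p n) (q n))) \<le> K * (\<Sum>n. functional_norm M (p n) * functional_norm M (q n))"
proof -
  note R = representsD[OF r]
  have le: "norm (\<beta> (p n) (q n)) \<le> K * (functional_norm M (p n) * functional_norm M (q n))" for n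
    by (rule bd[OF R(1,2)])
  show s: "summable (\<lambda>n. norm (\<beta> (p n) (q n)))"
    by (rule summable_comparison_test'[OF summable_mult[OF R(3)], where N = 0]) (use le in simp)
  show "(\<Sum>n. norm (\<beta> (p n) (q n))) \<le> K * (\<Sum>n. functional_norm M (p n) * functional_norm M (q n))"
    unfolding suminf_mult[OF R(3), symmetric] by (rule suminf_le[OF le s summable_mult[OF R(3)]])
qed

lemma represents_sums:
  assumes r: "represents A p q u" and \<beta>: "\<beta> \<in> BBF"
  shows "(\<lambda>n. \<beta> (p n) (q n)) sums u \<beta>"
proof -
  obtain K where "0 \<le> K" "\<And>a b. a \<in> predual M \<Longrightarrow> b \<in> predual M \<Longrightarrow> cmod (\<beta> a b) \<le> K * (functional_norm M a * functional_norm M b)"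
    using BBF_bound[OF \<beta>] by blast
  from represents_sum_bound(1)[OF r this] have "summable (\<lambda>n. \<beta> (p n) (q n))"
    by (rule summable_norm_cancel)
  then show ?thesis using representsD(4)[OF r \<beta>] by (simp add: summable_sums)
qed

lemma representsI:
  assumes "\<And>n. p n \<in> predual M" "\<And>n. q n \<in> predual M"
    "summable (\<lambda>n. functional_norm M (p n) * functional_norm M (q n))"
    "\<And>\<beta>. \<beta> \<in> BBF \<Longrightarrow> (\<lambda>n. \<beta> (p n) (q n)) sums u \<beta>" "\<And>\<beta>. \<beta> \<notin> BBF \<Longrightarrow> u \<beta> = 0"
  shows "represents A p q u"
  using assms by (auto simp: represents_def sums_iff intro!: ext)

section \<open>The projective tensor product and the product map\<close>

abbreviation PT where "PT \<equiv> projective_tensor A"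

lemma PT_simps [simp]:
  "u \<in> Elem PT \<longleftrightarrow> (\<exists>p q. represents A p q u)" "Sub PT u v = (\<lambda>\<beta>. u \<beta> - v \<beta>)"
  by (simp_all add: projective_tensor_def Sub_def)

text \<open>Each representing series gives the bound with its own mass; the infimum is taken after
  division by K, whence the separate case K = 0.\<close>

lemma PT_norm_bound:
  assumes u: "u \<in> Elem PT" and \<beta>: "\<beta> \<in> BBF" and K: "0 \<le> K"
    and bd: "\<And>a b. a \<in> predual M \<Longrightarrow> b \<in> predual M \<Longrightarrow> cmod (\<beta> a b) \<le> K * (functional_norm M a * functional_norm M b)"
  shows "cmod (u \<beta>) \<le> K * Norm PT u"
proof -
  let ?S = "{\<Sum>n. functional_norm M (p n) * functional_norm M (q n) | p q. represents A p q u}"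
  have N: "Norm PT u = Inf ?S" by (simp add: projective_tensor_def)
  have le: "cmod (u \<beta>) \<le> K * s" if sS: "s \<in> ?S" for s
  proof -
    obtain p q where r: "represents A p q u" and s: "s = (\<Sum>n. functional_norm M (p n) * functional_norm M (q n))"
      using sS by blast
    have "cmod (u \<beta>) \<le> (\<Sum>n. norm (\<beta> (p n) (q n)))"
      unfolding representsD(4)[OF r \<beta>] by (rule summable_norm[OF represents_sum_bound(1)[OF r K bd]])
    also have "\<dots> \<le> K * s" unfolding s by (rule represents_sum_bound(2)[OF r K bd])
    finally show ?thesis .
  qed
  obtain s0 where s0: "s0 \<in> ?S" using u by auto
  show ?thesis
  proof (cases "K = 0")
    case True then show ?thesis using le[OF s0] by simp
  next
    case False
    then have "cmod (u \<beta>) / K \<le> Inf ?S"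
      using le K s0 by (intro cInf_greatest) (auto simp: divide_le_eq mult.commute)
    then show ?thesis using False K unfolding N by (simp add: divide_le_eq mult.commute)
  qed
qed

text \<open>The definite description is legitimate because the value at \<beta> is u at the form (p,
  q) \<mapsto> \<open>\<beta> (conv a p) q\<close>, whichever series represents u.\<close>

lemma LAct_PT:
  assumes r: "represents A p q u" and a: "a \<in> predual M"
  shows "represents A (\<lambda>n. conv a (p n)) q (LAct PT a u)"
    and "\<beta> \<in> BBF \<Longrightarrow> LAct PT a u \<beta> = u (\<lambda>p q. \<beta> (conv a p) q)"
proof -
  define v where "v \<beta> = (if \<beta> \<in> BBF then u (\<lambda>p q. \<beta> (conv a p) q) else 0)" for \<beta>
  note R = representsD[OF r]
  have "functional_norm M (conv a (p n)) * functional_norm M (q n) \<le> functional_norm M a * (functional_norm M (p n) * functional_norm M (q n))" for n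
    using mult_right_mono[OF norm_conv[OF a R(1)] fn_nonneg[OF R(2)]] by (simp add: mult.assoc)
  then have s: "summable (\<lambda>n. functional_norm M (conv a (p n)) * functional_norm M (q n))"
    using R by (intro summable_comparison_test'[OF summable_mult[OF R(3)], where N = 0])
      (simp add: fn_nonneg conv_predual a)
  have rv: "represents A (\<lambda>n. conv a (p n)) q v"
    using s by (intro representsI) (auto simp: v_def R conv_predual a
        intro: represents_sums[OF r BBF_conv_left[OF _ a]])
  have "LAct PT a u = (THE v. \<exists>p q. represents A p q u \<and> represents A (\<lambda>n. conv a (p n)) q v)"
    by (simp add: projective_tensor_def)
  also have "\<dots> = v"
  proof (rule the_equality)
    fix v' assume "\<exists>p q. represents A p q u \<and> represents A (\<lambda>n. conv a (p n)) q v'"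
    then obtain p' q' where 1: "represents A p' q' u" and 2: "represents A (\<lambda>n. conv a (p' n)) q' v'" by blast
    show "v' = v"
    proof
      fix \<beta>
      show "v' \<beta> = v \<beta>"
      proof (cases "\<beta> \<in> BBF")
        case True
        have "(\<lambda>n. \<beta> (conv a (p' n)) (q' n)) sums v' \<beta>" by (rule represents_sums[OF 2 True])
        moreover have "(\<lambda>n. \<beta> (conv a (p' n)) (q' n)) sums v \<beta>"
          using represents_sums[OF 1 BBF_conv_left[OF True a]] True by (simp add: v_def)
        ultimately show ?thesis by (rule sums_unique2)
      qed (simp add: v_def representsD(5)[OF 2])
    qed
  qed (use r rv in blast)
  finally have eq: "LAct PT a u = v" .
  show "represents A (\<lambda>n. conv a (p n)) q (LAct PT a u)" "\<beta> \<in> BBF \<Longrightarrow> LAct PT a u \<beta> = u (\<lambda>p q. \<beta> (conv a p) q)"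
    using rv by (simp_all add: eq v_def)
qed

lemma RAct_PT:
  assumes r: "represents A p q u" and a: "a \<in> predual M"
  shows "represents A p (\<lambda>n. conv (q n) a) (RAct PT u a)"
    and "\<beta> \<in> BBF \<Longrightarrow> RAct PT u a \<beta> = u (\<lambda>p q. \<beta> p (conv q a))"
proof -
  define v where "v \<beta> = (if \<beta> \<in> BBF then u (\<lambda>p q. \<beta> p (conv q a)) else 0)" for \<beta>
  note R = representsD[OF r]
  have "functional_norm M (p n) * functional_norm M (conv (q n) a) \<le> functional_norm M a * (functional_norm M (p n) * functional_norm M (q n))" for n
    using mult_left_mono[OF norm_conv[OF R(2) a] fn_nonneg[OF R(1)], of n n] by (simp add: mult_ac)
  then have s: "summable (\<lambda>n. functional_norm M (p n) * functional_norm M (conv (q n) a))"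
    using R by (intro summable_comparison_test'[OF summable_mult[OF R(3)], where N = 0])
      (simp add: fn_nonneg conv_predual a)
  have rv: "represents A p (\<lambda>n. conv (q n) a) v"
    using s by (intro representsI) (auto simp: v_def R conv_predual a
        intro: represents_sums[OF r BBF_conv_right[OF _ a]])
  have "RAct PT u a = (THE v. \<exists>p q. represents A p q u \<and> represents A p (\<lambda>n. conv (q n) a) v)"
    by (simp add: projective_tensor_def)
  also have "\<dots> = v"
  proof (rule the_equality)
    fix v' assume "\<exists>p q. represents A p q u \<and> represents A p (\<lambda>n. conv (q n) a) v'"
    then obtain p' q' where 1: "represents A p' q' u" and 2: "represents A p' (\<lambda>n. conv (q' n) a) v'" by blast
    show "v' = v"
    proof
      fix \<beta>
      show "v' \<beta> = v \<beta>"
      proof (cases "\<beta> \<in> BBF")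
        case True
        have "(\<lambda>n. \<beta> (p' n) (conv (q' n) a)) sums v' \<beta>" by (rule represents_sums[OF 2 True])
        moreover have "(\<lambda>n. \<beta> (p' n) (conv (q' n) a)) sums v \<beta>"
          using represents_sums[OF 1 BBF_conv_right[OF True a]] True by (simp add: v_def)
        ultimately show ?thesis by (rule sums_unique2)
      qed (simp add: v_def representsD(5)[OF 2])
    qed
  qed (use r rv in blast)
  finally have eq: "RAct PT u a = v" .
  show "represents A p (\<lambda>n. conv (q n) a) (RAct PT u a)" "\<beta> \<in> BBF \<Longrightarrow> RAct PT u a \<beta> = u (\<lambda>p q. \<beta> p (conv q a))"
    using rv by (simp_all add: eq v_def)
qed

lemma PT_diff:
  assumes r: "represents A p q u" and r': "represents A p' q' u'"
  shows "(\<lambda>\<beta>. u \<beta> - u' \<beta>) \<in> Elem PT"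
proof -
  note R = representsD[OF r] and R' = representsD[OF r']
  let ?p' = "\<lambda>n x. (-1) * p' n x"
  have n: "functional_norm M (?p' n) = functional_norm M (p' n)" for n
    unfolding functional_norm_def by (simp add: norm_mult)
  have "represents A (interleave p ?p') (interleave q q') (\<lambda>\<beta>. u \<beta> - u' \<beta>)"
  proof (rule representsI)
    show "interleave p ?p' n \<in> predual M" "interleave q q' n \<in> predual M" for n
      using R(1,2) R'(1,2) predual_scale[OF R'(1), of "-1"] by (auto simp: interleave_def)
    have "interleave (\<lambda>n. functional_norm M (p n) * functional_norm M (q n)) (\<lambda>n. functional_norm M (?p' n) * functional_norm M (q' n))
        sums ((\<Sum>n. functional_norm M (p n) * functional_norm M (q n)) + (\<Sum>n. functional_norm M (?p' n) * functional_norm M (q' n)))"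
      using R(3) R'(3) unfolding n by (intro interleave_sums summable_sums)
    then show "summable (\<lambda>n. functional_norm M (interleave p ?p' n) * functional_norm M (interleave q q' n))"
      unfolding interleave_map2[of "\<lambda>f g. functional_norm M f * functional_norm M g"] by (rule sums_summable)
    show "u \<beta> - u' \<beta> = 0" if "\<beta> \<notin> BBF" for \<beta> using R(5)[OF that] R'(5)[OF that] by simp
    show "(\<lambda>n. \<beta> (interleave p ?p' n) (interleave q q' n)) sums (u \<beta> - u' \<beta>)" if \<beta>: "\<beta> \<in> BBF" for \<beta>
    proof -
      have "(\<lambda>n. \<beta> (?p' n) (q' n)) sums (- u' \<beta>)"
        using sums_minus[OF represents_sums[OF r' \<beta>]] BBF_D(3)[OF \<beta> R'(1,2), of "-1"] by simp
      from interleave_sums[OF represents_sums[OF r \<beta>] this] show ?thesis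
        unfolding interleave_map2[of \<beta>] by simp
    qed
  qed
  then show ?thesis by auto
qed

lemma psum_A: "psum A f n = (\<lambda>x. \<Sum>k<n. f k x)"
  by (induction n) auto

lemma BBF_conv_eval:
  assumes F: "F \<in> M"
  shows "(\<lambda>p q. conv p q F) \<in> BBF"
  by (rule BBF_I[where K = "norm F"])
    (use conv_bound[OF _ _ F] in \<open>simp_all add: conv_add_left conv_add_right conv_scale_left conv_scale_right mult_ac\<close>)

text \<open>The series of products converges in norm because its tails are bounded by tails of the
  mass. Its value at F is u at the bounded form (p, q) \<mapsto> \<open>conv p q F\<close>, so the
  sum does not depend on the representing series.\<close>

lemma product_map_PT:
  assumes r: "represents A p q u"
  shows "product_map A u \<in> predual M" and "F \<in> M \<Longrightarrow> product_map A u F = u (\<lambda>p q. conv p q F)"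
proof -
  note R = representsD[OF r]
  define c where "c F = (if F \<in> M then u (\<lambda>p q. conv p q F) else 0)" for F
  have sums: "(\<lambda>n. conv (p n) (q n) F) sums c F" if "F \<in> M" for F
    using represents_sums[OF r BBF_conv_eval[OF that]] that by (simp add: c_def)
  let ?m = "\<lambda>n. functional_norm M (p n) * functional_norm M (q n)"
  have tail: "cmod ((\<Sum>k<n. conv (p k) (q k) F) - c F) \<le> ((\<Sum>k. ?m k) - (\<Sum>k<n. ?m k)) * norm F" if F: "F \<in> M" for F n
  proof -
    have le: "norm (conv (p (k + n)) (q (k + n)) F) \<le> ?m (k + n) * norm F" for k
      by (rule conv_bound[OF R(1,2) F])
    have sm: "summable (\<lambda>k. ?m (k + n) * norm F)"
      by (intro summable_mult2 summable_ignore_initial_segment R(3))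
    have sn: "summable (\<lambda>k. norm (conv (p (k + n)) (q (k + n)) F))"
      by (rule summable_comparison_test'[OF sm, where N = 0]) (use le in simp)
    have "c F - (\<Sum>k<n. conv (p k) (q k) F) = (\<Sum>k. conv (p (k + n)) (q (k + n)) F)"
      using suminf_minus_initial_segment[OF sums_summable[OF sums[OF F]], of n] sums_unique[OF sums[OF F]] by simp
    then have "cmod ((\<Sum>k<n. conv (p k) (q k) F) - c F) \<le> (\<Sum>k. norm (conv (p (k + n)) (q (k + n)) F))"
      using summable_norm[OF sn] by (simp add: norm_minus_commute)
    also have "\<dots> \<le> (\<Sum>k. ?m (k + n) * norm F)" by (rule suminf_le[OF le sn sm])
    also have "\<dots> = ((\<Sum>k. ?m k) - (\<Sum>k<n. ?m k)) * norm F"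
      using suminf_mult2[OF summable_ignore_initial_segment[OF R(3)], of n "norm F"]
        suminf_minus_initial_segment[OF R(3), of n] by simp
    finally show ?thesis .
  qed
  have mass0: "(\<lambda>n. (\<Sum>k. ?m k) - (\<Sum>k<n. ?m k)) \<longlonglongrightarrow> 0"
    using tendsto_diff[OF tendsto_const summable_LIMSEQ[OF R(3)], of "\<Sum>k. ?m k"] by simp
  have mass_nn: "0 \<le> (\<Sum>k. ?m k) - (\<Sum>k<n. ?m k)" for n
    using sum_le_suminf[OF R(3), of "{..<n}"] R(1,2) by (simp add: fn_nonneg)
  have part: "(\<lambda>F. \<Sum>k<n. conv (p k) (q k) F) \<in> predual M" for n
    by (intro predual_sum conv_predual R)
  \<comment> \<open>A uniform limit of normal partial sums is normal by
    \<open>predual_closed\<close>.\<close>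
  have cP: "c \<in> predual M"
  proof (rule predual_closed[OF M])
    show "c x = 0" if "x \<notin> M" for x using that by (simp add: c_def)
    fix e :: real assume "0 < e"
    then have "eventually (\<lambda>n. (\<Sum>k. ?m k) - (\<Sum>k<n. ?m k) < e) sequentially"
      using mass0 by (intro order_tendstoD(2)) auto
    then obtain n where n: "(\<Sum>k. ?m k) - (\<Sum>k<n. ?m k) < e" by (auto simp: eventually_sequentially)
    show "\<exists>g\<in>predual M. \<forall>x\<in>M. cmod (c x - g x) \<le> e * norm x"
    proof (intro bexI[OF _ part[of n]] ballI)
      fix x assume "x \<in> M"
      from tail[OF this, of n] have "cmod (c x - (\<Sum>k<n. conv (p k) (q k) x)) \<le> ((\<Sum>k. ?m k) - (\<Sum>k<n. ?m k)) * norm x"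
        by (simp add: norm_minus_commute)
      also have "\<dots> \<le> e * norm x" using n by (intro mult_right_mono) auto
      finally show "cmod (c x - (\<Sum>k<n. conv (p k) (q k) x)) \<le> e * norm x" .
    qed
  qed
  have ser: "series_sums A (\<lambda>n. Mult A (p n) (q n)) c"
    unfolding series_sums_def
  proof
    show "c \<in> Elem A" using cP by simp
    have diffP: "(\<lambda>x. (\<Sum>k<n. conv (p k) (q k) x) - c x) \<in> predual M" for n
      by (rule predual_diff[OF part cP])
    have "(\<lambda>n. functional_norm M (\<lambda>x. (\<Sum>k<n. conv (p k) (q k) x) - c x)) \<longlonglongrightarrow> 0"
    proof (rule Lim_null_comparison[OF _ mass0], intro always_eventually allI)
      show "norm (functional_norm M (\<lambda>x. (\<Sum>k<n. conv (p k) (q k) x) - c x)) \<le> (\<Sum>k. ?m k) - (\<Sum>k<n. ?m k)" for n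
        using functional_norm_leI'[OF M mass_nn tail] fn_nonneg[OF diffP] by simp
    qed
    then show "(\<lambda>n. Norm A (Sub A (psum A (\<lambda>n. Mult A (p n) (q n)) n) c)) \<longlonglongrightarrow> 0"
      by (simp add: psum_A)
  qed
  have "product_map A u = c"
    unfolding product_map_def
  proof (rule the_equality)
    fix c' assume "\<exists>p q. represents A p q u \<and> series_sums A (\<lambda>n. Mult A (p n) (q n)) c'"
    then obtain p' q' where 1: "represents A p' q' u" and 2: "series_sums A (\<lambda>n. Mult A (p' n) (q' n)) c'" by blast
    note R' = representsD[OF 1]
    have c'P: "c' \<in> predual M" using 2 by (simp add: series_sums_def)
    have part': "(\<lambda>F. \<Sum>k<n. conv (p' k) (q' k) F) \<in> predual M" for n
      by (intro predual_sum conv_predual R')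
    have lim: "(\<lambda>n. functional_norm M (\<lambda>x. (\<Sum>k<n. conv (p' k) (q' k) x) - c' x)) \<longlonglongrightarrow> 0"
      using 2 by (simp add: series_sums_def psum_A)
    show "c' = c"
    proof
      fix F
      show "c' F = c F"
      proof (cases "F \<in> M")
        case True
        have "(\<lambda>n. functional_norm M (\<lambda>x. (\<Sum>k<n. conv (p' k) (q' k) x) - c' x) * norm F) \<longlonglongrightarrow> 0 * norm F"
          by (rule tendsto_mult_right[OF lim])
        then have "(\<lambda>n. functional_norm M (\<lambda>x. (\<Sum>k<n. conv (p' k) (q' k) x) - c' x) * norm F) \<longlonglongrightarrow> 0" by simp
        then have "(\<lambda>n. (\<Sum>k<n. conv (p' k) (q' k) F) - c' F) \<longlonglongrightarrow> 0"
          by (rule Lim_null_comparison[rotated])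
            (intro always_eventually allI predual_bound[OF M predual_diff[OF part' c'P] True])
        then have "(\<lambda>n. conv (p' n) (q' n) F) sums c' F"
          unfolding sums_def by (rule LIM_zero_cancel)
        moreover have "(\<lambda>n. conv (p' n) (q' n) F) sums c F"
          using represents_sums[OF 1 BBF_conv_eval[OF True]] True by (simp add: c_def)
        ultimately show ?thesis by (rule sums_unique2)
      qed (simp add: c_def predual_outside[OF c'P])
    qed
  qed (use r ser in blast)
  then show "product_map A u \<in> predual M" "F \<in> M \<Longrightarrow> product_map A u F = u (\<lambda>p q. conv p q F)"
    using cP by (simp_all add: c_def)
qed

text \<open>The character f \<mapsto> f 1 on one leg and evaluation at F on the other. The flag
  selects the leg so that \<open>act sw\<close> appears when the evaluated leg is multiplied by
  a.\<close>

definition leg_form :: "bool \<Rightarrow> ('a \<Rightarrow>\<^sub>L 'a) \<Rightarrow> (('a \<Rightarrow>\<^sub>L 'a) \<Rightarrow> complex) \<Rightarrow> (('a \<Rightarrow>\<^sub>L 'a) \<Rightarrow> complex) \<Rightarrow> complex"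
  where "leg_form sw F p q = (if sw then p F * q id_blinfun else p id_blinfun * q F)"

lemma leg_form_bound:
  assumes "F \<in> M" "p \<in> predual M" "q \<in> predual M"
  shows "cmod (leg_form sw F p q) \<le> norm F * (functional_norm M p * functional_norm M q)"
proof (cases sw)
  case True
  have "cmod (p F) * cmod (q id_blinfun) \<le> (functional_norm M p * norm F) * functional_norm M q"
    by (intro mult_mono predual_bound[OF M] predual_one_bound assms mult_nonneg_nonneg fn_nonneg) auto
  then show ?thesis using True by (simp add: leg_form_def norm_mult mult_ac)
next
  case False
  have "cmod (p id_blinfun) * cmod (q F) \<le> functional_norm M p * (functional_norm M q * norm F)"
    by (intro mult_mono predual_bound[OF M] predual_one_bound assms mult_nonneg_nonneg fn_nonneg) auto
  then show ?thesis using False by (simp add: leg_form_def norm_mult mult_ac)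
qed

lemma leg_form_BBF: "F \<in> M \<Longrightarrow> leg_form sw F \<in> BBF"
  by (rule BBF_I[where K = "norm F"])
    (use leg_form_bound in \<open>auto simp: leg_form_def algebra_simps\<close>)

lemma leg_form_add: "p \<in> predual M \<Longrightarrow> q \<in> predual M \<Longrightarrow> x \<in> M \<Longrightarrow> y \<in> M \<Longrightarrow>
    leg_form sw (x + y) p q = leg_form sw x p q + leg_form sw y p q"
  by (simp add: leg_form_def functional_on_add[OF predual_functional_on[OF M]] algebra_simps)

lemma leg_form_scale: "p \<in> predual M \<Longrightarrow> q \<in> predual M \<Longrightarrow> x \<in> M \<Longrightarrow>
    leg_form sw (op_scale c x) p q = c * leg_form sw x p q"
  by (simp add: leg_form_def functional_on_op_scale[OF predual_functional_on[OF M]])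

text \<open>\<open>M \<noteq> {0}\<close> guarantees a nonzero vector, whose vector functional is
  rescaled.\<close>

lemma unit_functional: "\<exists>e\<in>predual M. e id_blinfun = 1"
proof -
  have "M \<noteq> {0}" using hopf by (simp add: hopf_von_neumann_algebra_def von_neumann_algebra_def)
  then obtain T where "T \<in> M" "T \<noteq> 0" using vna_0[OF M] by blast
  then obtain u where u: "u \<noteq> (0::'a)" by (metis blinfun.zero_right blinfun_eqI)
  then have "cinner u u \<noteq> 0" by (simp add: cinner_self)
  then show ?thesis
    using predual_scale[OF vec_fun_predual[of M u u], of "1 / cinner u u"]
    by (intro bexI) (auto simp: vec_fun_def vna_id[OF M])
qed

text \<open>Applying the character \<open>f \<mapsto> f 1\<close> to one leg of an approximate diagonal gives an asymptotically
  invariant net.\<close>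

lemma pseudo_amenable_net:
  assumes "pseudo_amenable A"
  shows "\<exists>\<F>. asymptotically_invariant M (act sw) \<F>"
proof -
  obtain \<F> where F0: "\<F> \<noteq> bot" and Fe: "eventually (\<lambda>u. u \<in> Elem PT) \<F>"
    and Fc: "\<And>a. a \<in> predual M \<Longrightarrow> ((\<lambda>u. Norm PT (Sub PT (LAct PT a u) (RAct PT u a))) \<longlongrightarrow> 0) \<F>"
    and Fp: "\<And>a. a \<in> predual M \<Longrightarrow> ((\<lambda>u. Norm A (Sub A (Mult A (product_map A u) a) a)) \<longlongrightarrow> 0) \<F>"
    using assms unfolding pseudo_amenable_def Let_def by auto
  define n where "n u F = u (leg_form sw F)" for u :: "((('a \<Rightarrow>\<^sub>L 'a) \<Rightarrow> complex) \<Rightarrow> (('a \<Rightarrow>\<^sub>L 'a) \<Rightarrow> complex) \<Rightarrow> complex) \<Rightarrow> complex" and F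
  have nb: "bounded_functional M (n u)" if uE: "u \<in> Elem PT" for u
  proof -
    obtain p q where r: "represents A p q u" using uE by auto
    note R = representsD[OF r]
    have sm: "(\<lambda>k. leg_form sw x (p k) (q k)) sums n u x" if "x \<in> M" for x
      unfolding n_def by (rule represents_sums[OF r leg_form_BBF[OF that]])
    have "functional_on M (n u)" unfolding functional_on_def
    proof (intro conjI ballI allI)
      fix x y c assume x: "x \<in> M"
      show "n u (op_scale c x) = c * n u x"
        using sm[OF vna_op_scale[OF M x, of c]] sums_mult[OF sm[OF x], of c]
        by (simp add: leg_form_scale[OF R(1,2) x] sums_iff)
      assume y: "y \<in> M"
      show "n u (x + y) = n u x + n u y"
        using sm[OF vna_add[OF M x y]] sums_add[OF sm[OF x] sm[OF y]]
        by (simp add: leg_form_add[OF R(1,2) x y] sums_iff)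
    qed
    moreover have "cmod (n u x) \<le> Norm PT u * norm x" if "x \<in> M" for x
      using PT_norm_bound[OF uE leg_form_BBF[OF that] norm_ge_zero leg_form_bound[OF that]]
      by (simp add: n_def mult.commute)
    ultimately show ?thesis unfolding bounded_functional_def by blast
  qed
  \<comment> \<open>At F = 1 both legs carry the character, which is multiplicative for the
    convolution; so n u 1 is the character of the product of u.\<close>
  have n1: "n u id_blinfun = product_map A u id_blinfun" if uE: "u \<in> Elem PT" for u
  proof -
    obtain p q where r: "represents A p q u" using uE by auto
    note R = representsD[OF r]
    have "leg_form sw id_blinfun (p k) (q k) = conv (p k) (q k) id_blinfun" for k
      by (simp add: leg_form_def conv_one R)
    then show ?thesis
      using R(4)[OF leg_form_BBF[OF vna_id[OF M]]] R(4)[OF BBF_conv_eval[OF vna_id[OF M]]]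
        product_map_PT(2)[OF r vna_id[OF M]] by (simp add: n_def)
  qed
  have inv: "functional_norm M (\<lambda>F. n u (act sw a F) - a id_blinfun * n u F) \<le> Norm PT (Sub PT (LAct PT a u) (RAct PT u a))"
    "0 \<le> functional_norm M (\<lambda>F. n u (act sw a F) - a id_blinfun * n u F)"
    if u: "u \<in> Elem PT" and a: "a \<in> predual M" for u a
  proof -
    obtain p q where r: "represents A p q u" using u by auto
    note R = representsD[OF r]
    let ?w = "Sub PT (LAct PT a u) (RAct PT u a)"
    have wE: "?w \<in> Elem PT"
      unfolding PT_simps(2) by (rule PT_diff[OF LAct_PT(1)[OF r a] RAct_PT(1)[OF r a]])
    \<comment> \<open>One module action on u becomes translation by a and the other becomes
      multiplication by a 1. Which is which depends on the flag, so only absolute values are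
      compared.\<close>
    have w: "cmod (n u (act sw a F) - a id_blinfun * n u F) = cmod (?w (leg_form sw F))" if F: "F \<in> M" for F
    proof -
      note \<beta> = leg_form_BBF[OF F, of sw]
      have L: "(\<lambda>k. leg_form sw F (conv a (p k)) (q k)) sums LAct PT a u (leg_form sw F)"
        by (rule represents_sums[OF LAct_PT(1)[OF r a] \<beta>])
      have Rr: "(\<lambda>k. leg_form sw F (p k) (conv (q k) a)) sums RAct PT u a (leg_form sw F)"
        by (rule represents_sums[OF RAct_PT(1)[OF r a] \<beta>])
      have N: "(\<lambda>k. leg_form sw (act sw a F) (p k) (q k)) sums n u (act sw a F)"
        unfolding n_def by (rule represents_sums[OF r leg_form_BBF[OF act_in[OF a F]]])
      have N1: "(\<lambda>k. a id_blinfun * leg_form sw F (p k) (q k)) sums (a id_blinfun * n u F)"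
        unfolding n_def by (intro sums_mult represents_sums[OF r \<beta>])
      show ?thesis
      proof (cases sw)
        case True
        then have "LAct PT a u (leg_form sw F) = n u (act sw a F)" "RAct PT u a (leg_form sw F) = a id_blinfun * n u F"
          using L Rr N N1 by (simp_all add: leg_form_def act_pair[OF a F] conv_one R a mult_ac sums_iff)
        then show ?thesis by simp
      next
        case False
        then have "RAct PT u a (leg_form sw F) = n u (act sw a F)" "LAct PT a u (leg_form sw F) = a id_blinfun * n u F"
          using L Rr N N1 by (simp_all add: leg_form_def act_pair[OF a F] conv_one R a mult_ac sums_iff)
        then show ?thesis by (simp add: norm_minus_commute)
      qed
    qed
    show "functional_norm M (\<lambda>F. n u (act sw a F) - a id_blinfun * n u F) \<le> Norm PT ?w"
    proof (rule functional_norm_leI[OF M])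
      fix F assume F: "F \<in> M" "norm F \<le> 1"
      have "cmod (?w (leg_form sw F)) \<le> 1 * Norm PT ?w"
      proof (rule PT_norm_bound[OF wE leg_form_BBF[OF F(1)]])
        fix p q assume pq: "p \<in> predual M" "q \<in> predual M"
        have "norm F * (functional_norm M p * functional_norm M q) \<le> 1 * (functional_norm M p * functional_norm M q)"
          by (intro mult_right_mono F mult_nonneg_nonneg fn_nonneg pq)
        then show "cmod (leg_form sw F p q) \<le> 1 * (functional_norm M p * functional_norm M q)"
          using leg_form_bound[OF F(1) pq, of sw] by linarith
      qed simp
      then show "cmod (n u (act sw a F) - a id_blinfun * n u F) \<le> Norm PT ?w" using w[OF F(1)] by simp
    qed
    have "bounded_functional M (\<lambda>F. n u (act sw a F) - a id_blinfun * n u F)"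
      unfolding bounded_functional_def
    proof
      have nf: "functional_on M (n u)" using nb[OF u] by (simp add: bounded_functional_def)
      show "functional_on M (\<lambda>F. n u (act sw a F) - a id_blinfun * n u F)"
        unfolding functional_on_def
        by (auto simp: act_add[OF a] act_scale[OF a] functional_on_add[OF nf] functional_on_op_scale[OF nf]
            act_in[OF a] algebra_simps)
      have "cmod (n u (act sw a F) - a id_blinfun * n u F) \<le> Norm PT ?w * norm F" if F: "F \<in> M" for F
        using PT_norm_bound[OF wE leg_form_BBF[OF F] norm_ge_zero leg_form_bound[OF F]] w[OF F]
        by (simp add: mult.commute)
      then show "\<exists>K. \<forall>F\<in>M. cmod (n u (act sw a F) - a id_blinfun * n u F) \<le> K * norm F" by blast
    qed
    then show "0 \<le> functional_norm M (\<lambda>F. n u (act sw a F) - a id_blinfun * n u F)"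
      by (rule functional_norm_nonneg[OF M])
  qed
  \<comment> \<open>Evaluating the convergence of the product map of u, convolved with e, to e at
    the unit gives n u 1 \<rightarrow> 1.\<close>
  obtain e where e: "e \<in> predual M" "e id_blinfun = 1" using unit_functional by blast
  have "asymptotically_invariant M (act sw) (filtermap n \<F>)"
    unfolding asymptotically_invariant_def
  proof (intro conjI ballI)
    show "filtermap n \<F> \<noteq> bot" using F0 by (simp add: filtermap_bot_iff)
    show "eventually (bounded_functional M) (filtermap n \<F>)"
      unfolding eventually_filtermap using Fe by (rule eventually_mono) (rule nb)
    have "((\<lambda>u. n u id_blinfun - 1) \<longlongrightarrow> 0) \<F>"
    proof (rule Lim_null_comparison[OF _ Fp[OF e(1)]], rule eventually_mono[OF Fe])
      fix u assume u: "u \<in> Elem PT"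
      then obtain p q where r: "represents A p q u" by auto
      have "cmod (conv (product_map A u) e id_blinfun - e id_blinfun) \<le> functional_norm M (\<lambda>x. conv (product_map A u) e x - e x)"
        by (rule predual_one_bound[OF predual_diff[OF conv_predual[OF product_map_PT(1)[OF r] e(1)] e(1)]])
      then show "norm (n u id_blinfun - 1) \<le> Norm A (Sub A (Mult A (product_map A u) e) e)"
        using n1[OF u] by (simp add: conv_one product_map_PT(1)[OF r] e)
    qed
    then show "((\<lambda>n. n id_blinfun) \<longlongrightarrow> 1) (filtermap n \<F>)"
      unfolding filterlim_filtermap by (rule LIM_zero_cancel)
    fix a assume a: "a \<in> predual M"
    have "((\<lambda>u. functional_norm M (\<lambda>F. n u (act sw a F) - a id_blinfun * n u F)) \<longlongrightarrow> 0) \<F>"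
    proof (rule Lim_null_comparison[OF _ Fc[OF a]], rule eventually_mono[OF Fe])
      show "norm (functional_norm M (\<lambda>F. n u (act sw a F) - a id_blinfun * n u F)) \<le> Norm PT (Sub PT (LAct PT a u) (RAct PT u a))"
        if "u \<in> Elem PT" for u using inv[OF that a] by simp
    qed
    then show "((\<lambda>n. functional_norm M (\<lambda>F. n (act sw a F) - a id_blinfun * n F)) \<longlongrightarrow> 0) (filtermap n \<F>)"
      unfolding filterlim_filtermap .
  qed
  then show ?thesis by blast
qed

end

section \<open>Approximate amenability\<close>

text \<open>An injection of 'x into the argument type of the carrier type prescribed by
  \<open>approximately_amenable\<close>; the second argument is a dummy.\<close>

definition ev :: "'x \<Rightarrow> ('x \<Rightarrow> complex) \<Rightarrow> ('x \<Rightarrow> complex) \<Rightarrow> complex"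
  where "ev x = (\<lambda>p q. p x)"

lemma ev_inj: "ev x = ev y \<Longrightarrow> x = y"
proof -
  assume "ev x = ev y"
  then have "ev x (\<lambda>z. if z = x then 1 else 0) (\<lambda>_. 0) = ev y (\<lambda>z. if z = x then 1 else 0) (\<lambda>_. 0)" by simp
  then show "x = y" by (simp add: ev_def split: if_splits)
qed

text \<open>Functionals are moved into the carrier type of the bimodules along a left inverse of the
  evaluation map, which keeps addition and scaling pointwise. The left inverse is arbitrary outside
  the range of the evaluation map.\<close>

definition lift :: "('x \<Rightarrow> complex) \<Rightarrow> (('x \<Rightarrow> complex) \<Rightarrow> ('x \<Rightarrow> complex) \<Rightarrow> complex) \<Rightarrow> complex"
  where "lift m = (\<lambda>\<beta>. m (SOME x. \<beta> = ev x))"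

definition lower :: "((('x \<Rightarrow> complex) \<Rightarrow> ('x \<Rightarrow> complex) \<Rightarrow> complex) \<Rightarrow> complex) \<Rightarrow> ('x \<Rightarrow> complex)"
  where "lower u = (\<lambda>x. u (ev x))"

lemma lower_lift [simp]: "lower (lift m) = (m :: 'x \<Rightarrow> complex)"
proof
  fix x :: 'x
  have "ev x = ev (SOME y. ev x = ev y)" by (rule someI[of "\<lambda>y. ev x = ev y" x]) simp
  then have "(SOME y. ev x = ev y) = x" by (metis ev_inj)
  then show "lower (lift m) x = m x" by (simp add: lower_def lift_def)
qed

lemma lift_eq_iff [simp]: "lift m = lift m' \<longleftrightarrow> m = m'"
  by (metis lower_lift)

context hopf_vna
begin

text \<open>The annihilator of 1 among all bounded functionals. It is a submodule because the
  actions send 1 to a multiple of 1.\<close>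

definition E where "E = {m. bounded_functional M m \<and> m id_blinfun = 0 \<and> (\<forall>x. x \<notin> M \<longrightarrow> m x = 0)}"

lemma bounded_functional_add:
  assumes "bounded_functional M f" "bounded_functional M g"
  shows "bounded_functional M (\<lambda>x. f x + g x)"
proof -
  obtain K L where K: "\<forall>x\<in>M. cmod (f x) \<le> K * norm x" and L: "\<forall>x\<in>M. cmod (g x) \<le> L * norm x"
    using assms by (auto simp: bounded_functional_def)
  have "cmod (f x + g x) \<le> (K + L) * norm x" if "x \<in> M" for x
    using norm_triangle_mono[OF K[rule_format, OF that] L[rule_format, OF that]] by (simp add: distrib_right)
  moreover have "functional_on M (\<lambda>x. f x + g x)"
    using assms by (simp add: bounded_functional_def functional_on_def distrib_left)
  ultimately show ?thesis unfolding bounded_functional_def by blast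
qed

lemma bounded_functional_scale:
  assumes "bounded_functional M f"
  shows "bounded_functional M (\<lambda>x. c * f x)"
proof -
  obtain K where K: "\<forall>x\<in>M. cmod (f x) \<le> K * norm x" using assms by (auto simp: bounded_functional_def)
  have "cmod (c * f x) \<le> (cmod c * K) * norm x" if "x \<in> M" for x
    using mult_left_mono[OF K[rule_format, OF that], of "cmod c"] by (simp add: norm_mult mult.assoc)
  moreover have "functional_on M (\<lambda>x. c * f x)"
    using assms by (simp add: bounded_functional_def functional_on_def distrib_left mult.left_commute)
  ultimately show ?thesis unfolding bounded_functional_def by blast
qed

lemma bounded_functional_diff:
  "bounded_functional M f \<Longrightarrow> bounded_functional M g \<Longrightarrow> bounded_functional M (\<lambda>x. f x - g x)"
  using bounded_functional_add[of f "\<lambda>x. (-1) * g x"] bounded_functional_scale[of g "-1"] by simp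

lemma bounded_functional_act:
  assumes m: "bounded_functional M m" and a: "a \<in> predual M"
  shows "bounded_functional M (\<lambda>F. if F \<in> M then m (act sw a F) else 0)"
    and "F \<in> M \<Longrightarrow> cmod (m (act sw a F)) \<le> (functional_norm M a * functional_norm M m) * norm F"
proof -
  have mf: "functional_on M m" using m by (simp add: bounded_functional_def)
  have b: "cmod (m (act sw a F)) \<le> (functional_norm M a * functional_norm M m) * norm F" if F: "F \<in> M" for F
  proof -
    have "cmod (m (act sw a F)) \<le> functional_norm M m * norm (act sw a F)"
      by (rule functional_norm_bound[OF M m act_in[OF a F]])
    also have "\<dots> \<le> functional_norm M m * (functional_norm M a * norm F)"
      by (intro mult_left_mono norm_act a F functional_norm_nonneg[OF M m])
    finally show ?thesis by (simp add: mult_ac)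
  qed
  then show "F \<in> M \<Longrightarrow> cmod (m (act sw a F)) \<le> (functional_norm M a * functional_norm M m) * norm F" .
  have "functional_on M (\<lambda>F. if F \<in> M then m (act sw a F) else 0)"
    unfolding functional_on_def
    by (simp add: act_add[OF a] act_scale[OF a] functional_on_add[OF mf] functional_on_op_scale[OF mf]
        act_in[OF a] vna_add[OF M] vna_op_scale[OF M])
  then show "bounded_functional M (\<lambda>F. if F \<in> M then m (act sw a F) else 0)"
    unfolding bounded_functional_def using b by auto
qed

lemma functional_norm_add:
  "bounded_functional M f \<Longrightarrow> bounded_functional M g \<Longrightarrow>
    functional_norm M (\<lambda>x. f x + g x) \<le> functional_norm M f + functional_norm M g"
  by (rule functional_norm_leI[OF M]) (intro norm_triangle_mono functional_norm_upper)

lemma functional_norm_scale: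
  assumes f: "bounded_functional M f"
  shows "functional_norm M (\<lambda>x. c * f x) = cmod c * functional_norm M f"
proof (rule antisym)
  have le: "functional_norm M (\<lambda>x. c * f x) \<le> cmod c * functional_norm M f" if "bounded_functional M f" for c f
    by (rule functional_norm_leI[OF M]) (simp add: norm_mult mult_left_mono functional_norm_upper[OF that])
  show "functional_norm M (\<lambda>x. c * f x) \<le> cmod c * functional_norm M f" by (rule le[OF f])
  show "cmod c * functional_norm M f \<le> functional_norm M (\<lambda>x. c * f x)"
  proof (cases "c = 0")
    case True
    then show ?thesis
      using functional_norm_nonneg[OF M bounded_functional_scale[OF f, of c]] by simp
  next
    case False
    have "functional_norm M (\<lambda>x. (1 / c) * (c * f x)) \<le> cmod (1 / c) * functional_norm M (\<lambda>x. c * f x)"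
      by (rule le[OF bounded_functional_scale[OF f]])
    then show ?thesis using False by (simp add: norm_divide field_simps)
  qed
qed

lemma functional_norm_cong:
  assumes "\<And>x. x \<in> M \<Longrightarrow> cmod (f x) = cmod (g x)"
  shows "functional_norm M f = functional_norm M g"
proof -
  have "{cmod (f x) |x. x \<in> M \<and> norm x \<le> 1} = {cmod (g x) |x. x \<in> M \<and> norm x \<le> 1}"
    by (intro Collect_cong ex_cong1) (auto simp: assms)
  then show ?thesis unfolding functional_norm_def by simp
qed

lemma E_0: "(\<lambda>x. 0) \<in> E"
  by (auto simp: E_def bounded_functional_def functional_on_def intro: exI[of _ 0])
lemma E_add: "m \<in> E \<Longrightarrow> m' \<in> E \<Longrightarrow> (\<lambda>x. m x + m' x) \<in> E"
  by (simp add: E_def bounded_functional_add)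
lemma E_scale: "m \<in> E \<Longrightarrow> (\<lambda>x. c * m x) \<in> E"
  by (simp add: E_def bounded_functional_scale)
lemma E_bounded: "m \<in> E \<Longrightarrow> bounded_functional M m"
  by (simp add: E_def)
lemma E_outside: "m \<in> E \<Longrightarrow> x \<notin> M \<Longrightarrow> m x = 0"
  by (simp add: E_def)

text \<open>The transpose of the action on \<open>M\<close>; its companion \<open>ch\<close>
  multiplies by the character.\<close>

definition tr where "tr sw a m = (\<lambda>F. if F \<in> M then m (act sw a F) else (0::complex))"
definition ch where "ch a m = (\<lambda>F::'a \<Rightarrow>\<^sub>L 'a. a id_blinfun * m F :: complex)"

lemma E_tr:
  assumes a: "a \<in> predual M" and m: "m \<in> E"
  shows "tr sw a m \<in> E"
proof -
  have "m (act sw a id_blinfun) = 0"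
    using m functional_on_op_scale[of M m id_blinfun "a id_blinfun"] vna_id[OF M]
    by (simp add: act_one[OF a] E_def bounded_functional_def)
  then show ?thesis
    using bounded_functional_act(1)[OF E_bounded[OF m] a] vna_id[OF M] by (simp add: E_def tr_def)
qed

lemma E_ch: "m \<in> E \<Longrightarrow> ch a m \<in> E"
  unfolding ch_def by (rule E_scale)

lemma norm_tr:
  assumes a: "a \<in> predual M" and m: "m \<in> E"
  shows "functional_norm M (tr sw a m) \<le> functional_norm M a * functional_norm M m"
proof (rule functional_norm_leI'[OF M])
  show "0 \<le> functional_norm M a * functional_norm M m"
    by (intro mult_nonneg_nonneg fn_nonneg a functional_norm_nonneg[OF M E_bounded[OF m]])
  show "cmod (tr sw a m F) \<le> functional_norm M a * functional_norm M m * norm F" if "F \<in> M" for F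
    using bounded_functional_act(2)[OF E_bounded[OF m] a that] that by (simp add: tr_def)
qed

lemma norm_ch:
  assumes a: "a \<in> predual M" and m: "m \<in> E"
  shows "functional_norm M (ch a m) \<le> functional_norm M a * functional_norm M m"
  unfolding ch_def functional_norm_scale[OF E_bounded[OF m]]
  by (intro mult_right_mono predual_one_bound a functional_norm_nonneg[OF M E_bounded[OF m]])

text \<open>One side acts by the transpose and the other by the character. The flag swaps the sides
  because the order in which \<open>tr\<close> composes on a convolution depends on it.\<close>

definition dual_module ::
    "bool \<Rightarrow> (('a \<Rightarrow>\<^sub>L 'a) \<Rightarrow> complex, ((('a \<Rightarrow>\<^sub>L 'a) \<Rightarrow> complex) \<Rightarrow> (('a \<Rightarrow>\<^sub>L 'a) \<Rightarrow> complex) \<Rightarrow> complex) \<Rightarrow> complex) cnbimodule"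
  where "dual_module sw = \<lparr>Elem = lift ` E, Zero = (\<lambda>\<beta>. 0), Add = (\<lambda>u v \<beta>. u \<beta> + v \<beta>),
    Scale = (\<lambda>c u \<beta>. c * u \<beta>), Norm = (\<lambda>u. functional_norm M (lower u)),
    LAct = (\<lambda>a u. lift (if sw then tr sw a (lower u) else ch a (lower u))),
    RAct = (\<lambda>u a. lift (if sw then ch a (lower u) else tr sw a (lower u)))\<rparr>"

lemma dual_module_simps [simp]:
  "Elem (dual_module sw) = lift ` E" "Zero (dual_module sw) = lift (\<lambda>x. 0)"
  "Add (dual_module sw) (lift m) (lift m') = lift (\<lambda>x. m x + m' x)"
  "Scale (dual_module sw) c (lift m) = lift (\<lambda>x. c * m x)"
  "Sub (dual_module sw) (lift m) (lift m') = lift (\<lambda>x. m x - m' x)"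
  "Norm (dual_module sw) (lift m) = functional_norm M m"
  "LAct (dual_module sw) a (lift m) = lift (if sw then tr sw a m else ch a m)"
  "RAct (dual_module sw) (lift m) a = lift (if sw then ch a m else tr sw a m)"
  by (simp_all add: dual_module_def Sub_def lift_def) (simp_all add: lift_def[symmetric])

text \<open>The limit is formed pointwise; the Cauchy estimates are linear in norm x, so they
  survive the limit as norm estimates.\<close>

lemma E_complete:
  assumes s: "\<And>n. s n \<in> E"
    and C: "\<And>e. 0 < e \<Longrightarrow> \<exists>N. \<forall>m\<ge>N. \<forall>n\<ge>N. functional_norm M (\<lambda>x. s m x - s n x) < e"
  shows "\<exists>l\<in>E. (\<lambda>n. functional_norm M (\<lambda>x. s n x - l x)) \<longlonglongrightarrow> 0"
proof -
  have db: "bounded_functional M (\<lambda>x. s m x - s n x)" for m n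
    by (intro bounded_functional_diff E_bounded s)
  have close: "\<exists>N. \<forall>m\<ge>N. \<forall>n\<ge>N. \<forall>x\<in>M. cmod (s m x - s n x) \<le> e * norm x" if e: "0 < e" for e
  proof -
    obtain N where N: "\<forall>m\<ge>N. \<forall>n\<ge>N. functional_norm M (\<lambda>x. s m x - s n x) < e" using C[OF e] by blast
    have "cmod (s m x - s n x) \<le> e * norm x" if "N \<le> m" "N \<le> n" "x \<in> M" for m n x
    proof -
      have "cmod (s m x - s n x) \<le> functional_norm M (\<lambda>x. s m x - s n x) * norm x"
        by (rule functional_norm_bound[OF M db that(3)])
      also have "\<dots> \<le> e * norm x" using N that by (intro mult_right_mono) (auto intro: less_imp_le)
      finally show ?thesis .
    qed
    then show ?thesis by blast
  qed
  have "\<exists>l. (\<lambda>n. s n x) \<longlonglongrightarrow> l" for x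
  proof (cases "x \<in> M")
    case True
    have "Cauchy (\<lambda>n. s n x)"
    proof (rule metric_CauchyI)
      fix e :: real assume e: "0 < e"
      have pos: "0 < e / (norm x + 1)" using e by (simp add: add_nonneg_pos)
      obtain N where N: "\<And>m n. N \<le> m \<Longrightarrow> N \<le> n \<Longrightarrow> cmod (s m x - s n x) \<le> e / (norm x + 1) * norm x"
        using close[OF pos] True by blast
      have "0 < norm x + 1" by (simp add: add_nonneg_pos)
      then have "e / (norm x + 1) * norm x < e" using e by (simp add: pos_divide_less_eq distrib_left)
      then show "\<exists>N. \<forall>m\<ge>N. \<forall>n\<ge>N. dist (s m x) (s n x) < e"
        using N by (intro exI[of _ N]) (auto simp: dist_norm intro: le_less_trans)
    qed
    then show ?thesis using Cauchy_convergent unfolding convergent_def by blast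
  next
    case False
    then show ?thesis using E_outside[OF s False] by (intro exI[of _ 0]) simp
  qed
  then obtain l where l: "\<And>x. (\<lambda>n. s n x) \<longlonglongrightarrow> l x" by metis
  have lclose: "\<exists>N. \<forall>n\<ge>N. \<forall>x\<in>M. cmod (s n x - l x) \<le> e * norm x" if e: "0 < e" for e
  proof -
    obtain N where N: "\<And>m n x. N \<le> m \<Longrightarrow> N \<le> n \<Longrightarrow> x \<in> M \<Longrightarrow> cmod (s m x - s n x) \<le> e * norm x"
      using close[OF e] by blast
    have "cmod (s n x - l x) \<le> e * norm x" if "N \<le> n" "x \<in> M" for n x
    proof (rule LIMSEQ_le_const2)
      show "(\<lambda>k. cmod (s n x - s k x)) \<longlonglongrightarrow> cmod (s n x - l x)" by (intro tendsto_intros l)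
      show "\<exists>N. \<forall>k\<ge>N. cmod (s n x - s k x) \<le> e * norm x" using N that by blast
    qed
    then show ?thesis by blast
  qed
  have sf: "functional_on M (s n)" for n using E_bounded[OF s] by (simp add: bounded_functional_def)
  have lf: "functional_on M l" unfolding functional_on_def
  proof (intro conjI ballI allI)
    fix x y c assume x: "x \<in> M"
    have "(\<lambda>n. c * s n x) \<longlonglongrightarrow> c * l x" by (intro tendsto_intros l)
    then have "(\<lambda>n. s n (op_scale c x)) \<longlonglongrightarrow> c * l x" by (simp add: functional_on_op_scale[OF sf x])
    then show "l (op_scale c x) = c * l x" by (rule LIMSEQ_unique[OF l])
    assume y: "y \<in> M"
    have "(\<lambda>n. s n x + s n y) \<longlonglongrightarrow> l x + l y" by (intro tendsto_intros l)
    then have "(\<lambda>n. s n (x + y)) \<longlonglongrightarrow> l x + l y" by (simp add: functional_on_add[OF sf x y])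
    then show "l (x + y) = l x + l y" by (rule LIMSEQ_unique[OF l])
  qed
  have lb: "bounded_functional M l"
  proof -
    obtain N where N: "\<And>x. x \<in> M \<Longrightarrow> cmod (s N x - l x) \<le> 1 * norm x" using lclose[of 1] by auto
    have "cmod (l x) \<le> (functional_norm M (s N) + 1) * norm x" if "x \<in> M" for x
      using norm_triangle_ineq4[of "s N x" "s N x - l x"] N[OF that]
        functional_norm_bound[OF M E_bounded[OF s] that, of N] by (simp add: distrib_right)
    then show ?thesis using lf unfolding bounded_functional_def by blast
  qed
  have l0: "l x = 0" if "\<And>n. s n x = 0" for x
    using l[of x] that by (simp add: LIMSEQ_const_iff)
  have lE: "l \<in> E"
    using lb l0 s by (simp add: E_def)
  moreover have "(\<lambda>n. functional_norm M (\<lambda>x. s n x - l x)) \<longlonglongrightarrow> 0"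
  proof (rule LIMSEQ_I)
    fix e :: real assume e: "0 < e"
    obtain N where N: "\<forall>n\<ge>N. \<forall>x\<in>M. cmod (s n x - l x) \<le> (e / 2) * norm x"
      using lclose[of "e / 2"] e by auto
    have "functional_norm M (\<lambda>x. s n x - l x) < e" if "N \<le> n" for n
    proof -
      have "functional_norm M (\<lambda>x. s n x - l x) \<le> e / 2"
        using N that e by (intro functional_norm_leI'[OF M]) auto
      then show ?thesis using e by simp
    qed
    moreover have "0 \<le> functional_norm M (\<lambda>x. s n x - l x)" for n
      by (intro functional_norm_nonneg[OF M] bounded_functional_diff E_bounded s lE)
    ultimately show "\<exists>N. \<forall>n\<ge>N. norm (functional_norm M (\<lambda>x. s n x - l x) - 0) < e"
      by (intro exI[of _ N]) simp
  qed
  ultimately show ?thesis by blast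
qed

lemma dual_module_banach: "banach_space (dual_module sw)"
  unfolding banach_space_def
proof (intro conjI allI impI)
  have zero: "functional_norm M m = 0 \<longleftrightarrow> m = (\<lambda>x. 0)" if m: "m \<in> E" for m
  proof
    assume "functional_norm M m = 0"
    then have "m x = 0" for x
      using functional_norm_bound[OF M E_bounded[OF m], of x] E_outside[OF m, of x] by (cases "x \<in> M") auto
    then show "m = (\<lambda>x. 0)" by (rule ext)
  next
    assume "m = (\<lambda>x. 0)"
    then show "functional_norm M m = 0" using functional_norm_scale[OF E_bounded[OF m], of 0] by simp
  qed
  show "complex_normed_space (dual_module sw)"
    unfolding complex_normed_space_def
    by (auto simp: E_0 E_add E_scale zero functional_norm_scale[OF E_bounded] functional_norm_nonneg[OF M E_bounded]
        algebra_simps intro!: functional_norm_add E_bounded)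
next
  fix s :: "nat \<Rightarrow> ((('a \<Rightarrow>\<^sub>L 'a) \<Rightarrow> complex) \<Rightarrow> (('a \<Rightarrow>\<^sub>L 'a) \<Rightarrow> complex) \<Rightarrow> complex) \<Rightarrow> complex"
  assume s: "(\<forall>n. s n \<in> Elem (dual_module sw)) \<and>
    (\<forall>e>0. \<exists>N. \<forall>m\<ge>N. \<forall>n\<ge>N. Norm (dual_module sw) (Sub (dual_module sw) (s m) (s n)) < e)"
  then have "\<forall>n. \<exists>m\<in>E. s n = lift m" by auto
  then obtain m where m: "\<And>n. m n \<in> E" "\<And>n. s n = lift (m n)" by metis
  have "\<exists>l\<in>E. (\<lambda>n. functional_norm M (\<lambda>x. m n x - l x)) \<longlonglongrightarrow> 0"
    using s by (intro E_complete m) (simp add: m(2))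
  then show "\<exists>l\<in>Elem (dual_module sw). (\<lambda>n. Norm (dual_module sw) (Sub (dual_module sw) (s n) l)) \<longlonglongrightarrow> 0"
    by (auto simp: m(2))
qed

lemma tr_add: "tr sw a (\<lambda>x. m x + m' x) = (\<lambda>x. tr sw a m x + tr sw a m' x)"
  and tr_scale: "tr sw a (\<lambda>x. c * m x) = (\<lambda>x. c * tr sw a m x)"
  by (simp_all add: fun_eq_iff tr_def)

lemma tr_add_left: "a \<in> predual M \<Longrightarrow> b \<in> predual M \<Longrightarrow> m \<in> E \<Longrightarrow>
    tr sw (\<lambda>x. a x + b x) m = (\<lambda>x. tr sw a m x + tr sw b m x)"
  and tr_scale_left: "a \<in> predual M \<Longrightarrow> m \<in> E \<Longrightarrow> tr sw (\<lambda>x. c * a x) m = (\<lambda>x. c * tr sw a m x)"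
  using functional_on_add[of M m] functional_on_op_scale[of M m]
  by (simp_all add: fun_eq_iff tr_def act_add_left act_scale_left E_def bounded_functional_def act_in)

lemma tr_conv: "a \<in> predual M \<Longrightarrow> b \<in> predual M \<Longrightarrow>
    tr sw (conv a b) m = (if sw then tr sw a (tr sw b m) else tr sw b (tr sw a m))"
  by (rule ext) (simp add: tr_def act_conv act_in)

lemma tr_ch: "tr sw a (ch b m) = ch b (tr sw a m)"
  by (rule ext) (simp add: tr_def ch_def)

lemma dual_module_bimodule: "banach_bimodule A (dual_module sw)"
proof -
  have nE: "m \<in> E \<Longrightarrow> 0 \<le> functional_norm M m" for m by (rule functional_norm_nonneg[OF M E_bounded])
  have 1: "\<forall>a\<in>Elem A. complex_linear_on (dual_module sw) (dual_module sw) (LAct (dual_module sw) a) \<and>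
      complex_linear_on (dual_module sw) (dual_module sw) (\<lambda>x. RAct (dual_module sw) x a)"
    unfolding complex_linear_on_def
    by (auto simp: E_tr E_ch tr_add tr_scale) (auto simp: ch_def algebra_simps)
  have 2: "\<forall>x\<in>Elem (dual_module sw). complex_linear_on A (dual_module sw) (\<lambda>a. LAct (dual_module sw) a x) \<and>
      complex_linear_on A (dual_module sw) (RAct (dual_module sw) x)"
    unfolding complex_linear_on_def
    by (auto simp: E_tr E_ch tr_add_left tr_scale_left) (auto simp: ch_def algebra_simps)
  have 3: "\<forall>a\<in>Elem A. \<forall>b\<in>Elem A. \<forall>x\<in>Elem (dual_module sw).
      LAct (dual_module sw) (Mult A a b) x = LAct (dual_module sw) a (LAct (dual_module sw) b x) \<and>
      RAct (dual_module sw) x (Mult A a b) = RAct (dual_module sw) (RAct (dual_module sw) x a) b \<and>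
      RAct (dual_module sw) (LAct (dual_module sw) a x) b = LAct (dual_module sw) a (RAct (dual_module sw) x b)"
    by (auto simp: tr_conv tr_ch) (auto simp: ch_def conv_one)
  have 4: "\<forall>a\<in>Elem A. \<forall>x\<in>Elem (dual_module sw).
      Norm (dual_module sw) (LAct (dual_module sw) a x) \<le> 1 * Norm A a * Norm (dual_module sw) x \<and>
      Norm (dual_module sw) (RAct (dual_module sw) x a) \<le> 1 * Norm A a * Norm (dual_module sw) x"
    by (auto simp: norm_tr norm_ch)
  show ?thesis unfolding banach_bimodule_def using dual_module_banach 1 2 3 4 by blast
qed

text \<open>For a normal functional \<open>e\<close> with \<open>e 1 = 1\<close>, the derivation implemented by \<open>e\<close> takes values in
  the functionals that vanish at \<open>1\<close>. If \<open>x\<close> implements it approximately inside that module, then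
  \<open>e - x\<close> is approximately invariant.\<close>

lemma approximately_amenable_net:
  assumes am: "approximately_amenable A"
  shows "\<exists>\<F>. asymptotically_invariant M (act sw) \<F>"
proof -
  obtain e where e: "e \<in> predual M" "e id_blinfun = 1" using unit_functional by blast
  have eb: "bounded_functional M e" by (rule predual_bounded_functional[OF M e(1)])
  have ef: "functional_on M e" by (rule predual_functional_on[OF M e(1)])
  \<comment> \<open>The sign makes d a the left action minus the right action on e, whichever side
    carries the transpose.\<close>
  define s :: complex where "s = (if sw then - 1 else 1)"
  define d where "d a = (\<lambda>F. s * (ch a e F - tr sw a e F))" for a
  have eout: "F \<notin> M \<Longrightarrow> e F = 0" for F by (rule predual_outside[OF e(1)])
  \<comment> \<open>Both actions send e to a functional with value a 1 at the unit, so d a vanishes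
    there although e does not.\<close>
  have tre: "tr sw a e id_blinfun = a id_blinfun" if a: "a \<in> predual M" for a
    using vna_id[OF M] by (simp add: tr_def act_one[OF a] functional_on_op_scale[OF ef] e(2))
  have dE: "d a \<in> E" if a: "a \<in> predual M" for a
  proof -
    have "bounded_functional M (ch a e)" unfolding ch_def by (rule bounded_functional_scale[OF eb])
    moreover have "bounded_functional M (tr sw a e)" unfolding tr_def by (rule bounded_functional_act(1)[OF eb a])
    ultimately have "bounded_functional M (d a)"
      unfolding d_def by (intro bounded_functional_scale bounded_functional_diff)
    then show ?thesis using tre[OF a] eout by (simp add: E_def d_def ch_def e(2)) (simp add: tr_def)
  qed
  have dadd: "d (\<lambda>x. a x + b x) = (\<lambda>x. d a x + d b x)" if "a \<in> predual M" "b \<in> predual M" for a b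
    using that by (auto simp: d_def ch_def tr_def act_add_left functional_on_add[OF ef] act_in algebra_simps)
  have dscale: "d (\<lambda>x. c * a x) = (\<lambda>x. c * d a x)" if "a \<in> predual M" for a c
    using that by (auto simp: d_def ch_def tr_def act_scale_left functional_on_op_scale[OF ef] act_in algebra_simps)
  have en: "0 \<le> functional_norm M e" by (rule fn_nonneg[OF e(1)])
  have dn: "functional_norm M (d a) \<le> (2 * functional_norm M e) * functional_norm M a" if a: "a \<in> predual M" for a
  proof (rule functional_norm_leI'[OF M])
    show "0 \<le> 2 * functional_norm M e * functional_norm M a" using en fn_nonneg[OF a] by simp
    fix F assume F: "F \<in> M"
    have "cmod (ch a e F) \<le> functional_norm M a * (functional_norm M e * norm F)"
      unfolding ch_def norm_mult
      by (intro mult_mono predual_one_bound a functional_norm_bound[OF M eb F] fn_nonneg) auto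
    moreover have "cmod (tr sw a e F) \<le> functional_norm M a * functional_norm M e * norm F"
      using bounded_functional_act(2)[OF eb a F] F by (simp add: tr_def)
    ultimately have "cmod (ch a e F - tr sw a e F) \<le> 2 * functional_norm M e * functional_norm M a * norm F"
      using norm_triangle_ineq4[of "ch a e F" "tr sw a e F"] by (simp add: mult_ac)
    moreover have "cmod s = 1" by (simp add: s_def)
    ultimately show "cmod (d a F) \<le> 2 * functional_norm M e * functional_norm M a * norm F"
      by (simp add: d_def norm_mult)
  qed
  have dmult: "d (conv a b) = (\<lambda>x. (if sw then ch b (d a) else tr sw b (d a)) x + (if sw then tr sw a (d b) else ch a (d b)) x)"
    if "a \<in> predual M" "b \<in> predual M" for a b
    using that by (auto simp: d_def ch_def tr_def act_conv act_in conv_one s_def algebra_simps)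
  let ?X = "dual_module sw"
  have der: "continuous_derivation A ?X (\<lambda>a. lift (d a))"
    unfolding continuous_derivation_def complex_linear_on_def
    using dE dn by (auto simp: dadd dscale dmult)
  obtain \<F> where F0: "\<F> \<noteq> bot" and Fe: "eventually (\<lambda>x. x \<in> Elem ?X) \<F>"
    and Fl: "\<And>a. a \<in> predual M \<Longrightarrow>
      ((\<lambda>x. Norm ?X (Sub ?X (Sub ?X (LAct ?X a x) (RAct ?X x a)) (lift (d a)))) \<longlongrightarrow> 0) \<F>"
    using am[unfolded approximately_amenable_def, rule_format, OF conjI[OF dual_module_bimodule der]] by auto
  define n where "n u = (\<lambda>F. e F - lower u F)" for u
  have "asymptotically_invariant M (act sw) (filtermap n \<F>)"
    unfolding asymptotically_invariant_def
  proof (intro conjI ballI)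
    show "filtermap n \<F> \<noteq> bot" using F0 by (simp add: filtermap_bot_iff)
    show "eventually (bounded_functional M) (filtermap n \<F>)"
      unfolding eventually_filtermap using Fe
      by (rule eventually_mono) (auto simp: n_def bounded_functional_diff[OF eb] E_bounded)
    \<comment> \<open>Elements of the module vanish at 1, so the value is exactly that of e.\<close>
    have "eventually (\<lambda>u. n u id_blinfun = 1) \<F>"
      using Fe by (rule eventually_mono) (auto simp: n_def e(2) E_def)
    then show "((\<lambda>n. n id_blinfun) \<longlongrightarrow> 1) (filtermap n \<F>)"
      unfolding filterlim_filtermap by (rule tendsto_eventually)
    fix a assume a: "a \<in> predual M"
    have "((\<lambda>u. functional_norm M (\<lambda>F. n u (act sw a F) - a id_blinfun * n u F)) \<longlongrightarrow> 0) \<F>"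
    proof (rule Lim_transform_eventually[OF Fl[OF a]], rule eventually_mono[OF Fe])
      fix u assume "u \<in> Elem ?X"
      then obtain m where m: "m \<in> E" "u = lift m" by auto
      \<comment> \<open>Subtracting d a turns the commutator of a with m into that with m - e, the
        negative of n u; up to sign this is the invariance defect of n u.\<close>
      have "functional_norm M (\<lambda>F. (if sw then tr sw a m else ch a m) F - (if sw then ch a m else tr sw a m) F - d a F)
          = functional_norm M (\<lambda>F. n u (act sw a F) - a id_blinfun * n u F)"
      proof -
        have "cmod ((if sw then tr sw a m else ch a m) F - (if sw then ch a m else tr sw a m) F - d a F)
            = cmod (n u (act sw a F) - a id_blinfun * n u F)" if "F \<in> M" for F
        proof (cases sw)
          case True
          then have "(if sw then tr sw a m else ch a m) F - (if sw then ch a m else tr sw a m) F - d a F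
              = - (n u (act sw a F) - a id_blinfun * n u F)"
            using that by (simp add: d_def s_def n_def m(2) tr_def ch_def algebra_simps)
          then show ?thesis by (simp only: norm_minus_cancel)
        next
          case False
          then show ?thesis
            using that by (simp add: d_def s_def n_def m(2) tr_def ch_def algebra_simps)
        qed
        then show ?thesis by (rule functional_norm_cong)
      qed
      then show "Norm ?X (Sub ?X (Sub ?X (LAct ?X a u) (RAct ?X u a)) (lift (d a)))
          = functional_norm M (\<lambda>F. n u (act sw a F) - a id_blinfun * n u F)"
        by (simp add: m(2))
    qed
    then show "((\<lambda>n. functional_norm M (\<lambda>F. n (act sw a F) - a id_blinfun * n F)) \<longlongrightarrow> 0) (filtermap n \<F>)"
      unfolding filterlim_filtermap .
  qed
  then show ?thesis by blast
qed

section \<open>Invariant means\<close>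

text \<open>For fixed F the invariance defect is linear in \<omega>, bounded by 2 * norm F times the
  norm of \<omega>, and zero on \<Gamma>; hence it vanishes on the closed span of \<Gamma>.\<close>

lemma invariant_mean_exists:
  assumes net: "asymptotically_invariant M (act sw) \<F>"
    and \<Gamma>: "\<And>\<omega>. \<omega> \<in> \<Gamma> \<Longrightarrow> \<omega> \<in> predual M \<and> state_on M \<omega> \<and> normal_star_automorphism M (act sw \<omega>)"
    and dense: "\<And>f e. f \<in> predual M \<Longrightarrow> 0 < e \<Longrightarrow> \<exists>(n::nat) c w. (\<forall>i<n. w i \<in> \<Gamma>) \<and>
      functional_norm M (\<lambda>x. f x - (\<Sum>i<n. c i * w i x)) < e"
  shows "\<exists>\<mu>. state_on M \<mu> \<and> (\<forall>F\<in>M. \<forall>\<omega>\<in>predual M. \<mu> (act sw \<omega> F) = \<omega> id_blinfun * \<mu> F)"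
proof -
  have "\<omega> \<in> predual M \<and> \<omega> id_blinfun = 1 \<and> normal_star_automorphism M (act sw \<omega>)" if "\<omega> \<in> \<Gamma>" for \<omega>
    using \<Gamma>[OF that] by (simp add: state_on_def)
  then have "\<exists>\<mu>. state_on M \<mu> \<and> (\<forall>F\<in>M. cmod (\<mu> F) \<le> norm F) \<and>
      (\<forall>\<omega>\<in>\<Gamma>. \<forall>F\<in>M. \<mu> (act sw \<omega> F) = \<mu> F)"
    by (rule invariant_state_exists[OF M net])
  then obtain \<mu> where \<mu>: "state_on M \<mu>" "\<And>F. F \<in> M \<Longrightarrow> cmod (\<mu> F) \<le> norm F"
    "\<And>\<omega> F. \<omega> \<in> \<Gamma> \<Longrightarrow> F \<in> M \<Longrightarrow> \<mu> (act sw \<omega> F) = \<mu> F" by blast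
  have \<mu>f: "functional_on M \<mu>" using \<mu>(1) by (simp add: state_on_def pos_functional_def)
  have "\<mu> (act sw \<omega> F) = \<omega> id_blinfun * \<mu> F" if F: "F \<in> M" and \<omega>: "\<omega> \<in> predual M" for F \<omega>
  proof -
    define D where "D f = \<mu> (act sw f F) - f id_blinfun * \<mu> F" for f
    have Dadd: "D (\<lambda>x. f x + g x) = D f + D g" if "f \<in> predual M" "g \<in> predual M" for f g
      using that F by (simp add: D_def act_add_left functional_on_add[OF \<mu>f] act_in algebra_simps)
    have Dscale: "D (\<lambda>x. c * f x) = c * D f" if "f \<in> predual M" for f c
      using that F by (simp add: D_def act_scale_left functional_on_op_scale[OF \<mu>f] act_in algebra_simps)
    have D\<Gamma>: "D w = 0" if "w \<in> \<Gamma>" for w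
      using \<mu>(3)[OF that F] \<Gamma>[OF that] by (simp add: D_def state_on_def)
    have D0: "D (\<lambda>x. 0) = 0" using Dscale[OF predual_0, of 0] by simp
    have sumP: "(\<lambda>x. \<Sum>i<n. c i * w i x) \<in> predual M" and Dsum: "D (\<lambda>x. \<Sum>i<n. c i * w i x) = 0"
      if "\<forall>i<n. w i \<in> \<Gamma>" for n :: nat and c w
    proof -
      have "(\<lambda>x. \<Sum>i<n. c i * w i x) \<in> predual M \<and> D (\<lambda>x. \<Sum>i<n. c i * w i x) = 0"
        using that
      proof (induction n)
        case (Suc n)
        then have w: "w n \<in> predual M" "D (w n) = 0" using \<Gamma> D\<Gamma> by auto
        then show ?case using Suc by (simp add: predual_add predual_scale Dadd Dscale)
      qed (simp add: predual_0 D0)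
      then show "(\<lambda>x. \<Sum>i<n. c i * w i x) \<in> predual M" "D (\<lambda>x. \<Sum>i<n. c i * w i x) = 0" by auto
    qed
    have Dbound: "cmod (D f) \<le> (2 * norm F) * functional_norm M f" if f: "f \<in> predual M" for f
    proof -
      have "cmod (\<mu> (act sw f F)) \<le> functional_norm M f * norm F"
        by (rule order_trans[OF \<mu>(2)[OF act_in[OF f F]] norm_act[OF f F]])
      moreover have "cmod (f id_blinfun * \<mu> F) \<le> functional_norm M f * norm F"
        unfolding norm_mult by (intro mult_mono predual_one_bound f \<mu>(2) F fn_nonneg) auto
      ultimately show ?thesis
        using norm_triangle_ineq4[of "\<mu> (act sw f F)" "f id_blinfun * \<mu> F"] by (simp add: D_def mult_ac)
    qed
    have small: "cmod (D \<omega>) \<le> (2 * norm F) * e" if e: "0 < e" for e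
    proof -
      obtain n :: nat and c w where w: "\<forall>i<n. w i \<in> \<Gamma>" "functional_norm M (\<lambda>x. \<omega> x - (\<Sum>i<n. c i * w i x)) < e"
        using dense[OF \<omega> e] by blast
      let ?g = "\<lambda>x. \<Sum>i<n. c i * w i x" and ?h = "\<lambda>x. \<omega> x - (\<Sum>i<n. c i * w i x)"
      have h: "?h \<in> predual M" by (rule predual_diff[OF \<omega> sumP[OF w(1)]])
      have "D (\<lambda>x. ?h x + ?g x) = D ?h + D ?g" by (rule Dadd[OF h sumP[OF w(1)]])
      then have "D \<omega> = D ?h" by (simp add: Dsum[OF w(1)])
      then have "cmod (D \<omega>) \<le> (2 * norm F) * functional_norm M ?h" using Dbound[OF h] by simp
      also have "\<dots> \<le> (2 * norm F) * e" using w(2) by (intro mult_left_mono) auto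
      finally show ?thesis .
    qed
    have "cmod (D \<omega>) \<le> 0"
    proof (rule field_le_epsilon)
      fix \<epsilon> :: real assume \<epsilon>: "0 < \<epsilon>"
      \<comment> \<open>The summand 1 in the denominator covers F = 0.\<close>
      have "cmod (D \<omega>) \<le> (2 * norm F) * (\<epsilon> / (2 * norm F + 1))"
        using \<epsilon> by (intro small divide_pos_pos) (simp_all add: add_nonneg_pos)
      also have "\<dots> \<le> \<epsilon>"
      proof -
        have "0 < 2 * norm F + 1" by (simp add: add_nonneg_pos)
        then show ?thesis using \<epsilon> by (simp add: pos_divide_le_eq distrib_left mult_ac)
      qed
      finally show "cmod (D \<omega>) \<le> 0 + \<epsilon>" by simp
    qed
    then show ?thesis by (simp add: D_def)
  qed
  then show ?thesis using \<mu>(1) by blast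
qed

end

theorem theorem3:
  fixes t :: "'h::chilbert_space \<Rightarrow> 'h \<Rightarrow> 'h2::chilbert_space"
    and tL :: "'h2 \<Rightarrow> 'h \<Rightarrow> 'h3::chilbert_space"
    and tR :: "'h \<Rightarrow> 'h2 \<Rightarrow> 'h3"
    and M :: "('h \<Rightarrow>\<^sub>L 'h) set"
    and \<Delta> :: "('h \<Rightarrow>\<^sub>L 'h) \<Rightarrow> ('h2 \<Rightarrow>\<^sub>L 'h2)"
    and \<phi> \<psi> :: "('h \<Rightarrow>\<^sub>L 'h) \<Rightarrow> ennreal"
    and \<Lambda> :: "('h \<Rightarrow>\<^sub>L 'h) \<Rightarrow> 'g::chilbert_space"
    and tg :: "'g \<Rightarrow> 'g \<Rightarrow> 'g2::chilbert_space"
    and \<Lambda>2 :: "('h2 \<Rightarrow>\<^sub>L 'h2) \<Rightarrow> 'g2"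
    and W :: "'g2 \<Rightarrow>\<^sub>L 'g2"
    and \<Gamma> :: "(('h \<Rightarrow>\<^sub>L 'h) \<Rightarrow> complex) set"
  assumes "locally_compact_quantum_group t tL tR M \<Delta> \<phi> \<psi>"
    and "gns_map M \<phi> \<Lambda>"
    and "hilbert_tensor tg"
    and "gns_map_square t tg M \<phi> \<Lambda> \<Lambda>2"
    and "multiplicative_unitary t tg M \<Delta> \<phi> \<Lambda> \<Lambda>2 W"
    and "regular_family tg M \<phi> \<Lambda> W \<Gamma>"
  shows "(left_covariant t tg M \<Delta> \<phi> \<Lambda> W \<Gamma> \<longrightarrow>
      (pseudo_amenable (predual_algebra t M \<Delta>) \<longrightarrow>
        (\<exists>\<mu>. right_invariant_mean t M \<Delta> \<mu>)) \<and>
      (approximately_amenable (predual_algebra t M \<Delta>) \<and>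
        has_bounded_approximate_identity (predual_algebra t M \<Delta>) \<longrightarrow>
        (\<exists>\<mu>. right_invariant_mean t M \<Delta> \<mu>))) \<and>
    (right_covariant t tg M \<Delta> \<phi> \<Lambda> W \<Gamma> \<longrightarrow>
      (pseudo_amenable (predual_algebra t M \<Delta>) \<longrightarrow>
        (\<exists>\<mu>. left_invariant_mean t M \<Delta> \<mu>)) \<and>
      (approximately_amenable (predual_algebra t M \<Delta>) \<and>
        has_bounded_approximate_identity (predual_algebra t M \<Delta>) \<longrightarrow>
        (\<exists>\<mu>. left_invariant_mean t M \<Delta> \<mu>)))"
proof -
  interpret hopf_vna t tL tR M \<Delta>
    using assms(1) by unfold_locales (simp add: locally_compact_quantum_group_def)
  have state: "\<omega> \<in> predual M \<and> state_on M \<omega>" if "\<omega> \<in> \<Gamma>" for \<omega>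
    using assms(6) that by (simp add: regular_family_def)
  have dense: "\<exists>(n::nat) c w. (\<forall>i<n. w i \<in> \<Gamma>) \<and> functional_norm M (\<lambda>x. f x - (\<Sum>i<n. c i * w i x)) < e"
    if "f \<in> predual M" "0 < e" for f e
    using assms(6) that by (simp add: regular_family_def)
  have net: "\<exists>\<F>. asymptotically_invariant M (act sw) \<F>"
    if "pseudo_amenable A \<or> approximately_amenable A \<and> has_bounded_approximate_identity A" for sw
    using that pseudo_amenable_net approximately_amenable_net by blast
  \<comment> \<open>Left covariance concerns the slice of \<Delta> F in the second leg, the slice
    that occurs in the definition of a right invariant mean.\<close>
  have right: "\<exists>\<mu>. right_invariant_mean t M \<Delta> \<mu>"
    if cov: "left_covariant t tg M \<Delta> \<phi> \<Lambda> W \<Gamma>"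
      and am: "pseudo_amenable A \<or> approximately_amenable A \<and> has_bounded_approximate_identity A"
  proof -
    obtain \<F> where \<F>: "asymptotically_invariant M (act False) \<F>" using net[OF am] by blast
    have "act False \<omega> = act_left t M \<Delta> \<omega>" for \<omega> by (rule ext) (simp add: act_def act_left_def)
    then have "\<omega> \<in> predual M \<and> state_on M \<omega> \<and> normal_star_automorphism M (act False \<omega>)" if "\<omega> \<in> \<Gamma>" for \<omega>
      using cov state[OF that] that by (simp add: left_covariant_def)
    from invariant_mean_exists[OF \<F> this dense] show ?thesis
      by (simp add: right_invariant_mean_def act_def)
  qed
  have left: "\<exists>\<mu>. left_invariant_mean t M \<Delta> \<mu>"
    if cov: "right_covariant t tg M \<Delta> \<phi> \<Lambda> W \<Gamma>"
      and am: "pseudo_amenable A \<or> approximately_amenable A \<and> has_bounded_approximate_identity A"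
  proof -
    obtain \<F> where \<F>: "asymptotically_invariant M (act True) \<F>" using net[OF am] by blast
    have "act True \<omega> = (\<lambda>F. act_right t M \<Delta> F \<omega>)" for \<omega> by (rule ext) (simp add: act_def act_right_def)
    then have "\<omega> \<in> predual M \<and> state_on M \<omega> \<and> normal_star_automorphism M (act True \<omega>)" if "\<omega> \<in> \<Gamma>" for \<omega>
      using cov state[OF that] that by (simp add: right_covariant_def)
    from invariant_mean_exists[OF \<F> this dense] show ?thesis
      by (simp add: left_invariant_mean_def act_def)
  qed
  show ?thesis using left right by blast
qed

end
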